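(* Let $n\ge 2$ be an integer, let $f:\Sigma\to\mathbb{R}^3$ be a generic helicoidal $n$-type edge, and let $p\in\Sigma$ be a singular point. Then there exist an open neighborhood $D$ of $p$ and a $2$-parameter family of generic helicoidal $n$-type edges $\{f_{h,m}:D\to\mathbb{R}^3\}_{h,m}$ which gives a non-trivial isometric deformation of $f$. Conversely, every non-trivial isometric deformation of $f$ among generic helicoidal $n$-type edges is given by $\{f_{h,m}\}_{h,m}$.
   Context: All manifolds and maps are $C^\infty$. Let $\Sigma$ be an oriented smooth $2$-manifold and $f:\Sigma\to\mathbb{R}^3$ a smooth map. A point where $f$ is not an immersion is a singular point; $S(f)$ is the set of singular points. $f$ is a surface if $\Sigma\setminus S(f)$ is dense. The first fundamental form $g_f$ of $f$ is the pullback by $f$ of the Euclidean metric. A surface $f$ is a frontal if each point has an open neighborhood $D$ with a smooth map $\nu:D\to S^2$ (unit normal vector field) such that $df_q(v)\cdot\nu(q)=0$ for all $q\in D$, $v\in T_q\Sigma$. Two map-germs $f_i:(\Sigma_i,p_i)\to(\mathbb{R}^N,q_i)$ $(i=1,2)$ are $\mathcal{A}$-equivalent if there are diffeomorphism-germs $\varphi:(\Sigma_1,p_1)\to(\Sigma_2,p_2)$ and $\Phi:(\mathbb{R}^N,q_1)\to(\mathbb{R}^N,q_2)$ with $f_2=\Phi\circ f_1\circ\varphi^{-1}$. A point $p$ is an $n$-type edge singular point of $f$ if there is a smooth function $a(u,v)$ such that the germ of $f$ at $p$ is $\mathcal{A}$-equivalent to the germ at the origin of $(u,v)\mapsto(u^n,u^{n+1}a(u,v),v)$.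 A singular point $p$ is of rank one if $\operatorname{rank}(df_p)=1$. For a frontal $f$ and a rank one singular point $p$, take an orientation-compatible coordinate system $(u,v)$ with $f_u(p)=0$; the limiting normal curvature is $\kappa_\nu(p)=\dfrac{f_{vv}(p)\cdot\nu(p)}{\|f_v(p)\|^2}$ (independent of the choice of such coordinates). A rank one singular point is generic if $\kappa_\nu(p)\ne0$. A helicoidal motion is a non-trivial one-parameter subgroup of the isometry group of $\mathbb{R}^3$. For an integer $n>1$, a generic helicoidal $n$-type edge is a frontal in $\mathbb{R}^3$ that is invariant under a helicoidal motion, has non-empty singular set, and all of whose singular points are generic $n$-type edge singular points. A surface $\bar f$ is isometric to $f$ at $p$ if there exist an open neighborhood $D$ of $p$ and a diffeomorphism $\varphi:D\to D$ with $\varphi(p)=p$ and $g_f=\varphi^*g_{\bar f}$ on $D$. An isometric deformation of $f$ at $p$ is a continuous $1$-parameter family $\{f^\tau:D\to\mathbb{R}^3\}_{\tau\in[0,1]}$ on an open neighborhood $D$ of $p$ with $f^0=f$ and each $f^\tau$ isometric to $f$ at $p$. It is trivial if $f^\tau=T^\tau\circ f\circ(\varphi^\tau)^{-1}$ for continuous families of isometries $T^\tau$ of $\mathbb{R}^3$ and diffeomorphisms $\varphi^\tau$ of $D$ with $T^0,\varphi^0$ the identity maps; otherwise non-trivial. The same terminology is used for multi-parameter families: a $2$-parameter family gives a non-trivial isometric deformation of $f$ if it is continuous in its parameters, contains $f$ (restricted to $D$, up to an isometry of $\mathbb{R}^3$), all of its members are isometric to $f$ at $p$, and it is not obtained from $f$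 by composing with isometries of $\mathbb{R}^3$ and diffeomorphisms of the source. A deformation is given by $\{f_{h,m}\}$ if, near $p$ and up to isometries of $\mathbb{R}^3$ and diffeomorphisms of the source, its members are members of this family. *)

theory Defs
  imports "HOL-Analysis.Analysis"
begin

section \<open>Smooth maps between Euclidean spaces\<close>

primrec differentiable_upto :: "nat \<Rightarrow> 'a::real_normed_vector set \<Rightarrow> ('a \<Rightarrow> 'b::real_normed_vector) \<Rightarrow> bool"
  where
    "differentiable_upto 0 S = (\<lambda>f. continuous_on S f)"
  | "differentiable_upto (Suc k) S = (\<lambda>f. (\<forall>x\<in>S. f differentiable (at x)) \<and>
       (\<forall>v. differentiable_upto k S (\<lambda>x. frechet_derivative f (at x) v)))"

text \<open>Only used for open \<open>S\<close>; there it is \<open>C\<^sup>\<infinity>\<close>-smoothness on \<open>S\<close>.\<close>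

definition smooth_on :: "'a::real_normed_vector set \<Rightarrow> ('a \<Rightarrow> 'b::real_normed_vector) \<Rightarrow> bool"
  where "smooth_on S f \<longleftrightarrow> (\<forall>k. differentiable_upto k S f)"


section \<open>Manifolds\<close>

text \<open>
  A chart is a pair of an open domain \<open>U\<close> and a map \<open>x\<close> of which only the restriction to \<open>U\<close>
  matters; the local parametrization is \<open>inv_into U x\<close>. The manifold is the whole type \<open>'a\<close>
  (the Hausdorff and countability axioms are type class constraints where they are needed), and
  open submanifolds are open sets \<open>D\<close>. Maps defined on \<open>D\<close> only are total functions whose values
  outside \<open>D\<close> are irrelevant.
\<close>

type_synonym ('a, 'e) chart = "'a set \<times> ('a \<Rightarrow> 'e)"

definition smooth_atlas :: "('a::topological_space, 'e::euclidean_space) chart set \<Rightarrow> bool"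
  where "smooth_atlas A \<longleftrightarrow>
    (\<forall>(U, x)\<in>A. open U \<and> open (x ` U) \<and> homeomorphism U (x ` U) x (inv_into U x)) \<and>
    (\<Union>(U, x)\<in>A. U) = UNIV \<and>
    (\<forall>(U, x)\<in>A. \<forall>(V, y)\<in>A. smooth_on (x ` (U \<inter> V)) (y \<circ> inv_into U x))"

definition oriented_atlas :: "('a::topological_space, real^'n) chart set \<Rightarrow> bool"
  where "oriented_atlas A \<longleftrightarrow> smooth_atlas A \<and>
    (\<forall>(U, x)\<in>A. \<forall>(V, y)\<in>A. \<forall>w\<in>x ` (U \<inter> V).
       0 < det (matrix (frechet_derivative (y \<circ> inv_into U x) (at w))))"

text \<open>The charts of the maximal oriented atlas containing \<open>A\<close>.\<close>

definition oriented_chart :: "('a::topological_space, real^'n) chart set \<Rightarrow> ('a, real^'n) chart \<Rightarrow> bool"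
  where "oriented_chart A c \<longleftrightarrow> oriented_atlas (insert c A)"

definition euclidean_atlas :: "('e::euclidean_space, 'e) chart set"
  where "euclidean_atlas = {(UNIV, id)}"

text \<open>Atlas of the product of the real line with a manifold.\<close>

definition line_times_atlas :: "('a, 'e) chart set \<Rightarrow> (real \<times> 'a, real \<times> 'e) chart set"
  where "line_times_atlas A = (\<lambda>(U, x). (UNIV \<times> U, \<lambda>(t, q). (t, x q))) ` A"

definition smooth_map ::
    "('a::topological_space, 'e::euclidean_space) chart set \<Rightarrow>
     ('b::topological_space, 'd::euclidean_space) chart set \<Rightarrow> 'a set \<Rightarrow> ('a \<Rightarrow> 'b) \<Rightarrow> bool"
  where "smooth_map A B D \<phi> \<longleftrightarrow> continuous_on D \<phi> \<and>
    (\<forall>(U, x)\<in>A. \<forall>(V, y)\<in>B. smooth_on (x ` (U \<inter> D \<inter> \<phi> -` V)) (y \<circ> \<phi> \<circ> inv_into U x))"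

definition diffeo ::
    "('a::topological_space, 'e::euclidean_space) chart set \<Rightarrow>
     ('b::topological_space, 'd::euclidean_space) chart set \<Rightarrow> 'a set \<Rightarrow> 'b set \<Rightarrow> ('a \<Rightarrow> 'b) \<Rightarrow> bool"
  where "diffeo A B D E \<phi> \<longleftrightarrow>
    bij_betw \<phi> D E \<and> smooth_map A B D \<phi> \<and> smooth_map B A E (inv_into D \<phi>)"

text \<open>
  Differential at \<open>q\<close>, the tangent space at \<open>q\<close> being identified with \<open>'e\<close> by means of the chart.
\<close>

definition chart_deriv ::
    "('a, 'e::euclidean_space) chart \<Rightarrow> ('a \<Rightarrow> 'b::real_normed_vector) \<Rightarrow> 'a \<Rightarrow> 'e \<Rightarrow> 'b"
  where "chart_deriv c f q = frechet_derivative (f \<circ> inv_into (fst c) (snd c)) (at (snd c q))"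

definition chart_partial ::
    "('a, real^'n) chart \<Rightarrow> 'n \<Rightarrow> ('a \<Rightarrow> 'b::real_normed_vector) \<Rightarrow> 'a \<Rightarrow> 'b"
  where "chart_partial c i f q = chart_deriv c f q (axis i 1)"


section \<open>Surfaces with singularities and frontals\<close>

type_synonym 'a atlas2 = "('a, real^2) chart set"

definition singular_set :: "'a::topological_space atlas2 \<Rightarrow> 'a set \<Rightarrow> ('a \<Rightarrow> real^3) \<Rightarrow> 'a set"
  where "singular_set A D f = {q\<in>D. \<exists>c\<in>A. q \<in> fst c \<and> \<not> inj (chart_deriv c f q)}"

definition surface :: "'a::topological_space atlas2 \<Rightarrow> 'a set \<Rightarrow> ('a \<Rightarrow> real^3) \<Rightarrow> bool"
  where "surface A D f \<longleftrightarrow>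
    smooth_map A euclidean_atlas D f \<and> D \<subseteq> closure (D - singular_set A D f)"

definition unit_normal_field ::
    "'a::topological_space atlas2 \<Rightarrow> 'a set \<Rightarrow> ('a \<Rightarrow> real^3) \<Rightarrow> ('a \<Rightarrow> real^3) \<Rightarrow> bool"
  where "unit_normal_field A D f \<nu> \<longleftrightarrow>
    smooth_map A euclidean_atlas D \<nu> \<and> (\<forall>q\<in>D. norm (\<nu> q) = 1) \<and>
    (\<forall>q\<in>D. \<forall>c\<in>A. q \<in> fst c \<longrightarrow> (\<forall>a. chart_deriv c f q a \<bullet> \<nu> q = 0))"

definition frontal :: "'a::topological_space atlas2 \<Rightarrow> 'a set \<Rightarrow> ('a \<Rightarrow> real^3) \<Rightarrow> bool"
  where "frontal A D f \<longleftrightarrow> surface A D f \<and>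
    (\<forall>q\<in>D. \<exists>N \<nu>. open N \<and> q \<in> N \<and> N \<subseteq> D \<and> unit_normal_field A N f \<nu>)"

text \<open>
  First fundamental form at \<open>q\<close> on tangent vectors with components \<open>a\<close>, \<open>b\<close> in the chart \<open>c\<close>.
\<close>

definition first_fundamental_form ::
    "('a, real^2) chart \<Rightarrow> ('a \<Rightarrow> real^3) \<Rightarrow> 'a \<Rightarrow> real^2 \<Rightarrow> real^2 \<Rightarrow> real"
  where "first_fundamental_form c f q a b = chart_deriv c f q a \<bullet> chart_deriv c f q b"

text \<open>
  The first fundamental form of \<open>f\<close> is on \<open>E\<close> the pullback by \<open>\<phi>\<close> of that of \<open>g\<close>;
  \<open>chart_deriv c (snd d \<circ> \<phi>) q\<close> is the differential of \<open>\<phi>\<close> with respect to the charts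
  \<open>c\<close> at \<open>q\<close> and \<open>d\<close> at \<open>\<phi> q\<close>.
\<close>

definition metric_pullback ::
    "'a atlas2 \<Rightarrow> 'a set \<Rightarrow> ('a \<Rightarrow> 'a) \<Rightarrow> ('a \<Rightarrow> real^3) \<Rightarrow> ('a \<Rightarrow> real^3) \<Rightarrow> bool"
  where "metric_pullback A E \<phi> f g \<longleftrightarrow>
    (\<forall>q\<in>E. \<forall>c\<in>A. \<forall>d\<in>A. q \<in> fst c \<longrightarrow> \<phi> q \<in> fst d \<longrightarrow>
      (\<forall>a b. first_fundamental_form c f q a b =
        first_fundamental_form d g (\<phi> q)
          (chart_deriv c (snd d \<circ> \<phi>) q a) (chart_deriv c (snd d \<circ> \<phi>) q b)))"


section \<open>Edges of type n\<close>

text \<open>\<open>\<A>\<close>-equivalence of the germ of \<open>f\<close> at \<open>p\<close> and the germ of \<open>g\<close> at \<open>q\<close>.\<close>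

definition A_equivalent ::
    "('a::topological_space, 'e::euclidean_space) chart set \<Rightarrow> ('a \<Rightarrow> 'c::euclidean_space) \<Rightarrow> 'a \<Rightarrow>
     ('b::topological_space, 'd::euclidean_space) chart set \<Rightarrow> ('b \<Rightarrow> 'c) \<Rightarrow> 'b \<Rightarrow> bool"
  where "A_equivalent A f p B g q \<longleftrightarrow>
    (\<exists>U V W Z \<phi> \<Phi>. open U \<and> open V \<and> open W \<and> open Z \<and> p \<in> U \<and> q \<in> V \<and> f p \<in> W \<and> g q \<in> Z \<and>
      diffeo A B U V \<phi> \<and> \<phi> p = q \<and>
      diffeo euclidean_atlas euclidean_atlas W Z \<Phi> \<and> \<Phi> (f p) = g q \<and>
      f ` U \<subseteq> W \<and> (\<forall>w\<in>V. g w = \<Phi> (f (inv_into U \<phi> w))))"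

definition n_type_edge :: "nat \<Rightarrow> 'a::topological_space atlas2 \<Rightarrow> ('a \<Rightarrow> real^3) \<Rightarrow> 'a \<Rightarrow> bool"
  where "n_type_edge n A f p \<longleftrightarrow>
    (\<exists>V (a :: real^2 \<Rightarrow> real). open V \<and> 0 \<in> V \<and> smooth_on V a \<and>
      A_equivalent A f p euclidean_atlas
        (\<lambda>w. vector [(w$1) ^ n, (w$1) ^ (n + 1) * a w, w$2] :: real^3) 0)"

definition rank_one :: "'a atlas2 \<Rightarrow> ('a \<Rightarrow> real^3) \<Rightarrow> 'a \<Rightarrow> bool"
  where "rank_one A f p \<longleftrightarrow> (\<exists>c\<in>A. p \<in> fst c \<and> dim (range (chart_deriv c f p)) = 1)"

text \<open>To be used with charts \<open>c = (u, v)\<close> around \<open>p\<close> such that \<open>f\<^sub>u(p) = 0\<close>.\<close>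

definition limiting_normal_curvature ::
    "('a, real^2) chart \<Rightarrow> ('a \<Rightarrow> real^3) \<Rightarrow> ('a \<Rightarrow> real^3) \<Rightarrow> 'a \<Rightarrow> real"
  where "limiting_normal_curvature c f \<nu> p =
    (chart_partial c 2 (chart_partial c 2 f) p \<bullet> \<nu> p) / (norm (chart_partial c 2 f p))\<^sup>2"

text \<open>
  The limiting normal curvature does not depend on the coordinates, and only its sign
  depends on \<open>\<nu>\<close>; hence the existential quantifiers.
\<close>

definition generic_at :: "'a::topological_space atlas2 \<Rightarrow> ('a \<Rightarrow> real^3) \<Rightarrow> 'a \<Rightarrow> bool"
  where "generic_at A f p \<longleftrightarrow> rank_one A f p \<and>
    (\<exists>N \<nu> c. open N \<and> p \<in> N \<and> unit_normal_field A N f \<nu> \<and>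
      oriented_chart A c \<and> p \<in> fst c \<and> chart_partial c 1 f p = 0 \<and>
      limiting_normal_curvature c f \<nu> p \<noteq> 0)"


section \<open>Helicoidal edges\<close>

definition euclidean_isometry :: "(real^3 \<Rightarrow> real^3) \<Rightarrow> bool"
  where "euclidean_isometry T \<longleftrightarrow> (\<forall>y z. dist (T y) (T z) = dist y z)"

definition helicoidal_motion :: "(real \<Rightarrow> real^3 \<Rightarrow> real^3) \<Rightarrow> bool"
  where "helicoidal_motion T \<longleftrightarrow>
    (\<forall>t. euclidean_isometry (T t)) \<and> (\<forall>s t. T (s + t) = T s \<circ> T t) \<and>
    (\<forall>y. continuous_on UNIV (\<lambda>t. T t y)) \<and> (\<exists>t. T t \<noteq> id)"

text \<open>
  Invariance is understood locally: around every source point, \<open>T t\<close> for small \<open>t\<close> lifts to a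
  smooth local flow of the source. A global flow of the source would be too much to ask for: a
  neighbourhood \<open>D\<close> of a point need not admit one, e.g. a disc mapped to a helicoidal surface.
\<close>

definition invariant_under ::
    "'a::topological_space atlas2 \<Rightarrow> 'a set \<Rightarrow> ('a \<Rightarrow> real^3) \<Rightarrow> (real \<Rightarrow> real^3 \<Rightarrow> real^3) \<Rightarrow> bool"
  where "invariant_under A D f T \<longleftrightarrow>
    (\<forall>q\<in>D. \<exists>\<epsilon>>0. \<exists>U \<phi>. open U \<and> q \<in> U \<and> U \<subseteq> D \<and>
      smooth_map (line_times_atlas A) A ({-\<epsilon><..<\<epsilon>} \<times> U) \<phi> \<and>
      (\<forall>x\<in>U. \<phi> (0, x) = x) \<and>
      (\<forall>t\<in>{-\<epsilon><..<\<epsilon>}. \<forall>x\<in>U. \<phi> (t, x) \<in> D \<and> f (\<phi> (t, x)) = T t (f x)))"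

definition generic_helicoidal_edge ::
    "nat \<Rightarrow> 'a::topological_space atlas2 \<Rightarrow> 'a set \<Rightarrow> ('a \<Rightarrow> real^3) \<Rightarrow> bool"
  where "generic_helicoidal_edge n A D f \<longleftrightarrow> frontal A D f \<and>
    (\<exists>T. helicoidal_motion T \<and> invariant_under A D f T) \<and>
    singular_set A D f \<noteq> {} \<and>
    (\<forall>q\<in>singular_set A D f. n_type_edge n A f q \<and> generic_at A f q)"


section \<open>Isometric deformations\<close>

text \<open>\<open>g\<close>, defined on the neighbourhood \<open>D\<close> of \<open>p\<close>, is isometric to \<open>f\<close> at \<open>p\<close>.\<close>

definition isometric_at ::
    "'a::topological_space atlas2 \<Rightarrow> ('a \<Rightarrow> real^3) \<Rightarrow> 'a \<Rightarrow> 'a set \<Rightarrow> ('a \<Rightarrow> real^3) \<Rightarrow> bool"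
  where "isometric_at A f p D g \<longleftrightarrow> surface A D g \<and>
    (\<exists>E \<phi>. open E \<and> p \<in> E \<and> E \<subseteq> D \<and> diffeo A A E E \<phi> \<and> \<phi> p = p \<and> metric_pullback A E \<phi> f g)"

definition isometric_deformation ::
    "'a::topological_space atlas2 \<Rightarrow> ('a \<Rightarrow> real^3) \<Rightarrow> 'a \<Rightarrow> 'a set \<Rightarrow> (real \<Rightarrow> 'a \<Rightarrow> real^3) \<Rightarrow> bool"
  where "isometric_deformation A f p D g \<longleftrightarrow>
    open D \<and> p \<in> D \<and> continuous_on ({0..1} \<times> D) (\<lambda>(\<tau>, q). g \<tau> q) \<and>
    (\<forall>q\<in>D. g 0 q = f q) \<and> (\<forall>\<tau>\<in>{0..1}. isometric_at A f p D (g \<tau>))"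

definition trivial_deformation ::
    "'a::topological_space atlas2 \<Rightarrow> ('a \<Rightarrow> real^3) \<Rightarrow> 'a set \<Rightarrow> (real \<Rightarrow> 'a \<Rightarrow> real^3) \<Rightarrow> bool"
  where "trivial_deformation A f D g \<longleftrightarrow>
    (\<exists>T \<phi>. (\<forall>\<tau>\<in>{0..1}. euclidean_isometry (T \<tau>) \<and> diffeo A A D D (\<phi> \<tau>)) \<and>
      continuous_on ({0..1} \<times> UNIV) (\<lambda>(\<tau>, y). T \<tau> y) \<and>
      continuous_on ({0..1} \<times> D) (\<lambda>(\<tau>, q). \<phi> \<tau> q) \<and>
      T 0 = id \<and> (\<forall>q\<in>D. \<phi> 0 q = q) \<and>
      (\<forall>\<tau>\<in>{0..1}. \<forall>q\<in>D. g \<tau> q = T \<tau> (f (inv_into D (\<phi> \<tau>) q))))"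

text \<open>
  The family \<open>F h m\<close>, with \<open>(h, m)\<close> in \<open>\<Lambda>\<close>, of maps on \<open>D\<close> gives a non-trivial isometric
  deformation of \<open>f\<close> at \<open>p\<close>. Non-triviality is meant member by member: no continuity of
  the isometries and diffeomorphisms in the parameters is required in what is excluded.
\<close>

definition gives_nontrivial_isometric_deformation ::
    "'a::topological_space atlas2 \<Rightarrow> ('a \<Rightarrow> real^3) \<Rightarrow> 'a \<Rightarrow> 'a set \<Rightarrow>
     (real \<times> real) set \<Rightarrow> (real \<Rightarrow> real \<Rightarrow> 'a \<Rightarrow> real^3) \<Rightarrow> bool"
  where "gives_nontrivial_isometric_deformation A f p D \<Lambda> F \<longleftrightarrow>
    continuous_on (\<Lambda> \<times> D) (\<lambda>((h, m), q). F h m q) \<and>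
    (\<exists>(h, m)\<in>\<Lambda>. \<exists>T. euclidean_isometry T \<and> (\<forall>q\<in>D. F h m q = T (f q))) \<and>
    (\<forall>(h, m)\<in>\<Lambda>. isometric_at A f p D (F h m)) \<and>
    \<not> (\<forall>(h, m)\<in>\<Lambda>. \<exists>T \<phi>. euclidean_isometry T \<and> diffeo A A D D \<phi> \<and>
          (\<forall>q\<in>D. F h m q = T (f (inv_into D \<phi> q))))"

text \<open>The deformation \<open>g\<close>, defined on \<open>E\<close>, is given near \<open>p\<close> by the family \<open>F\<close> on \<open>D\<close>.\<close>

definition deformation_given_by ::
    "'a::topological_space atlas2 \<Rightarrow> 'a \<Rightarrow> 'a set \<Rightarrow> (real \<Rightarrow> 'a \<Rightarrow> real^3) \<Rightarrow>
     'a set \<Rightarrow> (real \<times> real) set \<Rightarrow> (real \<Rightarrow> real \<Rightarrow> 'a \<Rightarrow> real^3) \<Rightarrow> bool"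
  where "deformation_given_by A p E g D \<Lambda> F \<longleftrightarrow>
    (\<forall>\<tau>\<in>{0..1}. \<exists>(h, m)\<in>\<Lambda>. \<exists>T U V \<phi>. euclidean_isometry T \<and>
      open U \<and> p \<in> U \<and> U \<subseteq> E \<and> open V \<and> p \<in> V \<and> V \<subseteq> D \<and>
      diffeo A A U V \<phi> \<and> \<phi> p = p \<and> (\<forall>q\<in>U. g \<tau> q = T (F h m (\<phi> q))))"

end

theory Submission
  imports Defs
begin

text \<open>
  Write \<open>n = N + 1\<close>. Near a singular point a generic helicoidal \<open>n\<close>-type edge has natural coordinates
  \<open>(x, y)\<close>: \<open>y\<close> is the time of the helicoidal motion, and \<open>|x|\<^sup>n/n\<close> is the length of the curves orthogonal
  to the orbits, measured from the singular curve \<open>x = 0\<close>. Up to an isometry of space the edge is then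
  \<open>helix_surface k h \<rho> \<beta> \<zeta>\<close>, swept out with pitch \<open>h\<close> by a profile with cylindrical coordinates \<open>\<rho>\<close>, \<open>\<beta>\<close>,
  \<open>\<zeta> + h \<beta>\<close>, and its metric is \<open>x\<^sup>2\<^sup>N dx\<^sup>2 + P(x) dy\<^sup>2\<close> with \<open>P = k\<^sup>2(\<rho>\<^sup>2 + h\<^sup>2)\<close>. This is theorem
  \<open>edge_extraction\<close>; genericity enters in \<open>generator_on_singular_curve\<close>, which shows that the motion
  moves points along the singular curve and that the curve avoids the axis.

  The derivatives of \<open>\<rho>\<close>, \<open>\<beta>\<close>, \<open>\<zeta>\<close> are \<open>x\<^sup>N\<close> times smooth functions. After cancelling \<open>x\<^sup>N\<close>, Bour's
  classical description of helicoidal surfaces with a given metric applies across the singular curve: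
  with \<open>m = 1/k\<close>, the equation \<open>\<rho>\<^sup>2 = m\<^sup>2 P - h\<^sup>2\<close> gives \<open>\<rho>\<close>, and the orthogonality and length conditions
  are then algebraic equations for \<open>\<beta>'/x\<^sup>N\<close> and \<open>\<zeta>'/x\<^sup>N\<close>. They have a solution with \<open>\<zeta>'/x\<^sup>N > 0\<close> exactly
  if a certain function \<open>gap h m\<close> is positive, and this solution is unique (\<open>family_bour_profile\<close>, \<open>bour_unique\<close>). Hence the edges
  with this metric form a family over the open connected set \<open>params\<close> of pairs \<open>(h, m)\<close> with
  \<open>gap h m 0 > 0\<close>.

  Every edge isometric to \<open>f\<close> at \<open>p\<close> belongs to the family. In natural coordinates for both edges the
  isometry preserves the distance \<open>|x|\<^sup>n/n\<close> from the singular curve, which forces it to be of the form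
  \<open>(x, y) \<mapsto> (\<plusminus>x, c y)\<close> (\<open>edge_isometry_rigid\<close>). The signs are absorbed by a symmetry of space
  (\<open>bour_flip\<close>), the factor \<open>|c|\<close> changes \<open>m\<close>, and \<open>bour_unique\<close> identifies the edge with a member.

  The interval on which the member \<open>(h, m)\<close> exists shrinks as \<open>(h, m)\<close> approaches the boundary of
  \<open>params\<close>. In order to define all members on one neighbourhood of \<open>p\<close>, the first coordinate is
  reparametrized by a diffeomorphism depending on \<open>(h, m)\<close> that leaves a smaller interval invariant; on
  the corresponding neighbourhood the member is isometric to \<open>f\<close>. Finally, the singular curves are helices, and
  for fixed \<open>m\<close> their chords over equal time intervals increase with \<open>h\<^sup>2\<close>, so that members with the
  same \<open>m\<close> and different \<open>h\<^sup>2\<close> are not congruent.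
\<close>

section \<open>Calculus of smooth maps\<close>

lemma differentiable_upto_cong:
  assumes "open S" "\<And>x. x \<in> S \<Longrightarrow> f x = g x" "differentiable_upto k S f"
  shows "differentiable_upto k S g"
  using assms(2,3)
proof (induction k arbitrary: f g)
  case 0
  then show ?case using continuous_on_cong by force
next
  case (Suc k)
  have 1: "g differentiable (at x)" if "x \<in> S" for x
    using Suc.prems assms(1) that
    by (metis differentiable_def differentiable_upto.simps(2) has_derivative_transform_within_open)
  have 2: "frechet_derivative f (at x) v = frechet_derivative g (at x) v" if "x \<in> S" for x v
    using Suc.prems that 1 assms(1)
    by (metis differentiable_upto.simps(2) frechet_derivative_at frechet_derivative_works has_derivative_transform_within_open)
  show ?case using Suc.IH[OF 2] Suc.prems 1 by auto
qed

lemma differentiable_upto_imp_continuous_on: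
  "differentiable_upto k S f \<Longrightarrow> continuous_on S f"
  by (cases k) (auto intro!: continuous_at_imp_continuous_on differentiable_imp_continuous_within)

lemma differentiable_upto_Suc_D: "differentiable_upto (Suc k) S f \<Longrightarrow> differentiable_upto k S f"
proof (induction k arbitrary: f)
  case 0 then show ?case using differentiable_upto_imp_continuous_on by fastforce
qed auto

lemma differentiable_upto_subset:
  "differentiable_upto k S f \<Longrightarrow> T \<subseteq> S \<Longrightarrow> differentiable_upto k T f"
  by (induction k arbitrary: f) (auto intro: continuous_on_subset)

lemma differentiable_upto_local:
  assumes "\<And>x. x \<in> S \<Longrightarrow> \<exists>N. open N \<and> x \<in> N \<and> differentiable_upto k N f"
  shows "differentiable_upto k S f"
  using assms
proof (induction k arbitrary: f)
  case 0
  have "continuous (at x) f" if "x \<in> S" for x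
    using 0[OF that] by (auto simp: continuous_on_eq_continuous_at)
  then show ?case
    by (simp add: continuous_at_imp_continuous_on)
next
  case (Suc k)
  show ?case
    using Suc.prems by (force intro!: Suc.IH)
qed

lemma smooth_on_cong:
  "smooth_on S f \<Longrightarrow> open S \<Longrightarrow> (\<And>x. x \<in> S \<Longrightarrow> f x = g x) \<Longrightarrow> smooth_on S g"
  unfolding smooth_on_def using differentiable_upto_cong by blast

lemma smooth_on_subset: "smooth_on S f \<Longrightarrow> T \<subseteq> S \<Longrightarrow> smooth_on T f"
  unfolding smooth_on_def using differentiable_upto_subset by blast

lemma smooth_on_local:
  assumes "\<And>x. x \<in> S \<Longrightarrow> \<exists>N. open N \<and> x \<in> N \<and> smooth_on N f"
  shows "smooth_on S f"
  unfolding smooth_on_def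
  by (intro allI differentiable_upto_local) (use assms smooth_on_def in blast)

lemma smooth_on_differentiable: "smooth_on S f \<Longrightarrow> x \<in> S \<Longrightarrow> f differentiable (at x)"
  unfolding smooth_on_def by (metis differentiable_upto.simps(2))

lemma smooth_on_has_derivative:
  "smooth_on S f \<Longrightarrow> x \<in> S \<Longrightarrow> (f has_derivative frechet_derivative f (at x)) (at x)"
  using smooth_on_differentiable frechet_derivative_works by blast

lemma smooth_on_continuous: "smooth_on S f \<Longrightarrow> continuous_on S f"
  unfolding smooth_on_def using differentiable_upto_imp_continuous_on by blast

lemma smooth_on_frechet: "smooth_on S f \<Longrightarrow> smooth_on S (\<lambda>x. frechet_derivative f (at x) v)"
  unfolding smooth_on_def by (metis differentiable_upto.simps(2))

lemma differentiable_upto_SucI: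
  assumes "open S" "\<And>x. x \<in> S \<Longrightarrow> (f has_derivative f' x) (at x)"
    "\<And>v. differentiable_upto k S (\<lambda>x. f' x v)"
  shows "differentiable_upto (Suc k) S f"
proof -
  have "frechet_derivative f (at x) = f' x" if "x \<in> S" for x
    using assms(2)[OF that] frechet_derivative_at by metis
  then have "differentiable_upto k S (\<lambda>x. frechet_derivative f (at x) v)" for v
    using differentiable_upto_cong[OF assms(1) _ assms(3)[of v]] by simp
  moreover have "\<forall>x\<in>S. f differentiable (at x)"
    using assms(2) differentiable_def by blast
  ultimately show ?thesis by simp
qed

text \<open>
  Smoothness can be verified on any formula for the derivative, without reference to its canonical choice.
\<close>

lemma smooth_onI:
  assumes "open S" "\<And>x. x \<in> S \<Longrightarrow> (f has_derivative f' x) (at x)" "\<And>v. smooth_on S (\<lambda>x. f' x v)"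
  shows "smooth_on S f"
  unfolding smooth_on_def
proof
  fix k
  have "differentiable_upto (Suc k) S f"
    using assms by (intro differentiable_upto_SucI[where f'=f']) (auto simp: smooth_on_def)
  then show "differentiable_upto k S f" by (rule differentiable_upto_Suc_D)
qed

lemma differentiable_upto_const [simp]: "differentiable_upto k S (\<lambda>x. c)"
  by (induction k arbitrary: c) (auto simp: frechet_derivative_const)

lemma smooth_on_const [simp, intro]: "smooth_on S (\<lambda>x. c)"
  by (simp add: smooth_on_def)

lemma smooth_on_bounded_linear:
  assumes "bounded_linear f" shows "smooth_on S f"
proof -
  have "smooth_on UNIV f"
    by (rule smooth_onI[where f'="\<lambda>x. f"]) (auto simp: assms bounded_linear_imp_has_derivative)
  then show ?thesis using smooth_on_subset by blast
qed

lemma smooth_on_id [simp, intro]: "smooth_on S (\<lambda>x. x)" "smooth_on S id"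
  using smooth_on_bounded_linear[OF bounded_linear_ident] by (auto simp: id_def)

lemma differentiable_upto_add:
  assumes "open S" "differentiable_upto k S f" "differentiable_upto k S g"
  shows "differentiable_upto k S (\<lambda>x. f x + g x)"
  using assms(2,3)
proof (induction k arbitrary: f g)
  case 0 then show ?case by (simp add: continuous_on_add)
next
  case (Suc k)
  show ?case
  proof (rule differentiable_upto_SucI[OF assms(1)])
    show "((\<lambda>x. f x + g x) has_derivative
       (\<lambda>v. frechet_derivative f (at x) v + frechet_derivative g (at x) v)) (at x)" if "x \<in> S" for x
      using Suc.prems that by (auto intro!: has_derivative_add simp: frechet_derivative_works[symmetric])
  qed (use Suc in auto)
qed

lemma differentiable_upto_bilinear:
  assumes "bounded_bilinear B" "open S" "differentiable_upto k S f" "differentiable_upto k S g"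
  shows "differentiable_upto k S (\<lambda>x. B (f x) (g x))"
  using assms(3,4)
proof (induction k arbitrary: f g)
  case 0 then show ?case by (simp add: bounded_bilinear.continuous_on[OF assms(1)])
next
  case (Suc k)
  show ?case
  proof (rule differentiable_upto_SucI[OF assms(2)])
    show "((\<lambda>x. B (f x) (g x)) has_derivative
       (\<lambda>v. B (f x) (frechet_derivative g (at x) v) + B (frechet_derivative f (at x) v) (g x))) (at x)"
      if "x \<in> S" for x
      using Suc.prems that
      by (auto intro!: bounded_bilinear.FDERIV[OF assms(1)] simp: frechet_derivative_works[symmetric])
    show "differentiable_upto k S
      (\<lambda>x. B (f x) (frechet_derivative g (at x) v) + B (frechet_derivative f (at x) v) (g x))" for v
      using Suc.prems differentiable_upto_Suc_D[OF Suc.prems(1)] differentiable_upto_Suc_D[OF Suc.prems(2)]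
      by (intro differentiable_upto_add[OF assms(2)] Suc.IH) auto
  qed
qed

lemma smooth_on_add:
  "open S \<Longrightarrow> smooth_on S f \<Longrightarrow> smooth_on S g \<Longrightarrow> smooth_on S (\<lambda>x. f x + g x)"
  by (simp add: smooth_on_def differentiable_upto_add)

lemma smooth_on_bilinear:
  "bounded_bilinear B \<Longrightarrow> open S \<Longrightarrow> smooth_on S f \<Longrightarrow> smooth_on S g \<Longrightarrow> smooth_on S (\<lambda>x. B (f x) (g x))"
  by (simp add: smooth_on_def differentiable_upto_bilinear)

lemmas smooth_on_scaleR = smooth_on_bilinear[OF bounded_bilinear_scaleR]
lemmas smooth_on_inner = smooth_on_bilinear[OF bounded_bilinear_inner]

lemma smooth_on_mult:
  fixes f g :: "'a::real_normed_vector \<Rightarrow> real"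
  shows "open S \<Longrightarrow> smooth_on S f \<Longrightarrow> smooth_on S g \<Longrightarrow> smooth_on S (\<lambda>x. f x * g x)"
  by (rule smooth_on_bilinear[OF bounded_bilinear_mult])

lemma smooth_on_power:
  fixes f :: "'a::real_normed_vector \<Rightarrow> real"
  shows "open S \<Longrightarrow> smooth_on S f \<Longrightarrow> smooth_on S (\<lambda>x. f x ^ k)"
  by (induction k) (auto intro: smooth_on_mult)

lemma differentiable_upto_sum:
  assumes "open S" "\<And>i. i \<in> I \<Longrightarrow> differentiable_upto k S (f i)"
  shows "differentiable_upto k S (\<lambda>x. \<Sum>i\<in>I. f i x)"
  using assms(2)
  by (induction I rule: infinite_finite_induct) (auto intro: differentiable_upto_add[OF assms(1)])

lemma smooth_on_sum:
  "open S \<Longrightarrow> (\<And>i. i \<in> I \<Longrightarrow> smooth_on S (f i)) \<Longrightarrow> smooth_on S (\<lambda>x. \<Sum>i\<in>I. f i x)"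
  by (simp add: smooth_on_def differentiable_upto_sum)

text \<open>
  Expanding the derivative of the inner map in the standard basis turns the chain rule into a finite
  sum of products of maps that are covered by the induction hypothesis.
\<close>

lemma differentiable_upto_compose:
  fixes g :: "'a::real_normed_vector \<Rightarrow> 'b::euclidean_space" and f :: "'b \<Rightarrow> 'c::real_normed_vector"
  assumes "open S" "g ` S \<subseteq> T" "differentiable_upto k T f" "differentiable_upto k S g"
  shows "differentiable_upto k S (\<lambda>x. f (g x))"
  using assms(3,4)
proof (induction k arbitrary: f)
  case 0 then show ?case
    using assms(2) by (auto intro!: continuous_on_compose2[of T f])
next
  case (Suc k)
  note gk = differentiable_upto_Suc_D[OF Suc.prems(2)]
  have dg: "(g has_derivative frechet_derivative g (at x)) (at x)" if "x \<in> S" for x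
    using Suc.prems(2) that by (simp add: frechet_derivative_works[symmetric])
  have df: "(f has_derivative frechet_derivative f (at (g x))) (at (g x))" if "x \<in> S" for x
    using Suc.prems(1) that assms(2) by (auto simp: frechet_derivative_works[symmetric])
  show ?case
  proof (rule differentiable_upto_SucI[OF assms(1)])
    fix x assume x: "x \<in> S"
    have "((\<lambda>x. f (g x)) has_derivative (\<lambda>v. frechet_derivative f (at (g x)) (frechet_derivative g (at x) v))) (at x)"
      using has_derivative_compose[OF dg[OF x] df[OF x]] .
    moreover have "frechet_derivative f (at (g x)) (frechet_derivative g (at x) v) =
      (\<Sum>b\<in>Basis. (frechet_derivative g (at x) v \<bullet> b) *\<^sub>R frechet_derivative f (at (g x)) b)" for v
    proof -
      have "linear (frechet_derivative f (at (g x)))"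
        using df[OF x] has_derivative_linear by blast
      then have "frechet_derivative f (at (g x)) (\<Sum>b\<in>Basis. (y \<bullet> b) *\<^sub>R b) =
        (\<Sum>b\<in>Basis. (y \<bullet> b) *\<^sub>R frechet_derivative f (at (g x)) b)" for y
        by (simp add: linear_sum linear_scale)
      from this[of "frechet_derivative g (at x) v"] show ?thesis
        unfolding euclidean_representation .
    qed
    ultimately show "((\<lambda>x. f (g x)) has_derivative (\<lambda>v. \<Sum>b\<in>Basis. (frechet_derivative g (at x) v \<bullet> b) *\<^sub>R frechet_derivative f (at (g x)) b)) (at x)"
      by (rule has_derivative_eq_rhs[OF _ ext])
  next
    fix v
    have "differentiable_upto k S (\<lambda>x. frechet_derivative g (at x) v \<bullet> b)" for b
      using Suc.prems(2)
      by (intro differentiable_upto_bilinear[OF bounded_bilinear_inner assms(1)]) auto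
    moreover have "differentiable_upto k S (\<lambda>x. frechet_derivative f (at (g x)) b)" for b
      using Suc.IH[of "\<lambda>x. frechet_derivative f (at x) b"] Suc.prems(1) gk by simp
    ultimately show "differentiable_upto k S (\<lambda>x. \<Sum>b\<in>Basis. (frechet_derivative g (at x) v \<bullet> b) *\<^sub>R frechet_derivative f (at (g x)) b)"
      by (intro differentiable_upto_sum assms(1) differentiable_upto_bilinear[OF bounded_bilinear_scaleR])
  qed
qed

lemma smooth_on_compose2:
  fixes g :: "'a::real_normed_vector \<Rightarrow> 'b::euclidean_space" and f :: "'b \<Rightarrow> 'c::real_normed_vector"
  assumes "smooth_on T f" "open S" "g ` S \<subseteq> T" "smooth_on S g"
  shows "smooth_on S (\<lambda>x. f (g x))"
  using assms differentiable_upto_compose unfolding smooth_on_def by blast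

lemma smooth_on_bounded_linear_compose:
  fixes g :: "'a::real_normed_vector \<Rightarrow> 'b::euclidean_space"
  assumes "bounded_linear f" "open S" "smooth_on S g"
  shows "smooth_on S (\<lambda>x. f (g x))"
  using smooth_on_compose2[OF smooth_on_bounded_linear[OF assms(1), of UNIV]] assms by auto

lemma smooth_on_minus:
  fixes f :: "'a::real_normed_vector \<Rightarrow> 'b::euclidean_space"
  shows "open S \<Longrightarrow> smooth_on S f \<Longrightarrow> smooth_on S (\<lambda>x. - f x)"
  by (rule smooth_on_bounded_linear_compose[OF bounded_linear_minus[OF bounded_linear_ident]])

lemma smooth_on_diff:
  fixes f :: "'a::real_normed_vector \<Rightarrow> 'b::euclidean_space"
  shows "open S \<Longrightarrow> smooth_on S f \<Longrightarrow> smooth_on S g \<Longrightarrow> smooth_on S (\<lambda>x. f x - g x)"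
  using smooth_on_add[of S f "\<lambda>x. - g x"] smooth_on_minus[of S g] by simp

lemma smooth_on_nth:
  fixes f :: "'a::real_normed_vector \<Rightarrow> real^'n"
  shows "open S \<Longrightarrow> smooth_on S f \<Longrightarrow> smooth_on S (\<lambda>x. f x $ i)"
  by (rule smooth_on_bounded_linear_compose[OF bounded_linear_vec_nth])

lemma smooth_on_nth' [intro]: "smooth_on S (\<lambda>x::real^'n. x $ i)"
  by (rule smooth_on_bounded_linear[OF bounded_linear_vec_nth])

lemma smooth_on_vec:
  fixes f :: "'a::real_normed_vector \<Rightarrow> real^'n"
  assumes "open S" "\<And>i. smooth_on S (\<lambda>x. f x $ i)"
  shows "smooth_on S f"
proof -
  have "f = (\<lambda>x. \<Sum>i\<in>UNIV. (f x $ i) *\<^sub>R axis i 1)"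
    by (auto simp: fun_eq_iff vec_eq_iff axis_def if_distrib cong: if_cong)
  moreover have "smooth_on S (\<lambda>x. \<Sum>i\<in>UNIV. (f x $ i) *\<^sub>R (axis i 1 :: real^'n))"
    by (intro smooth_on_sum smooth_on_scaleR assms smooth_on_const)
  ultimately show ?thesis by metis
qed

lemma smooth_on_vector2:
  assumes "open S" "smooth_on S a" "smooth_on S b"
  shows "smooth_on S (\<lambda>x. vector [a x, b x] :: real^2)"
proof (rule smooth_on_vec[OF assms(1)])
  fix i :: 2
  show "smooth_on S (\<lambda>x. (vector [a x, b x] :: real^2) $ i)"
    using exhaust_2[of i] assms by auto
qed

lemma smooth_on_vector3:
  assumes "open S" "smooth_on S a" "smooth_on S b" "smooth_on S c"
  shows "smooth_on S (\<lambda>x. vector [a x, b x, c x] :: real^3)"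
proof (rule smooth_on_vec[OF assms(1)])
  fix i :: 3
  show "smooth_on S (\<lambda>x. (vector [a x, b x, c x] :: real^3) $ i)"
    using exhaust_3[of i] assms by auto
qed

lemma smooth_on_fst [intro]: "smooth_on S fst" and smooth_on_snd [intro]: "smooth_on S snd"
  by (auto intro: smooth_on_bounded_linear bounded_linear_fst bounded_linear_snd)

lemma smooth_on_Pair:
  fixes f :: "'a::real_normed_vector \<Rightarrow> 'b::euclidean_space" and g :: "'a \<Rightarrow> 'c::euclidean_space"
  assumes "open S" "smooth_on S f" "smooth_on S g"
  shows "smooth_on S (\<lambda>x. (f x, g x))"
proof -
  have "smooth_on S (\<lambda>x. (f x, 0::'c))" "smooth_on S (\<lambda>x. (0::'b, g x))"
    using smooth_on_bounded_linear_compose[OF bounded_linear_Pair[OF bounded_linear_ident bounded_linear_zero] assms(1,2)]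
      smooth_on_bounded_linear_compose[OF bounded_linear_Pair[OF bounded_linear_zero bounded_linear_ident] assms(1,3)]
    by auto
  from smooth_on_add[OF assms(1) this] show ?thesis by simp
qed

lemma smooth_on_realI:
  fixes f :: "real \<Rightarrow> 'b::real_normed_vector"
  assumes "open S" "\<And>x. x \<in> S \<Longrightarrow> (f has_vector_derivative f' x) (at x)" "smooth_on S f'"
  shows "smooth_on S f"
proof (rule smooth_onI[OF assms(1)])
  show "(f has_derivative (\<lambda>v. v *\<^sub>R f' x)) (at x)" if "x \<in> S" for x
    using assms(2)[OF that] by (simp add: has_vector_derivative_def)
  show "smooth_on S (\<lambda>x. v *\<^sub>R f' x)" for v
    using smooth_on_scaleR[OF assms(1) smooth_on_const assms(3)] .
qed

lemma smooth_on_real_deriv: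
  fixes f :: "real \<Rightarrow> 'b::real_normed_vector"
  assumes "smooth_on S f" "x \<in> S"
  shows "(f has_vector_derivative frechet_derivative f (at x) 1) (at x)"
proof -
  have d: "(f has_derivative frechet_derivative f (at x)) (at x)"
    by (rule smooth_on_has_derivative[OF assms])
  then have "frechet_derivative f (at x) v = v *\<^sub>R frechet_derivative f (at x) 1" for v
    using linear_scale[OF has_derivative_linear[OF d], of v 1] by simp
  then show ?thesis
    unfolding has_vector_derivative_def by (intro has_derivative_eq_rhs[OF d] ext)
qed

text \<open>
  If the derivative of \<open>g\<close> is a smooth function of the value of \<open>g\<close>, every order of differentiability
  of \<open>g\<close> yields the next one. This covers solutions of autonomous differential equations as well as
  inverse functions.
\<close>

lemma smooth_on_bootstrap:
  fixes g :: "'a::real_normed_vector \<Rightarrow> 'b::euclidean_space"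
  assumes "open S" "g ` S \<subseteq> T" "\<And>v. smooth_on T (K v)"
    "\<And>x. x \<in> S \<Longrightarrow> (g has_derivative (\<lambda>v. K v (g x))) (at x)"
  shows "smooth_on S g"
  unfolding smooth_on_def
proof
  fix k show "differentiable_upto k S g"
  proof (induction k)
    case 0
    then show ?case
      using assms(4) by (auto intro!: continuous_at_imp_continuous_on has_derivative_continuous)
  next
    case (Suc k)
    then show ?case
      using differentiable_upto_compose[OF assms(1,2) _ Suc] assms(3)
      by (intro differentiable_upto_SucI[OF assms(1,4)]) (auto simp: smooth_on_def)
  qed
qed

lemma smooth_on_real_bootstrap:
  fixes g :: "real \<Rightarrow> real"
  assumes "open S" "g ` S \<subseteq> T" "smooth_on T K" "open T"
    "\<And>x. x \<in> S \<Longrightarrow> (g has_real_derivative K (g x)) (at x)"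
  shows "smooth_on S g"
proof (rule smooth_on_bootstrap[OF assms(1,2), where K="\<lambda>v x. K x * v"])
  show "smooth_on T (\<lambda>x. K x * v)" for v
    by (intro smooth_on_mult assms smooth_on_const)
qed (use assms(5) in \<open>simp add: has_field_derivative_def mult_commute_abs\<close>)

lemma smooth_on_inverse': "smooth_on (- {0::real}) inverse"
  by (rule smooth_on_real_bootstrap[where T=UNIV and K="\<lambda>y. - (y\<^sup>2)"])
     (auto intro!: smooth_on_minus smooth_on_power derivative_eq_intros, simp add: power2_eq_square)

lemma smooth_on_exp: "smooth_on UNIV (exp :: real \<Rightarrow> real)"
  by (rule smooth_on_real_bootstrap[where T=UNIV and K="\<lambda>y. y"]) (auto intro!: derivative_eq_intros)

lemma smooth_on_ln': "smooth_on {0::real<..} ln"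
  by (rule smooth_on_realI[where f'="inverse"])
     (auto intro!: derivative_eq_intros smooth_on_subset[OF smooth_on_inverse']
       simp: has_real_derivative_iff_has_vector_derivative[symmetric] field_simps)

lemma smooth_on_sqrt': "smooth_on {0::real<..} sqrt"
proof (rule smooth_on_real_bootstrap[where T="{0<..}" and K="\<lambda>y. inverse y * (1/2)"])
  show "smooth_on {0::real<..} (\<lambda>y. inverse y * (1/2))"
    by (intro smooth_on_mult smooth_on_subset[OF smooth_on_inverse']) auto
qed (auto intro!: derivative_eq_intros simp: field_simps)

lemma differentiable_upto_sin_cos:
  "differentiable_upto k UNIV (\<lambda>x::real. a * sin x + b * cos x)"
proof (induction k arbitrary: a b)
  case (Suc k)
  show ?case
  proof (rule differentiable_upto_SucI)
    show "((\<lambda>x::real. a * sin x + b * cos x) has_derivative (\<lambda>v. (- b * v) * sin x + (a * v) * cos x)) (at x)" for x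
      by (auto intro!: derivative_eq_intros simp: algebra_simps)
    show "differentiable_upto k UNIV (\<lambda>x. (- b * v) * sin x + (a * v) * cos x)" for v
      by (rule Suc)
  qed auto
qed (auto intro!: continuous_intros)

lemma smooth_on_sin': "smooth_on UNIV (sin :: real \<Rightarrow> real)"
  and smooth_on_cos': "smooth_on UNIV (cos :: real \<Rightarrow> real)"
  using differentiable_upto_sin_cos[of _ 1 0] differentiable_upto_sin_cos[of _ 0 1]
  by (auto simp: smooth_on_def)

context
  fixes S :: "'a::real_normed_vector set" and f :: "'a \<Rightarrow> real"
  assumes S: "open S" and f: "smooth_on S f"
begin

lemma smooth_on_inverse: "(\<And>x. x \<in> S \<Longrightarrow> f x \<noteq> 0) \<Longrightarrow> smooth_on S (\<lambda>x. inverse (f x))"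
  by (rule smooth_on_compose2[OF smooth_on_inverse' S _ f]) auto

lemma smooth_on_sqrt: "(\<And>x. x \<in> S \<Longrightarrow> f x > 0) \<Longrightarrow> smooth_on S (\<lambda>x. sqrt (f x))"
  by (rule smooth_on_compose2[OF smooth_on_sqrt' S _ f]) auto

lemma smooth_on_sin: "smooth_on S (\<lambda>x. sin (f x))"
  by (rule smooth_on_compose2[OF smooth_on_sin' S _ f]) auto

lemma smooth_on_cos: "smooth_on S (\<lambda>x. cos (f x))"
  by (rule smooth_on_compose2[OF smooth_on_cos' S _ f]) auto

lemma smooth_on_powr_const: "(\<And>x. x \<in> S \<Longrightarrow> f x > 0) \<Longrightarrow> smooth_on S (\<lambda>x. f x powr a)"
proof -
  assume pos: "\<And>x. x \<in> S \<Longrightarrow> f x > 0"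
  have "smooth_on S (\<lambda>x. exp (a * ln (f x)))"
    by (rule smooth_on_compose2[OF smooth_on_exp S _ smooth_on_mult[OF S _ smooth_on_compose2[OF smooth_on_ln' S _ f]]])
      (use pos in auto)
  then show ?thesis
    by (rule smooth_on_cong[OF _ S]) (use pos in \<open>force simp: powr_def\<close>)
qed

lemma smooth_on_divide:
  "smooth_on S g \<Longrightarrow> (\<And>x. x \<in> S \<Longrightarrow> f x \<noteq> 0) \<Longrightarrow> smooth_on S (\<lambda>x. g x / f x)" for g :: "'a \<Rightarrow> real"
  unfolding divide_inverse by (intro smooth_on_mult[OF S] smooth_on_inverse)

lemma smooth_on_arctan: "smooth_on S (\<lambda>x. arctan (f x))"
proof -
  have "smooth_on UNIV arctan"
  proof (rule smooth_on_realI)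
    show "(arctan has_vector_derivative inverse (1 + x\<^sup>2)) (at x)" for x
      using DERIV_arctan[of x] by (simp add: has_real_derivative_iff_has_vector_derivative)
    have "smooth_on UNIV (\<lambda>x::real. 1 + x\<^sup>2)"
      by (intro smooth_on_add smooth_on_power) auto
    then show "smooth_on UNIV (\<lambda>x::real. inverse (1 + x\<^sup>2))"
      by (rule smooth_on_compose2[OF smooth_on_inverse' open_UNIV, rotated])
        (auto simp: add_nonneg_eq_0_iff)
  qed auto
  then show ?thesis
    by (rule smooth_on_compose2[OF _ S _ f]) auto
qed

end

lemmas smooth_intros = smooth_on_add smooth_on_scaleR smooth_on_inner smooth_on_mult smooth_on_power
  smooth_on_sum smooth_on_minus smooth_on_diff smooth_on_nth smooth_on_vector2 smooth_on_vector3
  smooth_on_Pair smooth_on_inverse smooth_on_sqrt smooth_on_sin smooth_on_cos smooth_on_powr_const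
  smooth_on_divide smooth_on_arctan smooth_on_const smooth_on_id smooth_on_nth'

section \<open>Dividing by powers, and the inverse function theorem\<close>

text \<open>
  Hadamard's quotient: \<open>u\<^sup>j\<^sup>+\<^sup>1 avg j e u\<close> is the primitive of \<open>u\<^sup>j e(u)\<close> that vanishes at the origin. It is how
  powers of the coordinate are divided out of the profile functions.
\<close>

definition avg :: "nat \<Rightarrow> (real \<Rightarrow> real) \<Rightarrow> real \<Rightarrow> real"
  where "avg j e u = integral {0..1} (\<lambda>x. x ^ j * e (x * u))"

lemma scaled_in_interval:
  fixes u r x :: real
  assumes "u \<in> {-r<..<r}" "x \<in> {0..1}" shows "x * u \<in> {-r<..<r}"
proof -
  have "\<bar>x * u\<bar> \<le> 1 * \<bar>u\<bar>" unfolding abs_mult using assms by (intro mult_right_mono) auto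
  also have "\<dots> < r" using assms by auto
  finally show ?thesis by auto
qed

lemma avg_continuous:
  fixes e :: "real \<Rightarrow> real"
  assumes "continuous_on {-r<..<r} e" "u \<in> {-r<..<r}"
  shows "continuous_on {0..1} (\<lambda>x. x ^ j * e (x * u))"
  using scaled_in_interval[OF assms(2)]
  by (auto intro!: continuous_intros continuous_on_compose2[OF assms(1)])

lemma avg_deriv:
  assumes e: "\<And>x. x \<in> {-r<..<r} \<Longrightarrow> (e has_real_derivative e' x) (at x)"
    and e': "continuous_on {-r<..<r} e'" and u: "u \<in> {-r<..<r}"
  shows "(avg j e has_real_derivative avg (Suc j) e' u) (at u)"
proof -
  have ce: "continuous_on {-r<..<r} e"
    using e by (meson DERIV_isCont continuous_at_imp_continuous_on)
  have sc: "x * v \<in> {-r<..<r}" if "v \<in> {-r<..<r}" "x \<in> {0..1}" for x v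
    using scaled_in_interval that by blast
  have "((\<lambda>u. integral (cbox 0 1) (\<lambda>x. x ^ j * e (x * u))) has_real_derivative
      integral (cbox 0 1) (\<lambda>x. x ^ Suc j * e' (x * u))) (at u within {-r<..<r})"
  proof (rule leibniz_rule_field_derivative)
    show "((\<lambda>x. t ^ j * e (t * x)) has_real_derivative t ^ Suc j * e' (t * x)) (at x within {-r<..<r})"
      if "x \<in> {-r<..<r}" "t \<in> cbox 0 1" for x t
    proof -
      have "(e has_real_derivative e' (t * x)) (at (t * x))"
        using e sc that by auto
      then have "((\<lambda>x. e (t * x)) has_real_derivative e' (t * x) * t) (at x within {-r<..<r})"
        by (rule DERIV_chain2) (auto intro!: derivative_eq_intros)
      then show ?thesis by (auto intro!: derivative_eq_intros)
    qed
    show "(\<lambda>x. x ^ j * e (x * v)) integrable_on cbox 0 1" if "v \<in> {-r<..<r}" for v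
      using integrable_continuous_interval[OF avg_continuous[OF ce that]] by simp
    show "continuous_on ({-r<..<r} \<times> cbox 0 1) (\<lambda>(x, t). t ^ Suc j * e' (t * x))"
      unfolding case_prod_unfold
      by (rule continuous_on_mult[OF _ continuous_on_compose2[OF e']])
         (use sc in \<open>auto intro!: continuous_intros\<close>)
  qed (use u in auto)
  then show ?thesis
    using u by (simp add: avg_def[abs_def] at_within_open[OF u open_greaterThanLessThan])
qed

lemma avg_parts:
  assumes e: "\<And>x. x \<in> {-r<..<r} \<Longrightarrow> (e has_real_derivative e' x) (at x)"
    and e': "continuous_on {-r<..<r} e'" and u: "u \<in> {-r<..<r}"
  shows "e u = (1 + real j) * avg j e u + u * avg (Suc j) e' u"
proof -
  have ce: "continuous_on {-r<..<r} e"
    using e by (meson DERIV_isCont continuous_at_imp_continuous_on)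
  have "((\<lambda>x. (1 + real j) * (x ^ j * e (x * u)) + u * (x ^ Suc j * e' (x * u))) has_integral
     1 ^ Suc j * e (1 * u) - 0 ^ Suc j * e (0 * u)) {0..1}"
  proof (rule fundamental_theorem_of_calculus)
    fix x :: real assume x: "x \<in> {0..1}"
    have "((\<lambda>x. e (x * u)) has_real_derivative e' (x * u) * u) (at x within {0..1})"
      by (rule DERIV_chain2[OF e]) (use scaled_in_interval[OF u x] in \<open>auto intro!: derivative_eq_intros\<close>)
    then show "((\<lambda>x. x ^ Suc j * e (x * u)) has_vector_derivative
       (1 + real j) * (x ^ j * e (x * u)) + u * (x ^ Suc j * e' (x * u))) (at x within {0..1})"
      unfolding has_real_derivative_iff_has_vector_derivative[symmetric]
      by (rule DERIV_mult'[OF DERIV_power[OF DERIV_ident], THEN DERIV_cong]) (simp add: algebra_simps)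
  qed auto
  moreover have "((\<lambda>x. (1 + real j) * (x ^ j * e (x * u)) + u * (x ^ Suc j * e' (x * u))) has_integral
     (1 + real j) * avg j e u + u * avg (Suc j) e' u) {0..1}"
    unfolding avg_def
    by (intro has_integral_add has_integral_mult_right integrable_integral integrable_continuous_interval
        avg_continuous[OF ce u] avg_continuous[OF e' u])
  ultimately have "1 ^ Suc j * e (1 * u) - 0 ^ Suc j * e (0 * u) = (1 + real j) * avg j e u + u * avg (Suc j) e' u"
    by (rule has_integral_unique)
  then show ?thesis by simp
qed

lemma smooth_on_real_DERIV:
  fixes e :: "real \<Rightarrow> real"
  assumes "smooth_on S e" "x \<in> S"
  shows "(e has_real_derivative frechet_derivative e (at x) 1) (at x)"
  using smooth_on_real_deriv[OF assms] by (simp add: has_real_derivative_iff_has_vector_derivative)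

lemma avg_primitive:
  assumes e: "smooth_on {-r<..<r} e" and u: "u \<in> {-r<..<r}"
  shows "((\<lambda>u. u ^ Suc j * avg j e u) has_real_derivative u ^ j * e u) (at u)"
proof -
  let ?e' = "\<lambda>x. frechet_derivative e (at x) 1"
  have c: "continuous_on {-r<..<r} ?e'"
    using smooth_on_continuous smooth_on_frechet e by blast
  have d: "\<And>x. x \<in> {-r<..<r} \<Longrightarrow> (e has_real_derivative ?e' x) (at x)"
    using smooth_on_real_DERIV[OF e] .
  show ?thesis
    by (rule DERIV_mult'[OF DERIV_power[OF DERIV_ident] avg_deriv[OF d c u], THEN DERIV_cong])
       (use avg_parts[OF d c u, of j] in \<open>simp_all add: algebra_simps\<close>)
qed

lemma avg_unique:
  assumes e: "smooth_on {-r<..<r} e" and u: "u \<in> {-r<..<r}"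
    and F: "\<And>x. x \<in> {-r<..<r} \<Longrightarrow> (F has_real_derivative x ^ j * e x) (at x)"
  shows "F u = F 0 + u ^ Suc j * avg j e u"
proof -
  have "((\<lambda>u. F u - u ^ Suc j * avg j e u) has_real_derivative 0) (at x)" if "x \<in> {-r<..<r}" for x
    using DERIV_diff[OF F[OF that] avg_primitive[OF e that, of j]] by simp
  then obtain c where c: "F x - x ^ Suc j * avg j e x = c" if "x \<in> {-r<..<r}" for x
    using has_field_derivative_zero_constant[of "{-r<..<r}" "\<lambda>u. F u - u ^ Suc j * avg j e u"]
    by (auto simp: has_field_derivative_at_within)
  have "F u - u ^ Suc j * avg j e u = F 0 - 0 ^ Suc j * avg j e 0"
    using c[OF u] c[of 0] u by auto
  then show ?thesis by simp
qed

lemma differentiable_upto_avg: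
  assumes "smooth_on {-r<..<r} e"
  shows "differentiable_upto k {-r<..<r} (avg j e)"
  using assms
proof (induction k arbitrary: j e)
  case 0
  show ?case
    unfolding differentiable_upto.simps
    using avg_deriv[OF smooth_on_real_DERIV[OF 0], OF _ smooth_on_continuous[OF smooth_on_frechet[OF 0]]]
    by (intro DERIV_continuous_on) (blast intro: has_field_derivative_at_within)
next
  case (Suc k)
  show ?case
  proof (rule differentiable_upto_SucI)
    let ?e' = "\<lambda>x. frechet_derivative e (at x) 1"
    show "(avg j e has_derivative (\<lambda>v. v *\<^sub>R avg (Suc j) ?e' x)) (at x)"
      if "x \<in> {-r<..<r}" for x
      using avg_deriv[OF smooth_on_real_DERIV[OF Suc.prems] smooth_on_continuous[OF smooth_on_frechet[OF Suc.prems]] that]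
      by (auto simp: has_real_derivative_iff_has_vector_derivative has_vector_derivative_def)
    show "differentiable_upto k {- r<..<r} (\<lambda>x. v *\<^sub>R avg (Suc j) ?e' x)" for v
      by (intro differentiable_upto_bilinear[OF bounded_bilinear_scaleR] Suc.IH smooth_on_frechet Suc.prems) auto
  qed auto
qed

lemma smooth_on_avg: "smooth_on {-r<..<r} e \<Longrightarrow> smooth_on {-r<..<r} (avg j e)"
  by (simp add: smooth_on_def[of _ "avg j e"] differentiable_upto_avg)

lemma avg_0: "avg j e 0 = e 0 / (1 + real j)"
proof -
  have "((\<lambda>x::real. x ^ j * e 0) has_integral 1 ^ Suc j * (e 0 / (1 + real j)) - 0 ^ Suc j * (e 0 / (1 + real j))) {0..1}"
  proof (rule fundamental_theorem_of_calculus)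
    show "((\<lambda>x::real. x ^ Suc j * (e 0 / (1 + real j))) has_vector_derivative x ^ j * e 0) (at x within {0..1})" for x
      unfolding has_real_derivative_iff_has_vector_derivative[symmetric]
      by (rule DERIV_cmult_right[OF DERIV_power_Suc[OF DERIV_ident], THEN DERIV_cong]) simp
  qed simp
  then show ?thesis unfolding avg_def mult_zero_right by (subst integral_unique) auto
qed

lemma avg_pos:
  assumes "continuous_on {-r<..<r} e" "u \<in> {-r<..<r}" "\<And>x. x \<in> {-r<..<r} \<Longrightarrow> e x > 0"
  shows "avg j e u > 0"
proof -
  let ?f = "\<lambda>x. x ^ j * e (x * u)"
  have c: "continuous_on {0..1} ?f" by (rule avg_continuous[OF assms(1,2)])
  have p: "?f x \<ge> 0" if "x \<in> {0..1}" for x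
    using that assms(3)[OF scaled_in_interval[OF assms(2) that]] by (auto intro!: mult_nonneg_nonneg)
  have "avg j e u \<ge> 0" unfolding avg_def
    by (rule integral_nonneg) (use p c in \<open>auto intro: integrable_continuous_interval\<close>)
  moreover have "avg j e u \<noteq> 0"
  proof
    assume "avg j e u = 0"
    then have "(?f has_integral 0) (cbox 0 1)"
      unfolding avg_def using integrable_integral[OF integrable_continuous_interval[OF c]] by simp
    then have "?f 1 = 0"
      using has_integral_0_cbox_imp_0[of 0 1 ?f 1] c p by (simp add: box_real)
    then show False using assms(3)[OF assms(2)] by simp
  qed
  ultimately show ?thesis by simp
qed

lemma smooth_on_prod:
  fixes f :: "'i \<Rightarrow> 'a::real_normed_vector \<Rightarrow> real"
  assumes "open S" "\<And>i. i \<in> I \<Longrightarrow> smooth_on S (f i)"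
  shows "smooth_on S (\<lambda>x. \<Prod>i\<in>I. f i x)"
  using assms(2) by (induction I rule: infinite_finite_induct) (auto intro: smooth_on_mult[OF assms(1)])

lemma smooth_on_det:
  fixes M :: "'a::real_normed_vector \<Rightarrow> real^'n^'n"
  assumes "open S" "\<And>i j. smooth_on S (\<lambda>x. M x $ i $ j)"
  shows "smooth_on S (\<lambda>x. det (M x))"
  unfolding det_def by (intro smooth_on_sum smooth_on_mult smooth_on_prod smooth_on_const assms)

text \<open>Cramer's rule shows that the inverse of the derivative depends smoothly on the point.\<close>

theorem smooth_inverse_function:
  fixes f :: "real^'n \<Rightarrow> real^'n"
  assumes S: "open S" and f: "smooth_on S f" and a: "a \<in> S"
    and inj: "inj (frechet_derivative f (at a))"
  obtains U V g where "open U" "a \<in> U" "U \<subseteq> S" "open V" "homeomorphism U V f g" "smooth_on V g"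
proof -
  let ?D = "\<lambda>x. frechet_derivative f (at x)"
  have bl: "bounded_linear (?D x)" if "x \<in> S" for x
    using smooth_on_has_derivative[OF f that] has_derivative_bounded_linear by blast
  define f' where "f' x = Blinfun (?D x)" for x
  have ap: "blinfun_apply (f' x) = ?D x" if "x \<in> S" for x
    unfolding f'_def by (rule bounded_linear_Blinfun_apply[OF bl[OF that]])
  have cf': "continuous_on S f'"
  proof (rule continuous_on_blinfun_componentwise)
    fix i :: "real^'n"
    have "continuous_on S (\<lambda>x. ?D x i)"
      by (rule smooth_on_continuous[OF smooth_on_frechet[OF f]])
    then show "continuous_on S (\<lambda>x. blinfun_apply (f' x) i)"
      by (rule continuous_on_eq) (simp add: ap)
  qed
  obtain L where L: "linear L" "L \<circ> ?D a = id"
    using linear_injective_left_inverse[OF bounded_linear.linear[OF bl[OF a]] inj] by blast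
  have "Blinfun L o\<^sub>L f' a = id_blinfun"
    using L by (intro blinfun_eqI) (auto simp: bounded_linear_Blinfun_apply linear_conv_bounded_linear ap[OF a] fun_eq_iff)
  from inverse_function_theorem[OF S _ cf' a this] obtain U V g g' where
    U: "open U" "U \<subseteq> S" "a \<in> U" "open V" "homeomorphism U V f g" and
    g: "\<And>y. y \<in> V \<Longrightarrow> (g has_derivative g' y) (at y)" "\<And>y. y \<in> V \<Longrightarrow> g' y = inv (blinfun_apply (f' (g y)))"
      "\<And>y. y \<in> V \<Longrightarrow> bij (blinfun_apply (f' (g y)))"
    using smooth_on_has_derivative[OF f] ap by metis
  have gU: "g ` V = U" using U(5) by (simp add: homeomorphism_def)
  let ?M = "\<lambda>x. matrix (?D x)"
  let ?K = "\<lambda>v x. \<chi> k. det (\<chi> i j. if j = k then v $ i else ?M x $ i $ j) / det (?M x)"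
  have M: "?M x *v w = ?D x w" if "x \<in> S" for x w
    using matrix_vector_mul(3)[OF bl[OF that]] by (rule fun_cong)
  have dM: "det (?M x) \<noteq> 0" if "x \<in> U" for x
  proof -
    obtain y where y: "y \<in> V" "x = g y" using gU \<open>x \<in> U\<close> by auto
    have "x \<in> S" using U that by auto
    have "bij (?D x)" using g(3)[OF y(1)] ap[of x] y \<open>x \<in> S\<close> by simp
    moreover have "linear (?D x)" using bl[OF \<open>x \<in> S\<close>] bounded_linear.linear by blast
    ultimately show ?thesis using det_nz_iff_inj[of "?D x"] by (simp add: bij_def)
  qed
  have "smooth_on V g"
  proof (rule smooth_on_bootstrap[OF U(4), where T=U and K="?K"])
    show "g ` V \<subseteq> U" using gU by simp
    have Ms: "smooth_on U (\<lambda>x. ?M x $ i $ j)" for i j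
      unfolding matrix_def
      by (auto intro!: smooth_on_nth U(1) smooth_on_subset[OF smooth_on_frechet[OF f] U(2)])
    show "smooth_on U (?K v)" for v
    proof (rule smooth_on_vec[OF U(1)])
      fix k
      have "smooth_on U (\<lambda>x. det (\<chi> i j. if j = k then v $ i else ?M x $ i $ j))"
      proof (rule smooth_on_det[OF U(1)])
        fix i j
        show "smooth_on U (\<lambda>x. (\<chi> i j. if j = k then v $ i else ?M x $ i $ j) $ i $ j)"
          using Ms by (cases "j = k") auto
      qed
      from smooth_on_divide[OF U(1) smooth_on_det[OF U(1) Ms] this dM]
      show "smooth_on U (\<lambda>x. ?K v x $ k)" by simp
    qed
    fix y assume y: "y \<in> V"
    have gy: "g y \<in> U" "g y \<in> S" using gU y U by auto
    have "g' y v = ?K v (g y)" for v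
    proof -
      have "?D (g y) (g' y v) = v"
        using g(2,3)[OF y] ap[OF gy(2)] by (simp add: bij_is_surj surj_f_inv_f)
      then have "?M (g y) *v (g' y v) = v" using M[OF gy(2)] by simp
      then show ?thesis using cramer[OF dM[OF gy(1)]] by blast
    qed
    then show "(g has_derivative (\<lambda>v. ?K v (g y))) (at y)"
      by (intro has_derivative_eq_rhs[OF g(1)[OF y]] ext)
  qed
  then show ?thesis using that U by blast
qed

section \<open>Maps between manifolds in coordinates\<close>

lemma euclidean_chart [simp]: "(U, x) \<in> euclidean_atlas \<longleftrightarrow> U = UNIV \<and> x = id"
  by (auto simp: euclidean_atlas_def)

lemma inv_into_id [simp]: "inv_into UNIV id = id"
  by (metis inv_id)

lemma smooth_atlas_euclidean [simp]: "smooth_atlas euclidean_atlas"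
  by (auto simp: smooth_atlas_def euclidean_atlas_def homeomorphism_def)

context
  fixes A :: "('a::topological_space, 'e::euclidean_space) chart set" and U x
  assumes A: "smooth_atlas A" and c: "(U, x) \<in> A"
begin

lemma chart_open: "open U" and chart_open_image: "open (x ` U)"
  and chart_homeo: "homeomorphism U (x ` U) x (inv_into U x)"
  using A c by (auto simp: smooth_atlas_def)

lemma chart_inv [simp]: "q \<in> U \<Longrightarrow> inv_into U x (x q) = q"
  using chart_homeo by (auto simp: homeomorphism_def)

lemma chart_inv2: "w \<in> x ` U \<Longrightarrow> inv_into U x w \<in> U" "w \<in> x ` U \<Longrightarrow> x (inv_into U x w) = w"
  by (auto simp: inv_into_into f_inv_into_f)

lemma chart_image_open: "open N \<Longrightarrow> N \<subseteq> U \<Longrightarrow> open (x ` N)"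
  using homeomorphism_imp_open_map[OF chart_homeo, of N] chart_open chart_open_image
  by (metis Int_absorb1 openin_open openin_open_trans)

end

lemma smooth_atlas_cover:
  assumes "smooth_atlas A" obtains U x where "(U, x) \<in> A" "q \<in> U"
  using assms unfolding smooth_atlas_def by blast

lemma smooth_mapI:
  assumes "continuous_on D \<phi>"
    "\<And>U x V y. (U, x) \<in> A \<Longrightarrow> (V, y) \<in> B \<Longrightarrow> smooth_on (x ` (U \<inter> D \<inter> \<phi> -` V)) (y \<circ> \<phi> \<circ> inv_into U x)"
  shows "smooth_map A B D \<phi>"
  using assms unfolding smooth_map_def by blast

lemma smooth_mapD:
  assumes "smooth_map A B D \<phi>" "(U, x) \<in> A" "(V, y) \<in> B"
  shows "smooth_on (x ` (U \<inter> D \<inter> \<phi> -` V)) (y \<circ> \<phi> \<circ> inv_into U x)"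
  using assms unfolding smooth_map_def by blast

lemma smooth_map_continuous: "smooth_map A B D \<phi> \<Longrightarrow> continuous_on D \<phi>"
  by (simp add: smooth_map_def)

lemma smooth_map_compose:
  assumes A: "smooth_atlas A" and B: "smooth_atlas B" and C: "smooth_atlas C"
    and D: "open D" and E: "open E" and f: "smooth_map A B D \<phi>" and g: "smooth_map B C E \<psi>" and DE: "\<phi> ` D \<subseteq> E"
  shows "smooth_map A C D (\<lambda>q. \<psi> (\<phi> q))"
proof (rule smooth_mapI)
  show cc: "continuous_on D (\<lambda>q. \<psi> (\<phi> q))"
    using f g DE by (auto simp: smooth_map_def intro: continuous_on_compose2)
  fix U x W z assume c: "(U, x) \<in> A" and d: "(W, z) \<in> C"
  note cU = chart_open[OF A c] chart_image_open[OF A c] chart_inv[OF A c]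
  have oW: "open W" using chart_open[OF C d] .
  show "smooth_on (x ` (U \<inter> D \<inter> (\<lambda>q. \<psi> (\<phi> q)) -` W)) (z \<circ> (\<lambda>q. \<psi> (\<phi> q)) \<circ> inv_into U x)"
  proof (rule smooth_on_local)
    fix w assume "w \<in> x ` (U \<inter> D \<inter> (\<lambda>q. \<psi> (\<phi> q)) -` W)"
    then obtain q where q: "q \<in> U" "q \<in> D" "\<psi> (\<phi> q) \<in> W" "w = x q" by auto
    obtain V y where V: "(V, y) \<in> B" "\<phi> q \<in> V" using smooth_atlas_cover[OF B] .
    define N where "N = U \<inter> (D \<inter> \<phi> -` V) \<inter> (D \<inter> (\<lambda>q. \<psi> (\<phi> q)) -` W)"
    have oN: "open N" unfolding N_def
      using continuous_open_preimage[OF smooth_map_continuous[OF f] D chart_open[OF B V(1)]]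
        continuous_open_preimage[OF cc D oW] cU(1)
      by (simp add: open_Int)
    have oxN: "open (x ` N)" using cU(2)[OF oN] by (auto simp: N_def)
    have "smooth_on (x ` N) (\<lambda>w. (z \<circ> \<psi> \<circ> inv_into V y) ((y \<circ> \<phi> \<circ> inv_into U x) w))"
    proof (rule smooth_on_compose2[where f="z \<circ> \<psi> \<circ> inv_into V y" and g="y \<circ> \<phi> \<circ> inv_into U x", OF _ oxN])
      show "smooth_on (y ` (V \<inter> E \<inter> \<psi> -` W)) (z \<circ> \<psi> \<circ> inv_into V y)"
        using smooth_mapD[OF g V(1) d] .
      show "(y \<circ> \<phi> \<circ> inv_into U x) ` (x ` N) \<subseteq> y ` (V \<inter> E \<inter> \<psi> -` W)"
        using DE cU(3) by (auto simp: N_def)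
      have "smooth_on (x ` (U \<inter> D \<inter> \<phi> -` V)) (y \<circ> \<phi> \<circ> inv_into U x)"
        using smooth_mapD[OF f c V(1)] .
      then show "smooth_on (x ` N) (y \<circ> \<phi> \<circ> inv_into U x)"
        by (rule smooth_on_subset) (auto simp: N_def)
    qed
    then have "smooth_on (x ` N) (z \<circ> (\<lambda>q. \<psi> (\<phi> q)) \<circ> inv_into U x)"
      by (rule smooth_on_cong[OF _ oxN]) (auto simp: N_def cU(3) chart_inv[OF B V(1)])
    then show "\<exists>N. open N \<and> w \<in> N \<and> smooth_on N (z \<circ> (\<lambda>q. \<psi> (\<phi> q)) \<circ> inv_into U x)"
      using oxN q V(2) by (auto simp: N_def intro!: exI[of _ "x ` N"])
  qed
qed

lemma smooth_map_subset: "smooth_map A B D \<phi> \<Longrightarrow> E \<subseteq> D \<Longrightarrow> smooth_map A B E \<phi>"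
  unfolding smooth_map_def
  by (fastforce intro: continuous_on_subset smooth_on_subset)

lemma smooth_map_cong:
  assumes A: "smooth_atlas A" and B: "smooth_atlas B"
    and D: "open D" and f: "smooth_map A B D \<phi>" and eq: "\<And>q. q \<in> D \<Longrightarrow> \<phi> q = \<psi> q"
  shows "smooth_map A B D \<psi>"
proof (rule smooth_mapI)
  show "continuous_on D \<psi>" using continuous_on_eq[OF smooth_map_continuous[OF f] eq] .
  fix U x V y assume c: "(U, x) \<in> A" and d: "(V, y) \<in> B"
  have eqs: "U \<inter> D \<inter> \<psi> -` V = U \<inter> (D \<inter> \<phi> -` V)" using eq by auto
  have "open (x ` (U \<inter> (D \<inter> \<phi> -` V)))"
    using continuous_open_preimage[OF smooth_map_continuous[OF f] D chart_open[OF B d]]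
    by (intro chart_image_open[OF A c]) (use chart_open[OF A c] in auto)
  then show "smooth_on (x ` (U \<inter> D \<inter> \<psi> -` V)) (y \<circ> \<psi> \<circ> inv_into U x)"
    unfolding eqs
  proof (rule smooth_on_cong[rotated])
    show "smooth_on (x ` (U \<inter> (D \<inter> \<phi> -` V))) (y \<circ> \<phi> \<circ> inv_into U x)"
      using smooth_mapD[OF f c d] by (simp only: Int_assoc)
    fix w assume "w \<in> x ` (U \<inter> (D \<inter> \<phi> -` V))"
    then obtain q where "q \<in> U" "q \<in> D" "w = x q" by blast
    then show "(y \<circ> \<phi> \<circ> inv_into U x) w = (y \<circ> \<psi> \<circ> inv_into U x) w"
      using chart_inv[OF A c] eq by simp
  qed
qed

lemma smooth_map_to_euclidean:
  "smooth_map A euclidean_atlas D f \<longleftrightarrow>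
    continuous_on D f \<and> (\<forall>(U, x)\<in>A. smooth_on (x ` (U \<inter> D)) (f \<circ> inv_into U x))"
proof -
  have "x ` (U \<inter> D \<inter> f -` UNIV) = x ` (U \<inter> D)" for U x by simp
  then show ?thesis by (simp add: smooth_map_def euclidean_atlas_def)
qed

lemma smooth_map_euclidean [simp]:
  "smooth_map euclidean_atlas euclidean_atlas D f \<longleftrightarrow> smooth_on D f"
  using smooth_on_continuous[of D f] unfolding smooth_map_to_euclidean
  by (auto simp: euclidean_atlas_def)

lemma smooth_map_chart:
  assumes "smooth_atlas A" "(U, x) \<in> A"
  shows "smooth_map A euclidean_atlas U x"
  unfolding smooth_map_to_euclidean
proof (intro conjI ballI)
  show "continuous_on U x" using chart_homeo[OF assms] by (simp add: homeomorphism_def)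
  fix d assume d: "d \<in> A"
  obtain V y where [simp]: "d = (V, y)" by (cases d)
  have "smooth_on (y ` (V \<inter> U)) (x \<circ> inv_into V y)"
    using assms d unfolding smooth_atlas_def by force
  then show "case d of (V, y) \<Rightarrow> smooth_on (y ` (V \<inter> U)) (x \<circ> inv_into V y)" by simp
qed

lemma smooth_map_id: "smooth_atlas A \<Longrightarrow> smooth_map A A D (\<lambda>q. q)"
proof (rule smooth_mapI)
  fix U x V y assume "smooth_atlas A" "(U, x) \<in> A" "(V, y) \<in> A"
  then have "smooth_on (x ` (U \<inter> V)) (y \<circ> inv_into U x)" unfolding smooth_atlas_def by blast
  then show "smooth_on (x ` (U \<inter> D \<inter> (\<lambda>q. q) -` V)) (y \<circ> (\<lambda>q. q) \<circ> inv_into U x)"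
    by (auto simp: comp_def intro: smooth_on_subset)
qed auto

lemma diffeoD:
  assumes "diffeo A B D E \<phi>"
  shows "bij_betw \<phi> D E" "smooth_map A B D \<phi>" "smooth_map B A E (inv_into D \<phi>)"
    "\<And>q. q \<in> D \<Longrightarrow> \<phi> q \<in> E" "\<And>q. q \<in> D \<Longrightarrow> inv_into D \<phi> (\<phi> q) = q"
    "\<And>w. w \<in> E \<Longrightarrow> inv_into D \<phi> w \<in> D" "\<And>w. w \<in> E \<Longrightarrow> \<phi> (inv_into D \<phi> w) = w"
  using assms unfolding diffeo_def bij_betw_def
  by (auto simp: inv_into_into f_inv_into_f)

lemma diffeoI:
  assumes A: "smooth_atlas A" and B: "smooth_atlas B" and E: "open E"
    and "smooth_map A B D \<phi>" "smooth_map B A E \<psi>" "\<And>q. q \<in> D \<Longrightarrow> \<phi> q \<in> E" "\<And>w. w \<in> E \<Longrightarrow> \<psi> w \<in> D"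
    "\<And>q. q \<in> D \<Longrightarrow> \<psi> (\<phi> q) = q" "\<And>w. w \<in> E \<Longrightarrow> \<phi> (\<psi> w) = w"
  shows "diffeo A B D E \<phi>" "\<And>w. w \<in> E \<Longrightarrow> inv_into D \<phi> w = \<psi> w"
proof -
  have b: "bij_betw \<phi> D E"
    by (rule bij_betwI[where g=\<psi>]) (simp_all add: assms(6-9) Pi_def)
  have i: "inv_into D \<phi> w = \<psi> w" if "w \<in> E" for w
    by (rule inv_into_f_eq) (use b that assms(7,9) in \<open>auto simp: bij_betw_def\<close>)
  then show "\<And>w. w \<in> E \<Longrightarrow> inv_into D \<phi> w = \<psi> w" .
  show "diffeo A B D E \<phi>"
    unfolding diffeo_def using b assms(4) smooth_map_cong[OF B A E assms(5) i[symmetric]] by blast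
qed

lemma diffeo_inv:
  assumes "smooth_atlas A" "smooth_atlas B" "open D" "diffeo A B D E \<phi>"
  shows "diffeo B A E D (inv_into D \<phi>)" "\<And>q. q \<in> D \<Longrightarrow> inv_into E (inv_into D \<phi>) q = \<phi> q"
  by (rule diffeoI[OF assms(2,1,3) diffeoD(3,2,6,4,7,5)[OF assms(4)]]; assumption)+

lemma diffeo_compose:
  assumes "smooth_atlas A" "smooth_atlas B" "smooth_atlas C" "open D" "open E" "open F"
    and "diffeo A B D E \<phi>" "diffeo B C E F \<psi>"
  shows "diffeo A C D F (\<lambda>q. \<psi> (\<phi> q))"
    "\<And>w. w \<in> F \<Longrightarrow> inv_into D (\<lambda>q. \<psi> (\<phi> q)) w = inv_into D \<phi> (inv_into E \<psi> w)"
proof -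
  note 1 = diffeoD[OF assms(7)] and 2 = diffeoD[OF assms(8)]
  have a: "smooth_map A C D (\<lambda>q. \<psi> (\<phi> q))"
    by (rule smooth_map_compose[OF assms(1-5) 1(2) 2(2)]) (use 1 in auto)
  have b: "smooth_map C A F (\<lambda>w. inv_into D \<phi> (inv_into E \<psi> w))"
    by (rule smooth_map_compose[OF assms(3,2,1,6,5) 2(3) 1(3)]) (use 2 in auto)
  have "q \<in> D \<Longrightarrow> \<psi> (\<phi> q) \<in> F" "w \<in> F \<Longrightarrow> inv_into D \<phi> (inv_into E \<psi> w) \<in> D"
    "q \<in> D \<Longrightarrow> inv_into D \<phi> (inv_into E \<psi> (\<psi> (\<phi> q))) = q"
    "w \<in> F \<Longrightarrow> \<psi> (\<phi> (inv_into D \<phi> (inv_into E \<psi> w))) = w" for q w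
    by (simp_all add: 1(4-7) 2(4-7))
  note c = diffeoI[OF assms(1,3,6) a b this]
  show "diffeo A C D F (\<lambda>q. \<psi> (\<phi> q))"
    "\<And>w. w \<in> F \<Longrightarrow> inv_into D (\<lambda>q. \<psi> (\<phi> q)) w = inv_into D \<phi> (inv_into E \<psi> w)"
    by (rule c; assumption)+
qed

lemma diffeo_restrict:
  assumes "smooth_atlas A" "smooth_atlas B" "open D" "open E" "diffeo A B D E \<phi>" "open E'" "E' \<subseteq> E"
  shows "diffeo A B (D \<inter> \<phi> -` E') E' \<phi>" "open (D \<inter> \<phi> -` E')"
    "\<And>w. w \<in> E' \<Longrightarrow> inv_into (D \<inter> \<phi> -` E') \<phi> w = inv_into D \<phi> w"
proof -
  note 1 = diffeoD[OF assms(5)]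
  show o: "open (D \<inter> \<phi> -` E')"
    using continuous_open_preimage[OF smooth_map_continuous[OF 1(2)] assms(3,6)] .
  have "q \<in> D \<inter> \<phi> -` E' \<Longrightarrow> \<phi> q \<in> E'" "w \<in> E' \<Longrightarrow> inv_into D \<phi> w \<in> D \<inter> \<phi> -` E'"
    "q \<in> D \<inter> \<phi> -` E' \<Longrightarrow> inv_into D \<phi> (\<phi> q) = q" "w \<in> E' \<Longrightarrow> \<phi> (inv_into D \<phi> w) = w" for q w
    using 1(5-7) assms(7) by auto
  note 2 = diffeoI[OF assms(1,2,6) smooth_map_subset[OF 1(2) Int_lower1] smooth_map_subset[OF 1(3) assms(7)] this]
  show "diffeo A B (D \<inter> \<phi> -` E') E' \<phi>" "\<And>w. w \<in> E' \<Longrightarrow> inv_into (D \<inter> \<phi> -` E') \<phi> w = inv_into D \<phi> w"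
    by (rule 2; assumption)+
qed

lemma diffeo_euclideanI:
  fixes f :: "'a::euclidean_space \<Rightarrow> 'b::euclidean_space"
  assumes "open V" "smooth_on U f" "smooth_on V g" "homeomorphism U V f g"
  shows "diffeo euclidean_atlas euclidean_atlas U V f" "\<And>w. w \<in> V \<Longrightarrow> inv_into U f w = g w"
proof -
  have "q \<in> U \<Longrightarrow> f q \<in> V" "w \<in> V \<Longrightarrow> g w \<in> U" "q \<in> U \<Longrightarrow> g (f q) = q" "w \<in> V \<Longrightarrow> f (g w) = w" for q w
    using assms(4) by (auto simp: homeomorphism_def)
  note 1 = diffeoI[OF smooth_atlas_euclidean smooth_atlas_euclidean assms(1) _ _ this]
  show "diffeo euclidean_atlas euclidean_atlas U V f" "\<And>w. w \<in> V \<Longrightarrow> inv_into U f w = g w"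
    using 1 assms by simp_all
qed

lemma line_times_inv:
  assumes "smooth_atlas A" "(U, x) \<in> A" "w \<in> UNIV \<times> x ` U"
  shows "inv_into (UNIV \<times> U) (\<lambda>(t, q). (t, x q)) w = (fst w, inv_into U x (snd w))"
proof (rule inv_into_f_eq)
  show "inj_on (\<lambda>(t, q). (t, x q)) (UNIV \<times> U)"
    by (rule inj_onI) (use chart_inv[OF assms(1,2)] in \<open>clarsimp, metis\<close>)
qed (use assms(3) chart_inv2[OF assms(1,2)] in \<open>auto simp: mem_Times_iff\<close>)

lemma smooth_atlas_line_times:
  assumes A: "smooth_atlas A" shows "smooth_atlas (line_times_atlas A)"
proof -
  have im: "(\<lambda>(t::real, q). (t, x q)) ` (UNIV \<times> U) = UNIV \<times> x ` U" for x :: "'a \<Rightarrow> 'b" and U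
    by auto
  have 1: "open (UNIV \<times> U)" "open (UNIV \<times> x ` U)"
    "homeomorphism (UNIV \<times> U) (UNIV \<times> x ` U) (\<lambda>(t::real, q). (t, x q)) (inv_into (UNIV \<times> U) (\<lambda>(t, q). (t, x q)))"
    if c: "(U, x) \<in> A" for U x
  proof -
    have cx: "continuous_on U x" "continuous_on (x ` U) (inv_into U x)"
      using chart_homeo[OF A c] by (auto simp: homeomorphism_def)
    show "open (UNIV \<times> U)" "open (UNIV \<times> x ` U)"
      using chart_open[OF A c] chart_open_image[OF A c] by (auto intro: open_Times)
    show "homeomorphism (UNIV \<times> U) (UNIV \<times> x ` U) (\<lambda>(t::real, q). (t, x q)) (inv_into (UNIV \<times> U) (\<lambda>(t, q). (t, x q)))"
    proof (rule homeomorphismI)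
      show "continuous_on (UNIV \<times> U) (\<lambda>(t::real, q). (t, x q))"
        unfolding case_prod_unfold by (intro continuous_intros continuous_on_compose2[OF cx(1)]) auto
      have "continuous_on (UNIV \<times> x ` U) (\<lambda>w::real \<times> 'b. (fst w, inv_into U x (snd w)))"
        by (intro continuous_intros continuous_on_compose2[OF cx(2)]) auto
      then show "continuous_on (UNIV \<times> x ` U) (inv_into (UNIV \<times> U) (\<lambda>(t::real, q). (t, x q)))"
        by (rule continuous_on_eq) (metis line_times_inv[OF A c])
      show "(case inv_into (UNIV \<times> U) (\<lambda>(t, q). (t, x q)) w of (t, q) \<Rightarrow> (t, x q)) = w"
        if "w \<in> UNIV \<times> x ` U" for w :: "real \<times> 'b"
        using that chart_inv2[OF A c] by (subst line_times_inv[OF A c that]) auto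
      show "inv_into (UNIV \<times> U) (\<lambda>(t, q). (t, x q)) (case w of (t, q) \<Rightarrow> (t, x q)) = w"
        if "w \<in> UNIV \<times> U" for w :: "real \<times> 'a"
      proof -
        have "(case w of (t, q) \<Rightarrow> (t, x q)) \<in> UNIV \<times> x ` U" using that by auto
        from line_times_inv[OF A c this] show ?thesis
          using that chart_inv[OF A c] by auto
      qed
      show "inv_into (UNIV \<times> U) (\<lambda>(t, q). (t, x q)) ` (UNIV \<times> x ` U) \<subseteq> (UNIV :: real set) \<times> U"
        using chart_inv2[OF A c] by (auto simp: line_times_inv[OF A c] simp del: UNIV_Times_UNIV)
    qed auto
  qed
  have 2: "(\<Union>(U, x)\<in>line_times_atlas A. U) = UNIV"
  proof (rule set_eqI, simp)
    fix q :: "real \<times> 'a"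
    obtain U x where "(U, x) \<in> A" "snd q \<in> U" using smooth_atlas_cover[OF A] .
    then show "\<exists>x\<in>line_times_atlas A. q \<in> (case x of (U, x) \<Rightarrow> U)"
      unfolding line_times_atlas_def by (force simp: mem_Times_iff)
  qed
  have 3: "smooth_on ((\<lambda>(t::real, q). (t, x q)) ` (UNIV \<times> U \<inter> UNIV \<times> V))
      ((\<lambda>(t, q). (t, y q)) \<circ> inv_into (UNIV \<times> U) (\<lambda>(t, q). (t, x q)))"
    if c: "(U, x) \<in> A" and d: "(V, y) \<in> A" for U x V y
  proof -
    have e: "(\<lambda>(t::real, q). (t, x q)) ` (UNIV \<times> U \<inter> UNIV \<times> V) = UNIV \<times> x ` (U \<inter> V)" by auto
    have o: "open (UNIV \<times> x ` (U \<inter> V) :: (real \<times> 'b) set)"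
      using chart_open[OF A c] chart_open[OF A d] by (intro open_Times chart_image_open[OF A c]) auto
    have "smooth_on (x ` (U \<inter> V)) (y \<circ> inv_into U x)" using A c d by (auto simp: smooth_atlas_def)
    from smooth_on_Pair[OF o smooth_on_fst smooth_on_compose2[OF this o _ smooth_on_snd]]
    have "smooth_on (UNIV \<times> x ` (U \<inter> V)) (\<lambda>w::real \<times> 'b. (fst w, (y \<circ> inv_into U x) (snd w)))"
      by auto
    then show ?thesis unfolding e
      by (rule smooth_on_cong[OF _ o]) (subst comp_def, subst line_times_inv[OF A c], auto)
  qed
  show ?thesis
    unfolding smooth_atlas_def using 2
    by (auto simp: line_times_atlas_def 1 3 im)
qed

lemma frechet_derivative_cong:
  assumes "open S" "x \<in> S" "\<And>y. y \<in> S \<Longrightarrow> f y = g y"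
  shows "frechet_derivative f (at x) = frechet_derivative g (at x)"
proof -
  have "(f has_derivative f') (at x) \<longleftrightarrow> (g has_derivative f') (at x)" for f'
    using has_derivative_transform_within_open[OF _ assms(1,2), of f f' UNIV g]
      has_derivative_transform_within_open[OF _ assms(1,2), of g f' UNIV f] assms(3) by auto
  then show ?thesis by (simp add: frechet_derivative_def)
qed

lemma frechet_derivative_chain:
  assumes "f differentiable (at (g x))" "g differentiable (at x)"
  shows "frechet_derivative (\<lambda>x. f (g x)) (at x) = (\<lambda>v. frechet_derivative f (at (g x)) (frechet_derivative g (at x) v))"
    "(\<lambda>x. f (g x)) differentiable (at x)"
proof -
  have "((\<lambda>x. f (g x)) has_derivative (\<lambda>v. frechet_derivative f (at (g x)) (frechet_derivative g (at x) v))) (at x)"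
    using assms by (intro has_derivative_compose[of g _ _ _ f]) (simp_all add: frechet_derivative_works[symmetric])
  then show "frechet_derivative (\<lambda>x. f (g x)) (at x) = (\<lambda>v. frechet_derivative f (at (g x)) (frechet_derivative g (at x) v))"
    "(\<lambda>x. f (g x)) differentiable (at x)"
    using frechet_derivative_at differentiable_def by metis+
qed

lemma smooth_map_chart_differentiable:
  assumes A: "smooth_atlas A" and c: "(U, x) \<in> A" and F: "smooth_map A euclidean_atlas N F"
    and q: "q \<in> U" "q \<in> N"
  shows "(F \<circ> inv_into U x) differentiable (at (x q))"
  using F q c unfolding smooth_map_to_euclidean by (blast intro: smooth_on_differentiable)

lemma chart_deriv_compose:
  assumes A: "smooth_atlas A" and B: "smooth_atlas B" and c: "(U, x) \<in> A" and d: "(V, y) \<in> B"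
    and f: "smooth_map A B N \<phi>" and g: "(F \<circ> inv_into V y) differentiable (at (y (\<phi> q)))"
    and N: "open N" and q: "q \<in> N" "q \<in> U" "\<phi> q \<in> V"
  shows "chart_deriv (U, x) (\<lambda>q. F (\<phi> q)) q = (\<lambda>a. chart_deriv (V, y) F (\<phi> q) (chart_deriv (U, x) (y \<circ> \<phi>) q a))"
proof -
  let ?M = "U \<inter> (N \<inter> \<phi> -` V)"
  have o: "open (x ` ?M)"
    using continuous_open_preimage[OF smooth_map_continuous[OF f] N chart_open[OF B d]]
    by (intro chart_image_open[OF A c]) (use chart_open[OF A c] in auto)
  have qm: "x q \<in> x ` ?M" using q by auto
  have "smooth_on (x ` ?M) (y \<circ> \<phi> \<circ> inv_into U x)"
    using smooth_mapD[OF f c d] by (simp only: Int_assoc)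
  then have d1: "(y \<circ> \<phi> \<circ> inv_into U x) differentiable (at (x q))"
    using smooth_on_differentiable qm by blast
  have xq: "(y \<circ> \<phi> \<circ> inv_into U x) (x q) = y (\<phi> q)" using chart_inv[OF A c q(2)] by simp
  have "frechet_derivative ((\<lambda>q. F (\<phi> q)) \<circ> inv_into U x) (at (x q)) =
        frechet_derivative (\<lambda>w. (F \<circ> inv_into V y) ((y \<circ> \<phi> \<circ> inv_into U x) w)) (at (x q))"
  proof (rule frechet_derivative_cong[OF o qm])
    fix w assume "w \<in> x ` ?M"
    then obtain q' where "q' \<in> U" "\<phi> q' \<in> V" "w = x q'" by blast
    then show "((\<lambda>q. F (\<phi> q)) \<circ> inv_into U x) w = (F \<circ> inv_into V y) ((y \<circ> \<phi> \<circ> inv_into U x) w)"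
      using chart_inv[OF A c] chart_inv[OF B d] by simp
  qed
  also have "\<dots> = (\<lambda>a. frechet_derivative (F \<circ> inv_into V y) (at (y (\<phi> q))) (frechet_derivative (y \<circ> \<phi> \<circ> inv_into U x) (at (x q)) a))"
    using frechet_derivative_chain(1)[of "F \<circ> inv_into V y" "y \<circ> \<phi> \<circ> inv_into U x" "x q"] d1 g xq by simp
  finally show ?thesis by (simp add: chart_deriv_def)
qed

lemma chart_deriv_cong:
  assumes "smooth_atlas A" "(U, x) \<in> A" "open N" "q \<in> N" "q \<in> U" "\<And>q. q \<in> N \<Longrightarrow> F q = G q"
  shows "chart_deriv (U, x) F q = chart_deriv (U, x) G q"
proof -
  have "open (x ` (U \<inter> N))" using chart_image_open[OF assms(1,2)] chart_open[OF assms(1,2)] assms(3) by blast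
  then have "frechet_derivative (F \<circ> inv_into U x) (at (x q)) = frechet_derivative (G \<circ> inv_into U x) (at (x q))"
    by (rule frechet_derivative_cong) (use assms chart_inv[OF assms(1,2)] in auto)
  then show ?thesis by (simp add: chart_deriv_def)
qed

lemma chart_deriv_linear:
  assumes "smooth_atlas A" "(U, x) \<in> A" "smooth_map A euclidean_atlas N F" "q \<in> U" "q \<in> N"
  shows "linear (chart_deriv (U, x) F q)"
  using smooth_map_chart_differentiable[OF assms]
  by (simp add: chart_deriv_def linear_frechet_derivative)

text \<open>
  By the chain rule the differential of \<open>\<phi>\<close> disappears from the condition once it is expressed by the
  composite \<open>g \<circ> \<phi>\<close>; in this form it can be transported to coordinates.
\<close>

lemma first_fundamental_pullback_iff:
  assumes A: "smooth_atlas A" and \<phi>: "smooth_map A A E \<phi>" and g: "smooth_map A euclidean_atlas D g"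
    and E: "open E" and ED: "\<phi> ` E \<subseteq> D"
  shows "metric_pullback A E \<phi> f g \<longleftrightarrow>
    (\<forall>q\<in>E. \<forall>c\<in>A. q \<in> fst c \<longrightarrow> (\<forall>a b. chart_deriv c f q a \<bullet> chart_deriv c f q b =
      chart_deriv c (\<lambda>q. g (\<phi> q)) q a \<bullet> chart_deriv c (\<lambda>q. g (\<phi> q)) q b))"
proof -
  have 1: "chart_deriv c (\<lambda>q. g (\<phi> q)) q = (\<lambda>a. chart_deriv d g (\<phi> q) (chart_deriv c (snd d \<circ> \<phi>) q a))"
    if "q \<in> E" "c \<in> A" "d \<in> A" "q \<in> fst c" "\<phi> q \<in> fst d" for q c d
  proof (cases c, cases d)
    fix U x V y assume [simp]: "c = (U, x)" "d = (V, y)"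
    have "(g \<circ> inv_into V y) differentiable (at (y (\<phi> q)))"
      using smooth_map_chart_differentiable[OF A _ g] that ED by auto
    then show ?thesis using chart_deriv_compose[OF A A _ _ \<phi> _ E] that by auto
  qed
  have 2: "\<exists>d\<in>A. \<phi> q \<in> fst d" for q
    by (rule smooth_atlas_cover[OF A, of "\<phi> q"]) (use fst_conv in metis)
  show ?thesis
  proof
    assume L: "metric_pullback A E \<phi> f g"
    show "\<forall>q\<in>E. \<forall>c\<in>A. q \<in> fst c \<longrightarrow> (\<forall>a b. chart_deriv c f q a \<bullet> chart_deriv c f q b =
      chart_deriv c (\<lambda>q. g (\<phi> q)) q a \<bullet> chart_deriv c (\<lambda>q. g (\<phi> q)) q b)"
    proof (intro ballI impI allI)
      fix q c a b assume q: "q \<in> E" "c \<in> A" "q \<in> fst c"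
      obtain d where d: "d \<in> A" "\<phi> q \<in> fst d" using 2 by blast
      show "chart_deriv c f q a \<bullet> chart_deriv c f q b =
        chart_deriv c (\<lambda>q. g (\<phi> q)) q a \<bullet> chart_deriv c (\<lambda>q. g (\<phi> q)) q b"
        using L q d unfolding metric_pullback_def first_fundamental_form_def 1[OF q(1,2) d(1) q(3) d(2)] by blast
    qed
  next
    assume R: "\<forall>q\<in>E. \<forall>c\<in>A. q \<in> fst c \<longrightarrow> (\<forall>a b. chart_deriv c f q a \<bullet> chart_deriv c f q b =
      chart_deriv c (\<lambda>q. g (\<phi> q)) q a \<bullet> chart_deriv c (\<lambda>q. g (\<phi> q)) q b)"
    show "metric_pullback A E \<phi> f g"
      unfolding metric_pullback_def first_fundamental_form_def
    proof (intro ballI impI allI)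
      fix q c d a b assume q: "q \<in> E" "c \<in> A" "d \<in> A" "q \<in> fst c" "\<phi> q \<in> fst d"
      show "chart_deriv c f q a \<bullet> chart_deriv c f q b =
         chart_deriv d g (\<phi> q) (chart_deriv c (snd d \<circ> \<phi>) q a) \<bullet>
         chart_deriv d g (\<phi> q) (chart_deriv c (snd d \<circ> \<phi>) q b)"
        using R q 1[OF q] by simp
    qed
  qed
qed

text \<open>
  In contrast to the charts of \<open>A\<close>, a coordinate system may reverse the orientation; it can therefore be
  adapted to the geometry of a surface.
\<close>

locale coords =
  fixes A :: "('a::topological_space, real^2) chart set" and D \<Omega> and \<kappa> :: "'a \<Rightarrow> real^2"
  assumes A: "smooth_atlas A" and D: "open D" and \<Omega>: "open \<Omega>"
    and diffeo: "diffeo A euclidean_atlas D \<Omega> \<kappa>"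
begin

abbreviation "\<kappa>i \<equiv> inv_into D \<kappa>"

lemmas \<kappa>D = diffeoD[OF diffeo]

lemma smooth_out:
  fixes G :: "real^2 \<Rightarrow> 'c::euclidean_space"
  assumes "open N" "N \<subseteq> D" "smooth_on W G" "open W" "\<kappa> ` N \<subseteq> W"
  shows "smooth_map A euclidean_atlas N (\<lambda>q. G (\<kappa> q))"
  by (rule smooth_map_compose[OF A _ _ assms(1,4) smooth_map_subset[OF \<kappa>D(2) assms(2)]])
     (use assms in auto)

lemma open_coord_preimage: "open N \<Longrightarrow> open (\<Omega> \<inter> \<kappa>i -` N)"
  using continuous_open_preimage[OF smooth_map_continuous[OF \<kappa>D(3)] \<Omega>] .

lemma smooth_in:
  fixes F :: "'a \<Rightarrow> 'c::euclidean_space"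
  assumes "open N" "smooth_map A euclidean_atlas N F"
  shows "smooth_on (\<Omega> \<inter> \<kappa>i -` N) (\<lambda>w. F (\<kappa>i w))"
proof -
  have "smooth_map euclidean_atlas euclidean_atlas (\<Omega> \<inter> \<kappa>i -` N) (\<lambda>w. F (\<kappa>i w))"
    by (rule smooth_map_compose[OF _ A _ open_coord_preimage[OF assms(1)] assms(1) smooth_map_subset[OF \<kappa>D(3)] assms(2)]) auto
  then show ?thesis by simp
qed

lemma restrict: "open \<Omega>' \<Longrightarrow> \<Omega>' \<subseteq> \<Omega> \<Longrightarrow> coords A (D \<inter> \<kappa> -` \<Omega>') \<Omega>' \<kappa>"
  unfolding coords_def
  by (intro conjI A diffeo_restrict(1,2)[OF A smooth_atlas_euclidean D \<Omega> diffeo]; assumption)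

context
  fixes U x q
  assumes c: "(U, x) \<in> A" and q: "q \<in> U" "q \<in> D"
begin

lemma chart_deriv_coord:
  fixes F :: "'a \<Rightarrow> 'c::real_normed_vector"
  assumes "open N" "q \<in> N" "\<And>q'. q' \<in> N \<Longrightarrow> F q' = G (\<kappa> q')" "G differentiable (at (\<kappa> q))"
  shows "chart_deriv (U, x) F q = (\<lambda>a. frechet_derivative G (at (\<kappa> q)) (chart_deriv (U, x) \<kappa> q a))"
proof -
  have "chart_deriv (U, x) F q = chart_deriv (U, x) (\<lambda>q. G (\<kappa> q)) q"
    by (rule chart_deriv_cong[OF A c assms(1,2) q(1) assms(3)])
  also have "\<dots> = (\<lambda>a. chart_deriv (UNIV, id) G (\<kappa> q) (chart_deriv (U, x) (id \<circ> \<kappa>) q a))"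
    by (rule chart_deriv_compose[OF A smooth_atlas_euclidean c _ \<kappa>D(2) _ D q(2,1)]) (use assms(4) in \<open>auto simp: comp_def\<close>)
  finally show ?thesis by (simp add: chart_deriv_def comp_def)
qed

lemma chart_deriv_inverse:
  "frechet_derivative (\<lambda>w. x (\<kappa>i w)) (at (\<kappa> q)) (chart_deriv (U, x) \<kappa> q a) = a"
proof -
  have N: "open (U \<inter> D)" using D chart_open[OF A c] by auto
  have "smooth_on (\<Omega> \<inter> \<kappa>i -` U) (\<lambda>w. x (\<kappa>i w))"
    by (rule smooth_in[OF chart_open[OF A c] smooth_map_chart[OF A c]])
  moreover have "\<kappa> q \<in> \<Omega> \<inter> \<kappa>i -` U" using q \<kappa>D(4,5) by simp
  ultimately have "(\<lambda>w. x (\<kappa>i w)) differentiable (at (\<kappa> q))"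
    by (rule smooth_on_differentiable)
  then have *: "chart_deriv (U, x) x q = (\<lambda>a. frechet_derivative (\<lambda>w. x (\<kappa>i w)) (at (\<kappa> q)) (chart_deriv (U, x) \<kappa> q a))"
    by (intro chart_deriv_coord[OF N]) (use q \<kappa>D(5) in auto)
  have "chart_deriv (U, x) x q = frechet_derivative (\<lambda>w. w) (at (x q))"
    unfolding chart_deriv_def fst_conv snd_conv
    by (rule frechet_derivative_cong[OF chart_open_image[OF A c]]) (use q chart_inv2[OF A c] in auto)
  also have "\<dots> = (\<lambda>a. a)" by (simp add: frechet_derivative_ident id_def)
  finally show ?thesis using * by (metis)
qed

lemma bij_chart_deriv: "bij (chart_deriv (U, x) \<kappa> q)" "linear (chart_deriv (U, x) \<kappa> q)"
proof -
  have i: "inj (chart_deriv (U, x) \<kappa> q)"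
    using chart_deriv_inverse by (rule inj_on_inverseI)
  show l: "linear (chart_deriv (U, x) \<kappa> q)"
    by (rule chart_deriv_linear[OF A c \<kappa>D(2) q])
  show "bij (chart_deriv (U, x) \<kappa> q)"
    using i linear_injective_imp_surjective[OF l i] by (simp add: bij_def)
qed

end

lemma singular_set_iff:
  fixes F :: "'a \<Rightarrow> real^3"
  assumes "q \<in> D" "q \<in> E" "open N" "q \<in> N" "\<And>q'. q' \<in> N \<Longrightarrow> F q' = G (\<kappa> q')" "G differentiable (at (\<kappa> q))"
  shows "q \<in> singular_set A E F \<longleftrightarrow> \<not> inj (frechet_derivative G (at (\<kappa> q)))"
proof -
  have 1: "inj (chart_deriv c F q) \<longleftrightarrow> inj (frechet_derivative G (at (\<kappa> q)))"
    if c: "c \<in> A" "q \<in> fst c" for c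
  proof -
    obtain U x where [simp]: "c = (U, x)" by (cases c)
    note b = bij_chart_deriv[of U x q] chart_deriv_coord[of U x q N F G]
    have e: "chart_deriv c F q = frechet_derivative G (at (\<kappa> q)) \<circ> chart_deriv c \<kappa> q"
      using b(3) c assms by (auto simp: comp_def)
    show ?thesis
    proof
      assume "inj (chart_deriv c F q)"
      then have "inj_on (frechet_derivative G (at (\<kappa> q))) (range (chart_deriv c \<kappa> q))"
        unfolding e by (rule inj_on_imageI)
      then show "inj (frechet_derivative G (at (\<kappa> q)))" using b(1) c assms by (simp add: bij_def)
    next
      assume "inj (frechet_derivative G (at (\<kappa> q)))"
      then show "inj (chart_deriv c F q)" unfolding e
        by (rule inj_compose) (use b(1) c assms in \<open>simp add: bij_def\<close>)
    qed
  qed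
  obtain U x where "(U, x) \<in> A" "q \<in> U" using smooth_atlas_cover[OF A] .
  then show ?thesis
    unfolding singular_set_def using 1 assms(2) by force
qed

lemma range_chart_deriv:
  fixes F :: "'a \<Rightarrow> real^3"
  assumes "c \<in> A" "q \<in> fst c" "q \<in> D" "open N" "q \<in> N" "\<And>q'. q' \<in> N \<Longrightarrow> F q' = G (\<kappa> q')" "G differentiable (at (\<kappa> q))"
  shows "range (chart_deriv c F q) = range (frechet_derivative G (at (\<kappa> q)))"
proof -
  obtain U x where [simp]: "c = (U, x)" by (cases c)
  have e: "chart_deriv c F q = frechet_derivative G (at (\<kappa> q)) \<circ> chart_deriv c \<kappa> q"
    using chart_deriv_coord[of U x q N F G] assms by (auto simp: comp_def)
  have "surj (chart_deriv c \<kappa> q)" using bij_chart_deriv[of U x q] assms by (simp add: bij_def)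
  then show ?thesis unfolding e by (metis image_comp)
qed

lemma insert_chart:
  assumes "smooth_atlas (insert c A)"
  shows "coords (insert c A) D \<Omega> \<kappa>"
proof -
  have sub: "smooth_on (x ` (U \<inter> V)) (y \<circ> inv_into U x)" if "(U, x) \<in> insert c A" "(V, y) \<in> insert c A" for U x V y
    using assms that unfolding smooth_atlas_def by (metis (no_types, lifting) case_prodD)
  have i: "smooth_map B C D' (\<lambda>q. q)" if "B \<subseteq> insert c A" "C \<subseteq> insert c A" for B C D'
  proof (rule smooth_mapI)
    fix U x V y assume "(U, x) \<in> B" "(V, y) \<in> C"
    then have "smooth_on (x ` (U \<inter> V)) (y \<circ> inv_into U x)" using sub that by blast
    then show "smooth_on (x ` (U \<inter> D' \<inter> (\<lambda>q. q) -` V)) (y \<circ> (\<lambda>q. q) \<circ> inv_into U x)"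
      by (auto simp: comp_def intro: smooth_on_subset)
  qed auto
  have "diffeo (insert c A) euclidean_atlas D \<Omega> \<kappa>"
    unfolding diffeo_def
  proof (intro conjI)
    show "smooth_map (insert c A) euclidean_atlas D \<kappa>"
      using smooth_map_compose[OF assms A smooth_atlas_euclidean D D i \<kappa>D(2)] by auto
    show "smooth_map euclidean_atlas (insert c A) \<Omega> \<kappa>i"
      by (rule smooth_map_compose[OF smooth_atlas_euclidean A assms \<Omega> D \<kappa>D(3) i]) (use \<kappa>D(6) in auto)
  qed (rule \<kappa>D(1))
  then show ?thesis using assms D \<Omega> by (simp add: coords_def)
qed

lemma line_times_out:
  "smooth_map (line_times_atlas A) euclidean_atlas (UNIV \<times> D) (\<lambda>z. (fst z, \<kappa> (snd z)))"
  unfolding smooth_map_to_euclidean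
proof (intro conjI ballI)
  show "continuous_on (UNIV \<times> D) (\<lambda>z::real \<times> 'a. (fst z, \<kappa> (snd z)))"
    by (intro continuous_intros continuous_on_compose2[OF smooth_map_continuous[OF \<kappa>D(2)]]) auto
  fix c assume "c \<in> line_times_atlas A"
  then obtain U x where c: "c = (UNIV \<times> U, \<lambda>(t, q). (t, x q))" "(U, x) \<in> A"
    unfolding line_times_atlas_def by auto
  have o: "open (UNIV \<times> x ` (U \<inter> D) :: (real \<times> (real^2)) set)"
    using chart_open[OF A c(2)] D by (intro open_Times chart_image_open[OF A c(2)]) auto
  have im: "(\<lambda>(t::real, q). (t, x q)) ` (UNIV \<times> U \<inter> UNIV \<times> D) = UNIV \<times> x ` (U \<inter> D)" by auto
  have "smooth_on (x ` (U \<inter> D)) (\<kappa> \<circ> inv_into U x)"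
    using \<kappa>D(2) c(2) by (auto simp: smooth_map_to_euclidean)
  from smooth_on_Pair[OF o smooth_on_fst smooth_on_compose2[OF this o _ smooth_on_snd]]
  have "smooth_on (UNIV \<times> x ` (U \<inter> D)) (\<lambda>w::real \<times> (real^2). (fst w, (\<kappa> \<circ> inv_into U x) (snd w)))"
    by auto
  then have "smooth_on (UNIV \<times> x ` (U \<inter> D)) ((\<lambda>z::real \<times> 'a. (fst z, \<kappa> (snd z))) \<circ> inv_into (UNIV \<times> U) (\<lambda>(t, q). (t, x q)))"
  proof (rule smooth_on_cong[OF _ o])
    fix w :: "real \<times> (real^2)" assume "w \<in> UNIV \<times> x ` (U \<inter> D)"
    then have "w \<in> UNIV \<times> x ` U" by auto
    from line_times_inv[OF A c(2) this]
    show "(fst w, (\<kappa> \<circ> inv_into U x) (snd w)) = ((\<lambda>z. (fst z, \<kappa> (snd z))) \<circ> inv_into (UNIV \<times> U) (\<lambda>(t, q). (t, x q))) w"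
      by simp
  qed
  then show "case c of (U, x) \<Rightarrow> smooth_on (x ` (U \<inter> UNIV \<times> D)) ((\<lambda>z. (fst z, \<kappa> (snd z))) \<circ> inv_into U x)"
    using im c(1) by simp
qed

lemma line_times_in:
  "smooth_map euclidean_atlas (line_times_atlas A) (UNIV \<times> \<Omega>) (\<lambda>z. (fst z, \<kappa>i (snd z)))"
proof (rule smooth_mapI)
  show "continuous_on (UNIV \<times> \<Omega>) (\<lambda>z::real \<times> (real^2). (fst z, \<kappa>i (snd z)))"
    by (intro continuous_intros continuous_on_compose2[OF smooth_map_continuous[OF \<kappa>D(3)]]) auto
  fix W z V' y' assume "(W, z) \<in> (euclidean_atlas :: (real \<times> (real^2), real \<times> (real^2)) chart set)"
    and "(V', y') \<in> line_times_atlas A"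
  then obtain V y where [simp]: "W = UNIV" "z = id" "V' = UNIV \<times> V" "y' = (\<lambda>(t, q). (t, y q))" and d: "(V, y) \<in> A"
    unfolding line_times_atlas_def by auto
  have im: "z ` (W \<inter> UNIV \<times> \<Omega> \<inter> (\<lambda>z. (fst z, \<kappa>i (snd z))) -` V') = UNIV \<times> (\<Omega> \<inter> \<kappa>i -` V)" by auto
  have o: "open (UNIV \<times> (\<Omega> \<inter> \<kappa>i -` V) :: (real \<times> (real^2)) set)"
    by (intro open_Times open_coord_preimage chart_open[OF A d]) auto
  have "smooth_on (\<Omega> \<inter> \<kappa>i -` V) (\<lambda>w. y (\<kappa>i w))"
    by (rule smooth_in[OF chart_open[OF A d] smooth_map_chart[OF A d]])
  from smooth_on_Pair[OF o smooth_on_fst smooth_on_compose2[OF this o _ smooth_on_snd]]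
  have "smooth_on (UNIV \<times> (\<Omega> \<inter> \<kappa>i -` V)) (\<lambda>w::real \<times> (real^2). (fst w, y (\<kappa>i (snd w))))"
    by auto
  then show "smooth_on (z ` (W \<inter> UNIV \<times> \<Omega> \<inter> (\<lambda>z. (fst z, \<kappa>i (snd z))) -` V')) (y' \<circ> (\<lambda>z. (fst z, \<kappa>i (snd z))) \<circ> inv_into W z)"
    unfolding im by (simp add: comp_def)
qed

end

context coords
begin

lemma open_image: "open N \<Longrightarrow> N \<subseteq> D \<Longrightarrow> open (\<kappa> ` N)"
proof -
  assume "open N" "N \<subseteq> D"
  moreover from this have "\<kappa> ` N = \<Omega> \<inter> \<kappa>i -` N"
  proof (intro equalityI subsetI)
    fix w assume "w \<in> \<Omega> \<inter> \<kappa>i -` N"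
    then show "w \<in> \<kappa> ` N" using \<kappa>D(7) by (intro image_eqI[of _ _ "\<kappa>i w"]) auto
  qed (use \<kappa>D(4,5) in auto)
  ultimately show ?thesis using open_coord_preimage by simp
qed

lemma inv_into_subset: "N \<subseteq> D \<Longrightarrow> w \<in> \<kappa> ` N \<Longrightarrow> inv_into N \<kappa> w = \<kappa>i w"
proof -
  assume N: "N \<subseteq> D" "w \<in> \<kappa> ` N"
  then obtain q where q: "q \<in> N" "w = \<kappa> q" by blast
  have "inj_on \<kappa> N" using \<kappa>D(1) N(1) by (meson bij_betw_imp_inj_on inj_on_subset)
  then show ?thesis using q N \<kappa>D(5) by auto
qed

text \<open>
  Whether a coordinate system is compatible with the orientation is decided by the sign of its
  Jacobian in a single oriented chart.
\<close>

lemma oriented_chart_coords: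
  assumes or: "oriented_atlas A" and c0: "(U0, x0) \<in> A" and N: "open N" "N \<subseteq> D" "N \<subseteq> U0"
    and pos: "\<And>q. q \<in> N \<Longrightarrow> det (matrix (chart_deriv (U0, x0) \<kappa> q)) > 0"
  shows "oriented_chart A (N, \<kappa>)"
proof -
  have im: "\<kappa> ` N \<subseteq> \<Omega>" using N \<kappa>D(4) by auto
  have hom: "homeomorphism N (\<kappa> ` N) \<kappa> (inv_into N \<kappa>)"
  proof (rule homeomorphismI)
    show "continuous_on N \<kappa>" using continuous_on_subset[OF smooth_map_continuous[OF \<kappa>D(2)] N(2)] .
    have "continuous_on (\<kappa> ` N) \<kappa>i" using continuous_on_subset[OF smooth_map_continuous[OF \<kappa>D(3)] im] .
    then show "continuous_on (\<kappa> ` N) (inv_into N \<kappa>)"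
      by (rule continuous_on_eq) (simp add: inv_into_subset[OF N(2)])
  qed (use inv_into_subset[OF N(2)] N(2) \<kappa>D(5) in \<open>auto simp: subset_iff\<close>)
  note oN = open_image[OF N(1,2)]
  have tr1: "smooth_on (z ` (V \<inter> N)) (\<kappa> \<circ> inv_into V z)" if d: "(V, z) \<in> A" for V z
  proof -
    have "smooth_on (z ` (V \<inter> D)) (\<kappa> \<circ> inv_into V z)"
      using \<kappa>D(2) d by (auto simp: smooth_map_to_euclidean)
    then show ?thesis by (rule smooth_on_subset) (use N in auto)
  qed
  have tr2: "smooth_on (\<kappa> ` (N \<inter> V)) (z \<circ> inv_into N \<kappa>)" if d: "(V, z) \<in> A" for V z
  proof -
    have "smooth_on (\<Omega> \<inter> \<kappa>i -` V) (\<lambda>w. z (\<kappa>i w))"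
      by (rule smooth_in[OF chart_open[OF A d] smooth_map_chart[OF A d]])
    then have "smooth_on (\<kappa> ` (N \<inter> V)) (\<lambda>w. z (\<kappa>i w))"
      by (rule smooth_on_subset) (use N \<kappa>D(4,5) in auto)
    then show ?thesis
    proof (rule smooth_on_cong)
      show "open (\<kappa> ` (N \<inter> V))" using N chart_open[OF A d] by (intro open_image) auto
      show "z (\<kappa>i w) = (z \<circ> inv_into N \<kappa>) w" if "w \<in> \<kappa> ` (N \<inter> V)" for w
        using that inv_into_subset[OF N(2), of w] by auto
    qed
  qed
  have self: "smooth_on (\<kappa> ` (N \<inter> N)) (\<kappa> \<circ> inv_into N \<kappa>)"
    by (rule smooth_on_cong[OF smooth_on_id(1)]) (use oN f_inv_into_f[of _ \<kappa> N] in auto)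
  have At: "smooth_atlas (insert (N, \<kappa>) A)"
    using A N(1) oN hom tr1 tr2 self unfolding smooth_atlas_def by auto
  have d1: "det (matrix (chart_deriv (V, z) \<kappa> q)) > 0" if d: "(V, z) \<in> A" and q: "q \<in> V" "q \<in> N" for V z q
  proof -
    have qU: "q \<in> U0" "q \<in> D" using q N by auto
    have "(\<kappa> \<circ> inv_into U0 x0) differentiable (at (x0 q))"
      by (rule smooth_map_chart_differentiable[OF A c0 \<kappa>D(2) qU])
    then have e: "chart_deriv (V, z) \<kappa> q = (\<lambda>a. chart_deriv (U0, x0) \<kappa> q (chart_deriv (V, z) (x0 \<circ> (\<lambda>q. q)) q a))"
      by (intro chart_deriv_compose[OF A A d c0 smooth_map_id[OF A] _ open_UNIV _ q(1) qU(1)]) auto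
    have "0 < det (matrix (frechet_derivative (x0 \<circ> inv_into V z) (at (z q))))"
      using or d c0 q qU unfolding oriented_atlas_def by fastforce
    then have p: "0 < det (matrix (chart_deriv (V, z) (x0 \<circ> (\<lambda>q. q)) q))"
      by (simp add: chart_deriv_def comp_def)
    have l: "linear (chart_deriv (U0, x0) \<kappa> q)" "linear (chart_deriv (V, z) (x0 \<circ> (\<lambda>q. q)) q)"
      using chart_deriv_linear[OF A c0 \<kappa>D(2) qU] chart_deriv_linear[OF A d smooth_map_chart[OF A c0] q(1) qU(1)]
      by (simp_all add: comp_def)
    have "matrix (chart_deriv (V, z) \<kappa> q) = matrix (chart_deriv (U0, x0) \<kappa> q) ** matrix (chart_deriv (V, z) (x0 \<circ> (\<lambda>q. q)) q)"
      unfolding e using matrix_compose[OF l(2,1)] by (simp add: comp_def)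
    then show ?thesis using p pos[OF q(2)] by (simp add: det_mul)
  qed
  have d2: "det (matrix (frechet_derivative (z \<circ> inv_into N \<kappa>) (at (\<kappa> q)))) > 0"
    if d: "(V, z) \<in> A" and q: "q \<in> V" "q \<in> N" for V z q
  proof -
    have qD: "q \<in> D" using q N by auto
    have qo: "open (\<kappa> ` (N \<inter> V))" "\<kappa> q \<in> \<kappa> ` (N \<inter> V)"
      using N chart_open[OF A d] q by (auto intro!: open_image)
    have e: "frechet_derivative (z \<circ> inv_into N \<kappa>) (at (\<kappa> q)) = frechet_derivative (\<lambda>w. z (\<kappa>i w)) (at (\<kappa> q))"
      by (rule frechet_derivative_cong[OF qo]) (use inv_into_subset[OF N(2)] in auto)
    have l1: "linear (frechet_derivative (z \<circ> inv_into N \<kappa>) (at (\<kappa> q)))"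
      by (intro linear_frechet_derivative smooth_on_differentiable[OF tr2[OF d] qo(2)])
    note l2 = bij_chart_deriv(2)[OF d q(1) qD]
    have "(frechet_derivative (z \<circ> inv_into N \<kappa>) (at (\<kappa> q)) \<circ> chart_deriv (V, z) \<kappa> q) = id"
      unfolding e using chart_deriv_inverse[OF d q(1) qD] by (simp add: fun_eq_iff)
    then have "matrix (frechet_derivative (z \<circ> inv_into N \<kappa>) (at (\<kappa> q))) ** matrix (chart_deriv (V, z) \<kappa> q) = mat 1"
      using matrix_compose[OF l2 l1] by (simp add: matrix_id_mat_1)
    then have "det (matrix (frechet_derivative (z \<circ> inv_into N \<kappa>) (at (\<kappa> q)))) * det (matrix (chart_deriv (V, z) \<kappa> q)) = 1"
      by (metis det_I det_mul)
    then show ?thesis using d1[OF d q] by (metis zero_less_mult_pos2 zero_less_one)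
  qed
  have d3: "det (matrix (frechet_derivative (\<kappa> \<circ> inv_into N \<kappa>) (at w))) > 0" if "w \<in> \<kappa> ` N" for w
  proof -
    have "frechet_derivative (\<kappa> \<circ> inv_into N \<kappa>) (at w) = frechet_derivative (\<lambda>w. w) (at w)"
      by (rule frechet_derivative_cong[OF oN that]) (auto simp: f_inv_into_f)
    then show ?thesis by (simp add: frechet_derivative_ident matrix_id_mat_1 id_def[symmetric])
  qed
  have d4: "0 < det (matrix (frechet_derivative (y \<circ> inv_into U x) (at w)))"
    if "(U, x) \<in> A" "(V, y) \<in> A" "w \<in> x ` (U \<inter> V)" for U x V y w
    using or that unfolding oriented_atlas_def by blast
  have d5: "0 < det (matrix (frechet_derivative (\<kappa> \<circ> inv_into V z) (at w)))"
    if d: "(V, z) \<in> A" and w: "w \<in> z ` (V \<inter> N)" for V z w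
  proof -
    obtain q where "q \<in> V" "q \<in> N" "w = z q" using w by blast
    then show ?thesis using d1[OF d] by (simp add: chart_deriv_def)
  qed
  show ?thesis
    unfolding oriented_chart_def oriented_atlas_def
    using At d2 d3 d4 d5 by auto
qed

lemma oriented_chart_near:
  assumes or: "oriented_atlas A" and c0: "(U0, x0) \<in> A" and q: "q \<in> U0" "q \<in> D"
    and pos: "det (matrix (chart_deriv (U0, x0) \<kappa> q)) > 0"
  obtains N where "open N" "q \<in> N" "N \<subseteq> D" "oriented_chart A (N, \<kappa>)"
proof -
  let ?d = "\<lambda>w. det (matrix (frechet_derivative (\<kappa> \<circ> inv_into U0 x0) (at w)))"
  let ?W = "x0 ` (U0 \<inter> D)"
  have oW: "open ?W" using chart_open[OF A c0] D by (intro chart_image_open[OF A c0]) auto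
  have "smooth_on ?W (\<kappa> \<circ> inv_into U0 x0)"
    using \<kappa>D(2) c0 by (auto simp: smooth_map_to_euclidean)
  then have "smooth_on ?W ?d"
    unfolding matrix_def by (intro smooth_on_det oW) (auto intro!: smooth_on_nth[OF oW] smooth_on_frechet)
  then have "open (?W \<inter> ?d -` {0<..})"
    by (intro continuous_open_preimage[OF smooth_on_continuous oW]) auto
  then have oN: "open (U0 \<inter> x0 -` (?W \<inter> ?d -` {0<..}))"
    using chart_homeo[OF A c0]
    by (intro continuous_open_preimage[OF _ chart_open[OF A c0]]) (simp_all add: homeomorphism_def)
  let ?N = "U0 \<inter> x0 -` (?W \<inter> ?d -` {0<..})"
  have sub: "?N \<subseteq> D"
  proof
    fix q' assume q': "q' \<in> ?N"
    then obtain q'' where "q'' \<in> U0" "q'' \<in> D" "x0 q' = x0 q''" by blast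
    moreover from q' have "q' \<in> U0" by blast
    ultimately have "q' = q''" using chart_inv[OF A c0] by metis
    then show "q' \<in> D" using \<open>q'' \<in> D\<close> by simp
  qed
  have "oriented_chart A (?N, \<kappa>)"
    by (rule oriented_chart_coords[OF or c0 oN sub]) (auto simp: chart_deriv_def)
  moreover have "q \<in> ?N" using q pos by (auto simp: chart_deriv_def)
  ultimately show ?thesis using that oN sub by blast
qed

lemma flip: "coords A D ((\<lambda>w. vector [w$1, - w$2]) -` \<Omega>) (\<lambda>q. vector [\<kappa> q $ 1, - \<kappa> q $ 2])"
proof -
  let ?R = "\<lambda>w::real^2. vector [w$1, - w$2] :: real^2"
  have RR: "?R (?R w) = w" for w by (simp add: vec_eq_iff forall_2)
  have sR: "smooth_on S ?R" for S
    by (rule smooth_on_subset[of UNIV]) (intro smooth_on_vector2 smooth_on_minus smooth_on_nth' | simp)+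
  have o: "open (?R -` \<Omega>)"
    by (intro open_vimage \<Omega> continuous_on_eq_continuous_within[THEN iffD2]) (use smooth_on_continuous[OF sR[of UNIV]] in \<open>simp add: continuous_on_eq_continuous_within\<close>)
  have "diffeo euclidean_atlas euclidean_atlas \<Omega> (?R -` \<Omega>) ?R"
    by (rule diffeoI(1)[where \<psi>="?R"]) (use o sR RR in auto)
  from diffeo_compose(1)[OF A _ _ D \<Omega> o diffeo this]
  show ?thesis using A D o by (simp add: coords_def)
qed

lemma oriented_chart_exists:
  assumes or: "oriented_atlas A" and q: "q \<in> D"
  obtains N \<sigma> where "open N" "q \<in> N" "N \<subseteq> D" "\<sigma> = 1 \<or> \<sigma> = -1"
    "oriented_chart A (N, \<lambda>q. vector [\<kappa> q $ 1, \<sigma> * \<kappa> q $ 2])"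
proof -
  obtain U0 x0 where c0: "(U0, x0) \<in> A" "q \<in> U0" using smooth_atlas_cover[OF A] .
  let ?d = "det (matrix (chart_deriv (U0, x0) \<kappa> q))"
  note b = bij_chart_deriv[OF c0 q]
  have "?d \<noteq> 0" using det_nz_iff_inj[OF b(2)] b(1) by (simp add: bij_def)
  then consider "?d > 0" | "?d < 0" by linarith
  then show ?thesis
  proof cases
    case 1
    have e: "(\<lambda>q. vector [\<kappa> q $ 1, 1 * \<kappa> q $ 2]) = \<kappa>" by (auto simp: vec_eq_iff forall_2)
    from oriented_chart_near[OF or c0 q 1] show ?thesis using that[of _ 1] e by metis
  next
    case 2
    let ?R = "\<lambda>w::real^2. vector [w$1, - w$2] :: real^2"
    have lR: "linear ?R" by (rule linearI) (simp_all add: vec_eq_iff forall_2)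
    interpret F: coords A D "?R -` \<Omega>" "\<lambda>q. ?R (\<kappa> q)" by (rule flip)
    have "?R differentiable (at (\<kappa> q))" using lR by (simp add: linear_imp_differentiable)
    then have "chart_deriv (U0, x0) (\<lambda>q. ?R (\<kappa> q)) q = (\<lambda>a. frechet_derivative ?R (at (\<kappa> q)) (chart_deriv (U0, x0) \<kappa> q a))"
      by (intro chart_deriv_coord[OF c0 q D q]) auto
    also have "frechet_derivative ?R (at (\<kappa> q)) = ?R"
      by (rule frechet_derivative_at[OF linear_imp_has_derivative[OF lR], symmetric])
    finally have "matrix (chart_deriv (U0, x0) (\<lambda>q. ?R (\<kappa> q)) q) = matrix ?R ** matrix (chart_deriv (U0, x0) \<kappa> q)"
      using matrix_compose[OF b(2) lR] by (simp add: comp_def)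
    moreover have "det (matrix ?R) = -1" by (simp add: det_2 matrix_def axis_def)
    ultimately have "det (matrix (chart_deriv (U0, x0) (\<lambda>q. ?R (\<kappa> q)) q)) > 0" using 2 by (simp add: det_mul)
    from F.oriented_chart_near[OF or c0 q this] obtain N where
      N: "open N" "q \<in> N" "N \<subseteq> D" "oriented_chart A (N, \<lambda>q. ?R (\<kappa> q))" by blast
    then show ?thesis using that[of N "-1"] by simp
  qed
qed

lemma unit_normal_field_coords:
  fixes G :: "real^2 \<Rightarrow> real^3"
  assumes N: "open N" "N \<subseteq> D" and W: "open W" "\<kappa> ` N \<subseteq> W" and F: "\<And>q. q \<in> N \<Longrightarrow> F q = G (\<kappa> q)"
    and G: "smooth_on W G" and nu: "smooth_on W \<nu>" "\<And>w. w \<in> W \<Longrightarrow> norm (\<nu> w) = 1"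
      "\<And>w v. w \<in> W \<Longrightarrow> frechet_derivative G (at w) v \<bullet> \<nu> w = 0"
  shows "unit_normal_field A N F (\<lambda>q. \<nu> (\<kappa> q))"
  unfolding unit_normal_field_def
proof (intro conjI ballI impI allI)
  show "smooth_map A euclidean_atlas N (\<lambda>q. \<nu> (\<kappa> q))" by (rule smooth_out[OF N nu(1) W])
  show "norm (\<nu> (\<kappa> q)) = 1" if "q \<in> N" for q using that W nu(2) by auto
  fix q c a assume q: "q \<in> N" "c \<in> A" "q \<in> fst c"
  obtain U x where [simp]: "c = (U, x)" by (cases c)
  have w: "\<kappa> q \<in> W" using q W by auto
  have "chart_deriv c F q = (\<lambda>a. frechet_derivative G (at (\<kappa> q)) (chart_deriv c \<kappa> q a))"
    using chart_deriv_coord[of U x q N F G] q N F smooth_on_differentiable[OF G w] by auto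
  then show "chart_deriv c F q a \<bullet> \<nu> (\<kappa> q) = 0" using nu(3)[OF w] by simp
qed

text \<open>
  Reversing the second coordinate changes neither the second derivative in its direction nor the
  condition on the first derivative, so that the coordinates can be made compatible with the orientation.
\<close>

lemma generic_at_coords:
  fixes G :: "real^2 \<Rightarrow> real^3"
  assumes or: "oriented_atlas A" and N: "open N" "N \<subseteq> D" "q \<in> N" and W: "open W" "\<kappa> ` N \<subseteq> W"
    and F: "\<And>q. q \<in> N \<Longrightarrow> F q = G (\<kappa> q)"
    and G: "smooth_on W G" and nu: "smooth_on W \<nu>" "\<And>w. w \<in> W \<Longrightarrow> norm (\<nu> w) = 1"
      "\<And>w v. w \<in> W \<Longrightarrow> frechet_derivative G (at w) v \<bullet> \<nu> w = 0"
    and d1: "frechet_derivative G (at (\<kappa> q)) (axis 1 1) = 0"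
    and d2: "frechet_derivative G (at (\<kappa> q)) (axis 2 1) \<noteq> 0"
    and d22: "frechet_derivative (\<lambda>w. frechet_derivative G (at w) (axis 2 1)) (at (\<kappa> q)) (axis 2 1) \<bullet> \<nu> (\<kappa> q) \<noteq> 0"
  shows "generic_at A F q"
proof -
  have qD: "q \<in> D" "\<kappa> q \<in> W" using N W by auto
  let ?D = "\<lambda>G w. frechet_derivative G (at w)"
  let ?e1 = "axis 1 1 :: real^2" and ?e2 = "axis 2 1 :: real^2"
  have lin: "linear (?D G w)" if "w \<in> W" for w
    using smooth_on_differentiable[OF G that] by (rule linear_frechet_derivative)
  have DG: "?D G (\<kappa> q) v = v$2 *\<^sub>R ?D G (\<kappa> q) ?e2" for v
  proof -
    have "v = v$1 *\<^sub>R ?e1 + v$2 *\<^sub>R ?e2" by (simp add: vec_eq_iff forall_2 axis_def)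
    then have "?D G (\<kappa> q) v = ?D G (\<kappa> q) (v$1 *\<^sub>R ?e1 + v$2 *\<^sub>R ?e2)" by simp
    also have "\<dots> = v$2 *\<^sub>R ?D G (\<kappa> q) ?e2"
      by (simp only: linear_add[OF lin[OF qD(2)]] linear_scale[OF lin[OF qD(2)]] d1) simp
    finally show ?thesis .
  qed
  have "range (?D G (\<kappa> q)) = span {?D G (\<kappa> q) ?e2}"
  proof (intro equalityI subsetI)
    fix y assume "y \<in> span {?D G (\<kappa> q) ?e2}"
    then obtain k where "y = k *\<^sub>R ?D G (\<kappa> q) ?e2" by (auto simp: span_singleton)
    then have "y = ?D G (\<kappa> q) (k *\<^sub>R ?e2)" by (simp add: linear_scale[OF lin[OF qD(2)]])
    then show "y \<in> range (?D G (\<kappa> q))" by blast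
  next
    fix y assume "y \<in> range (?D G (\<kappa> q))"
    then obtain v where "y = ?D G (\<kappa> q) v" by blast
    then have "y = v$2 *\<^sub>R ?D G (\<kappa> q) ?e2" using DG[of v] by (rule trans)
    then show "y \<in> span {?D G (\<kappa> q) ?e2}" by (simp add: span_base span_scale)
  qed
  then have dim: "dim (range (?D G (\<kappa> q))) = 1" using d2 by (simp add: dim_eq_card_independent)
  obtain U0 x0 where c0: "(U0, x0) \<in> A" "q \<in> U0" using smooth_atlas_cover[OF A] .
  have r1: "rank_one A F q"
    unfolding rank_one_def using range_chart_deriv[of "(U0,x0)" q N F G] c0 N F qD dim smooth_on_differentiable[OF G]
    by (intro bexI[of _ "(U0,x0)"]) auto
  obtain M \<sigma> where M: "open M" "q \<in> M" "M \<subseteq> D" "\<sigma> = 1 \<or> \<sigma> = -1"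
    "oriented_chart A (M, \<lambda>q. vector [\<kappa> q $ 1, \<sigma> * \<kappa> q $ 2])"
    by (rule oriented_chart_exists[OF or qD(1)])
  let ?R = "\<lambda>w::real^2. vector [w$1, \<sigma> * w$2] :: real^2"
  let ?c = "(M, \<lambda>q. ?R (\<kappa> q))"
  have RR: "?R (?R w) = w" for w using M(4) by (auto simp: vec_eq_iff forall_2)
  have lR: "linear ?R" by (rule linearI) (simp_all add: vec_eq_iff forall_2 algebra_simps)
  have oM: "smooth_atlas (insert ?c A)" using M(5) by (simp add: oriented_chart_def oriented_atlas_def)
  interpret I: coords "insert ?c A" D \<Omega> \<kappa> by (rule insert_chart[OF oM])
  have Dc: "chart_deriv ?c \<kappa> q' v = ?R v" if "q' \<in> M" for q' v
  proof -
    have iR: "frechet_derivative ?R (at w) = ?R" for w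
      by (rule frechet_derivative_at[OF linear_imp_has_derivative[OF lR], symmetric])
    have "q' \<in> D" using that M by auto
    from I.chart_deriv_coord[of M "\<lambda>q. ?R (\<kappa> q)" q' M "\<lambda>q. ?R (\<kappa> q)" ?R] that this M(1) lR
    have "chart_deriv ?c (\<lambda>q. ?R (\<kappa> q)) q' = (\<lambda>a. ?R (chart_deriv ?c \<kappa> q' a))"
      by (auto simp: iR linear_imp_differentiable)
    moreover have "chart_deriv ?c (\<lambda>q. ?R (\<kappa> q)) q' = (\<lambda>a. a)"
    proof -
      have "chart_deriv ?c (\<lambda>q. ?R (\<kappa> q)) q' = frechet_derivative (\<lambda>w. w) (at (?R (\<kappa> q')))"
        unfolding chart_deriv_def fst_conv snd_conv
      proof (rule frechet_derivative_cong[OF chart_open_image[OF oM insertI1]])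
        show "?R (\<kappa> q') \<in> (\<lambda>q. ?R (\<kappa> q)) ` M" using that by (rule image_eqI[rotated]) (rule refl)
        fix y assume "y \<in> (\<lambda>q. ?R (\<kappa> q)) ` M"
        from f_inv_into_f[OF this] show "((\<lambda>q. ?R (\<kappa> q)) \<circ> inv_into M (\<lambda>q. ?R (\<kappa> q))) y = y"
          by (simp only: comp_apply)
      qed
      then show ?thesis by (simp add: frechet_derivative_ident id_def)
    qed
    ultimately have "(\<lambda>a. ?R (chart_deriv ?c \<kappa> q' a)) = (\<lambda>a. a)" by (rule trans[OF sym])
    then have "?R (chart_deriv ?c \<kappa> q' v) = v" by (rule fun_cong)
    then have "?R (?R (chart_deriv ?c \<kappa> q' v)) = ?R v" by (rule arg_cong)
    then show ?thesis unfolding RR .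
  qed
  have part: "chart_deriv ?c H q' = (\<lambda>v. frechet_derivative G' (at (\<kappa> q')) (?R v))"
    if "q' \<in> M \<inter> N" "\<And>q. q \<in> M \<inter> N \<Longrightarrow> H q = G' (\<kappa> q)" "smooth_on W G'" for H G' and q'
  proof -
    have "\<kappa> q' \<in> W" "q' \<in> D" using that N W by auto
    then have "chart_deriv ?c H q' = (\<lambda>a. frechet_derivative G' (at (\<kappa> q')) (chart_deriv ?c \<kappa> q' a))"
      using that M(1) N(1) smooth_on_differentiable[OF that(3)]
      by (intro I.chart_deriv_coord[of M _ q' "M \<inter> N"]) auto
    then show ?thesis using Dc that by simp
  qed
  have R1: "?R ?e1 = ?e1" and R2: "?R ?e2 = \<sigma> *\<^sub>R ?e2" by (auto simp: vec_eq_iff forall_2 axis_def)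
  have p2: "chart_partial ?c 2 F q' = \<sigma> *\<^sub>R ?D G (\<kappa> q') ?e2" if "q' \<in> M \<inter> N" for q'
  proof -
    have e: "chart_deriv ?c F q' = (\<lambda>v. ?D G (\<kappa> q') (?R v))" by (rule part[OF that _ G]) (use F in auto)
    have "\<kappa> q' \<in> W" using that W by auto
    then show ?thesis unfolding chart_partial_def e R2 by (rule linear_scale[OF lin])
  qed
  define G2 where "G2 w = \<sigma> *\<^sub>R ?D G w ?e2" for w
  have sG2: "smooth_on W G2" unfolding G2_def
    by (intro smooth_on_scaleR W(1) smooth_on_const smooth_on_frechet G)
  have qMN: "q \<in> M \<inter> N" using M N by auto
  have "chart_partial ?c 2 (chart_partial ?c 2 F) q = ?D G2 (\<kappa> q) (?R ?e2)"
    unfolding chart_partial_def[of ?c 2 "chart_partial ?c 2 F"]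
    by (subst part[OF qMN _ sG2]) (use p2 in \<open>auto simp: G2_def\<close>)
  also have "\<dots> = \<sigma> *\<^sub>R (\<sigma> *\<^sub>R ?D (\<lambda>w. ?D G w ?e2) (\<kappa> q) ?e2)"
  proof -
    have d: "(\<lambda>w. ?D G w ?e2) differentiable (at (\<kappa> q))"
      by (rule smooth_on_differentiable[OF smooth_on_frechet[OF G] qD(2)])
    have "(G2 has_derivative (\<lambda>v. \<sigma> *\<^sub>R ?D (\<lambda>w. ?D G w ?e2) (\<kappa> q) v)) (at (\<kappa> q))"
      unfolding G2_def using d by (intro has_derivative_scaleR_right) (simp add: frechet_derivative_works)
    then have e: "?D G2 (\<kappa> q) = (\<lambda>v. \<sigma> *\<^sub>R ?D (\<lambda>w. ?D G w ?e2) (\<kappa> q) v)" using frechet_derivative_at by metis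
    show ?thesis unfolding e R2 using linear_scale[OF linear_frechet_derivative[OF d]] by simp
  qed
  also have "\<dots> = ?D (\<lambda>w. ?D G w ?e2) (\<kappa> q) ?e2" using M(4) by auto
  finally have p22: "chart_partial ?c 2 (chart_partial ?c 2 F) q = ?D (\<lambda>w. ?D G w ?e2) (\<kappa> q) ?e2" .
  have p1: "chart_partial ?c 1 F q = 0"
  proof -
    have e: "chart_deriv ?c F q = (\<lambda>v. ?D G (\<kappa> q) (?R v))" by (rule part[OF qMN _ G]) (use F in auto)
    show ?thesis unfolding chart_partial_def e R1 by (rule d1)
  qed
  have "limiting_normal_curvature ?c F (\<lambda>q. \<nu> (\<kappa> q)) q \<noteq> 0"
    unfolding limiting_normal_curvature_def p22 p2[OF qMN] using d2 d22 M(4) by auto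
  then show ?thesis
    unfolding generic_at_def
    using r1 N(1,3) unit_normal_field_coords[OF N(1,2) W F G nu] M p1
    by (intro conjI exI[of _ N] exI[of _ "\<lambda>q. \<nu> (\<kappa> q)"] exI[of _ ?c]) auto
qed

end

section \<open>One-parameter groups of isometries\<close>

lemma has_vector_derivative_scaleR_const_right:
  "(f has_vector_derivative f') F \<Longrightarrow> ((\<lambda>x. c *\<^sub>R f x) has_vector_derivative c *\<^sub>R f') F"
  by (rule bounded_linear.has_vector_derivative[OF bounded_linear_scaleR_right])

lemma euclidean_isometryE:
  assumes "euclidean_isometry T"
  obtains L s where "orthogonal_transformation L" "\<And>y. T y = L y + s"
proof -
  have "linear (\<lambda>y. T y - T 0)"
    by (rule isometry_linear) (use assms in \<open>auto simp: euclidean_isometry_def dist_norm\<close>)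
  moreover have "norm (T y - T 0) = norm y" for y
    using assms by (metis dist_norm diff_zero euclidean_isometry_def)
  ultimately have "orthogonal_transformation (\<lambda>y. T y - T 0)"
    by (simp add: orthogonal_transformation)
  then show ?thesis by (intro that[of "\<lambda>y. T y - T 0" "T 0"]) auto
qed

lemma euclidean_isometryI:
  "orthogonal_transformation L \<Longrightarrow> euclidean_isometry (\<lambda>y. L y + s)"
  unfolding euclidean_isometry_def dist_norm
  by (auto simp: orthogonal_transformation linear_diff[symmetric])

lemma euclidean_isometry_compose:
  "euclidean_isometry S \<Longrightarrow> euclidean_isometry T \<Longrightarrow> euclidean_isometry (\<lambda>y. S (T y))"
  by (simp add: euclidean_isometry_def)

lemma euclidean_isometry_inverse:
  assumes "euclidean_isometry T"
  obtains T' where "euclidean_isometry T'" "\<And>y. T (T' y) = y" "\<And>y. T' (T y) = y"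
proof -
  obtain L s where L: "orthogonal_transformation L" "\<And>y. T y = L y + s"
    using euclidean_isometryE[OF assms] by blast
  have "surj T"
  proof (rule surjI)
    show "T (inv L (y - s)) = y" for y
      using surj_f_inv_f[OF orthogonal_transformation_surj[OF L(1)], of "y - s"] L(2) by simp
  qed
  then have *: "T (inv T y) = y" for y by (simp add: surj_f_inv_f)
  have "inj T"
    using assms by (metis dist_eq_0_iff euclidean_isometry_def injI)
  then have "inv T (T y) = y" for y by simp
  moreover have "euclidean_isometry (inv T)"
    using assms * unfolding euclidean_isometry_def by metis
  ultimately show ?thesis using that * by blast
qed

lemma orthogonal_transformation_inner:
  "orthogonal_transformation L \<Longrightarrow> L x \<bullet> L y = x \<bullet> y"
  by (simp add: orthogonal_transformation_def)

text \<open>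
  Averaging over a short time interval makes a continuous one-parameter group differentiable:
  every point is the average over \<open>[0, a]\<close> of an orbit, because this averaging is an affine map with
  linear part close to the identity, hence onto, and \<open>T t\<close> maps it to the average over \<open>[t, t + a]\<close>.
\<close>

lemma helicoidal_motion_generator:
  assumes T: "helicoidal_motion T"
  obtains B d where "linear B" "\<And>y. y \<bullet> B y = 0" "T 0 = id" "\<exists>y. B y + d \<noteq> 0"
    "\<And>t y. ((\<lambda>t. T t y) has_vector_derivative (B (T t y) + d)) (at t)"
proof -
  have iso: "euclidean_isometry (T t)" for t using T by (simp add: helicoidal_motion_def)
  have grp: "T (s + t) y = T s (T t y)" for s t y
    using T by (simp add: helicoidal_motion_def)
  have cont: "continuous_on UNIV (\<lambda>t. T t y)" for y using T by (simp add: helicoidal_motion_def)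
  have T0: "T 0 y = y" for y
  proof -
    have "T 0 (T 0 y) = T 0 y" using grp[of 0 0 y] by simp
    moreover have "dist (T 0 (T 0 y)) (T 0 y) = dist (T 0 y) y"
      using iso[of 0] unfolding euclidean_isometry_def by blast
    ultimately have "dist (T 0 y) y = 0" by simp
    then show ?thesis by simp
  qed
  define L where "L t y = T t y - T t 0" for t y
  have L: "orthogonal_transformation (L t)" for t
  proof -
    obtain L' s where L': "orthogonal_transformation L'" "\<And>y. T t y = L' y + s"
      using euclidean_isometryE[OF iso] by blast
    have "L' 0 = 0" using L'(1) orthogonal_transformation_linear linear_0 by blast
    then have "L t = L'" by (simp add: L_def fun_eq_iff L'(2))
    then show ?thesis using L'(1) by simp
  qed
  have linL: "linear (L t)" for t using L orthogonal_transformation by blast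
  have TL: "T t y = L t y + T t 0" for t y by (simp add: L_def)
  have L0: "L 0 y = y" for y by (simp add: L_def T0)
  have contL: "continuous_on UNIV (\<lambda>t. L t y)" for y
    unfolding L_def by (intro continuous_on_diff cont)
  have "eventually (\<lambda>t. \<forall>b\<in>Basis. dist (L t b) b < 1/6) (nhds 0)"
  proof (rule eventually_ball_finite)
    show "\<forall>b\<in>Basis. \<forall>\<^sub>F t in nhds 0. dist (L t b) b < 1 / 6"
    proof
      fix b :: "real^3"
      have "isCont (\<lambda>t. L t b) 0" using contL continuous_on_eq_continuous_at by blast
      then have "((\<lambda>t. L t b) \<longlongrightarrow> b) (nhds 0)"
        using L0[of b] by (metis continuous_at tendsto_at_iff_tendsto_nhds)
      from tendstoD[OF this, of "1/6"] show "\<forall>\<^sub>F t in nhds 0. dist (L t b) b < 1 / 6" by simp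
    qed
  qed simp
  then obtain \<delta> where \<delta>: "\<delta> > 0" "\<And>t b. \<bar>t\<bar> < \<delta> \<Longrightarrow> b \<in> Basis \<Longrightarrow> norm (L t b - b) < 1/6"
    unfolding eventually_nhds_metric by (auto simp: dist_norm)
  define a where "a = \<delta> / 2"
  have a: "a > 0" using \<delta> by (simp add: a_def)
  have Lclose: "norm (L t y - y) \<le> norm y / 2" if "t \<in> {0..a}" for t y
  proof -
    have t: "\<bar>t\<bar> < \<delta>" using that a \<delta> by (auto simp: a_def)
    have "L t y - y = (\<Sum>b\<in>Basis. (y \<bullet> b) *\<^sub>R (L t b - b))"
    proof -
      have "L t (\<Sum>b\<in>Basis. (y \<bullet> b) *\<^sub>R b) = (\<Sum>b\<in>Basis. (y \<bullet> b) *\<^sub>R L t b)"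
        by (simp add: linear_sum[OF linL] linear_scale[OF linL])
      then show ?thesis
        by (simp add: euclidean_representation scaleR_diff_right sum_subtractf)
    qed
    also have "norm \<dots> \<le> (\<Sum>b\<in>(Basis::(real^3) set). norm y * (1/6))"
    proof (rule sum_norm_le)
      fix b :: "real^3" assume b: "b \<in> Basis"
      show "norm ((y \<bullet> b) *\<^sub>R (L t b - b)) \<le> norm y * (1/6)"
        unfolding norm_scaleR using \<delta>(2)[OF t b] Basis_le_norm[OF b, of y] by (intro mult_mono) auto
    qed
    also have "\<dots> = norm y / 2" by simp
    finally show ?thesis .
  qed
  have intT: "(\<lambda>s. T s y) integrable_on {u..v}" and intL: "(\<lambda>s. L s y) integrable_on {u..v}" for y u v
    using continuous_on_subset[OF cont] continuous_on_subset[OF contL] by (auto intro!: integrable_continuous_interval)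
  define N where "N y = integral {0..a} (\<lambda>s. L s y)" for y
  have "linear N"
  proof (rule linearI)
    show "N (x + y) = N x + N y" for x y
      unfolding N_def by (simp add: linear_add[OF linL] integral_add[OF intL intL])
    show "N (c *\<^sub>R x) = c *\<^sub>R N x" for c x
      unfolding N_def by (simp add: linear_scale[OF linL])
  qed
  have "y = 0" if "N y = 0" for y
  proof -
    have "norm (integral {0..a} (\<lambda>s. L s y - y)) \<le> integral {0..a} (\<lambda>s. norm y / 2)"
      by (rule integral_norm_bound_integral) (use Lclose intL in \<open>auto intro!: integrable_diff\<close>)
    moreover have "integral {0..a} (\<lambda>s. L s y - y) = N y - a *\<^sub>R y"
      using a by (subst integral_diff[OF intL]) (auto simp: N_def)
    ultimately have "a * norm y \<le> a * (norm y / 2)" using that a by simp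
    then show ?thesis using a by simp
  qed
  then have "inj N" using \<open>linear N\<close> linear_injective_0 by blast
  then have "surj N" using \<open>linear N\<close> linear_injective_imp_surjective by blast
  have K: "\<exists>y. z = (1/a) *\<^sub>R integral {0..a} (\<lambda>s. T s y)" for z
  proof -
    obtain y where y: "N y = a *\<^sub>R z - integral {0..a} (\<lambda>s. T s 0)" using \<open>surj N\<close> by (metis surjD)
    have "integral {0..a} (\<lambda>s. T s y) = N y + integral {0..a} (\<lambda>s. T s 0)"
      unfolding N_def by (subst integral_add[OF intL intT, symmetric]) (simp add: L_def)
    then show ?thesis using y a by (intro exI[of _ y]) simp
  qed
  have diff: "\<exists>D. ((\<lambda>t. T t z) has_vector_derivative D) (at 0)" for z
  proof -
    obtain y where y: "z = (1/a) *\<^sub>R integral {0..a} (\<lambda>s. T s y)" using K by blast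
    define H where "H t = integral {-1..t} (\<lambda>s. T s y)" for t
    have HD: "(H has_vector_derivative T t y) (at t)" if "t > -1" for t
    proof -
      have "(H has_vector_derivative T t y) (at t within {-1..t+1})"
        unfolding H_def
        by (rule integral_has_vector_derivative) (use that continuous_on_subset[OF cont] in auto)
      then show ?thesis using that at_within_interior[of t "{-1..t+1}"] by (simp add: interior_atLeastAtMost_real)
    qed
    have eq: "T t z = (1/a) *\<^sub>R (H (t + a) - H t)" if "t \<in> {-1<..<1}" for t
    proof -
      have "L t z = (1/a) *\<^sub>R integral {0..a} (\<lambda>s. L t (T s y))"
        using integral_linear[OF intT, of "L t" 0 a y] linL[of t]
        by (simp add: y linear_scale[OF linL] linear_conv_bounded_linear comp_def)
      then have "T t z = (1/a) *\<^sub>R integral {0..a} (\<lambda>s. L t (T s y)) + (1/a) *\<^sub>R integral {0..a} (\<lambda>s. T t 0)"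
        using a by (subst TL) simp
      also have "\<dots> = (1/a) *\<^sub>R integral {0..a} (\<lambda>s. L t (T s y) + T t 0)"
        using integrable_linear[OF intT, of "L t" y 0 a] linL[of t]
        by (subst integral_add) (auto simp: linear_conv_bounded_linear comp_def scaleR_add_right)
      also have "\<dots> = (1/a) *\<^sub>R integral {0..a} (\<lambda>s. T (s + t) y)"
      proof -
        have "L t (T s y) + T t 0 = T (s + t) y" for s
          using TL[of t "T s y"] grp[of t s y] by (metis add.commute)
        then show ?thesis by simp
      qed
      also have "integral {0..a} (\<lambda>s. T (s + t) y) = integral {t..t + a} (\<lambda>s. T s y)"
        using integral_shift_real_ivl[where a=t and b="t + a" and c=t and f="\<lambda>s. T s y"] by simp
      also have "\<dots> = H (t + a) - H t"
        unfolding H_def using that a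
        by (subst Henstock_Kurzweil_Integration.integral_combine[of "-1" t "t + a" "\<lambda>s. T s y", symmetric])
           (auto simp: intT)
      finally show ?thesis .
    qed
    have "((\<lambda>t. (1/a) *\<^sub>R (H (t + a) - H t)) has_vector_derivative (1/a) *\<^sub>R (T (0 + a) y - T 0 y)) (at 0)"
    proof (rule has_vector_derivative_scaleR_const_right, rule has_vector_derivative_diff)
      have "((H \<circ> (\<lambda>t. t + a)) has_vector_derivative 1 *\<^sub>R T (0 + a) y) (at 0)"
        by (rule vector_diff_chain_at) (use HD[of "0 + a"] a in \<open>auto intro!: derivative_eq_intros\<close>)
      then show "((\<lambda>t. H (t + a)) has_vector_derivative T (0 + a) y) (at 0)" by (simp add: comp_def)
      show "(H has_vector_derivative T 0 y) (at 0)" using HD[of 0] by simp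
    qed
    then have "((\<lambda>t. T t z) has_vector_derivative (1/a) *\<^sub>R (T (0 + a) y - T 0 y)) (at 0)"
      by (rule has_vector_derivative_transform_within_open[of _ _ _ "{-1<..<1}"]) (use eq in auto)
    then show ?thesis by blast
  qed
  then obtain X where X: "\<And>z. ((\<lambda>t. T t z) has_vector_derivative X z) (at 0)" by metis
  have Xt: "((\<lambda>t. T t z) has_vector_derivative X (T t z)) (at t)" for t z
  proof -
    have "(((\<lambda>s. T s (T t z)) \<circ> (\<lambda>s. s - t)) has_vector_derivative 1 *\<^sub>R X (T t z)) (at t)"
      by (rule vector_diff_chain_at) (use X[of "T t z"] in \<open>auto intro!: derivative_eq_intros\<close>)
    then show ?thesis by (simp add: comp_def grp[symmetric])
  qed
  define B where "B y = X y - X 0" for y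
  have LB: "((\<lambda>t. L t y) has_vector_derivative B y) (at 0)" for y
    unfolding L_def B_def by (intro has_vector_derivative_diff X)
  have "linear B"
  proof (rule linearI)
    fix x y c
    have "((\<lambda>t. L t (x + y)) has_vector_derivative B x + B y) (at 0)"
      unfolding linear_add[OF linL] by (intro has_vector_derivative_add LB)
    then show "B (x + y) = B x + B y" using LB vector_derivative_unique_at by blast
    have "((\<lambda>t. L t (c *\<^sub>R x)) has_vector_derivative c *\<^sub>R B x) (at 0)"
      unfolding linear_scale[OF linL] by (intro has_vector_derivative_scaleR_const_right LB)
    then show "B (c *\<^sub>R x) = c *\<^sub>R B x" using LB vector_derivative_unique_at by blast
  qed
  moreover have "y \<bullet> B y = 0" for y
  proof -
    have "((\<lambda>t. L t y \<bullet> L t y) has_vector_derivative L 0 y \<bullet> B y + B y \<bullet> L 0 y) (at 0)"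
      by (rule bounded_bilinear.has_vector_derivative[OF bounded_bilinear_inner LB LB])
    moreover have "(\<lambda>t. L t y \<bullet> L t y) = (\<lambda>t. y \<bullet> y)"
      using orthogonal_transformation_inner[OF L] by simp
    ultimately have "L 0 y \<bullet> B y + B y \<bullet> L 0 y = 0"
      using vector_derivative_unique_at has_vector_derivative_const by metis
    then show ?thesis by (simp add: L0 inner_commute)
  qed
  moreover have "\<exists>y. B y + X 0 \<noteq> 0"
  proof (rule ccontr)
    assume "\<not> ?thesis"
    then have z: "X y = 0" for y by (simp add: B_def)
    have "T t y = T 0 y" for t y
      using has_vector_derivative_zero_constant[of UNIV "\<lambda>t. T t y"] Xt[of y] z by (metis convex_UNIV UNIV_I)
    then have "T t = id" for t using T0 by (simp add: fun_eq_iff)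
    then show False using T by (simp add: helicoidal_motion_def)
  qed
  moreover have "T 0 = id" using T0 by (simp add: fun_eq_iff)
  moreover have "((\<lambda>t. T t y) has_vector_derivative (B (T t y) + X 0)) (at t)" for t y
    using Xt by (simp add: B_def)
  ultimately show ?thesis using that by blast
qed

definition screw :: "real \<Rightarrow> real \<Rightarrow> real \<Rightarrow> real^3 \<Rightarrow> real^3"
  where "screw \<omega> c t y =
    vector [cos (\<omega> * t) * y$1 - sin (\<omega> * t) * y$2, sin (\<omega> * t) * y$1 + cos (\<omega> * t) * y$2, y$3 + c * t]"

lemma vec3_eq_iff: "(v::real^3) = w \<longleftrightarrow> v$1 = w$1 \<and> v$2 = w$2 \<and> v$3 = w$3"
  by (auto simp: vec_eq_iff forall_3)

lemma inner3: "(v::real^3) \<bullet> w = v$1 * w$1 + v$2 * w$2 + v$3 * w$3"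
  by (simp add: inner_vec_def sum_3)

lemma has_vector_derivative_vector3:
  assumes "(a has_real_derivative a') F" "(b has_real_derivative b') F" "(c has_real_derivative c') F"
  shows "((\<lambda>t. vector [a t, b t, c t] :: real^3) has_vector_derivative vector [a', b', c']) F"
proof -
  have e: "(vector [x, y, z] :: real^3) = x *\<^sub>R axis 1 1 + y *\<^sub>R axis 2 1 + z *\<^sub>R axis 3 1" for x y z :: real
    by (simp add: vec3_eq_iff axis_def)
  have s: "((\<lambda>t. f t *\<^sub>R v) has_vector_derivative f' *\<^sub>R v) F"
    if "(f has_real_derivative f') F" for f f' and v :: "real^3"
    using bounded_linear.has_vector_derivative[OF bounded_linear_scaleR_left[of v], of f f' F] that
    by (simp add: has_real_derivative_iff_has_vector_derivative)
  show ?thesis unfolding e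
    by (intro has_vector_derivative_add s assms)
qed

text \<open>
  The kernel of a non-zero skew map of three-space is a line, the axis. The translational part of the
  generator is moved into the axis direction by a suitable choice of the origin.
\<close>

lemma skew_normal_form:
  fixes B :: "real^3 \<Rightarrow> real^3"
  assumes B: "linear B" "\<And>y. y \<bullet> B y = 0" and nz: "B y0 \<noteq> 0"
  obtains S s \<omega> c where "orthogonal_transformation S" "\<omega> \<noteq> 0"
    "\<And>y::real^3. B (S y + s) + d = S (vector [- \<omega> * y$2, \<omega> * y$1, c])"
proof -
  have skew: "x \<bullet> B y = - (B x \<bullet> y)" for x y
  proof -
    have "(x + y) \<bullet> B (x + y) = 0" by (rule B(2))
    then have "x \<bullet> B x + x \<bullet> B y + (y \<bullet> B x + y \<bullet> B y) = 0"
      by (simp only: linear_add[OF B(1)] inner_add_left inner_add_right add_ac)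
    then show ?thesis using B(2)[of x] B(2)[of y] by (simp add: inner_commute)
  qed
  let ?e = "\<lambda>i. axis i 1 :: real^3"
  define b where "b i j = ?e i \<bullet> B (?e j)" for i j
  have bs: "b i j = - b j i" for i j unfolding b_def by (subst skew) (simp add: inner_commute)
  have b0: "b i i = 0" for i using bs[of i i] by simp
  have ei: "?e i \<bullet> v = v $ i" "v \<bullet> ?e i = v $ i" for v i by (simp_all add: inner_axis inner_axis')
  have ey: "y = y$1 *\<^sub>R ?e 1 + y$2 *\<^sub>R ?e 2 + y$3 *\<^sub>R ?e 3" for y :: "real^3"
    by (simp add: vec3_eq_iff axis_def)
  have Bexp: "B y = y$1 *\<^sub>R B (?e 1) + y$2 *\<^sub>R B (?e 2) + y$3 *\<^sub>R B (?e 3)" for y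
  proof -
    have "B (y$1 *\<^sub>R ?e 1 + y$2 *\<^sub>R ?e 2 + y$3 *\<^sub>R ?e 3) = y$1 *\<^sub>R B (?e 1) + y$2 *\<^sub>R B (?e 2) + y$3 *\<^sub>R B (?e 3)"
      by (simp only: linear_add[OF B(1)] linear_scale[OF B(1)])
    then show ?thesis using ey[of y] by simp
  qed
  have Bk: "B (?e j) $ i = b i j" for i j unfolding b_def ei ..
  have By: "B y $ i = y$1 * b i 1 + y$2 * b i 2 + y$3 * b i 3" for y i
    by (subst Bexp) (simp add: Bk)
  define w :: "real^3" where "w = vector [- b 2 3, b 1 3, - b 1 2]"
  have Bw: "B w = 0"
    unfolding vec3_eq_iff By using bs[of 2 1] bs[of 3 1] bs[of 3 2] by (simp add: w_def b0)
  have "w \<noteq> 0"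
  proof
    assume "w = 0"
    then have "b 2 3 = 0" "b 1 3 = 0" "b 1 2 = 0" by (simp_all add: w_def vec3_eq_iff)
    then have "B y0 = 0"
      unfolding vec3_eq_iff By using bs[of 2 1] bs[of 3 1] bs[of 3 2] by (simp add: b0)
    then show False using nz by simp
  qed
  have "norm (?e 3) = norm ((1 / norm w) *\<^sub>R w)" using \<open>w \<noteq> 0\<close> by simp
  then obtain S where S: "orthogonal_transformation S" "S (?e 3) = (1 / norm w) *\<^sub>R w"
    using orthogonal_transformation_exists by blast
  have linS: "linear S" using S(1) orthogonal_transformation_linear by blast
  have "B (S (?e 3)) = 0" unfolding S(2) linear_scale[OF B(1)] Bw by simp
  define \<omega> where "\<omega> = S (?e 2) \<bullet> B (S (?e 1))"
  have Sexp: "S y = y$1 *\<^sub>R S (?e 1) + y$2 *\<^sub>R S (?e 2) + y$3 *\<^sub>R S (?e 3)" for y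
  proof -
    have "S (y$1 *\<^sub>R ?e 1 + y$2 *\<^sub>R ?e 2 + y$3 *\<^sub>R ?e 3) = y$1 *\<^sub>R S (?e 1) + y$2 *\<^sub>R S (?e 2) + y$3 *\<^sub>R S (?e 3)"
      by (simp only: linear_add[OF linS] linear_scale[OF linS])
    then show ?thesis using ey[of y] by simp
  qed
  have comp: "v = S (vector [S (?e 1) \<bullet> v, S (?e 2) \<bullet> v, S (?e 3) \<bullet> v])" for v
  proof -
    obtain u where "v = S u" using orthogonal_transformation_surj[OF S(1)] by (metis surjD)
    then have "S (?e i) \<bullet> v = u $ i" for i
      using orthogonal_transformation_inner[OF S(1)] ei by simp
    then have "vector [S (?e 1) \<bullet> v, S (?e 2) \<bullet> v, S (?e 3) \<bullet> v] = u" by (simp add: vec3_eq_iff)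
    then show ?thesis using \<open>v = S u\<close> by simp
  qed
  have BS: "B (S y) = S (vector [- \<omega> * y$2, \<omega> * y$1, 0])" for y
  proof -
    have "B (S y) = y$1 *\<^sub>R B (S (?e 1)) + y$2 *\<^sub>R B (S (?e 2))"
      by (subst Sexp) (simp add: linear_add[OF B(1)] linear_scale[OF B(1)] \<open>B (S (?e 3)) = 0\<close>)
    moreover have "S (?e 1) \<bullet> B (S (?e 2)) = - \<omega>" unfolding \<omega>_def by (subst skew) (simp add: inner_commute)
    moreover have "S (?e 3) \<bullet> B v = 0" for v by (subst skew) (simp add: \<open>B (S (?e 3)) = 0\<close>)
    ultimately have "S (?e 1) \<bullet> B (S y) = - \<omega> * y$2" "S (?e 2) \<bullet> B (S y) = \<omega> * y$1" "S (?e 3) \<bullet> B (S y) = 0"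
      using B(2)[of "S (?e 1)"] B(2)[of "S (?e 2)"] by (simp_all add: inner_add_right \<omega>_def[symmetric])
    then show ?thesis using comp[of "B (S y)"] by simp
  qed
  have "\<omega> \<noteq> 0"
  proof
    assume "\<omega> = 0"
    obtain u where "y0 = S u" using orthogonal_transformation_surj[OF S(1)] by (metis surjD)
    moreover have "vector [0, 0, 0] = (0 :: real^3)" by (simp add: vec3_eq_iff)
    ultimately have "B y0 = 0" using BS[of u] \<open>\<omega> = 0\<close> linear_0[OF linS] by simp
    then show False using nz by simp
  qed
  obtain d' where d': "d = S d'" using orthogonal_transformation_surj[OF S(1)] by (metis surjD)
  define v :: "real^3" where "v = vector [- d'$2 / \<omega>, d'$1 / \<omega>, 0]"
  have "B (S y + S v) + d = S (vector [- \<omega> * y$2, \<omega> * y$1, d'$3])" for y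
  proof -
    have "B (S y + S v) + d = S (vector [- \<omega> * (y + v)$2, \<omega> * (y + v)$1, 0] + d')"
      by (simp only: linear_add[OF linS, symmetric] BS d')
    also have "vector [- \<omega> * (y + v)$2, \<omega> * (y + v)$1, 0] + d' = vector [- \<omega> * y$2, \<omega> * y$1, d'$3]"
      using \<open>\<omega> \<noteq> 0\<close> by (simp add: vec3_eq_iff v_def field_simps)
    finally show ?thesis .
  qed
  then show ?thesis using that S(1) \<open>\<omega> \<noteq> 0\<close> by blast
qed

lemma affine_flow_unique:
  fixes B :: "real^3 \<Rightarrow> real^3"
  assumes B: "linear B" "\<And>y. y \<bullet> B y = 0"
    and u: "\<And>t. (u has_vector_derivative (B (u t) + d)) (at t)"
    and v: "\<And>t. (v has_vector_derivative (B (v t) + d)) (at t)" and "u 0 = v 0"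
  shows "u t = v t"
proof -
  have e: "((\<lambda>t. u t - v t) has_vector_derivative B (u t - v t)) (at t)" for t
    by (rule has_vector_derivative_diff[OF u v, THEN has_vector_derivative_eq_rhs]) (simp add: linear_diff[OF B(1)])
  have "((\<lambda>t. (u t - v t) \<bullet> (u t - v t)) has_vector_derivative 0) (at t)" for t
    using bounded_bilinear.has_vector_derivative[OF bounded_bilinear_inner e e] B(2) by (simp add: inner_commute)
  then obtain c where "(u t - v t) \<bullet> (u t - v t) = c" for t
    using has_vector_derivative_zero_constant[of UNIV "\<lambda>t. (u t - v t) \<bullet> (u t - v t)"] by auto
  from this[of t] this[of 0] show ?thesis using assms(5) by simp
qed

lemma screw_normal_form:
  fixes B S :: "real^3 \<Rightarrow> real^3"
  assumes T: "T 0 = id" "\<And>t y. ((\<lambda>t. T t y) has_vector_derivative (B (T t y) + d)) (at t)"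
    and B: "linear B" "\<And>y. y \<bullet> B y = 0" and S: "orthogonal_transformation S"
    and BS: "\<And>y::real^3. B (S y + s) + d = S (vector [- \<omega> * y$2, \<omega> * y$1, c])"
  shows "T t (S y + s) = S (screw \<omega> c t y) + s"
proof (rule affine_flow_unique[OF B])
  show "((\<lambda>t. T t (S y + s)) has_vector_derivative (B (T t (S y + s)) + d)) (at t)" for t by (rule T)
  have bl: "bounded_linear S" using S by (simp add: orthogonal_transformation_linear linear_conv_bounded_linear[symmetric])
  have "((\<lambda>t. screw \<omega> c t y) has_vector_derivative vector [- \<omega> * screw \<omega> c t y $ 2, \<omega> * screw \<omega> c t y $ 1, c]) (at t)" for t
    unfolding screw_def
    by (rule has_vector_derivative_vector3[THEN has_vector_derivative_eq_rhs]; (auto intro!: derivative_eq_intros)?)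
       (auto simp: vec3_eq_iff algebra_simps)
  from bounded_linear.has_vector_derivative[OF bl this]
  show "((\<lambda>t. S (screw \<omega> c t y) + s) has_vector_derivative (B (S (screw \<omega> c t y) + s) + d)) (at t)" for t
    unfolding BS by (auto intro!: derivative_eq_intros)
  have "screw \<omega> c 0 y = y" by (simp add: screw_def vec3_eq_iff)
  then show "T 0 (S y + s) = S (screw \<omega> c 0 y) + s" using T(1) by simp
qed

section \<open>Helicoidal surfaces swept out by a profile with an edge\<close>

lemma has_derivative_vector3:
  assumes "(a has_derivative a') F" "(b has_derivative b') F" "(c has_derivative c') F"
  shows "((\<lambda>t. vector [a t, b t, c t] :: real^3) has_derivative (\<lambda>v. vector [a' v, b' v, c' v])) F"
proof -
  have e: "(vector [x, y, z] :: real^3) = x *\<^sub>R axis 1 1 + y *\<^sub>R axis 2 1 + z *\<^sub>R axis 3 1" for x y z :: real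
    by (simp add: vec3_eq_iff axis_def)
  show ?thesis unfolding e
    by (intro has_derivative_add has_derivative_scaleR_left assms)
qed

lemma nth_has_derivative [derivative_intros]: "((\<lambda>w::real^'n. w $ i) has_derivative (\<lambda>v. v $ i)) F"
  by (rule bounded_linear_imp_has_derivative[OF bounded_linear_vec_nth])

definition plane_box :: "real \<Rightarrow> (real^2) set"
  where "plane_box r = {w. \<bar>w$1\<bar> < r \<and> \<bar>w$2\<bar> < r}"

lemma open_plane_box [simp]: "open (plane_box r)"
  unfolding plane_box_def by (intro open_Collect_conj open_Collect_less continuous_intros)

definition helix_surface :: "real \<Rightarrow> real \<Rightarrow> (real \<Rightarrow> real) \<Rightarrow> (real \<Rightarrow> real) \<Rightarrow> (real \<Rightarrow> real) \<Rightarrow> real^2 \<Rightarrow> real^3"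
  where "helix_surface k h \<rho> \<beta> \<zeta> w =
    vector [\<rho> (w$1) * cos (k * w$2 + \<beta> (w$1)), \<rho> (w$1) * sin (k * w$2 + \<beta> (w$1)),
      \<zeta> (w$1) + h * (k * w$2 + \<beta> (w$1))]"

text \<open>The vector with components \<open>a\<close>, \<open>b\<close>, \<open>c\<close> in the cylindrical frame at the angle \<open>t\<close>.\<close>

definition cyl :: "real \<Rightarrow> real \<Rightarrow> real \<Rightarrow> real \<Rightarrow> real^3"
  where "cyl t a b c = vector [a * cos t - b * sin t, a * sin t + b * cos t, c]"

lemma rotation_isometric:
  assumes "S * S + C * C = (1::real)"
  shows "(a * C - b * S) * (c * C - d * S) + (a * S + b * C) * (c * S + d * C) = a * c + b * d"
  using assms by algebra

lemma cyl_inner: "cyl t a b c \<bullet> cyl t a' b' c' = a * a' + b * b' + c * c'"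
proof -
  have "sin t * sin t + cos t * cos t = 1" using sin_cos_squared_add[of t] by (simp add: power2_eq_square)
  from rotation_isometric[OF this, of a b a' b'] show ?thesis by (simp add: cyl_def inner3)
qed

lemma helicoidal_motion_screw:
  assumes "\<omega> \<noteq> 0" shows "helicoidal_motion (screw \<omega> c)"
  unfolding helicoidal_motion_def
proof (intro conjI allI)
  show "euclidean_isometry (screw \<omega> c t)" for t
  proof -
    have "norm (screw \<omega> c t y - screw \<omega> c t z) = norm (y - z)" for y z
    proof -
      have e: "screw \<omega> c t y - screw \<omega> c t z = cyl (\<omega> * t) (y$1 - z$1) (y$2 - z$2) (y$3 - z$3)"
        by (simp add: screw_def cyl_def vec3_eq_iff algebra_simps)
      have "(norm (screw \<omega> c t y - screw \<omega> c t z))\<^sup>2 = (norm (y - z))\<^sup>2"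
        unfolding power2_norm_eq_inner e cyl_inner by (simp add: inner3)
      then show ?thesis by simp
    qed
    then show ?thesis by (simp add: euclidean_isometry_def dist_norm)
  qed
  show "screw \<omega> c (s + t) = screw \<omega> c s \<circ> screw \<omega> c t" for s t
    by (auto simp: screw_def vec3_eq_iff fun_eq_iff distrib_left cos_add sin_add algebra_simps)
  show "continuous_on UNIV (\<lambda>t. screw \<omega> c t y)" for y
    unfolding screw_def
    by (intro smooth_on_continuous smooth_on_vector3 smooth_intros open_UNIV)
  have "screw \<omega> c (pi / \<omega>) (axis 1 1) $ 1 = -1" using assms by (simp add: screw_def axis_def)
  then have "screw \<omega> c (pi / \<omega>) (axis 1 1) \<noteq> id (axis 1 1)" by (auto simp: axis_def)
  then show "\<exists>t. screw \<omega> c t \<noteq> id" by metis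
qed

text \<open>
  The derivatives of the profile vanish to the order \<open>N\<close> at \<open>w = 0\<close>. Positivity of \<open>l1\<close> makes the quotient
  \<open>V1\<close> of the first partial derivative by \<open>w\<^sup>N\<close> independent of the direction \<open>V2\<close> of the orbit.
\<close>

locale edge_profile =
  fixes N :: nat and r k h :: real and \<rho> r1 \<beta> b1 \<zeta> l1 :: "real \<Rightarrow> real"
  assumes N: "N \<ge> 1" and r: "r > 0" and k: "k \<noteq> 0"
    and \<rho>pos: "\<And>w. w \<in> {-r<..<r} \<Longrightarrow> \<rho> w > 0" and l1pos: "\<And>w. w \<in> {-r<..<r} \<Longrightarrow> l1 w > 0"
    and d\<rho>: "\<And>w. w \<in> {-r<..<r} \<Longrightarrow> (\<rho> has_real_derivative w ^ N * r1 w) (at w)"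
    and d\<beta>: "\<And>w. w \<in> {-r<..<r} \<Longrightarrow> (\<beta> has_real_derivative w ^ N * b1 w) (at w)"
    and d\<zeta>: "\<And>w. w \<in> {-r<..<r} \<Longrightarrow> (\<zeta> has_real_derivative w ^ N * l1 w) (at w)"
    and sr: "smooth_on {-r<..<r} r1" and sb: "smooth_on {-r<..<r} b1" and sl: "smooth_on {-r<..<r} l1"
begin

abbreviation "G \<equiv> helix_surface k h \<rho> \<beta> \<zeta>"

definition V1 :: "real^2 \<Rightarrow> real^3" where
  "V1 w = cyl (k * w$2 + \<beta> (w$1)) (r1 (w$1)) (\<rho> (w$1) * b1 (w$1)) (l1 (w$1) + h * b1 (w$1))"

definition V2 :: "real^2 \<Rightarrow> real^3" where
  "V2 w = cyl (k * w$2 + \<beta> (w$1)) 0 (\<rho> (w$1)) h"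

definition nrm :: "real^2 \<Rightarrow> real^3" where
  "nrm w = cyl (k * w$2 + \<beta> (w$1)) (- l1 (w$1) * \<rho> (w$1)) (- r1 (w$1) * h) (r1 (w$1) * \<rho> (w$1))"

definition nlen :: "real^2 \<Rightarrow> real" where
  "nlen w = sqrt ((l1 (w$1) * \<rho> (w$1))\<^sup>2 + (r1 (w$1) * h)\<^sup>2 + (r1 (w$1) * \<rho> (w$1))\<^sup>2)"

definition \<nu> :: "real^2 \<Rightarrow> real^3" where "\<nu> w = (1 / nlen w) *\<^sub>R nrm w"

lemma smooth_prim:
  assumes "\<And>w. w \<in> {-r<..<r} \<Longrightarrow> (f has_real_derivative w ^ N * e w) (at w)" "smooth_on {-r<..<r} e"
  shows "smooth_on {-r<..<r} f"
  by (rule smooth_on_realI[where f'="\<lambda>w. w ^ N * e w"])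
     (use assms in \<open>auto simp: has_real_derivative_iff_has_vector_derivative[symmetric] intro!: smooth_on_mult smooth_on_power\<close>)

lemmas s\<rho> = smooth_prim[OF d\<rho> sr] and s\<beta> = smooth_prim[OF d\<beta> sb] and s\<zeta> = smooth_prim[OF d\<zeta> sl]

lemma box1: "w \<in> plane_box r \<Longrightarrow> w$1 \<in> {-r<..<r}"
  by (auto simp: plane_box_def)

lemma smooth_fst_box: "smooth_on {-r<..<r} f \<Longrightarrow> smooth_on (plane_box r) (\<lambda>w. f (w$1))" for f :: "real \<Rightarrow> real"
  by (rule smooth_on_compose2[OF _ open_plane_box]) (use box1 in auto)

lemmas smooth_data = smooth_fst_box[OF s\<rho>] smooth_fst_box[OF s\<beta>] smooth_fst_box[OF s\<zeta>]
  smooth_fst_box[OF sr] smooth_fst_box[OF sb] smooth_fst_box[OF sl]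

lemma smooth_angle: "smooth_on (plane_box r) (\<lambda>w. k * w$2 + \<beta> (w$1))"
  by (intro smooth_intros smooth_data open_plane_box)

lemma smooth_G: "smooth_on (plane_box r) G"
  unfolding helix_surface_def
  by (intro smooth_on_vector3 smooth_intros smooth_data smooth_angle open_plane_box)

lemma fst_deriv:
  assumes "(f has_real_derivative f') (at (w$1))"
  shows "((\<lambda>w::real^2. f (w$1)) has_derivative (\<lambda>v. f' * v$1)) (at w)"
  using DERIV_compose_FDERIV[OF assms nth_has_derivative] by (simp add: mult.commute)

lemma G_deriv:
  assumes w: "w \<in> plane_box r"
  shows "(G has_derivative (\<lambda>v. (v$1 * w$1 ^ N) *\<^sub>R V1 w + (v$2 * k) *\<^sub>R V2 w)) (at w)"
proof -
  note [derivative_intros] = fst_deriv[OF d\<rho>[OF box1[OF w]]] fst_deriv[OF d\<beta>[OF box1[OF w]]] fst_deriv[OF d\<zeta>[OF box1[OF w]]]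
  let ?t = "k * w$2 + \<beta> (w$1)"
  have t: "((\<lambda>w. k * w$2 + \<beta> (w$1)) has_derivative (\<lambda>v. k * v$2 + w$1 ^ N * b1 (w$1) * v$1)) (at w)"
    by (auto intro!: derivative_eq_intros)
  have "(G has_derivative (\<lambda>v. vector [
      \<rho> (w$1) * ((k * v$2 + w$1 ^ N * b1 (w$1) * v$1) * - sin ?t) + (w$1 ^ N * r1 (w$1) * v$1) * cos ?t,
      \<rho> (w$1) * ((k * v$2 + w$1 ^ N * b1 (w$1) * v$1) * cos ?t) + (w$1 ^ N * r1 (w$1) * v$1) * sin ?t,
      w$1 ^ N * l1 (w$1) * v$1 + h * (k * v$2 + w$1 ^ N * b1 (w$1) * v$1)])) (at w)"
    unfolding helix_surface_def
    by (intro has_derivative_vector3 has_derivative_mult has_derivative_add has_derivative_mult_right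
        has_derivative_cos[OF t] has_derivative_sin[OF t] t fst_deriv[OF d\<rho>[OF box1[OF w]]] fst_deriv[OF d\<zeta>[OF box1[OF w]]])
  then show ?thesis
    by (rule has_derivative_eq_rhs) (auto simp: fun_eq_iff vec3_eq_iff V1_def V2_def cyl_def algebra_simps)
qed

lemma frechet_G: "w \<in> plane_box r \<Longrightarrow> frechet_derivative G (at w) = (\<lambda>v. (v$1 * w$1 ^ N) *\<^sub>R V1 w + (v$2 * k) *\<^sub>R V2 w)"
  by (rule frechet_derivative_at[OF G_deriv, symmetric])

lemma inner_frame:
  "V1 w \<bullet> V1 w = (r1 (w$1))\<^sup>2 + (\<rho> (w$1) * b1 (w$1))\<^sup>2 + (l1 (w$1) + h * b1 (w$1))\<^sup>2"
  "V1 w \<bullet> V2 w = (\<rho> (w$1))\<^sup>2 * b1 (w$1) + h * (l1 (w$1) + h * b1 (w$1))"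
  "V2 w \<bullet> V2 w = (\<rho> (w$1))\<^sup>2 + h\<^sup>2"
  "V1 w \<bullet> nrm w = 0" "V2 w \<bullet> nrm w = 0"
  "nrm w \<bullet> nrm w = (l1 (w$1) * \<rho> (w$1))\<^sup>2 + (r1 (w$1) * h)\<^sup>2 + (r1 (w$1) * \<rho> (w$1))\<^sup>2"
  unfolding V1_def V2_def nrm_def cyl_inner by (simp_all add: power2_eq_square algebra_simps)

lemma nlen_pos: "w \<in> plane_box r \<Longrightarrow> nlen w > 0"
proof -
  assume w: "w \<in> plane_box r"
  have "l1 (w$1) * \<rho> (w$1) > 0" using l1pos[OF box1[OF w]] \<rho>pos[OF box1[OF w]] by simp
  then show ?thesis unfolding nlen_def by (intro real_sqrt_gt_zero add_pos_nonneg) auto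
qed

lemma smooth_\<nu>: "smooth_on (plane_box r) \<nu>"
proof -
  have 1: "smooth_on (plane_box r) nlen"
    unfolding nlen_def
  proof (rule smooth_on_sqrt[OF open_plane_box])
    show "smooth_on (plane_box r) (\<lambda>w. (l1 (w$1) * \<rho> (w$1))\<^sup>2 + (r1 (w$1) * h)\<^sup>2 + (r1 (w$1) * \<rho> (w$1))\<^sup>2)"
      by (intro smooth_intros smooth_data open_plane_box)
    show "(l1 (w$1) * \<rho> (w$1))\<^sup>2 + (r1 (w$1) * h)\<^sup>2 + (r1 (w$1) * \<rho> (w$1))\<^sup>2 > 0" if "w \<in> plane_box r" for w
      using nlen_pos[OF that] by (simp add: nlen_def)
  qed
  have 2: "smooth_on (plane_box r) nrm"
    unfolding nrm_def cyl_def
    by (intro smooth_on_vector3 smooth_intros smooth_data smooth_angle open_plane_box)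
  show ?thesis unfolding \<nu>_def
    by (intro smooth_on_scaleR smooth_on_divide[OF open_plane_box 1] 2 smooth_on_const open_plane_box)
       (use nlen_pos in force)
qed

lemma norm_\<nu>: "w \<in> plane_box r \<Longrightarrow> norm (\<nu> w) = 1"
proof -
  assume w: "w \<in> plane_box r"
  have "norm (nrm w) = nlen w" unfolding norm_eq_sqrt_inner inner_frame nlen_def ..
  then show ?thesis using nlen_pos[OF w] by (simp add: \<nu>_def)
qed

lemma \<nu>_orth: "w \<in> plane_box r \<Longrightarrow> frechet_derivative G (at w) v \<bullet> \<nu> w = 0"
  unfolding frechet_G \<nu>_def inner_add_left inner_scaleR_left inner_scaleR_right inner_frame by simp

lemma frame_independent:
  assumes w: "w \<in> plane_box r" and 0: "a *\<^sub>R V1 w + b *\<^sub>R V2 w = 0"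
  shows "a = 0" "b = 0"
proof -
  let ?t = "k * w$2 + \<beta> (w$1)"
  let ?X = "cyl ?t 0 (- h) (\<rho> (w$1))"
  have p: "\<rho> (w$1) > 0" "l1 (w$1) > 0" using l1pos[OF box1[OF w]] \<rho>pos[OF box1[OF w]] by auto
  have "V1 w \<bullet> ?X = l1 (w$1) * \<rho> (w$1)"
    unfolding V1_def cyl_inner by (simp add: algebra_simps)
  moreover have "V2 w \<bullet> ?X = 0"
    unfolding V2_def cyl_inner by simp
  moreover have "(a *\<^sub>R V1 w + b *\<^sub>R V2 w) \<bullet> ?X = 0" using 0 by simp
  ultimately have "a * (l1 (w$1) * \<rho> (w$1)) = 0" by (simp add: inner_add_left)
  then show a: "a = 0" using p by simp
  have "(b *\<^sub>R V2 w) \<bullet> V2 w = 0" using 0 a by simp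
  then have "b * (V2 w \<bullet> V2 w) = 0" by (simp only: inner_scaleR_left)
  moreover have "(\<rho> (w$1))\<^sup>2 + h\<^sup>2 > 0" using p by (intro add_pos_nonneg) auto
  ultimately show "b = 0" using p by (auto simp: inner_frame)
qed

lemma inj_frechet_G: "w \<in> plane_box r \<Longrightarrow> inj (frechet_derivative G (at w)) \<longleftrightarrow> w$1 \<noteq> 0"
proof -
  assume w: "w \<in> plane_box r"
  have lin: "linear (frechet_derivative G (at w))"
    by (rule has_derivative_linear[OF smooth_on_has_derivative[OF smooth_G w]])
  show ?thesis
  proof
    assume i: "inj (frechet_derivative G (at w))"
    have "frechet_derivative G (at w) (axis 1 1) \<noteq> 0"
    proof
      assume "frechet_derivative G (at w) (axis 1 1) = 0"
      then have "(axis 1 1 :: real^2) = 0" using i linear_injective_0[OF lin] by blast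
      then show False by (simp add: axis_eq_0_iff)
    qed
    then show "w$1 \<noteq> 0" using N by (auto simp: frechet_G[OF w] axis_def power_0_left)
  next
    assume nz: "w$1 \<noteq> 0"
    have "v = 0" if "frechet_derivative G (at w) v = 0" for v
      using frame_independent[OF w, of "v$1 * w$1 ^ N" "v$2 * k"] that nz k
      by (simp add: frechet_G[OF w] vec_eq_iff forall_2)
    then show "inj (frechet_derivative G (at w))" using linear_injective_0[OF lin] by blast
  qed
qed

lemma G_metric:
  assumes "w \<in> plane_box r"
  shows "frechet_derivative G (at w) a \<bullet> frechet_derivative G (at w) b =
    a$1 * b$1 * w$1 ^ (2 * N) * (V1 w \<bullet> V1 w) + (a$1 * b$2 + a$2 * b$1) * k * w$1 ^ N * (V1 w \<bullet> V2 w) + a$2 * b$2 * k\<^sup>2 * (V2 w \<bullet> V2 w)"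
  unfolding frechet_G[OF assms] mult_2 power_add
  by (simp add: inner_add_left inner_add_right inner_commute[of "V2 w" "V1 w"] power2_eq_square algebra_simps)

text \<open>
  The orbit through a singular point accelerates towards the axis, and the radial component of the
  normal is a multiple of \<open>l1 \<rho>\<close>.
\<close>

lemma G_second:
  assumes w: "w \<in> plane_box r" and w0: "w$1 = 0"
  shows "frechet_derivative (\<lambda>w. frechet_derivative G (at w) (axis 2 1)) (at w) (axis 2 1) \<bullet> \<nu> w \<noteq> 0"
proof -
  note p = \<rho>pos[OF box1[OF w]] l1pos[OF box1[OF w]] nlen_pos[OF w]
  let ?t = "k * w$2 + \<beta> (w$1)"
  have t: "((\<lambda>w. k * w$2 + \<beta> (w$1)) has_derivative (\<lambda>v. k * v$2 + w$1 ^ N * b1 (w$1) * v$1)) (at w)"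
    by (intro has_derivative_add has_derivative_mult_right nth_has_derivative fst_deriv d\<beta> box1 w)
  let ?D = "\<lambda>v::real^2. k *\<^sub>R vector [
      - (\<rho> (w$1) * ((k * v$2 + w$1 ^ N * b1 (w$1) * v$1) * cos ?t) + (w$1 ^ N * r1 (w$1) * v$1) * sin ?t),
      \<rho> (w$1) * ((k * v$2 + w$1 ^ N * b1 (w$1) * v$1) * - sin ?t) + (w$1 ^ N * r1 (w$1) * v$1) * cos ?t, 0] :: real^3"
  have "((\<lambda>w. k *\<^sub>R V2 w) has_derivative ?D) (at w)"
    unfolding V2_def cyl_def mult_zero_left diff_0 add_0
    by (intro has_derivative_scaleR_right has_derivative_vector3 has_derivative_mult has_derivative_minus has_derivative_const
        has_derivative_cos[OF t] has_derivative_sin[OF t] fst_deriv[OF d\<rho>[OF box1[OF w]]])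
  then have "frechet_derivative (\<lambda>w. k *\<^sub>R V2 w) (at w) = ?D"
    by (rule frechet_derivative_at[symmetric])
  moreover have "frechet_derivative (\<lambda>w. frechet_derivative G (at w) (axis 2 1)) (at w) = frechet_derivative (\<lambda>w. k *\<^sub>R V2 w) (at w)"
    by (rule frechet_derivative_cong[OF open_plane_box w]) (simp add: frechet_G axis_def)
  moreover have "?D (axis 2 1) \<bullet> \<nu> w = k\<^sup>2 * (\<rho> (w$1))\<^sup>2 * l1 (w$1) / nlen w"
  proof -
    have "?D (axis 2 1) = cyl ?t (- (k * \<rho> (w$1) * k)) 0 0"
      by (simp add: vec3_eq_iff cyl_def axis_def)
    then show ?thesis unfolding \<nu>_def nrm_def inner_scaleR_right
      by (simp only: cyl_inner) (simp add: power2_eq_square)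
  qed
  ultimately show ?thesis using p k by simp
qed

lemma G_shift: "G (vector [w$1, w$2 + s]) = screw k (h * k) s (G w)"
proof -
  have "k * (w$2 + s) + \<beta> (w$1) = (k * w$2 + \<beta> (w$1)) + k * s" by (simp add: algebra_simps)
  then show ?thesis
    by (simp add: helix_surface_def screw_def vec3_eq_iff cos_add sin_add algebra_simps)
qed

end

locale edge_surface = edge_profile N r k h \<rho> r1 \<beta> b1 \<zeta> l1 + coords A D "plane_box r" \<kappa>
  for N r k h \<rho> r1 \<beta> b1 \<zeta> l1 and A :: "('a::topological_space, real^2) chart set" and D \<kappa>
begin

definition F :: "'a \<Rightarrow> real^3" where "F q = G (\<kappa> q)"

lemma \<kappa>_box: "q \<in> D \<Longrightarrow> \<kappa> q \<in> plane_box r" using \<kappa>D(4) .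

lemma singular_F: "singular_set A D F = {q\<in>D. \<kappa> q $ 1 = 0}"
proof (intro set_eqI iffI)
  fix q assume q: "q \<in> singular_set A D F"
  then have "q \<in> D" by (simp add: singular_set_def)
  then show "q \<in> {q\<in>D. \<kappa> q $ 1 = 0}"
    using q singular_set_iff[of q D D F G] D inj_frechet_G[OF \<kappa>_box] smooth_on_differentiable[OF smooth_G \<kappa>_box]
    by (auto simp: F_def)
next
  fix q assume q: "q \<in> {q\<in>D. \<kappa> q $ 1 = 0}"
  then show "q \<in> singular_set A D F"
    using singular_set_iff[of q D D F G] D inj_frechet_G[OF \<kappa>_box] smooth_on_differentiable[OF smooth_G \<kappa>_box]
    by (auto simp: F_def)
qed

lemma smooth_F: "smooth_map A euclidean_atlas D F"
  unfolding F_def by (rule smooth_out[OF D _ smooth_G]) (use \<kappa>_box in auto)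

lemma surface_F: "surface A D F"
  unfolding surface_def
proof (intro conjI smooth_F subsetI)
  fix q assume q: "q \<in> D"
  show "q \<in> closure (D - singular_set A D F)"
    unfolding closure_iff_nhds_not_empty
  proof (intro allI impI)
    fix S V assume V: "V \<subseteq> S" "open V" "q \<in> V"
    have "open (plane_box r \<inter> \<kappa>i -` V)" by (rule open_coord_preimage[OF V(2)])
    moreover have "\<kappa> q \<in> plane_box r \<inter> \<kappa>i -` V" using q V \<kappa>D by simp
    ultimately obtain e where e: "e > 0" "ball (\<kappa> q) e \<subseteq> plane_box r \<inter> \<kappa>i -` V"
      by (meson open_contains_ball)
    define w where "w = \<kappa> q + (if \<kappa> q $ 1 = 0 then e/2 else 0) *\<^sub>R axis 1 1"
    have w: "w \<in> ball (\<kappa> q) e" using e by (auto simp: w_def dist_norm)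
    have "w $ 1 \<noteq> 0" using e by (auto simp: w_def axis_def)
    moreover have "w \<in> plane_box r" "\<kappa>i w \<in> V" using w e by auto
    ultimately have "\<kappa>i w \<in> (D - singular_set A D F) \<inter> S"
      using V \<kappa>D(6,7) by (auto simp: singular_F)
    then show "(D - singular_set A D F) \<inter> S \<noteq> {}" by blast
  qed
qed

lemma unit_normal_F: "unit_normal_field A D F (\<lambda>q. \<nu> (\<kappa> q))"
  by (rule unit_normal_field_coords[OF D _ open_plane_box _ _ smooth_G smooth_\<nu> norm_\<nu> \<nu>_orth])
     (use \<kappa>_box in \<open>auto simp: F_def\<close>)

lemma frontal_F: "frontal A D F"
  unfolding frontal_def using surface_F unit_normal_F D by blast

lemma generic_F:
  assumes "oriented_atlas A" "q \<in> D" "\<kappa> q $ 1 = 0"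
  shows "generic_at A F q"
proof (rule generic_at_coords[OF assms(1) D _ assms(2) open_plane_box _ _ smooth_G smooth_\<nu> norm_\<nu> \<nu>_orth])
  note w = \<kappa>_box[OF assms(2)]
  show "frechet_derivative G (at (\<kappa> q)) (axis 1 1) = 0"
    using N assms(3) by (simp add: frechet_G[OF w] axis_def power_0_left)
  have "V2 (\<kappa> q) \<bullet> V2 (\<kappa> q) > 0" unfolding inner_frame using \<rho>pos[OF box1[OF w]] by (intro add_pos_nonneg) auto
  then show "frechet_derivative G (at (\<kappa> q)) (axis 2 1) \<noteq> 0"
    using k by (auto simp add: frechet_G[OF w] axis_def)
  show "frechet_derivative (\<lambda>w. frechet_derivative G (at w) (axis 2 1)) (at (\<kappa> q)) (axis 2 1) \<bullet> \<nu> (\<kappa> q) \<noteq> 0"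
    by (rule G_second[OF w assms(3)])
qed (use \<kappa>_box in \<open>auto simp: F_def\<close>)

lemma invariant_F: "invariant_under A D F (screw k (h * k))"
  unfolding invariant_under_def
proof
  fix q assume q: "q \<in> D"
  define \<epsilon> where "\<epsilon> = (r - \<bar>\<kappa> q $ 2\<bar>) / 2"
  have \<epsilon>: "\<epsilon> > 0" using \<kappa>_box[OF q] by (simp add: \<epsilon>_def plane_box_def)
  define W where "W = {w \<in> plane_box r. \<bar>w$2 - \<kappa> q $ 2\<bar> < \<epsilon>}"
  have "W = plane_box r \<inter> {w. \<bar>w$2 - \<kappa> q $ 2\<bar> < \<epsilon>}" by (auto simp: W_def)
  then have oW: "open W" by (auto intro!: open_Int open_Collect_less continuous_intros)
  have Wb: "W \<subseteq> plane_box r" by (auto simp: W_def)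
  define U where "U = D \<inter> \<kappa> -` W"
  interpret R: coords A U W \<kappa> unfolding U_def by (rule restrict[OF oW Wb])
  define sh :: "real \<times> (real^2) \<Rightarrow> real^2" where "sh z = vector [snd z $ 1, snd z $ 2 + fst z]" for z
  have sh: "sh (s, w) \<in> plane_box r" if "\<bar>s\<bar> < \<epsilon>" "w \<in> W" for s w
  proof -
    have "\<bar>w$2 + s\<bar> \<le> \<bar>w$2 - \<kappa> q $ 2\<bar> + \<bar>s\<bar> + \<bar>\<kappa> q $ 2\<bar>" by arith
    also have "\<dots> < \<epsilon> + \<epsilon> + \<bar>\<kappa> q $ 2\<bar>" using that by (auto simp: W_def)
    finally have "\<bar>w$2 + s\<bar> < r" by (simp add: \<epsilon>_def field_simps)
    then show ?thesis using that by (auto simp: sh_def W_def plane_box_def)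
  qed
  define \<phi> where "\<phi> z = \<kappa>i (sh (fst z, \<kappa> (snd z)))" for z
  have ssh: "smooth_on T sh" if "open T" for T
    unfolding sh_def by (intro smooth_intros that smooth_on_nth smooth_on_fst smooth_on_snd)
  have UD: "U \<subseteq> D" by (auto simp: U_def)
  have "smooth_map (line_times_atlas A) A ({-\<epsilon><..<\<epsilon>} \<times> U) \<phi>"
    unfolding \<phi>_def
  proof (rule smooth_map_compose[OF smooth_atlas_line_times[OF A] smooth_atlas_euclidean A _ open_plane_box _ \<kappa>D(3)])
    show "open ({-\<epsilon><..<\<epsilon>} \<times> U)" using R.D by (intro open_Times) auto
    show "(\<lambda>z. sh (fst z, \<kappa> (snd z))) ` ({-\<epsilon><..<\<epsilon>} \<times> U) \<subseteq> plane_box r"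
      using sh by (auto simp: U_def)
    show "smooth_map (line_times_atlas A) euclidean_atlas ({-\<epsilon><..<\<epsilon>} \<times> U) (\<lambda>z. sh (fst z, \<kappa> (snd z)))"
    proof (rule smooth_map_compose[where \<phi>="\<lambda>z. (fst z, \<kappa> (snd z))" and \<psi>=sh,
          OF smooth_atlas_line_times[OF A] smooth_atlas_euclidean smooth_atlas_euclidean _ open_UNIV])
      show "smooth_map (line_times_atlas A) euclidean_atlas ({-\<epsilon><..<\<epsilon>} \<times> U) (\<lambda>z. (fst z, \<kappa> (snd z)))"
        by (rule smooth_map_subset[OF line_times_out]) (use UD in auto)
      show "open ({-\<epsilon><..<\<epsilon>} \<times> U)" using R.D by (intro open_Times) auto
      show "smooth_map euclidean_atlas euclidean_atlas UNIV sh" using ssh[OF open_UNIV] by simp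
    qed auto
  qed
  moreover have "\<phi> (0, x) = x" if "x \<in> U" for x
  proof -
    have "sh (0, \<kappa> x) = \<kappa> x" by (simp add: sh_def vec_eq_iff forall_2)
    then show ?thesis using that UD \<kappa>D(5) by (auto simp: \<phi>_def)
  qed
  moreover have "\<phi> (t, x) \<in> D \<and> F (\<phi> (t, x)) = screw k (h * k) t (F x)" if "t \<in> {-\<epsilon><..<\<epsilon>}" "x \<in> U" for t x
  proof -
    have "sh (t, \<kappa> x) \<in> plane_box r" using sh that by (auto simp: U_def)
    then have "\<phi> (t, x) \<in> D" "\<kappa> (\<phi> (t, x)) = vector [\<kappa> x $ 1, \<kappa> x $ 2 + t]"
      using \<kappa>D(6,7) by (simp_all add: \<phi>_def sh_def)
    then show ?thesis using G_shift[of "\<kappa> x" t] by (simp add: F_def)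
  qed
  moreover have "open U" "q \<in> U" "U \<subseteq> D"
    using R.D UD q \<epsilon> \<kappa>_box[OF q] by (auto simp: U_def W_def)
  ultimately show "\<exists>\<epsilon>>0. \<exists>U \<phi>. open U \<and> q \<in> U \<and> U \<subseteq> D \<and>
      smooth_map (line_times_atlas A) A ({-\<epsilon><..<\<epsilon>} \<times> U) \<phi> \<and>
      (\<forall>x\<in>U. \<phi> (0, x) = x) \<and>
      (\<forall>t\<in>{-\<epsilon><..<\<epsilon>}. \<forall>x\<in>U. \<phi> (t, x) \<in> D \<and> F (\<phi> (t, x)) = screw k (h * k) t (F x))"
    using \<epsilon> by blast
qed

text \<open>
  In cylindrical coordinates, after subtracting the screw motion, the surface is the product of the
  plane curve \<open>(\<zeta>, \<rho>)\<close> with a line. Since \<open>\<zeta> - \<zeta>(0) = w\<^sup>n avg(l1)\<close> with a positive average, an \<open>n\<close>-th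
  root of it serves as a coordinate, and a shear removes the part of \<open>\<rho>\<close> of order \<open>n\<close>.
\<close>

lemma n_type_F:
  assumes q: "q \<in> D" "\<kappa> q $ 1 = 0"
  shows "n_type_edge (Suc N) A F q"
proof -
  define w0 where "w0 = \<kappa> q"
  have w0: "w0 \<in> plane_box r" "w0 $ 1 = 0" using \<kappa>_box q by (auto simp: w0_def)
  have r0: "0 \<in> {-r<..<r}" using r by simp
  define \<theta>0 where "\<theta>0 = k * w0$2 + \<beta> 0"
  define L where "L = avg N l1"
  define R where "R = avg N r1"
  have sL: "smooth_on {-r<..<r} L" and sR: "smooth_on {-r<..<r} R" unfolding L_def R_def by (intro smooth_on_avg sl sr)+
  have Lpos: "L w > 0" if "w \<in> {-r<..<r}" for w
    unfolding L_def by (rule avg_pos[OF smooth_on_continuous[OF sl] that l1pos])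
  have \<zeta>L: "\<zeta> w = \<zeta> 0 + w ^ Suc N * L w" if "w \<in> {-r<..<r}" for w
    unfolding L_def by (rule avg_unique[OF sl that d\<zeta>])
  have \<rho>R: "\<rho> w = \<rho> 0 + w ^ Suc N * R w" if "w \<in> {-r<..<r}" for w
    unfolding R_def by (rule avg_unique[OF sr that d\<rho>])
  define m where "m = R 0 / L 0"
  define Q where "Q w = R w / L w - m" for w
  have sQ: "smooth_on {-r<..<r} Q"
    unfolding Q_def by (intro smooth_on_diff smooth_on_divide sL sR smooth_on_const) (use Lpos in force)+
  define Q' where "Q' w = frechet_derivative Q (at w) 1" for w
  have sQ': "smooth_on {-r<..<r} Q'" unfolding Q'_def by (rule smooth_on_frechet[OF sQ])
  have QQ: "Q w = w * avg 0 Q' w" if "w \<in> {-r<..<r}" for w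
    using avg_unique[OF sQ' that, of Q 0] smooth_on_real_DERIV[OF sQ] by (simp add: Q'_def Q_def m_def)
  define u where "u w = w * L w powr (1 / real (Suc N))" for w
  have root: "(L w powr (1 / real (Suc N))) ^ Suc N = L w" if "w \<in> {-r<..<r}" for w
    using Lpos[OF that] by (subst powr_realpow[symmetric]) (auto simp: powr_powr)
  have un: "u w ^ Suc N = w ^ Suc N * L w" if "w \<in> {-r<..<r}" for w
    unfolding u_def power_mult_distrib root[OF that] ..
  have sP: "smooth_on {-r<..<r} (\<lambda>w. L w powr (1 / real (Suc N)))"
    by (rule smooth_on_powr_const[OF _ sL]) (use Lpos in auto)
  have su: "smooth_on {-r<..<r} u" unfolding u_def by (intro smooth_intros sP) auto
  define S where "S = {w \<in> plane_box r. \<bar>k * w$2 + \<beta> (w$1) - \<theta>0\<bar> < pi/2}"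
  have "S = plane_box r \<inter> (\<lambda>w. \<bar>k * w$2 + \<beta> (w$1) - \<theta>0\<bar>) -` {..<pi/2}" by (auto simp: S_def)
  moreover have "continuous_on (plane_box r) (\<lambda>w. \<bar>k * w$2 + \<beta> (w$1) - \<theta>0\<bar>)"
    by (intro continuous_intros smooth_on_continuous[OF smooth_angle])
  ultimately have oS: "open S" by (auto intro!: continuous_open_preimage)
  have Sb: "S \<subseteq> plane_box r" and w0S: "w0 \<in> S" using w0 by (auto simp: S_def \<theta>0_def)
  define \<eta> :: "real^2 \<Rightarrow> real^2" where "\<eta> w = vector [u (w$1), k * w$2 + \<beta> (w$1) - \<theta>0]" for w
  have s\<eta>: "smooth_on S \<eta>"
    unfolding \<eta>_def
    by (intro smooth_on_vector2 smooth_on_diff smooth_on_subset[OF smooth_fst_box[OF su] Sb]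
        smooth_on_subset[OF smooth_angle Sb] smooth_on_const oS)
  let ?c = "L 0 powr (1 / real (Suc N))"
  have d\<eta>: "(\<eta> has_derivative (\<lambda>v. vector [?c * v$1, k * v$2])) (at w0)"
  proof -
    have "(u has_real_derivative 0 * frechet_derivative (\<lambda>w. L w powr (1 / real (Suc N))) (at 0) 1 + 1 * ?c) (at 0)"
      unfolding u_def by (rule DERIV_mult'[OF DERIV_ident smooth_on_real_DERIV[OF sP r0]])
    then have 1: "((\<lambda>w::real^2. u (w$1)) has_derivative (\<lambda>v. ?c * v$1)) (at w0)"
      by (intro fst_deriv) (simp add: w0)
    have "(\<beta> has_real_derivative 0) (at 0)" using d\<beta>[OF r0] N by (simp add: power_0_left)
    then have 2: "((\<lambda>w::real^2. \<beta> (w$1)) has_derivative (\<lambda>v. 0 * v$1)) (at w0)"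
      by (intro fst_deriv) (simp add: w0)
    have e: "(vector [x, y] :: real^2) = x *\<^sub>R axis 1 1 + y *\<^sub>R axis 2 1" for x y :: real
      by (simp add: vec_eq_iff forall_2 axis_def)
    have 3: "((\<lambda>w. k * w$2 + \<beta> (w$1) - \<theta>0) has_derivative (\<lambda>v. k * v$2 + 0 * v$1 - 0)) (at w0)"
      by (intro has_derivative_diff has_derivative_add has_derivative_mult_right nth_has_derivative 2 has_derivative_const)
    have "(\<eta> has_derivative (\<lambda>v. (?c * v$1) *\<^sub>R axis 1 1 + (k * v$2 + 0 * v$1 - 0) *\<^sub>R axis 2 1)) (at w0)"
      unfolding \<eta>_def e by (intro has_derivative_add has_derivative_scaleR_left 1 3)
    then show ?thesis unfolding e by simp
  qed
  have inj: "inj (frechet_derivative \<eta> (at w0))"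
  proof -
    have e: "frechet_derivative \<eta> (at w0) = (\<lambda>v. vector [?c * v$1, k * v$2])"
      by (rule frechet_derivative_at[OF d\<eta>, symmetric])
    have "?c > 0" using Lpos[OF r0] by simp
    then show ?thesis unfolding e using k
      by (intro injI) (auto simp: vec_eq_iff forall_2)
  qed
  obtain U1 V1' g where U1: "open U1" "w0 \<in> U1" "U1 \<subseteq> S" "open V1'" "homeomorphism U1 V1' \<eta> g" "smooth_on V1' g"
    by (rule smooth_inverse_function[OF oS s\<eta> w0S inj])
  have \<eta>g: "g w \<in> U1" "\<eta> (g w) = w" if "w \<in> V1'" for w using U1(5) that by (auto simp: homeomorphism_def)
  have dif: "diffeo euclidean_atlas euclidean_atlas U1 V1' \<eta>" "\<And>w. w \<in> V1' \<Longrightarrow> inv_into U1 \<eta> w = g w"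
    by (rule diffeo_euclideanI[OF U1(4) smooth_on_subset[OF s\<eta> U1(3)] U1(6,5)]; assumption)+
  have Ub: "U1 \<subseteq> plane_box r" using U1(3) Sb by blast
  define U where "U = D \<inter> \<kappa> -` U1"
  interpret RC: coords A U U1 \<kappa> unfolding U_def by (rule restrict[OF U1(1) Ub])
  have di: "diffeo A euclidean_atlas U V1' (\<lambda>q. \<eta> (\<kappa> q))"
    "\<And>w. w \<in> V1' \<Longrightarrow> inv_into U (\<lambda>q. \<eta> (\<kappa> q)) w = inv_into U \<kappa> (inv_into U1 \<eta> w)"
    by (rule diffeo_compose[OF A smooth_atlas_euclidean smooth_atlas_euclidean RC.D U1(1,4) RC.diffeo dif(1)]; assumption)+
  have \<eta>0: "\<eta> (\<kappa> q) = 0" using w0 unfolding w0_def[symmetric] \<eta>_def by (simp add: vec_eq_iff forall_2 u_def \<theta>0_def)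
  have qU: "q \<in> U" using q U1(2) by (simp add: U_def w0_def)
  define a :: "real^2 \<Rightarrow> real" where "a z = avg 0 Q' (g z $ 1) / L (g z $ 1) powr (1 / real (Suc N))" for z
  have gb: "(\<lambda>z. g z $ 1) ` V1' \<subseteq> {-r<..<r}" using \<eta>g(1) Ub box1 by blast
  have sa: "smooth_on V1' a"
  proof -
    have "smooth_on {-r<..<r} (\<lambda>w. avg 0 Q' w / L w powr (1 / real (Suc N)))"
      by (intro smooth_on_divide sP smooth_on_avg sQ') (use Lpos in force)+
    from smooth_on_compose2[OF this U1(4) gb smooth_on_nth[OF U1(4,6)]] show ?thesis unfolding a_def .
  qed
  \<comment> \<open>the ambient diffeomorphism and its inverse\<close>
  define X where "X y = cos \<theta>0 * y$1 + sin \<theta>0 * y$2" for y :: "real^3"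
  define Y where "Y y = - sin \<theta>0 * y$1 + cos \<theta>0 * y$2" for y :: "real^3"
  define T where "T y = arctan (Y y / X y)" for y
  define P where "P y = y$3 - h * (T y + \<theta>0) - \<zeta> 0" for y :: "real^3"
  define \<Phi> :: "real^3 \<Rightarrow> real^3" where "\<Phi> y = vector [P y, sqrt ((X y)\<^sup>2 + (Y y)\<^sup>2) - \<rho> 0 - m * P y, T y]" for y
  define W where "W = {y. X y > 0}"
  define Z :: "(real^3) set" where "Z = {z. \<bar>z$3\<bar> < pi/2 \<and> z$2 + m * z$1 + \<rho> 0 > 0}"
  define \<Psi> :: "real^3 \<Rightarrow> real^3" where "\<Psi> z = vector [(z$2 + m * z$1 + \<rho> 0) * cos (z$3 + \<theta>0), (z$2 + m * z$1 + \<rho> 0) * sin (z$3 + \<theta>0),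
     z$1 + \<zeta> 0 + h * (z$3 + \<theta>0)]" for z
  have oW: "open W" unfolding W_def X_def by (intro open_Collect_less continuous_intros)
  have oZ: "open Z" unfolding Z_def by (intro open_Collect_conj open_Collect_less continuous_intros)
  have sX: "smooth_on W X" and sY: "smooth_on W Y" unfolding X_def Y_def by (intro smooth_intros oW)+
  have sT: "smooth_on W T" unfolding T_def
    by (intro smooth_on_arctan smooth_on_divide oW sX sY) (auto simp: W_def)
  have sPp: "smooth_on W P" unfolding P_def by (intro smooth_intros oW sT)
  have pos2: "(X y)\<^sup>2 + (Y y)\<^sup>2 > 0" if "y \<in> W" for y using that by (auto simp: W_def intro!: add_pos_nonneg)
  have s\<Phi>: "smooth_on W \<Phi>" unfolding \<Phi>_def
    by (intro smooth_on_vector3 smooth_on_diff smooth_on_mult smooth_on_sqrt smooth_on_add smooth_on_power sPp sT sX sY smooth_on_const oW pos2)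
  have s\<Psi>: "smooth_on Z \<Psi>" unfolding \<Psi>_def by (intro smooth_intros oZ)
  have sc: "sin \<theta>0 * sin \<theta>0 + cos \<theta>0 * cos \<theta>0 = 1" using sin_cos_squared_add[of \<theta>0] by (simp add: power2_eq_square)
  have polar: "\<Phi> y = vector [y$3 - h * (t + \<theta>0) - \<zeta> 0, p - \<rho> 0 - m * (y$3 - h * (t + \<theta>0) - \<zeta> 0), t]" "y \<in> W"
    if "y$1 = p * cos (t + \<theta>0)" "y$2 = p * sin (t + \<theta>0)" "p > 0" "\<bar>t\<bar> < pi/2" for y p t
  proof -
    have c: "cos t > 0" using that by (intro cos_gt_zero_pi) auto
    have x: "X y = p * cos t"
    proof -
      have "X y = p * (cos t * (sin \<theta>0 * sin \<theta>0 + cos \<theta>0 * cos \<theta>0))"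
        unfolding X_def that(1,2) cos_add sin_add by algebra
      then show ?thesis by (simp only: sc mult_1_right)
    qed
    have y': "Y y = p * sin t"
    proof -
      have "Y y = p * (sin t * (sin \<theta>0 * sin \<theta>0 + cos \<theta>0 * cos \<theta>0))"
        unfolding Y_def that(1,2) cos_add sin_add by algebra
      then show ?thesis by (simp only: sc mult_1_right)
    qed
    have t: "T y = t"
    proof -
      have "Y y / X y = tan t" using x y' that c by (simp add: tan_def)
      then show ?thesis unfolding T_def using that by (simp add: arctan_tan)
    qed
    have "(X y)\<^sup>2 + (Y y)\<^sup>2 = p\<^sup>2 * ((sin t)\<^sup>2 + (cos t)\<^sup>2)" unfolding x y' by algebra
    then have "sqrt ((X y)\<^sup>2 + (Y y)\<^sup>2) = p" using that by simp
    then show "\<Phi> y = vector [y$3 - h * (t + \<theta>0) - \<zeta> 0, p - \<rho> 0 - m * (y$3 - h * (t + \<theta>0) - \<zeta> 0), t]"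
      by (simp add: \<Phi>_def P_def t)
    show "y \<in> W" using x c that by (simp add: W_def)
  qed
  have \<Phi>\<Psi>: "\<Psi> z \<in> W" "\<Phi> (\<Psi> z) = z" if "z \<in> Z" for z
    using polar[of "\<Psi> z" "z$2 + m * z$1 + \<rho> 0" "z$3"] that
    by (auto simp: \<Psi>_def Z_def vec3_eq_iff)
  have \<Psi>\<Phi>: "\<Phi> y \<in> Z" "\<Psi> (\<Phi> y) = y" if y: "y \<in> W" for y
  proof -
    have x: "X y > 0" using y by (simp add: W_def)
    define p where "p = sqrt ((X y)\<^sup>2 + (Y y)\<^sup>2)"
    have p: "p > 0" using pos2[OF y] by (simp add: p_def)
    have p': "p = X y * sqrt (1 + (Y y / X y)\<^sup>2)"
    proof -
      have "X y * sqrt (1 + (Y y / X y)\<^sup>2) = sqrt ((X y)\<^sup>2) * sqrt (1 + (Y y / X y)\<^sup>2)" using x by simp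
      also have "\<dots> = sqrt ((X y)\<^sup>2 * (1 + (Y y / X y)\<^sup>2))" by (simp only: real_sqrt_mult)
      also have "(X y)\<^sup>2 * (1 + (Y y / X y)\<^sup>2) = (X y)\<^sup>2 + (Y y)\<^sup>2" using x by (simp add: field_simps)
      finally show ?thesis by (simp add: p_def)
    qed
    have pc: "p * cos (T y) = X y" "p * sin (T y) = Y y"
      using x unfolding p' T_def cos_arctan sin_arctan by (auto simp: add_nonneg_eq_0_iff)
    have t: "\<bar>T y\<bar> < pi/2" using arctan_lbound[of "Y y / X y"] arctan_ubound[of "Y y / X y"] unfolding T_def by linarith
    have "p * cos (T y + \<theta>0) = y$1"
    proof -
      have "p * cos (T y + \<theta>0) = X y * cos \<theta>0 - Y y * sin \<theta>0" by (simp add: cos_add pc[symmetric] algebra_simps)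
      also have "\<dots> = y$1 * (sin \<theta>0 * sin \<theta>0 + cos \<theta>0 * cos \<theta>0)" unfolding X_def Y_def by algebra
      finally show ?thesis by (simp only: sc mult_1_right)
    qed
    moreover have "p * sin (T y + \<theta>0) = y$2"
    proof -
      have "p * sin (T y + \<theta>0) = Y y * cos \<theta>0 + X y * sin \<theta>0" by (simp add: sin_add pc[symmetric] algebra_simps)
      also have "\<dots> = y$2 * (sin \<theta>0 * sin \<theta>0 + cos \<theta>0 * cos \<theta>0)" unfolding X_def Y_def by algebra
      finally show ?thesis by (simp only: sc mult_1_right)
    qed
    ultimately show "\<Psi> (\<Phi> y) = y" using p
      by (simp add: \<Psi>_def \<Phi>_def vec3_eq_iff p_def[symmetric] P_def)
    show "\<Phi> y \<in> Z" using t p by (simp add: Z_def \<Phi>_def p_def[symmetric])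
  qed
  have dif\<Phi>: "diffeo euclidean_atlas euclidean_atlas W Z \<Phi>"
    by (rule diffeoI(1)[OF smooth_atlas_euclidean smooth_atlas_euclidean oZ, where \<psi>=\<Psi>]) (use s\<Phi> s\<Psi> \<Phi>\<Psi> \<Psi>\<Phi> in auto)
  \<comment> \<open>the normal form\<close>
  have GW: "G w \<in> W" "\<Phi> (G w) = vector [(\<eta> w $ 1) ^ Suc N, (\<eta> w $ 1) ^ (Suc N + 1) * (avg 0 Q' (w$1) / L (w$1) powr (1 / real (Suc N))), \<eta> w $ 2]"
    if w: "w \<in> S" for w
  proof -
    let ?t = "k * w$2 + \<beta> (w$1) - \<theta>0"
    have wr: "w$1 \<in> {-r<..<r}" using w Sb box1 by blast
    have t: "\<bar>?t\<bar> < pi/2" using w by (simp add: S_def)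
    have g: "G w $ 1 = \<rho> (w$1) * cos (?t + \<theta>0)" "G w $ 2 = \<rho> (w$1) * sin (?t + \<theta>0)" "G w $ 3 = \<zeta> (w$1) + h * (?t + \<theta>0)"
      by (simp_all add: helix_surface_def)
    note pol = polar[OF g(1,2) \<rho>pos[OF wr] t]
    show "G w \<in> W" by (rule pol(2))
    let ?p = "L (w$1) powr (1 / real (Suc N))"
    have pp: "?p > 0" using Lpos[OF wr] by simp
    have "R (w$1) = L (w$1) * (Q (w$1) + m)" using Lpos[OF wr] by (simp add: Q_def)
    then have "\<rho> (w$1) - \<rho> 0 - m * (\<zeta> (w$1) - \<zeta> 0) = (w$1) ^ Suc N * L (w$1) * Q (w$1)"
      using \<rho>R[OF wr] \<zeta>L[OF wr] by (simp add: algebra_simps)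
    also have "\<dots> = u (w$1) ^ Suc N * ((u (w$1) / ?p) * avg 0 Q' (w$1))"
    proof -
      have "u (w$1) / ?p = w$1" using pp by (simp add: u_def)
      then show ?thesis by (simp only: un[OF wr] QQ[OF wr] mult.assoc)
    qed
    also have "\<dots> = u (w$1) ^ (Suc N + 1) * (avg 0 Q' (w$1) / ?p)" by simp
    finally show "\<Phi> (G w) = vector [(\<eta> w $ 1) ^ Suc N, (\<eta> w $ 1) ^ (Suc N + 1) * (avg 0 Q' (w$1) / L (w$1) powr (1 / real (Suc N))), \<eta> w $ 2]"
      unfolding pol(1) g(3) using un[OF wr] \<zeta>L[OF wr] by (simp add: \<eta>_def vec3_eq_iff)
  qed
  let ?nf = "\<lambda>w. vector [(w$1) ^ Suc N, (w$1) ^ (Suc N + 1) * a w, w$2] :: real^3"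
  have norm_form: "?nf w = \<Phi> (F (inv_into U (\<lambda>q. \<eta> (\<kappa> q)) w))" if w: "w \<in> V1'" for w
  proof -
    have "\<kappa> (inv_into U (\<lambda>q. \<eta> (\<kappa> q)) w) = g w"
      unfolding di(2)[OF w] dif(2)[OF w] using RC.\<kappa>D(7)[OF \<eta>g(1)[OF w]] .
    then have "\<Phi> (F (inv_into U (\<lambda>q. \<eta> (\<kappa> q)) w)) = \<Phi> (G (g w))" by (simp add: F_def)
    also have "\<dots> = ?nf w" using GW(2)[of "g w"] \<eta>g[OF w] U1(3) by (auto simp: a_def)
    finally show ?thesis by simp
  qed
  have V0: "0 \<in> V1'" using U1(2,5) \<eta>0 by (auto simp: homeomorphism_def w0_def)
  have Fq: "\<Phi> (F q) = ?nf 0"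
    using GW(2)[OF w0S] \<eta>0 by (simp add: F_def w0_def vec3_eq_iff)
  have "A_equivalent A F q euclidean_atlas ?nf 0"
    unfolding A_equivalent_def
  proof (intro exI conjI)
    show "open U" "open V1'" "open W" "open Z" "q \<in> U" "0 \<in> V1'" "diffeo A euclidean_atlas U V1' (\<lambda>q. \<eta> (\<kappa> q))"
      "\<eta> (\<kappa> q) = 0" "diffeo euclidean_atlas euclidean_atlas W Z \<Phi>"
      using RC.D U1 oW oZ qU V0 di(1) \<eta>0 dif\<Phi> by auto
    show "F q \<in> W" using GW(1)[OF w0S] by (simp add: F_def w0_def)
    then show "?nf 0 \<in> Z" using \<Psi>\<Phi>(1) Fq by metis
    show "\<Phi> (F q) = ?nf 0" by (rule Fq)
    show "F ` U \<subseteq> W" using GW(1) U1(3) by (auto simp: F_def U_def)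
    show "\<forall>w\<in>V1'. ?nf w = \<Phi> (F (inv_into U (\<lambda>q. \<eta> (\<kappa> q)) w))" using norm_form by blast
  qed
  then show ?thesis unfolding n_type_edge_def using U1(4) V0 sa by blast
qed

theorem generic_helicoidal_edge_F:
  assumes "oriented_atlas A"
  shows "generic_helicoidal_edge (Suc N) A D F"
proof -
  have "0 \<in> plane_box r" using r by (simp add: plane_box_def)
  then have "\<kappa>i 0 \<in> singular_set A D F" unfolding singular_F using \<kappa>D(6,7) by simp
  then show ?thesis
    unfolding generic_helicoidal_edge_def
    using frontal_F helicoidal_motion_screw[OF k] invariant_F n_type_F generic_F[OF assms]
    by (auto simp: singular_F)
qed

end

section \<open>Rigidity of the induced metric\<close>

lemma square_constant:
  fixes g :: "'a::topological_space \<Rightarrow> real"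
  assumes "connected S" "continuous_on S g" "\<And>x. x \<in> S \<Longrightarrow> (g x)\<^sup>2 = K"
  obtains c where "\<And>x. x \<in> S \<Longrightarrow> g x = c"
proof -
  have "g x = sqrt K \<or> g x = - sqrt K" if "x \<in> S" for x
    using assms(3)[OF that] real_sqrt_abs[of "g x"] by (auto simp: abs_if split: if_splits)
  then have "g ` S \<subseteq> {sqrt K, - sqrt K}" by auto
  then have "finite (g ` S)" using finite_subset by blast
  then show ?thesis using continuous_finite_range_constant[OF assms(1,2)] that
    unfolding constant_on_def by blast
qed

lemma vec2_eq_iff: "(v::real^2) = w \<longleftrightarrow> v$1 = w$1 \<and> v$2 = w$2"
  by (auto simp: vec_eq_iff forall_2)

definition edge_metric :: "nat \<Rightarrow> (real \<Rightarrow> real) \<Rightarrow> real^2 \<Rightarrow> real^2 \<Rightarrow> real"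
  where "edge_metric N P w v = (v$1)\<^sup>2 * (w$1) ^ (2 * N) + P (w$1) * (v$2)\<^sup>2"

lemma axis_line: "vector [x, y] = x *\<^sub>R axis 1 1 + y *\<^sub>R (axis 2 1 :: real^2)"
  by (simp add: vec2_eq_iff axis_def)

lemma line_deriv:
  fixes \<Theta> :: "real^2 \<Rightarrow> real^2"
  assumes "\<Theta> differentiable (at (vector [x, y]))"
  shows "((\<lambda>x. \<Theta> (vector [x, y]) $ i) has_real_derivative frechet_derivative \<Theta> (at (vector [x, y])) (axis 1 1) $ i) (at x)"
    "((\<lambda>y. \<Theta> (vector [x, y]) $ i) has_real_derivative frechet_derivative \<Theta> (at (vector [x, y])) (axis 2 1) $ i) (at y)"
proof -
  let ?D = "frechet_derivative \<Theta> (at (vector [x, y]))"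
  have D: "(\<Theta> has_derivative ?D) (at (vector [x, y]))" using assms frechet_derivative_works by blast
  have l: "linear ?D" by (rule linear_frechet_derivative[OF assms])
  have "((\<lambda>x. \<Theta> (vector [x, y])) has_derivative (\<lambda>v. ?D (v *\<^sub>R axis 1 1))) (at x)"
    by (rule has_derivative_compose[where f="\<lambda>x. vector [x, y]" and g=\<Theta> and x=x, OF _ D]) (unfold axis_line, auto intro!: derivative_eq_intros)
  then have "((\<lambda>x. \<Theta> (vector [x, y]) $ i) has_derivative (\<lambda>v. ?D (v *\<^sub>R axis 1 1) $ i)) (at x)"
    by (rule bounded_linear.has_derivative[OF bounded_linear_vec_nth])
  then show "((\<lambda>x. \<Theta> (vector [x, y]) $ i) has_real_derivative ?D (axis 1 1) $ i) (at x)"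
    unfolding has_field_derivative_def linear_scale[OF l] vector_scaleR_component
    by (rule has_derivative_eq_rhs) (auto simp: mult.commute)
  have "((\<lambda>y. \<Theta> (vector [x, y])) has_derivative (\<lambda>v. ?D (v *\<^sub>R axis 2 1))) (at y)"
    by (rule has_derivative_compose[where f="\<lambda>y. vector [x, y]" and g=\<Theta> and x=y, OF _ D]) (unfold axis_line, auto intro!: derivative_eq_intros)
  then have "((\<lambda>y. \<Theta> (vector [x, y]) $ i) has_derivative (\<lambda>v. ?D (v *\<^sub>R axis 2 1) $ i)) (at y)"
    by (rule bounded_linear.has_derivative[OF bounded_linear_vec_nth])
  then show "((\<lambda>y. \<Theta> (vector [x, y]) $ i) has_real_derivative ?D (axis 2 1) $ i) (at y)"
    unfolding has_field_derivative_def linear_scale[OF l] vector_scaleR_component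
    by (rule has_derivative_eq_rhs) (auto simp: mult.commute)
qed

text \<open>
  \<open>|w\<^sub>1|\<^sup>n/n\<close> is the distance from the singular set, and it is not increased by isometries. The estimate is
  obtained by integrating along the lines on which the second coordinate is constant.
\<close>

lemma edge_isometry_bound:
  fixes \<Theta> :: "real^2 \<Rightarrow> real^2"
  assumes N: "N \<ge> 1" and sm: "\<And>w. w \<in> plane_box r \<Longrightarrow> \<Theta> differentiable (at w)"
    and pos: "\<And>w. w \<in> plane_box r \<Longrightarrow> P' (\<Theta> w $ 1) > 0"
    and inj: "\<And>w. w \<in> plane_box r \<Longrightarrow> inj (frechet_derivative \<Theta> (at w))"
    and iso: "\<And>w v. w \<in> plane_box r \<Longrightarrow> edge_metric N P' (\<Theta> w) (frechet_derivative \<Theta> (at w) v) = edge_metric N P w v"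
    and w: "w \<in> plane_box r"
  shows "\<bar>\<Theta> w $ 1\<bar> \<le> \<bar>w $ 1\<bar>"
proof -
  let ?f = "\<lambda>x. \<Theta> (vector [x, w$2]) $ 1"
  let ?f' = "\<lambda>x. frechet_derivative \<Theta> (at (vector [x, w$2])) (axis 1 1) $ 1"
  have inb: "vector [x, w$2] \<in> plane_box r" if "\<bar>x\<bar> \<le> \<bar>w$1\<bar>" for x using that w by (auto simp: plane_box_def)
  have df: "(?f has_real_derivative ?f' x) (at x)" if "\<bar>x\<bar> \<le> \<bar>w$1\<bar>" for x
    by (rule line_deriv(1)[OF sm[OF inb[OF that]]])
  have bnd: "\<bar>?f x ^ N * ?f' x\<bar> \<le> \<bar>x\<bar> ^ N" if "\<bar>x\<bar> \<le> \<bar>w$1\<bar>" for x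
  proof -
    let ?d = "frechet_derivative \<Theta> (at (vector [x, w$2])) (axis 1 1)"
    have "(?d$1)\<^sup>2 * ?f x ^ (2 * N) + P' (?f x) * (?d$2)\<^sup>2 = x ^ (2 * N)"
      using iso[OF inb[OF that], of "axis 1 1"] by (simp add: edge_metric_def axis_def)
    moreover have "P' (?f x) * (?d$2)\<^sup>2 \<ge> 0" using pos[OF inb[OF that]] by simp
    ultimately have "(?d$1)\<^sup>2 * ?f x ^ (2 * N) \<le> x ^ (2 * N)" by linarith
    then have "(?f x ^ N * ?f' x)\<^sup>2 \<le> (\<bar>x\<bar> ^ N)\<^sup>2"
      by (simp add: power_mult_distrib power_mult[symmetric] mult.commute power_even_abs)
    then show ?thesis using abs_le_square_iff[of "?f x ^ N * ?f' x" "\<bar>x\<bar> ^ N"] by simp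
  qed
  have f0: "?f 0 = 0"
  proof -
    let ?w = "vector [0, w$2] :: real^2"
    let ?d = "frechet_derivative \<Theta> (at ?w) (axis 1 1)"
    have b: "?w \<in> plane_box r" by (rule inb) simp
    have e: "(?d$1)\<^sup>2 * ?f 0 ^ (2 * N) + P' (?f 0) * (?d$2)\<^sup>2 = 0"
      using iso[OF b, of "axis 1 1"] N by (simp add: edge_metric_def axis_def power_0_left)
    have "(?d$1)\<^sup>2 * ?f 0 ^ (2 * N) \<ge> 0" by (simp add: power_mult)
    moreover have "P' (?f 0) * (?d$2)\<^sup>2 \<ge> 0" using pos[OF b] by simp
    ultimately have "(?d$1)\<^sup>2 * ?f 0 ^ (2 * N) = 0" "P' (?f 0) * (?d$2)\<^sup>2 = 0" using e by linarith+
    moreover have "?d \<noteq> 0"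
    proof
      assume "?d = 0"
      then have "(axis 1 1 :: real^2) = 0"
        using inj[OF b] linear_injective_0[OF linear_frechet_derivative[OF sm[OF b]]] by blast
      then show False by (simp add: axis_eq_0_iff)
    qed
    ultimately show ?thesis using pos[OF b] by (auto simp: vec2_eq_iff)
  qed
  have key: "0 \<le> \<bar>w$1\<bar> ^ Suc N + \<sigma> * ?f (\<tau> * \<bar>w$1\<bar>) ^ Suc N"
    if s: "\<sigma> = 1 \<or> \<sigma> = -1" "\<tau> = 1 \<or> \<tau> = -1" for \<sigma> \<tau>
  proof -
    let ?h = "\<lambda>y. y ^ Suc N + \<sigma> * ?f (\<tau> * y) ^ Suc N"
    have "\<exists>d. (?h has_real_derivative d) (at y) \<and> 0 \<le> d" if y: "0 \<le> y" "y \<le> \<bar>w$1\<bar>" for y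
    proof (intro exI conjI)
      have ty: "\<bar>\<tau> * y\<bar> = y" "\<bar>\<tau> * y\<bar> \<le> \<bar>w$1\<bar>" using s y by auto
      have 1: "((\<lambda>y. ?f (\<tau> * y)) has_real_derivative ?f' (\<tau> * y) * \<tau>) (at y)"
        by (rule DERIV_chain2[where f="?f" and g="\<lambda>y. \<tau> * y" and x=y, OF df[OF ty(2)]]) (auto intro!: derivative_eq_intros)
      show "(?h has_real_derivative (1 + real N) * (1 * y ^ N) + \<sigma> * ((1 + real N) * ((?f' (\<tau> * y) * \<tau>) * ?f (\<tau> * y) ^ N))) (at y)"
        by (intro DERIV_add DERIV_cmult DERIV_power_Suc[OF DERIV_ident] DERIV_power_Suc[OF 1])
      have "- (\<sigma> * \<tau> * (?f (\<tau> * y) ^ N * ?f' (\<tau> * y))) \<le> \<bar>?f (\<tau> * y) ^ N * ?f' (\<tau> * y)\<bar>" using s by auto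
      also have "\<dots> \<le> y ^ N" using bnd[OF ty(2)] ty(1) by simp
      finally have "0 \<le> (1 + real N) * (y ^ N + \<sigma> * \<tau> * (?f (\<tau> * y) ^ N * ?f' (\<tau> * y)))" by (intro mult_nonneg_nonneg) auto
      then show "0 \<le> (1 + real N) * (1 * y ^ N) + \<sigma> * ((1 + real N) * ((?f' (\<tau> * y) * \<tau>) * ?f (\<tau> * y) ^ N))"
        by (simp add: algebra_simps)
    qed
    then have "?h 0 \<le> ?h \<bar>w$1\<bar>" by (intro DERIV_nonneg_imp_nondecreasing[of 0 "\<bar>w$1\<bar>" ?h]) auto
    then show ?thesis using f0 by simp
  qed
  define \<tau> where "\<tau> = (if w$1 \<ge> 0 then 1 else -1 :: real)"
  have t: "\<tau> = 1 \<or> \<tau> = -1" "\<tau> * \<bar>w$1\<bar> = w$1" by (auto simp: \<tau>_def)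
  have ww: "vector [w$1, w$2] = w" by (simp add: vec2_eq_iff)
  have "\<bar>(\<Theta> w $ 1) ^ Suc N\<bar> \<le> \<bar>w$1\<bar> ^ Suc N"
    using key[of 1 \<tau>] key[of "-1" \<tau>] t ww by (auto simp: abs_le_iff)
  then have "\<bar>\<Theta> w $ 1\<bar> ^ Suc N \<le> \<bar>w$1\<bar> ^ Suc N" by (simp only: power_abs)
  then show ?thesis by (rule power_le_imp_le_base) simp
qed

lemma plane_box_subset_ball: assumes "open U" "0 \<in> U" obtains e where "e > 0" "plane_box e \<subseteq> U"
proof -
  obtain d where d: "d > 0" "ball 0 d \<subseteq> U" using assms open_contains_ball by blast
  have "plane_box (d/2) \<subseteq> ball 0 d"
  proof
    fix w :: "real^2" assume "w \<in> plane_box (d/2)"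
    then have "norm w < d" using norm_le_l1_cart[of w] by (auto simp: plane_box_def sum_2)
    then show "w \<in> ball 0 d" by simp
  qed
  then show ?thesis using that[of "d/2"] d by auto
qed

lemma plane_box_mono: "a \<le> b \<Longrightarrow> plane_box a \<subseteq> plane_box b" by (auto simp: plane_box_def)

text \<open>
  The distance estimate for \<open>\<Theta>\<close> and its inverse yields \<open>|\<Theta>\<^sub>1| = |w\<^sub>1|\<close>, and \<open>\<Theta>\<^sub>1\<close> is \<open>\<plusminus>w\<^sub>1\<close> by smoothness. What
  remains of the metric equation says that \<open>\<Theta>\<^sub>2\<close> does not depend on \<open>w\<^sub>1\<close> and has a derivative of constant
  absolute value on the axis \<open>w\<^sub>1 = 0\<close>.
\<close>

theorem edge_isometry_rigid:
  fixes \<Theta> \<Theta>' :: "real^2 \<Rightarrow> real^2"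
  assumes N: "N \<ge> 1" and U: "open U" "0 \<in> U" and V: "open V"
    and s: "smooth_on U \<Theta>" "smooth_on V \<Theta>'" and hom: "homeomorphism U V \<Theta> \<Theta>'" and z: "\<Theta> 0 = 0"
    and P: "\<And>w. w \<in> U \<Longrightarrow> P (w$1) > 0" and P': "\<And>w. w \<in> V \<Longrightarrow> P' (w$1) > 0"
    and iso: "\<And>w v. w \<in> U \<Longrightarrow> edge_metric N P' (\<Theta> w) (frechet_derivative \<Theta> (at w) v) = edge_metric N P w v"
  obtains e \<sigma> c where "e > 0" "plane_box e \<subseteq> U" "\<sigma> = 1 \<or> \<sigma> = -1" "c \<noteq> 0"
    "\<And>w. w \<in> plane_box e \<Longrightarrow> \<Theta> w = vector [\<sigma> * w$1, c * w$2]"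
    "\<And>w. w \<in> plane_box e \<Longrightarrow> P (w$1) = c\<^sup>2 * P' (\<sigma> * w$1)"
proof -
  have TT: "\<Theta>' (\<Theta> w) = w" "\<Theta> w \<in> V" if "w \<in> U" for w using hom that by (auto simp: homeomorphism_def)
  have TT': "\<Theta> (\<Theta>' w) = w" "\<Theta>' w \<in> U" if "w \<in> V" for w using hom that by (auto simp: homeomorphism_def)
  have dT: "\<Theta> differentiable (at w)" if "w \<in> U" for w using smooth_on_differentiable[OF s(1) that] .
  have dT': "\<Theta>' differentiable (at w)" if "w \<in> V" for w using smooth_on_differentiable[OF s(2) that] .
  let ?D = "\<lambda>w. frechet_derivative \<Theta> (at w)" and ?D' = "\<lambda>w. frechet_derivative \<Theta>' (at w)"
  have DD': "?D (\<Theta>' w) (?D' w v) = v" if w: "w \<in> V" for w v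
  proof -
    have "frechet_derivative (\<lambda>w. \<Theta> (\<Theta>' w)) (at w) = (\<lambda>v. ?D (\<Theta>' w) (?D' w v))"
      by (rule frechet_derivative_chain(1)) (use dT dT' TT' w in auto)
    moreover have "frechet_derivative (\<lambda>w. \<Theta> (\<Theta>' w)) (at w) = frechet_derivative (\<lambda>w. w) (at w)"
      by (rule frechet_derivative_cong[OF V w]) (use TT' in auto)
    ultimately have "(\<lambda>v. ?D (\<Theta>' w) (?D' w v)) = (\<lambda>v. v)" by (simp add: frechet_derivative_ident id_def)
    then show ?thesis by (rule fun_cong)
  qed
  have D'D: "?D' (\<Theta> w) (?D w v) = v" if w: "w \<in> U" for w v
  proof -
    have "frechet_derivative (\<lambda>w. \<Theta>' (\<Theta> w)) (at w) = (\<lambda>v. ?D' (\<Theta> w) (?D w v))"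
      by (rule frechet_derivative_chain(1)) (use dT dT' TT w in auto)
    moreover have "frechet_derivative (\<lambda>w. \<Theta>' (\<Theta> w)) (at w) = frechet_derivative (\<lambda>w. w) (at w)"
      by (rule frechet_derivative_cong[OF U(1) w]) (use TT in auto)
    ultimately have "(\<lambda>v. ?D' (\<Theta> w) (?D w v)) = (\<lambda>v. v)" by (simp add: frechet_derivative_ident id_def)
    then show ?thesis by (rule fun_cong)
  qed
  have injD: "inj (?D w)" if "w \<in> U" for w using D'D[OF that] by (rule inj_on_inverseI)
  have injD': "inj (?D' w)" if "w \<in> V" for w using DD'[OF that] by (rule inj_on_inverseI)
  have "0 \<in> V" using TT(2)[OF U(2)] z by simp
  then obtain e2 where e2: "e2 > 0" "plane_box e2 \<subseteq> V" using plane_box_subset_ball[OF V] by blast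
  have "open (U \<inter> \<Theta> -` plane_box e2)"
    by (rule continuous_open_preimage[OF smooth_on_continuous[OF s(1)] U(1) open_plane_box])
  moreover have "0 \<in> U \<inter> \<Theta> -` plane_box e2" using U z e2 by (simp add: plane_box_def)
  ultimately obtain e where e: "e > 0" "plane_box e \<subseteq> U \<inter> \<Theta> -` plane_box e2" using plane_box_subset_ball by blast
  have eU: "w \<in> U" "\<Theta> w \<in> plane_box e2" if "w \<in> plane_box e" for w using e that by auto
  have le1: "\<bar>\<Theta> w $ 1\<bar> \<le> \<bar>w $ 1\<bar>" if "w \<in> plane_box e" for w
    by (rule edge_isometry_bound[OF N dT P' injD iso that]) (use eU e2 in blast)+
  have iso': "edge_metric N P (\<Theta>' w) (?D' w v) = edge_metric N P' w v" if "w \<in> V" for w v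
    using iso[OF TT'(2)[OF that], of "?D' w v"] TT'(1)[OF that] DD'[OF that] by simp
  have le2: "\<bar>\<Theta>' w $ 1\<bar> \<le> \<bar>w $ 1\<bar>" if "w \<in> plane_box e2" for w
    by (rule edge_isometry_bound[OF N dT' P injD' iso' that]) (use TT' e2 in blast)+
  have abs_eq: "\<bar>\<Theta> w $ 1\<bar> = \<bar>w $ 1\<bar>" if "w \<in> plane_box e" for w
    using le1[OF that] le2[OF eU(2)[OF that]] TT(1)[OF eU(1)[OF that]] by simp
  let ?f' = "\<lambda>w. ?D w (axis 1 1) $ 1"
  have c1: "continuous_on (plane_box e) (\<lambda>w. ?D w a $ i)" for a i
    using smooth_on_continuous[OF smooth_on_nth[OF U(1) smooth_on_frechet[OF s(1)]]] continuous_on_subset e(2) by blast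
  have inb: "vector [x, w$2] \<in> plane_box e" if "w \<in> plane_box e" "\<bar>x\<bar> < e" for w x using that by (auto simp: plane_box_def)
  have w12: "vector [w$1, w$2] = w" for w :: "real^2" by (simp add: vec2_eq_iff)
  have ff: "\<Theta> w $ 1 * ?f' w = w $ 1" if w: "w \<in> plane_box e" for w
  proof -
    have d: "((\<lambda>x. \<Theta> (vector [x, w$2]) $ 1) has_real_derivative ?f' w) (at (w$1))"
      using line_deriv(1)[of \<Theta> "w$1" "w$2" 1] dT[OF eU(1)[OF w]] by (simp add: w12)
    have "((\<lambda>x. (\<Theta> (vector [x, w$2]) $ 1)\<^sup>2) has_real_derivative 2 * (\<Theta> w $ 1 * ?f' w)) (at (w$1))"
      using DERIV_power[OF d, of 2] by (simp add: w12 mult.commute)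
    moreover have "((\<lambda>x. (\<Theta> (vector [x, w$2]) $ 1)\<^sup>2) has_real_derivative 2 * (w$1)) (at (w$1))"
    proof (rule has_field_derivative_transform_within_open[where f="\<lambda>x. x\<^sup>2" and S="{-e<..<e}"])
      show "((\<lambda>x. x\<^sup>2) has_real_derivative 2 * (w$1)) (at (w$1))" by (auto intro!: derivative_eq_intros)
      show "w$1 \<in> {-e<..<e}" using w by (auto simp: plane_box_def)
      show "x\<^sup>2 = (\<Theta> (vector [x, w$2]) $ 1)\<^sup>2" if "x \<in> {-e<..<e}" for x
        using abs_eq[OF inb[OF w, of x]] that by (metis abs_less_iff greaterThanLessThan_iff minus_less_iff power2_abs vector_2(1))
    qed simp
    ultimately have "2 * (\<Theta> w $ 1 * ?f' w) = 2 * (w$1)" by (rule DERIV_unique)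
    then show ?thesis by simp
  qed
  have sq: "(?f' w)\<^sup>2 = 1" if w: "w \<in> plane_box e" for w
  proof -
    have nz: "(?f' w)\<^sup>2 = 1" if w: "w \<in> plane_box e" and "w$1 \<noteq> 0" for w
    proof -
      have "(\<Theta> w $ 1)\<^sup>2 * (?f' w)\<^sup>2 = (w$1)\<^sup>2" using ff[OF w] by (metis power_mult_distrib)
      moreover have "(\<Theta> w $ 1)\<^sup>2 = (w$1)\<^sup>2" using abs_eq[OF w] by (metis power2_abs)
      ultimately show ?thesis using that(2) by simp
    qed
    show ?thesis
    proof (cases "w$1 = 0")
      case True
      let ?l = "\<lambda>x. vector [x, w$2] :: real^2"
      have "continuous_on {-e<..<e} (\<lambda>x. (?f' (?l x))\<^sup>2)"
        by (intro continuous_intros continuous_on_compose2[OF c1])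
          (use inb[OF w] in \<open>auto simp: axis_line intro!: continuous_intros\<close>)
      then have "isCont (\<lambda>x. (?f' (?l x))\<^sup>2) 0"
        using e(1) by (simp add: continuous_on_eq_continuous_at)
      then have "((\<lambda>x. (?f' (?l x))\<^sup>2) \<longlongrightarrow> (?f' (?l 0))\<^sup>2) (at 0)" by (simp add: isCont_def)
      moreover have "((\<lambda>x. (?f' (?l x))\<^sup>2) \<longlongrightarrow> 1) (at 0)"
      proof (rule tendsto_eventually)
        have "eventually (\<lambda>x. x \<in> {-e<..<e} - {0}) (at (0::real))"
          using e(1) by (intro eventually_at_in_open) auto
        then show "\<forall>\<^sub>F x in at 0. (?f' (?l x))\<^sup>2 = 1"
          by eventually_elim (use nz inb[OF w] in auto)
      qed
      ultimately have "(?f' (?l 0))\<^sup>2 = 1" by (rule LIM_unique)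
      then show ?thesis using True w12[of w] by simp
    qed (use nz w in blast)
  qed
  have "convex (plane_box e)"
  proof -
    have "plane_box e = box (vector [-e, -e]) (vector [e, e])"
      by (auto simp: plane_box_def box_def Basis_vec_def inner_axis axis_eq_axis forall_2 abs_less_iff)
    then show ?thesis by simp
  qed
  then have con: "connected (plane_box e)" by (rule convex_connected)
  obtain \<sigma> where \<sigma>: "\<And>w. w \<in> plane_box e \<Longrightarrow> ?f' w = \<sigma>"
    using square_constant[OF con c1 sq] by blast
  have b0: "(0::real^2) \<in> plane_box e" using e by (simp add: plane_box_def)
  have \<sigma>1: "\<sigma> = 1 \<or> \<sigma> = -1" using sq[OF b0] \<sigma>[OF b0] by (simp add: power2_eq_1_iff)
  have \<Theta>1: "\<Theta> w $ 1 = \<sigma> * w$1" if "w \<in> plane_box e" for w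
    using ff[OF that] \<sigma>[OF that] \<sigma>1 by auto
  have D1: "?D w v $ 1 = \<sigma> * v$1" if w: "w \<in> plane_box e" for w v
  proof -
    have "((\<lambda>w. \<Theta> w $ 1) has_derivative (\<lambda>v. ?D w v $ 1)) (at w)"
      using dT[OF eU(1)[OF w]] by (intro bounded_linear.has_derivative[OF bounded_linear_vec_nth]) (simp add: frechet_derivative_works)
    moreover have "((\<lambda>w. \<Theta> w $ 1) has_derivative (\<lambda>v. \<sigma> * v$1)) (at w)"
      by (rule has_derivative_transform_within_open[OF _ open_plane_box w, where f="\<lambda>w. \<sigma> * w$1"])
         (use \<Theta>1 in \<open>auto intro!: derivative_eq_intros\<close>)
    ultimately have "(\<lambda>v. ?D w v $ 1) = (\<lambda>v. \<sigma> * v$1)" by (rule has_derivative_unique)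
    then show ?thesis by (rule fun_cong)
  qed
  have PP: "P' (\<sigma> * w$1) * (?D w v $ 2)\<^sup>2 = P (w$1) * (v$2)\<^sup>2" if w: "w \<in> plane_box e" for w v
    using iso[OF eU(1)[OF w], of v] D1[OF w] \<Theta>1[OF w] \<sigma>1
    by (auto simp: edge_metric_def power_mult_distrib)
  have P'pos: "P' (\<sigma> * w$1) > 0" if w: "w \<in> plane_box e" for w
    using P'[of "\<Theta> w"] TT(2)[OF eU(1)[OF w]] \<Theta>1[OF w] by simp
  have D12: "?D w (axis 1 1) $ 2 = 0" if w: "w \<in> plane_box e" for w
    using PP[OF w, of "axis 1 1"] P'pos[OF w] by (simp add: axis_def)
  have \<Theta>2: "\<Theta> w $ 2 = \<Theta> (vector [0, w$2]) $ 2" if w: "w \<in> plane_box e" for w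
  proof -
    have "((\<lambda>x. \<Theta> (vector [x, w$2]) $ 2) has_real_derivative 0) (at x within {-e<..<e})" if "x \<in> {-e<..<e}" for x
    proof -
      have b: "vector [x, w$2] \<in> plane_box e" using inb[OF w, of x] that by auto
      show ?thesis using line_deriv(1)[OF dT[OF eU(1)[OF b]], of 2] D12[OF b] by (simp add: has_field_derivative_at_within)
    qed
    then obtain C where C: "\<And>x. x \<in> {-e<..<e} \<Longrightarrow> \<Theta> (vector [x, w$2]) $ 2 = C"
      using has_field_derivative_zero_constant[of "{-e<..<e}" "\<lambda>x. \<Theta> (vector [x, w$2]) $ 2"] by auto
    show ?thesis using C[of "w$1"] C[of 0] w e by (auto simp: plane_box_def w12 abs_less_iff)
  qed
  let ?m = "\<lambda>y. vector [0, y] :: real^2"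
  have mb: "?m y \<in> plane_box e" if "y \<in> {-e<..<e}" for y using that by (auto simp: plane_box_def)
  have T'sq: "(?D (?m y) (axis 2 1) $ 2)\<^sup>2 = P 0 / P' 0" if y: "y \<in> {-e<..<e}" for y
    using PP[OF mb[OF y], of "axis 2 1"] P'pos[OF mb[OF y]] by (simp add: axis_def field_simps)
  have "continuous_on {-e<..<e} (\<lambda>y. ?D (?m y) (axis 2 1) $ 2)"
    by (intro continuous_on_compose2[OF c1]) (use mb in \<open>auto simp: axis_line intro!: continuous_intros\<close>)
  then obtain c where c: "\<And>y. y \<in> {-e<..<e} \<Longrightarrow> ?D (?m y) (axis 2 1) $ 2 = c"
    using square_constant[of "{-e<..<e}" "\<lambda>y. ?D (?m y) (axis 2 1) $ 2" "P 0 / P' 0"] T'sq by auto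
  have Ty: "\<Theta> (?m y) $ 2 = c * y" if y: "y \<in> {-e<..<e}" for y
  proof -
    have "((\<lambda>y. \<Theta> (?m y) $ 2 - c * y) has_real_derivative 0) (at y within {-e<..<e})" if "y \<in> {-e<..<e}" for y
    proof -
      have "((\<lambda>y. \<Theta> (?m y) $ 2 - c * y) has_real_derivative c - c) (at y)"
        using line_deriv(2)[OF dT[OF eU(1)[OF mb[OF that]]], of 2] c[OF that]
        by (intro DERIV_diff) (auto intro!: derivative_eq_intros)
      then show ?thesis by (simp add: has_field_derivative_at_within)
    qed
    then obtain C where C: "\<And>y. y \<in> {-e<..<e} \<Longrightarrow> \<Theta> (?m y) $ 2 - c * y = C"
      using has_field_derivative_zero_constant[of "{-e<..<e}" "\<lambda>y. \<Theta> (?m y) $ 2 - c * y"] by auto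
    have "?m 0 = 0" by (simp add: vec2_eq_iff)
    then show ?thesis using C[OF y] C[of 0] e z by auto
  qed
  have final: "\<Theta> w = vector [\<sigma> * w$1, c * w$2]" if w: "w \<in> plane_box e" for w
    using \<Theta>1[OF w] \<Theta>2[OF w] Ty[of "w$2"] w by (auto simp: vec2_eq_iff plane_box_def abs_less_iff)
  have D22: "?D w (axis 2 1) $ 2 = c" if w: "w \<in> plane_box e" for w
  proof -
    have "((\<lambda>w. \<Theta> w $ 2) has_derivative (\<lambda>v. ?D w v $ 2)) (at w)"
      using dT[OF eU(1)[OF w]] by (intro bounded_linear.has_derivative[OF bounded_linear_vec_nth]) (simp add: frechet_derivative_works)
    moreover have "((\<lambda>w. \<Theta> w $ 2) has_derivative (\<lambda>v. c * v$2)) (at w)"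
      by (rule has_derivative_transform_within_open[OF _ open_plane_box w, where f="\<lambda>w. c * w$2"])
         (use final in \<open>auto intro!: derivative_eq_intros\<close>)
    ultimately have "(\<lambda>v. ?D w v $ 2) = (\<lambda>v. c * v$2)" by (rule has_derivative_unique)
    from fun_cong[OF this, of "axis 2 1"] show ?thesis by (simp add: axis_def)
  qed
  have last: "P (w$1) = c\<^sup>2 * P' (\<sigma> * w$1)" if w: "w \<in> plane_box e" for w
    using PP[OF w, of "axis 2 1"] D22[OF w] by (simp add: axis_def mult.commute)
  have "c \<noteq> 0" using last[OF b0] P[OF eU(1)[OF b0]] by auto
  then show ?thesis using that[of e \<sigma> c] e(1) \<sigma>1 final last eU(1) by blast
qed

section \<open>Natural parameters\<close>

text \<open>
  Natural parameters: the profile curves meet the orbits orthogonally, and their velocity is \<open>|w|\<^sup>N\<close>.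
\<close>

locale bour_profile = edge_profile +
  assumes kpos: "k > 0" and \<beta>0: "\<beta> 0 = 0" and \<zeta>0: "\<zeta> 0 = 0"
    and unit: "\<And>w. w \<in> {-r<..<r} \<Longrightarrow> (r1 w)\<^sup>2 + (\<rho> w * b1 w)\<^sup>2 + (l1 w + h * b1 w)\<^sup>2 = 1"
    and orth: "\<And>w. w \<in> {-r<..<r} \<Longrightarrow> (\<rho> w)\<^sup>2 * b1 w + h * (l1 w + h * b1 w) = 0"

lemma edge_profile_mono:
  "edge_profile N r k \<rho> r1 \<beta> b1 \<zeta> l1 \<Longrightarrow> 0 < r' \<Longrightarrow> r' \<le> r \<Longrightarrow> edge_profile N r' k \<rho> r1 \<beta> b1 \<zeta> l1"
  unfolding edge_profile_def by (auto intro: smooth_on_subset)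

lemma bour_profile_mono:
  "bour_profile N r k h \<rho> r1 \<beta> b1 \<zeta> l1 \<Longrightarrow> 0 < r' \<Longrightarrow> r' \<le> r \<Longrightarrow> bour_profile N r' k h \<rho> r1 \<beta> b1 \<zeta> l1"
  unfolding bour_profile_def bour_profile_axioms_def using edge_profile_mono by auto

lemma (in bour_profile) G_edge_metric:
  assumes "w \<in> plane_box r"
  shows "frechet_derivative G (at w) v \<bullet> frechet_derivative G (at w) v = edge_metric N (\<lambda>x. k\<^sup>2 * ((\<rho> x)\<^sup>2 + h\<^sup>2)) w v"
  unfolding G_metric[OF assms] inner_frame edge_metric_def unit[OF box1[OF assms]] orth[OF box1[OF assms]]
  by (simp add: power2_eq_square)

text \<open>
  The length of the profile orthogonal to the orbits, raised to a suitable power, becomes the new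
  parameter \<open>x\<close>, and the angle is shifted along the profile so that it runs orthogonally to the orbits.
\<close>

lemma natural_parametrization:
  assumes ep: "edge_profile N \<delta> k \<rho> r1 \<beta> b1 \<zeta> l1" and kp: "k > 0" and z: "\<beta> 0 = 0" "\<zeta> 0 = 0"
  obtains r \<upsilon> \<rho>' r1' \<beta>' b1' \<zeta>' l1' where
    "bour_profile N r k h \<rho>' r1' \<beta>' b1' \<zeta>' l1'" "smooth_on {-r<..<r} \<upsilon>" "\<upsilon> 0 = 0"
    "\<And>x. x \<in> {-r<..<r} \<Longrightarrow> \<upsilon> x \<in> {-\<delta><..<\<delta>}" "frechet_derivative \<upsilon> (at 0) 1 \<noteq> 0"
    "\<And>x. x \<in> {-r<..<r} \<Longrightarrow> \<rho>' x = \<rho> (\<upsilon> x)" "\<And>x. x \<in> {-r<..<r} \<Longrightarrow> \<zeta>' x = \<zeta> (\<upsilon> x)"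
    "smooth_on {-r<..<r} (\<lambda>x. (\<beta>' x - \<beta> (\<upsilon> x)) / k)"
    "((\<lambda>x. (\<beta>' x - \<beta> (\<upsilon> x)) / k) has_real_derivative 0) (at 0)"
proof -
  interpret edge_profile N \<delta> k h \<rho> r1 \<beta> b1 \<zeta> l1 by (rule ep)
  define I where "I = {-\<delta><..<\<delta>}"
  have I0: "0 \<in> I" and oI: "open I" using r by (auto simp: I_def)
  have q: "(\<rho> u)\<^sup>2 + h\<^sup>2 > 0" if "u \<in> I" for u
    using \<rho>pos[of u] that by (intro add_pos_nonneg) (auto simp: I_def)
  note sm = s\<rho>[folded I_def] s\<beta>[folded I_def] s\<zeta>[folded I_def] sr[folded I_def] sb[folded I_def] sl[folded I_def]
  \<comment> \<open>the velocity of the profile has a component of length \<open>|u|\<^sup>N e(u)\<close> orthogonal to the orbit\<close>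
  define e where "e u = sqrt ((r1 u)\<^sup>2 + (l1 u * \<rho> u)\<^sup>2 / ((\<rho> u)\<^sup>2 + h\<^sup>2))" for u
  have ep0: "(r1 u)\<^sup>2 + (l1 u * \<rho> u)\<^sup>2 / ((\<rho> u)\<^sup>2 + h\<^sup>2) > 0" if "u \<in> I" for u
    by (rule add_nonneg_pos[OF _ divide_pos_pos[OF _ q[OF that]]])
       (use \<rho>pos[of u] l1pos[of u] that in \<open>auto simp: I_def\<close>)
  have epos: "e u > 0" if "u \<in> I" for u using ep0[OF that] by (simp add: e_def)
  have e2: "(e u)\<^sup>2 = (r1 u)\<^sup>2 + (l1 u * \<rho> u)\<^sup>2 / ((\<rho> u)\<^sup>2 + h\<^sup>2)" if "u \<in> I" for u
    using ep0[OF that] by (simp add: e_def)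
  have se: "smooth_on I e" unfolding e_def
  proof (rule smooth_on_sqrt[OF oI _ ep0])
    have "smooth_on I (\<lambda>u. (\<rho> u)\<^sup>2 + h\<^sup>2)" by (intro smooth_intros sm oI)
    then show "smooth_on I (\<lambda>u. (r1 u)\<^sup>2 + (l1 u * \<rho> u)\<^sup>2 / ((\<rho> u)\<^sup>2 + h\<^sup>2))"
      by (intro smooth_on_add smooth_on_divide[OF oI] smooth_on_power smooth_on_mult sm oI) (use q in force)+
  qed
  define Av where "Av u = (1 + real N) * avg N e u" for u
  have sA: "smooth_on I Av" unfolding Av_def I_def
    by (intro smooth_on_mult smooth_on_avg smooth_on_const) (use se in \<open>auto simp: I_def\<close>)
  have Ap: "Av u > 0" if "u \<in> I" for u
    using avg_pos[OF smooth_on_continuous[OF se[unfolded I_def]], of u N] epos that by (simp add: Av_def I_def)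
  define \<kappa> where "\<kappa> u = Av u powr (1 / real (Suc N))" for u
  have \<kappa>p: "\<kappa> u > 0" if "u \<in> I" for u using Ap[OF that] by (simp add: \<kappa>_def)
  have \<kappa>n: "\<kappa> u ^ Suc N = Av u" if "u \<in> I" for u
    unfolding \<kappa>_def using Ap[OF that] by (subst powr_realpow[symmetric]) (auto simp: powr_powr)
  have s\<kappa>: "smooth_on I \<kappa>" unfolding \<kappa>_def by (rule smooth_on_powr_const[OF oI sA Ap])
  \<comment> \<open>the new parameter: \<open>W(u)\<^sup>n\<close> is \<open>n\<close> times the integral of \<open>u\<^sup>N e(u)\<close>\<close>
  define W where "W u = u * \<kappa> u" for u
  have sW: "smooth_on I W" unfolding W_def by (intro smooth_intros s\<kappa> oI)
  have dW: "(W has_real_derivative e u / \<kappa> u ^ N) (at u)" if u: "u \<in> I" for u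
  proof -
    let ?d = "frechet_derivative W (at u) 1"
    have d: "(W has_real_derivative ?d) (at u)" by (rule smooth_on_real_DERIV[OF sW u])
    have "?d = e u / \<kappa> u ^ N"
    proof (cases "u = 0")
      case True
      have "(W has_real_derivative 0 * frechet_derivative \<kappa> (at 0) 1 + 1 * \<kappa> 0) (at 0)"
        unfolding W_def by (rule DERIV_mult'[OF DERIV_ident smooth_on_real_DERIV[OF s\<kappa> I0]])
      then have "?d = \<kappa> 0" using d True DERIV_unique by fastforce
      moreover have "e 0 = \<kappa> 0 ^ Suc N" unfolding \<kappa>n[OF I0] Av_def avg_0 by simp
      ultimately show ?thesis using True \<kappa>p[OF I0] by simp
    next
      case False
      have 1: "((\<lambda>u. W u ^ Suc N) has_real_derivative (1 + real N) * (?d * W u ^ N)) (at u)"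
        by (rule DERIV_power_Suc[OF d])
      have "((\<lambda>u. (1 + real N) * (u ^ Suc N * avg N e u)) has_real_derivative (1 + real N) * (u ^ N * e u)) (at u)"
        by (rule DERIV_cmult[OF avg_primitive]) (use se u in \<open>auto simp: I_def\<close>)
      then have "((\<lambda>u. W u ^ Suc N) has_real_derivative (1 + real N) * (u ^ N * e u)) (at u)"
      proof (rule has_field_derivative_transform_within_open[OF _ oI u])
        show "(1 + real N) * (u ^ Suc N * avg N e u) = W u ^ Suc N" if "u \<in> I" for u
          unfolding W_def power_mult_distrib \<kappa>n[OF that] Av_def by (simp only: mult_ac)
      qed
      from DERIV_unique[OF 1 this] have "(1 + real N) * (u ^ N * (?d * \<kappa> u ^ N)) = (1 + real N) * (u ^ N * e u)"
        by (simp add: W_def power_mult_distrib mult_ac)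
      then have "?d * \<kappa> u ^ N = e u" using False by simp
      then show ?thesis using \<kappa>p[OF u] by (simp add: field_simps)
    qed
    then show ?thesis using d by simp
  qed
  \<comment> \<open>the inverse of \<open>W\<close>, obtained from the planar inverse function theorem\<close>
  define \<eta> :: "real^2 \<Rightarrow> real^2" where "\<eta> w = vector [W (w$1), w$2]" for w
  have s\<eta>: "smooth_on (plane_box \<delta>) \<eta>" unfolding \<eta>_def
    by (intro smooth_on_vector2 smooth_fst_box smooth_on_nth' open_plane_box) (use sW in \<open>simp add: I_def\<close>)
  have b0: "0 \<in> plane_box \<delta>" using r by (simp add: plane_box_def)
  have "(\<eta> has_derivative (\<lambda>v. vector [e 0 / \<kappa> 0 ^ N * v$1, v$2])) (at 0)"
  proof -
    have e: "(vector [x, y] :: real^2) = x *\<^sub>R axis 1 1 + y *\<^sub>R axis 2 1" for x y :: real by (rule axis_line)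
    have "((\<lambda>w::real^2. W (w$1)) has_derivative (\<lambda>v. e 0 / \<kappa> 0 ^ N * v$1)) (at 0)"
      by (rule fst_deriv) (use dW[OF I0] in simp)
    then show ?thesis unfolding \<eta>_def e
      by (intro has_derivative_add has_derivative_scaleR_left nth_has_derivative)
  qed
  from frechet_derivative_at[OF this] have "frechet_derivative \<eta> (at 0) = (\<lambda>v. vector [e 0 / \<kappa> 0 ^ N * v$1, v$2])" by (rule sym)
  then have "inj (frechet_derivative \<eta> (at 0))"
    using epos[OF I0] \<kappa>p[OF I0] by (auto intro!: injI simp: vec2_eq_iff)
  from smooth_inverse_function[OF open_plane_box s\<eta> b0 this]
  obtain U V g where U: "open U" "0 \<in> U" "U \<subseteq> plane_box \<delta>" "open V" "homeomorphism U V \<eta> g" "smooth_on V g" by blast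
  have \<eta>0: "\<eta> 0 = 0" by (simp add: \<eta>_def W_def vec2_eq_iff)
  have V0: "0 \<in> V" using U(2,5) \<eta>0 by (force simp: homeomorphism_def)
  obtain r' where r': "r' > 0" "plane_box r' \<subseteq> V" using plane_box_subset_ball[OF U(4) V0] by blast
  define \<upsilon> where "\<upsilon> x = g (vector [x, 0]) $ 1" for x
  have inV: "vector [x, 0] \<in> V" if "x \<in> {-r'<..<r'}" for x
  proof -
    have "vector [x, 0] \<in> plane_box r'" using that r' by (auto simp: plane_box_def)
    then show ?thesis using r' by blast
  qed
  have gU: "g w \<in> U" "\<eta> (g w) = w" if "w \<in> V" for w using U(5) that by (auto simp: homeomorphism_def)
  have \<upsilon>I: "\<upsilon> x \<in> I" if "x \<in> {-r'<..<r'}" for x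
    using box1[of "g (vector [x, 0])"] gU(1)[OF inV[OF that]] U(3) by (auto simp: \<upsilon>_def I_def)
  have W\<upsilon>: "W (\<upsilon> x) = x" if "x \<in> {-r'<..<r'}" for x
  proof -
    have "\<eta> (g (vector [x, 0])) $ 1 = x" using gU(2)[OF inV[OF that]] by simp
    then show ?thesis by (simp add: \<eta>_def \<upsilon>_def)
  qed
  have s\<upsilon>: "smooth_on {-r'<..<r'} \<upsilon>"
    unfolding \<upsilon>_def
    by (rule smooth_on_compose2[OF smooth_on_nth[OF U(4,6)]]) (use inV in \<open>auto intro!: smooth_on_vector2\<close>)
  have \<upsilon>0: "\<upsilon> 0 = 0"
  proof -
    have "W (\<upsilon> 0) = 0" using W\<upsilon>[of 0] r' by simp
    moreover have "\<kappa> (\<upsilon> 0) > 0" using \<kappa>p[OF \<upsilon>I] r' by simp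
    ultimately show ?thesis by (simp add: W_def)
  qed
  have d\<upsilon>: "(\<upsilon> has_real_derivative \<kappa> (\<upsilon> x) ^ N / e (\<upsilon> x)) (at x)" if x: "x \<in> {-r'<..<r'}" for x
  proof -
    let ?d = "frechet_derivative \<upsilon> (at x) 1"
    have d: "(\<upsilon> has_real_derivative ?d) (at x)" by (rule smooth_on_real_DERIV[OF s\<upsilon> x])
    have "((\<lambda>x. W (\<upsilon> x)) has_real_derivative e (\<upsilon> x) / \<kappa> (\<upsilon> x) ^ N * ?d) (at x)"
      by (rule DERIV_chain2[where f=W and g=\<upsilon> and x=x, OF dW[OF \<upsilon>I[OF x]] d])
    moreover have "((\<lambda>x. W (\<upsilon> x)) has_real_derivative 1) (at x)"
      by (rule has_field_derivative_transform_within_open[OF DERIV_ident _ x]) (use W\<upsilon> in auto)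
    ultimately have "e (\<upsilon> x) / \<kappa> (\<upsilon> x) ^ N * ?d = 1" by (rule DERIV_unique)
    then have "?d = \<kappa> (\<upsilon> x) ^ N / e (\<upsilon> x)"
      using epos[OF \<upsilon>I[OF x]] \<kappa>p[OF \<upsilon>I[OF x]] by (simp add: field_simps)
    then show ?thesis using d by simp
  qed
  have comp: "((\<lambda>x. f (\<upsilon> x)) has_real_derivative x ^ N * (f1 (\<upsilon> x) / e (\<upsilon> x))) (at x)"
    if f: "\<And>u. u \<in> I \<Longrightarrow> (f has_real_derivative u ^ N * f1 u) (at u)" and x: "x \<in> {-r'<..<r'}" for f f1 x
  proof -
    have "((\<lambda>x. f (\<upsilon> x)) has_real_derivative \<upsilon> x ^ N * f1 (\<upsilon> x) * (\<kappa> (\<upsilon> x) ^ N / e (\<upsilon> x))) (at x)"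
      by (rule DERIV_chain2[where f=f and g=\<upsilon> and x=x, OF f[OF \<upsilon>I[OF x]] d\<upsilon>[OF x]])
    also have "\<upsilon> x ^ N * f1 (\<upsilon> x) * (\<kappa> (\<upsilon> x) ^ N / e (\<upsilon> x)) = W (\<upsilon> x) ^ N * (f1 (\<upsilon> x) / e (\<upsilon> x))"
      by (simp add: W_def power_mult_distrib)
    finally show ?thesis unfolding W\<upsilon>[OF x] .
  qed
  have sc: "smooth_on {-r'<..<r'} (\<lambda>x. f (\<upsilon> x))" if "smooth_on I f" for f :: "real \<Rightarrow> real"
    by (rule smooth_on_compose2[OF that _ _ s\<upsilon>]) (use \<upsilon>I in auto)
  define r1' where "r1' x = r1 (\<upsilon> x) / e (\<upsilon> x)" for x
  define l1' where "l1' x = l1 (\<upsilon> x) / e (\<upsilon> x)" for x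
  define b1' where "b1' x = - (h * l1' x) / ((\<rho> (\<upsilon> x))\<^sup>2 + h\<^sup>2)" for x
  define \<beta>' where "\<beta>' x = x ^ Suc N * avg N b1' x" for x
  have ee: "e (\<upsilon> x) \<noteq> 0" if "x \<in> {-r'<..<r'}" for x using epos[OF \<upsilon>I[OF that]] by simp
  have sr1': "smooth_on {-r'<..<r'} r1'" and sl1': "smooth_on {-r'<..<r'} l1'"
    unfolding r1'_def l1'_def by (intro smooth_on_divide sc sm se; use ee in simp)+
  have sb1': "smooth_on {-r'<..<r'} b1'" unfolding b1'_def
  proof (intro smooth_on_divide)
    show "smooth_on {-r'<..<r'} (\<lambda>x. (\<rho> (\<upsilon> x))\<^sup>2 + h\<^sup>2)" by (intro smooth_intros sc sm) auto
    show "smooth_on {-r'<..<r'} (\<lambda>x. - (h * l1' x))" by (intro smooth_intros sl1') auto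
    show "(\<rho> (\<upsilon> x))\<^sup>2 + h\<^sup>2 \<noteq> 0" if "x \<in> {-r'<..<r'}" for x using q[OF \<upsilon>I[OF that]] by (intro notI) simp
  qed simp
  have d\<beta>': "(\<beta>' has_real_derivative x ^ N * b1' x) (at x)" if "x \<in> {-r'<..<r'}" for x
    unfolding \<beta>'_def by (rule avg_primitive[OF sb1' that])
  have "edge_profile N r' k (\<lambda>x. \<rho> (\<upsilon> x)) r1' \<beta>' b1' (\<lambda>x. \<zeta> (\<upsilon> x)) l1'"
  proof
    fix x assume x: "x \<in> {-r'<..<r'}"
    show "\<rho> (\<upsilon> x) > 0" "l1' x > 0"
      using \<rho>pos[of "\<upsilon> x"] l1pos[of "\<upsilon> x"] \<upsilon>I[OF x] epos[OF \<upsilon>I[OF x]] by (auto simp: I_def l1'_def)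
    show "((\<lambda>x. \<rho> (\<upsilon> x)) has_real_derivative x ^ N * r1' x) (at x)"
      unfolding r1'_def by (rule comp[OF _ x]) (use d\<rho> in \<open>simp add: I_def\<close>)
    show "((\<lambda>x. \<zeta> (\<upsilon> x)) has_real_derivative x ^ N * l1' x) (at x)"
      unfolding l1'_def by (rule comp[OF _ x]) (use d\<zeta> in \<open>simp add: I_def\<close>)
  qed (use N k r' d\<beta>' sr1' sl1' sb1' in auto)
  moreover have "(r1' x)\<^sup>2 + (\<rho> (\<upsilon> x) * b1' x)\<^sup>2 + (l1' x + h * b1' x)\<^sup>2 = 1"
    and "(\<rho> (\<upsilon> x))\<^sup>2 * b1' x + h * (l1' x + h * b1' x) = 0" if x: "x \<in> {-r'<..<r'}" for x
  proof -
    define R where "R = \<rho> (\<upsilon> x)"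
    define Q where "Q = R\<^sup>2 + h\<^sup>2"
    have Q: "Q > 0" using q[OF \<upsilon>I[OF x]] by (simp add: Q_def R_def)
    have b: "b1' x * Q = - (h * l1' x)" using Q by (simp add: b1'_def Q_def R_def)
    show "(\<rho> (\<upsilon> x))\<^sup>2 * b1' x + h * (l1' x + h * b1' x) = 0"
      using b unfolding Q_def R_def by (simp add: algebra_simps power2_eq_square)
    have 1: "Q * (l1' x + h * b1' x) = l1' x * R\<^sup>2"
      using b unfolding Q_def by algebra
    have "Q\<^sup>2 * ((R * b1' x)\<^sup>2 + (l1' x + h * b1' x)\<^sup>2) = R\<^sup>2 * (b1' x * Q)\<^sup>2 + (Q * (l1' x + h * b1' x))\<^sup>2"
      by algebra
    also have "\<dots> = Q * (l1' x * R)\<^sup>2" unfolding b 1 unfolding Q_def by algebra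
    finally have "Q * (Q * ((R * b1' x)\<^sup>2 + (l1' x + h * b1' x)\<^sup>2)) = Q * (l1' x * R)\<^sup>2" by (simp only: power2_eq_square[of Q] mult.assoc)
    then have "Q * ((R * b1' x)\<^sup>2 + (l1' x + h * b1' x)\<^sup>2) = (l1' x * R)\<^sup>2"
      using Q by (simp only: mult_cancel_left) linarith
    then have 2: "(R * b1' x)\<^sup>2 + (l1' x + h * b1' x)\<^sup>2 = (l1' x * R)\<^sup>2 / Q"
      using Q by (metis less_irrefl nonzero_mult_div_cancel_left)
    have "(r1' x)\<^sup>2 + (l1' x * R)\<^sup>2 / Q = ((r1 (\<upsilon> x))\<^sup>2 + (l1 (\<upsilon> x) * R)\<^sup>2 / Q) / (e (\<upsilon> x))\<^sup>2"
      by (simp add: r1'_def l1'_def power_mult_distrib power_divide add_divide_distrib)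
    also have "(r1 (\<upsilon> x))\<^sup>2 + (l1 (\<upsilon> x) * R)\<^sup>2 / Q = (e (\<upsilon> x))\<^sup>2"
      using e2[OF \<upsilon>I[OF x]] by (simp add: Q_def R_def)
    also have "(e (\<upsilon> x))\<^sup>2 / (e (\<upsilon> x))\<^sup>2 = 1" using ee[OF x] by simp
    finally show "(r1' x)\<^sup>2 + (\<rho> (\<upsilon> x) * b1' x)\<^sup>2 + (l1' x + h * b1' x)\<^sup>2 = 1" using 2 by (simp add: R_def)
  qed
  moreover have "\<beta>' 0 = 0" "\<zeta> (\<upsilon> 0) = 0" by (simp_all add: \<beta>'_def \<upsilon>0 z)
  ultimately have B: "bour_profile N r' k h (\<lambda>x. \<rho> (\<upsilon> x)) r1' \<beta>' b1' (\<lambda>x. \<zeta> (\<upsilon> x)) l1'"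
    using kp by (simp add: bour_profile_def bour_profile_axioms_def)
  then interpret B: bour_profile N r' k h "\<lambda>x. \<rho> (\<upsilon> x)" r1' \<beta>' b1' "\<lambda>x. \<zeta> (\<upsilon> x)" l1' .
  have x0: "0 \<in> {-r'<..<r'}" using r' by simp
  show ?thesis
  proof (rule that[OF B s\<upsilon> \<upsilon>0])
    show "\<And>x. x \<in> {-r'<..<r'} \<Longrightarrow> \<upsilon> x \<in> {-\<delta><..<\<delta>}" using \<upsilon>I by (simp add: I_def)
    have "frechet_derivative \<upsilon> (at 0) 1 = \<kappa> (\<upsilon> 0) ^ N / e (\<upsilon> 0)"
      using DERIV_unique[OF smooth_on_real_DERIV[OF s\<upsilon> x0] d\<upsilon>[OF x0]] .
    then show "frechet_derivative \<upsilon> (at 0) 1 \<noteq> 0" using \<kappa>p[OF \<upsilon>I[OF x0]] epos[OF \<upsilon>I[OF x0]] by simp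
    show "smooth_on {-r'<..<r'} (\<lambda>x. (\<beta>' x - \<beta> (\<upsilon> x)) / k)"
      by (intro smooth_on_divide smooth_on_diff B.s\<beta> sc sm smooth_on_const) (use k in auto)
    have "((\<lambda>x. (\<beta>' x - \<beta> (\<upsilon> x)) / k) has_real_derivative (0 ^ N * b1' 0 - 0 ^ N * (b1 (\<upsilon> 0) / e (\<upsilon> 0))) / k) (at 0)"
      by (rule DERIV_cdivide[OF DERIV_diff[OF d\<beta>'[OF x0] comp[OF _ x0]]]) (use d\<beta> in \<open>simp add: I_def\<close>)
    then show "((\<lambda>x. (\<beta>' x - \<beta> (\<upsilon> x)) / k) has_real_derivative 0) (at 0)" using N by (simp add: power_0_left)
  qed auto
qed

lemma polar_arctan:
  assumes "x > 0"
  shows "sqrt (x\<^sup>2 + y\<^sup>2) * cos (arctan (y / x)) = x" "sqrt (x\<^sup>2 + y\<^sup>2) * sin (arctan (y / x)) = y"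
proof -
  have "sqrt (x\<^sup>2 + y\<^sup>2) = x * sqrt (1 + (y / x)\<^sup>2)"
  proof -
    have "x * sqrt (1 + (y / x)\<^sup>2) = sqrt (x\<^sup>2) * sqrt (1 + (y / x)\<^sup>2)" using assms by simp
    also have "\<dots> = sqrt (x\<^sup>2 * (1 + (y / x)\<^sup>2))" by (simp only: real_sqrt_mult)
    also have "x\<^sup>2 * (1 + (y / x)\<^sup>2) = x\<^sup>2 + y\<^sup>2" using assms by (simp add: field_simps)
    finally show ?thesis by simp
  qed
  then show "sqrt (x\<^sup>2 + y\<^sup>2) * cos (arctan (y / x)) = x" "sqrt (x\<^sup>2 + y\<^sup>2) * sin (arctan (y / x)) = y"
    using assms by (auto simp: cos_arctan sin_arctan add_nonneg_eq_0_iff)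
qed

text \<open>
  The frame is turned about the axis and shifted along it until \<open>y0\<close> lies on the first coordinate axis; a
  reflection makes the angular velocity positive.
\<close>

lemma screw_frame:
  assumes S: "orthogonal_transformation S" and \<omega>: "\<omega> \<noteq> 0"
    and T: "\<And>t y. T t (S y + s) = S (screw \<omega> c t y) + s" and off: "y0 $ 1 \<noteq> 0 \<or> y0 $ 2 \<noteq> 0"
  obtains L s' k c' x0 where "orthogonal_transformation L" "k > 0" "x0 > 0"
    "\<And>t y. T t (L y + s') = L (screw k c' t y) + s'" "L (vector [x0, 0, 0]) + s' = S y0 + s"
proof -
  define \<sigma> where "\<sigma> = sgn \<omega>"
  have \<sigma>: "\<sigma> * \<sigma> = 1" "\<sigma> * \<omega> > 0" using \<omega> by (auto simp: \<sigma>_def sgn_if)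
  define x0 where "x0 = sqrt ((y0$1)\<^sup>2 + (y0$2)\<^sup>2)"
  have x0: "x0 > 0" using off by (auto simp: x0_def intro: add_pos_nonneg add_nonneg_pos)
  have "(y0$1 / x0)\<^sup>2 + (\<sigma> * y0$2 / x0)\<^sup>2 = 1"
  proof -
    have "(\<sigma> * y0$2)\<^sup>2 = (y0$2)\<^sup>2" using \<sigma>(1) by (simp add: power2_eq_square mult.left_commute mult.assoc[symmetric])
    moreover have "x0\<^sup>2 = (y0$1)\<^sup>2 + (y0$2)\<^sup>2" by (simp add: x0_def)
    ultimately have "(y0$1)\<^sup>2 + (\<sigma> * y0$2)\<^sup>2 = x0\<^sup>2" by simp
    moreover have "(y0$1 / x0)\<^sup>2 + (\<sigma> * y0$2 / x0)\<^sup>2 = ((y0$1)\<^sup>2 + (\<sigma> * y0$2)\<^sup>2) / x0\<^sup>2"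
      by (simp add: power_divide add_divide_distrib)
    ultimately show ?thesis using x0 by simp
  qed
  then obtain \<alpha> where \<alpha>: "y0$1 / x0 = cos \<alpha>" "\<sigma> * y0$2 / x0 = sin \<alpha>" using sincos_total_2pi by metis
  define E where "E y = (vector [cos \<alpha> * y$1 - sin \<alpha> * y$2, \<sigma> * (sin \<alpha> * y$1 + cos \<alpha> * y$2), y$3] :: real^3)" for y :: "real^3"
  have lE: "linear E" unfolding E_def by (rule linearI) (simp_all add: vec3_eq_iff algebra_simps)
  have "norm (E y) = norm y" for y
  proof -
    have "(\<sigma> * (sin \<alpha> * y$1 + cos \<alpha> * y$2)) * (\<sigma> * (sin \<alpha> * y$1 + cos \<alpha> * y$2)) = (\<sigma> * \<sigma>) * ((sin \<alpha> * y$1 + cos \<alpha> * y$2) * (sin \<alpha> * y$1 + cos \<alpha> * y$2))"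
      by (simp only: mult_ac)
    then have "E y \<bullet> E y = cyl \<alpha> (y$1) (y$2) (y$3) \<bullet> cyl \<alpha> (y$1) (y$2) (y$3)"
      using \<sigma>(1) by (simp add: inner3 E_def cyl_def mult_ac)
    also have "\<dots> = y \<bullet> y" unfolding cyl_inner by (simp add: inner3)
    finally show ?thesis by (simp add: norm_eq_sqrt_inner)
  qed
  then have oE: "orthogonal_transformation E" using lE by (simp add: orthogonal_transformation)
  let ?z = "vector [0, 0, y0$3] :: real^3"
  have linS: "linear S" using S by (rule orthogonal_transformation_linear)
  have scr: "screw \<omega> c t (E y + ?z) = E (screw (\<sigma> * \<omega>) c t y) + ?z" for t y
  proof -
    have "\<sigma> = 1 \<or> \<sigma> = -1" using \<omega> by (auto simp: \<sigma>_def sgn_if)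
    then show ?thesis by (elim disjE) (simp_all add: vec3_eq_iff screw_def E_def algebra_simps)
  qed
  have o: "orthogonal_transformation (S \<circ> E)" using S oE by (rule orthogonal_transformation_compose)
  have "T t ((S \<circ> E) y + (S ?z + s)) = (S \<circ> E) (screw (\<sigma> * \<omega>) c t y) + (S ?z + s)" for t y
    using T[of t "E y + ?z"] by (simp add: scr linear_add[OF linS] add.assoc)
  moreover have "(S \<circ> E) (vector [x0, 0, 0]) + (S ?z + s) = S y0 + s"
  proof -
    have "cos \<alpha> * x0 = y0$1" using \<alpha>(1)[symmetric] x0 by simp
    moreover have "\<sigma> * (sin \<alpha> * x0) = y0$2" using \<alpha>(2)[symmetric] x0 \<sigma>(1) by (simp add: mult.assoc[symmetric])
    ultimately have "E (vector [x0, 0, 0]) + ?z = y0" by (simp add: vec3_eq_iff E_def)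
    then show ?thesis by (simp add: linear_add[OF linS, symmetric] add.assoc[symmetric])
  qed
  ultimately show ?thesis using that[OF o \<sigma>(2) x0] by blast
qed

section \<open>Extracting the profile of a helicoidal edge\<close>

lemma line_vector_deriv:
  fixes F :: "real^2 \<Rightarrow> 'b::real_normed_vector"
  assumes "F differentiable (at (vector [x, y]))"
  shows "((\<lambda>x. F (vector [x, y])) has_vector_derivative frechet_derivative F (at (vector [x, y])) (axis 1 1)) (at x)"
    "((\<lambda>y. F (vector [x, y])) has_vector_derivative frechet_derivative F (at (vector [x, y])) (axis 2 1)) (at y)"
proof -
  let ?D = "frechet_derivative F (at (vector [x, y]))"
  have D: "(F has_derivative ?D) (at (vector [x, y]))" using assms frechet_derivative_works by blast
  have l: "linear ?D" by (rule linear_frechet_derivative[OF assms])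
  have "((\<lambda>x. F (vector [x, y])) has_derivative (\<lambda>v. ?D (v *\<^sub>R axis 1 1))) (at x)"
    by (rule has_derivative_compose[where f="\<lambda>x. vector [x, y]" and g=F and x=x, OF _ D]) (unfold axis_line, auto intro!: derivative_eq_intros)
  then show "((\<lambda>x. F (vector [x, y])) has_vector_derivative ?D (axis 1 1)) (at x)"
    unfolding has_vector_derivative_def linear_scale[OF l] .
  have "((\<lambda>y. F (vector [x, y])) has_derivative (\<lambda>v. ?D (v *\<^sub>R axis 2 1))) (at y)"
    by (rule has_derivative_compose[where f="\<lambda>y. vector [x, y]" and g=F and x=y, OF _ D]) (unfold axis_line, auto intro!: derivative_eq_intros)
  then show "((\<lambda>y. F (vector [x, y])) has_vector_derivative ?D (axis 2 1)) (at y)"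
    unfolding has_vector_derivative_def linear_scale[OF l] .
qed

lemma linear_axes2: "linear D \<Longrightarrow> D (v::real^2) = v$1 *\<^sub>R D (axis 1 1) + v$2 *\<^sub>R D (axis 2 1)"
proof -
  assume l: "linear D"
  have "D (vector [v$1, v$2]) = v$1 *\<^sub>R D (axis 1 1) + v$2 *\<^sub>R D (axis 2 1)"
    unfolding axis_line by (simp only: linear_add[OF l] linear_scale[OF l])
  moreover have "vector [v$1, v$2] = v" by (simp add: vec2_eq_iff)
  ultimately show ?thesis by simp
qed

text \<open>
  On the singular curve \<open>c\<close> the generator \<open>B y + d\<close> of the motion is \<open>\<mu> c'\<close>. If \<open>\<mu>(0) = 0\<close>, skewness of \<open>B\<close>
  forces the whole curve to consist of fixed points, hence to be straight; this contradicts that the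
  curve has a normal acceleration. Otherwise \<open>B\<close> turns the tangent of the curve off the tangent plane,
  so that the motion is not a translation and the curve is not on the axis.
\<close>

lemma generator_on_singular_curve:
  fixes B :: "real^3 \<Rightarrow> real^3"
  assumes B: "linear B" "\<And>y. y \<bullet> B y = 0" and Bd: "B y1 + d \<noteq> 0"
    and \<delta>: "\<delta> > 0"
    and c: "\<And>v. v \<in> {-\<delta><..<\<delta>} \<Longrightarrow> (c has_vector_derivative c1 v) (at v)"
    and c1: "\<And>v. v \<in> {-\<delta><..<\<delta>} \<Longrightarrow> (c1 has_vector_derivative c2 v) (at v)"
    and X: "\<And>v. v \<in> {-\<delta><..<\<delta>} \<Longrightarrow> B (c v) + d = \<mu> v *\<^sub>R c1 v"
    and \<mu>: "(\<mu> has_real_derivative \<mu>') (at 0)"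
    and nz: "c1 0 \<noteq> 0" and n1: "c1 0 \<bullet> n = 0" and n2: "c2 0 \<bullet> n \<noteq> 0"
  shows "\<mu> 0 \<noteq> 0" "B (B (c 0) + d) \<bullet> n \<noteq> 0"
proof -
  let ?J = "{-\<delta><..<\<delta>}"
  have 0: "0 \<in> ?J" using \<delta> by simp
  have bl: "bounded_linear B" using B(1) linear_conv_bounded_linear by blast
  show mu0: "\<mu> 0 \<noteq> 0"
  proof
    assume mu: "\<mu> 0 = 0"
    define g where "g v = c1 v \<bullet> (c v - c 0)" for v
    have zero: "\<mu> v * g v = 0" if "v \<in> ?J" for v
    proof -
      have "B (c v - c 0) = (B (c v) + d) - (B (c 0) + d)" by (simp add: linear_diff[OF B(1)])
      also have "\<dots> = \<mu> v *\<^sub>R c1 v" using X[OF that] X[OF 0] mu by simp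
      finally have "(c v - c 0) \<bullet> (\<mu> v *\<^sub>R c1 v) = 0" using B(2)[of "c v - c 0"] by simp
      then show ?thesis by (simp add: g_def inner_commute)
    qed
    have "(g has_real_derivative c1 0 \<bullet> c1 0) (at 0)"
    proof -
      have "((\<lambda>v. c v - c 0) has_vector_derivative c1 0) (at 0)"
        using has_vector_derivative_diff[OF c[OF 0] has_vector_derivative_const[of "c 0"]] by simp
      from bounded_bilinear.has_vector_derivative[OF bounded_bilinear_inner c1[OF 0] this]
      show ?thesis unfolding g_def has_real_derivative_iff_has_vector_derivative by simp
    qed
    moreover have "c1 0 \<bullet> c1 0 > 0" using nz by simp
    ultimately obtain e1 e2 where e: "e1 > 0" "e2 > 0" "\<And>h. 0 < h \<Longrightarrow> h < e1 \<Longrightarrow> g 0 < g (0 + h)" "\<And>h. 0 < h \<Longrightarrow> h < e2 \<Longrightarrow> g (0 - h) < g 0"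
      using DERIV_pos_inc_right DERIV_pos_inc_left by metis
    define e where "e = min \<delta> (min e1 e2)"
    have e0: "e > 0" "e \<le> \<delta>" "e \<le> e1" "e \<le> e2" using e \<delta> by (simp_all add: e_def)
    have "g v \<noteq> 0" if "v \<in> {-e<..<e}" "v \<noteq> 0" for v
    proof -
      have "g 0 = 0" by (simp add: g_def)
      moreover have "v < e1" "- v < e2" using that e0 by auto
      ultimately show ?thesis using e(3)[of v] e(4)[of "- v"] that by (cases "v > 0") auto
    qed
    then have muz: "\<mu> v = 0" if "v \<in> {-e<..<e}" for v
      using zero[of v] mu that e0 by (cases "v = 0") auto
    have sub: "v \<in> ?J" if "v \<in> {-e<..<e}" for v using that e0 by auto
    have Bc1: "B (c1 v) = 0" if v: "v \<in> {-e<..<e}" for v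
    proof -
      have "((\<lambda>v. B (c v) + d) has_vector_derivative B (c1 v) + 0) (at v)"
        by (intro has_vector_derivative_add bounded_linear.has_vector_derivative[OF bl] c sub v has_vector_derivative_const)
      moreover have "((\<lambda>v. B (c v) + d) has_vector_derivative 0) (at v)"
        by (rule has_vector_derivative_transform_within_open[OF has_vector_derivative_const[of 0] open_greaterThanLessThan v])
           (use X sub muz in auto)
      ultimately show ?thesis using vector_derivative_unique_at by fastforce
    qed
    have Bc2: "B (c2 0) = 0"
    proof -
      have 1: "((\<lambda>v. B (c1 v)) has_vector_derivative B (c2 0)) (at 0)"
        by (intro bounded_linear.has_vector_derivative[OF bl] c1 0)
      have "((\<lambda>v. B (c1 v)) has_vector_derivative 0) (at 0)"
        by (rule has_vector_derivative_transform_within_open[OF has_vector_derivative_const[of 0], of "{-e<..<e}"])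
           (use Bc1 e0 in auto)
      with 1 show ?thesis using vector_derivative_unique_at by blast
    qed
    have X0: "B (c 0) + d = 0" using X[OF 0] mu by simp
    have "B (y1 - c 0) \<noteq> 0"
    proof
      assume "B (y1 - c 0) = 0"
      then have "B y1 = B (c 0)" by (simp add: linear_diff[OF B(1)])
      then show False using Bd X0 by simp
    qed
    then obtain S s \<omega> k where
      S: "orthogonal_transformation S" "\<omega> \<noteq> 0" "\<And>y::real^3. B (S y + s) + d = S (vector [- \<omega> * y$2, \<omega> * y$1, k])"
      by (rule skew_normal_form[OF B, where d=d]) (rule that)
    have linS: "linear S" using S(1) by (rule orthogonal_transformation_linear)
    have ker: "u$1 = 0 \<and> u$2 = 0" if "B (S u) = 0" for u
    proof -
      have "B (S u) = (B (S u + s) + d) - (B (S 0 + s) + d)"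
        by (simp add: linear_add[OF B(1)] linear_0[OF linS])
      also have "\<dots> = S (vector [- \<omega> * u$2, \<omega> * u$1, k] - vector [- \<omega> * 0, \<omega> * 0, k])"
        unfolding S(3) by (simp add: linear_diff[OF linS])
      also have "vector [- \<omega> * u$2, \<omega> * u$1, k] - vector [- \<omega> * 0, \<omega> * 0, k] = (vector [- \<omega> * u$2, \<omega> * u$1, 0] :: real^3)"
        by (simp add: vec3_eq_iff)
      finally have "S (vector [- \<omega> * u$2, \<omega> * u$1, 0]) = 0" using that by simp
      then have "norm (vector [- \<omega> * u$2, \<omega> * u$1, 0] :: real^3) = 0"
        using orthogonal_transformation_norm[OF S(1)] by (metis norm_zero)
      then show ?thesis using S(2) by (simp add: vec3_eq_iff)
    qed
    obtain u where u: "c1 0 = S u" using orthogonal_transformation_surj[OF S(1)] by (metis surjD)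
    obtain u' where u': "c2 0 = S u'" using orthogonal_transformation_surj[OF S(1)] by (metis surjD)
    have k1: "u$1 = 0 \<and> u$2 = 0" using ker[of u] Bc1[of 0] e0 u by simp
    have k2: "u'$1 = 0 \<and> u'$2 = 0" using ker[of u'] Bc2 u' by simp
    have "u$3 \<noteq> 0"
    proof
      assume "u$3 = 0"
      then have "u = 0" using k1 by (simp add: vec3_eq_iff)
      then show False using nz u linear_0[OF linS] by simp
    qed
    then have "u' = (u'$3 / u$3) *\<^sub>R u" using k1 k2 by (simp add: vec3_eq_iff)
    then have "c2 0 = (u'$3 / u$3) *\<^sub>R c1 0" using u u' linear_scale[OF linS] by metis
    then show False using n1 n2 by simp
  qed
  have "((\<lambda>v. B (c v) + d) has_vector_derivative B (c1 0) + 0) (at 0)"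
    by (intro has_vector_derivative_add bounded_linear.has_vector_derivative[OF bl] c 0 has_vector_derivative_const)
  moreover have "((\<lambda>v. B (c v) + d) has_vector_derivative (\<mu> 0 *\<^sub>R c2 0 + \<mu>' *\<^sub>R c1 0)) (at 0)"
  proof (rule has_vector_derivative_transform_within_open[OF _ open_greaterThanLessThan 0])
    show "((\<lambda>v. \<mu> v *\<^sub>R c1 v) has_vector_derivative (\<mu> 0 *\<^sub>R c2 0 + \<mu>' *\<^sub>R c1 0)) (at 0)"
      by (rule has_vector_derivative_scaleR[OF \<mu> c1[OF 0]])
  qed (use X in auto)
  ultimately have "B (c1 0) = \<mu> 0 *\<^sub>R c2 0 + \<mu>' *\<^sub>R c1 0" using vector_derivative_unique_at by fastforce
  then have "B (c1 0) \<bullet> n = \<mu> 0 * (c2 0 \<bullet> n)" using n1 by (simp add: inner_add_left)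
  moreover have "B (B (c 0) + d) = \<mu> 0 *\<^sub>R B (c1 0)" unfolding X[OF 0] by (rule linear_scale[OF B(1)])
  ultimately show "B (B (c 0) + d) \<bullet> n \<noteq> 0" using mu0 n2 by simp
qed

lemma isCont_pos:
  fixes f :: "real \<Rightarrow> real"
  assumes "isCont f 0" "f 0 > 0"
  obtains e where "e > 0" "\<And>u. \<bar>u\<bar> < e \<Longrightarrow> f u > 0"
proof -
  obtain e where e: "e > 0" "\<And>u. dist u 0 < e \<Longrightarrow> dist (f u) (f 0) < f 0"
    using assms unfolding continuous_at_eps_delta by blast
  have "f u > 0" if "\<bar>u\<bar> < e" for u using e(2)[of u] that by (simp add: dist_real_def abs_less_iff)
  then show ?thesis using that e(1) by blast
qed

lemma orthogonal_components:
  fixes L :: "real^3 \<Rightarrow> real^3"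
  assumes L: "orthogonal_transformation L"
  defines "M \<equiv> \<lambda>x. vector [L (axis 1 1) \<bullet> x, L (axis 2 1) \<bullet> x, L (axis 3 1) \<bullet> x] :: real^3"
  shows "M (L y) = y" "L (M x) = x"
proof -
  show 1: "M (L y) = y" for y
    unfolding M_def orthogonal_transformation_inner[OF L] by (simp add: vec3_eq_iff inner_axis')
  obtain y where "x = L y" using orthogonal_transformation_surj[OF L] by (metis surjD)
  then show "L (M x) = x" using 1 by simp
qed

text \<open>
  By \<open>generator_on_singular_curve\<close> the lifted motion is transversal to the line \<open>v = 0\<close>, so that its time and
  the parameter of this line are coordinates in which \<open>f\<close> is swept out by the profile \<open>u \<mapsto> f(u, 0)\<close>.
  Cylindrical coordinates turn the profile into an \<open>edge_profile\<close>, and a shift of the time along it leads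
  to natural parameters.
\<close>

theorem plane_extraction:
  fixes f :: "real^2 \<Rightarrow> real^3" and H :: "real \<times> (real^2) \<Rightarrow> real^2"
  assumes N: "N \<ge> 1" and V: "open V" "0 \<in> V" and f: "smooth_on V f"
    and C1: "\<And>w. w \<in> V \<Longrightarrow> frechet_derivative f (at w) (axis 1 1) = w$1 ^ N *\<^sub>R C1 w" "smooth_on V C1"
    and ind: "\<And>a. C1 0 \<noteq> a *\<^sub>R frechet_derivative f (at 0) (axis 2 1)" "frechet_derivative f (at 0) (axis 2 1) \<noteq> 0"
    and nu: "smooth_on V \<nu>" "\<And>w v. w \<in> V \<Longrightarrow> frechet_derivative f (at w) v \<bullet> \<nu> w = 0"
    and cur: "frechet_derivative (\<lambda>w. frechet_derivative f (at w) (axis 2 1)) (at 0) (axis 2 1) \<bullet> \<nu> 0 \<noteq> 0"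
    and O': "open O'" "(0, 0) \<in> O'" and H: "smooth_on O' H" "\<And>z. z \<in> O' \<Longrightarrow> H z \<in> V" "\<And>w. (0, w) \<in> O' \<Longrightarrow> H (0, w) = w"
      "\<And>t w. (t, w) \<in> O' \<Longrightarrow> f (H (t, w)) = T t (f w)"
    and T: "helicoidal_motion T"
  obtains r k h \<rho> r1 \<beta> b1 \<zeta> l1 \<Sigma> \<Omega> \<Psi> \<Psi>' where
    "bour_profile N r k h \<rho> r1 \<beta> b1 \<zeta> l1" "euclidean_isometry \<Sigma>" "open \<Omega>" "\<Omega> \<subseteq> V"
    "homeomorphism \<Omega> (plane_box r) \<Psi>' \<Psi>" "smooth_on \<Omega> \<Psi>'" "smooth_on (plane_box r) \<Psi>" "\<Psi> 0 = 0"
    "\<And>w. w \<in> plane_box r \<Longrightarrow> f (\<Psi> w) = \<Sigma> (helix_surface k h \<rho> \<beta> \<zeta> w)"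
proof -
  obtain B d where B: "linear B" "\<And>y. y \<bullet> B y = 0" and T0: "T 0 = id" and Bd: "\<exists>y. B y + d \<noteq> 0"
    and Td: "\<And>t y. ((\<lambda>t. T t y) has_vector_derivative (B (T t y) + d)) (at t)"
    using helicoidal_motion_generator[OF T] by blast
  let ?e1 = "axis 1 1 :: real^2" and ?e2 = "axis 2 1 :: real^2"
  let ?Df = "\<lambda>w. frechet_derivative f (at w)"
  have dif: "f differentiable (at w)" if "w \<in> V" for w using smooth_on_differentiable[OF f that] .
  have linD: "linear (?Df w)" if "w \<in> V" for w using linear_frechet_derivative[OF dif[OF that]] .
  \<comment> \<open>the vector field generating the lifted motion\<close>
  let ?O0 = "{w. (0::real, w) \<in> O'}"
  have oO: "open ?O0"
  proof -
    have "?O0 = (\<lambda>w. (0::real, w)) -` O'" by auto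
    moreover have "open ((\<lambda>w. (0::real, w)) -` O')"
      by (intro open_vimage O'(1) continuous_intros)
    ultimately show ?thesis by simp
  qed
  have OV: "w \<in> V" if "w \<in> ?O0" for w using H(2)[of "(0, w)"] H(3)[of w] that by simp
  define \<xi> where "\<xi> w = frechet_derivative H (at (0, w)) (1, 0)" for w
  have s\<xi>: "smooth_on ?O0 \<xi>" unfolding \<xi>_def
    by (rule smooth_on_compose2[OF smooth_on_frechet[OF H(1)] oO]) (auto intro!: smooth_on_Pair oO)
  have dH: "((\<lambda>t. H (t, w)) has_vector_derivative \<xi> w) (at 0)" if "w \<in> ?O0" for w
  proof -
    have hd: "(H has_derivative frechet_derivative H (at (0, w))) (at (0, w))"
      using smooth_on_has_derivative[OF H(1)] that by blast
    have "((\<lambda>t. H (t, w)) has_derivative (\<lambda>v. frechet_derivative H (at (0, w)) (v, 0))) (at 0)"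
      by (rule has_derivative_compose[where f="\<lambda>t. (t, w)" and g=H and x=0, OF _ hd]) (auto intro!: derivative_eq_intros)
    moreover have "frechet_derivative H (at (0, w)) (v, 0) = v *\<^sub>R \<xi> w" for v
      using linear_scale[OF has_derivative_linear[OF hd], of v "(1, 0)"] by (simp add: \<xi>_def)
    ultimately show ?thesis unfolding has_vector_derivative_def by simp
  qed
  have X\<xi>: "?Df w (\<xi> w) = B (f w) + d" if w: "w \<in> ?O0" for w
  proof -
    have wV: "w \<in> V" using OV[OF w] .
    have fd: "(f has_derivative ?Df w) (at (H (0, w)))"
      using H(3) w smooth_on_has_derivative[OF f wV] by simp
    have "((\<lambda>t. f (H (t, w))) has_derivative (\<lambda>v. ?Df w (v *\<^sub>R \<xi> w))) (at 0)"
      by (rule has_derivative_compose[where f="\<lambda>t. H (t, w)" and g=f and x=0, OF _ fd])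
         (use dH[OF w] in \<open>simp add: has_vector_derivative_def\<close>)
    then have 1: "((\<lambda>t. f (H (t, w))) has_vector_derivative ?Df w (\<xi> w)) (at 0)"
      unfolding has_vector_derivative_def linear_scale[OF linD[OF wV]] .
    have ot: "open {t. (t, w) \<in> O'}"
    proof -
      have "{t. (t, w) \<in> O'} = (\<lambda>t. (t, w)) -` O'" by auto
      moreover have "open ((\<lambda>t. (t, w)) -` O')" by (intro open_vimage O'(1) continuous_intros)
      ultimately show ?thesis by simp
    qed
    have "((\<lambda>t. f (H (t, w))) has_vector_derivative B (T 0 (f w)) + d) (at 0)"
      by (rule has_vector_derivative_transform_within_open[OF Td ot]) (use w H(4) in auto)
    from vector_derivative_unique_at[OF 1 this] show ?thesis by (simp add: T0)
  qed
  have "0 \<in> ?O0" using O' by simp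
  then obtain \<delta> where \<delta>: "\<delta> > 0" "plane_box \<delta> \<subseteq> ?O0" using plane_box_subset_ball[OF oO] by blast
  let ?J = "{-\<delta><..<\<delta>}"
  have m: "vector [0, v] \<in> ?O0" "vector [0, v] \<in> V" if "v \<in> ?J" for v
  proof -
    have "vector [0, v] \<in> plane_box \<delta>" using that by (auto simp: plane_box_def)
    then show "vector [0, v] \<in> ?O0" "vector [0, v] \<in> V" using \<delta> OV by auto
  qed
  have z0: "vector [0, 0] = (0::real^2)" by (simp add: vec2_eq_iff)
  define c where "c v = f (vector [0, v])" for v
  define c1 where "c1 v = ?Df (vector [0, v]) ?e2" for v
  define c2 where "c2 v = frechet_derivative (\<lambda>w. ?Df w ?e2) (at (vector [0, v])) ?e2" for v
  define \<mu> where "\<mu> v = \<xi> (vector [0, v]) $ 2" for v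
  have f1z: "?Df w ?e1 = 0" if "w \<in> V" "w$1 = 0" for w using C1(1)[OF that(1)] that(2) N by (simp add: power_0_left)
  have X\<mu>: "B (c v) + d = \<mu> v *\<^sub>R c1 v" if v: "v \<in> ?J" for v
  proof -
    have "B (c v) + d = ?Df (vector [0, v]) (\<xi> (vector [0, v]))" using X\<xi>[OF m(1)[OF v]] by (simp add: c_def)
    also have "\<dots> = \<mu> v *\<^sub>R c1 v"
      by (subst linear_axes2[OF linD[OF m(2)[OF v]]]) (simp add: f1z[OF m(2)[OF v]] \<mu>_def c1_def)
    finally show ?thesis .
  qed
  have J0: "0 \<in> ?J" using \<delta> by simp
  have \<mu>': "(\<mu> has_real_derivative frechet_derivative (\<lambda>w. \<xi> w $ 2) (at (vector [0, 0])) ?e2) (at 0)"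
    unfolding \<mu>_def has_real_derivative_iff_has_vector_derivative
    by (rule line_vector_deriv(2), rule smooth_on_differentiable[OF smooth_on_nth[OF oO s\<xi>] m(1)[OF J0]])
  have c': "(c has_vector_derivative c1 v) (at v)" if "v \<in> ?J" for v
    unfolding c_def c1_def by (rule line_vector_deriv(2)[OF dif[OF m(2)[OF that]]])
  have c1': "(c1 has_vector_derivative c2 v) (at v)" if "v \<in> ?J" for v
    unfolding c1_def c2_def by (rule line_vector_deriv(2)[OF smooth_on_differentiable[OF smooth_on_frechet[OF f] m(2)[OF that]]])
  obtain y1 where y1: "B y1 + d \<noteq> 0" using Bd by blast
  have c10: "c1 0 \<noteq> 0" "c1 0 \<bullet> \<nu> 0 = 0" "c2 0 \<bullet> \<nu> 0 \<noteq> 0"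
    using ind(2) nu(2)[OF V(2)] cur by (simp_all add: c1_def c2_def z0)
  note gen = generator_on_singular_curve[OF B y1 \<delta>(1) c' c1' X\<mu> \<mu>' c10]
  \<comment> \<open>the frame of the motion\<close>
  have "B (B (c 0) + d) \<noteq> 0" using gen(2) by auto
  then obtain S s \<omega> c0 where
    S: "orthogonal_transformation S" "\<omega> \<noteq> 0" "\<And>y::real^3. B (S y + s) + d = S (vector [- \<omega> * y$2, \<omega> * y$1, c0])"
    by (rule skew_normal_form[OF B, where d=d]) (rule that)
  have TS: "T t (S y + s) = S (screw \<omega> c0 t y) + s" for t y
    by (rule screw_normal_form[where T=T and B=B and d=d and S=S and s=s and \<omega>=\<omega> and c=c0, OF T0 Td B S(1,3)])
  have genL: "B (L u) = L (vector [- k * u$2, k * u$1, 0])" "B (L y + s) + d = L (vector [- k * y$2, k * y$1, cc])"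
    if L: "orthogonal_transformation L" and TL: "\<And>t y. T t (L y + s) = L (screw k cc t y) + s" for L s k cc u y
  proof -
    have lL: "linear L" using L by (rule orthogonal_transformation_linear)
    then have bL: "bounded_linear L" using linear_conv_bounded_linear by blast
    have g: "B (L y + s) + d = L (vector [- k * y$2, k * y$1, cc])" for y
    proof -
      have "((\<lambda>t. screw k cc t y) has_vector_derivative vector [- k * y$2, k * y$1, cc]) (at 0)"
        unfolding screw_def
        by (rule has_vector_derivative_vector3; auto intro!: derivative_eq_intros)
      then have 1: "((\<lambda>t. L (screw k cc t y) + s) has_vector_derivative L (vector [- k * y$2, k * y$1, cc]) + 0) (at 0)"
        by (intro has_vector_derivative_add bounded_linear.has_vector_derivative[OF bL] has_vector_derivative_const)
      have 2: "((\<lambda>t. L (screw k cc t y) + s) has_vector_derivative B (T 0 (L y + s)) + d) (at 0)"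
        using Td[of "L y + s" 0] unfolding TL .
      from vector_derivative_unique_at[OF 1 2] show ?thesis by (simp add: T0)
    qed
    then show "B (L y + s) + d = L (vector [- k * y$2, k * y$1, cc])" .
    have "B (L u) = (B (L u + s) + d) - (B (L 0 + s) + d)" by (simp add: linear_add[OF B(1)] linear_0[OF lL])
    also have "\<dots> = L (vector [- k * u$2, k * u$1, cc] - vector [- k * 0, k * 0, cc])"
      unfolding g by (simp add: linear_diff[OF lL])
    also have "vector [- k * u$2, k * u$1, cc] - vector [- k * 0, k * 0, cc] = (vector [- k * u$2, k * u$1, 0] :: real^3)"
      by (simp add: vec3_eq_iff)
    finally show "B (L u) = L (vector [- k * u$2, k * u$1, 0])" .
  qed
  define y0 where "y0 = (vector [S (axis 1 1) \<bullet> (c 0 - s), S (axis 2 1) \<bullet> (c 0 - s), S (axis 3 1) \<bullet> (c 0 - s)] :: real^3)"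
  have Sy0: "S y0 + s = c 0" using orthogonal_components(2)[OF S(1), of "c 0 - s"] by (simp add: y0_def)
  have "y0 $ 1 \<noteq> 0 \<or> y0 $ 2 \<noteq> 0"
  proof (rule ccontr)
    assume a: "\<not> ?thesis"
    have "B (B (c 0) + d) = B (S (vector [- \<omega> * y0$2, \<omega> * y0$1, c0]))" using S(3)[of y0] Sy0 by simp
    also have "\<dots> = S (vector [0, 0, 0])" using a by (simp add: genL(1)[where L=S and s=s and k=\<omega> and cc=c0, OF S(1) TS])
    also have "vector [0, 0, 0] = (0 :: real^3)" by (simp add: vec3_eq_iff)
    finally have "B (B (c 0) + d) = 0" using linear_0[OF orthogonal_transformation_linear[OF S(1)]] by simp
    then show False using gen(2) by simp
  qed
  then obtain L' s' k c'' x0 where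
    L'': "orthogonal_transformation L'" "k > 0" "x0 > 0" "\<And>t y. T t (L' y + s') = L' (screw k c'' t y) + s'"
      "L' (vector [x0, 0, 0]) + s' = S y0 + s"
    by (rule screw_frame[where T=T and S=S and s=s and \<omega>=\<omega> and c=c0, OF S(1,2) TS]) (rule that)
  note L' = L''[unfolded Sy0]
  \<comment> \<open>the cuspidal direction \<open>C1 0\<close> has an axial component relative to the orbit\<close>
  let ?l = "\<lambda>L cc. L (axis 3 1) \<bullet> C1 0 - cc / k * (L (axis 2 1) \<bullet> C1 0) / x0"
  have C1\<nu>: "C1 0 \<bullet> \<nu> 0 = 0"
  proof -
    have ob: "open (V \<inter> plane_box \<delta>)" using V by auto
    let ?g = "\<lambda>x. C1 (vector [x, 0]) \<bullet> \<nu> (vector [x, 0])"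
    have inb: "vector [x, 0] \<in> V" if "x \<in> ?J" for x
    proof -
      have "vector [x, 0] \<in> plane_box \<delta>" using that by (auto simp: plane_box_def)
      then show ?thesis using \<delta> OV by auto
    qed
    have "continuous_on ?J (\<lambda>x. (\<lambda>w. C1 w \<bullet> \<nu> w) (vector [x, 0]))"
      by (rule continuous_on_compose2[OF smooth_on_continuous[OF smooth_on_inner[OF V(1) C1(2) nu(1)]]])
         (use inb in \<open>auto simp: axis_line intro!: continuous_intros\<close>)
    then have "isCont ?g 0" using J0 by (simp add: continuous_on_eq_continuous_at)
    then have "(?g \<longlongrightarrow> ?g 0) (at 0)" by (simp add: isCont_def)
    moreover have "(?g \<longlongrightarrow> 0) (at 0)"
    proof (rule tendsto_eventually)
      have "eventually (\<lambda>x. x \<in> ?J - {0}) (at (0::real))" using \<delta> by (intro eventually_at_in_open) auto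
      then show "\<forall>\<^sub>F x in at 0. ?g x = 0"
      proof eventually_elim
        case (elim x)
        then have b: "vector [x, 0] \<in> V" using inb by simp
        have "x ^ N * ?g x = 0" using nu(2)[OF b, of ?e1] C1(1)[OF b] by simp
        then show ?case using elim by simp
      qed
    qed
    ultimately have "?g 0 = 0" by (rule LIM_unique)
    then show ?thesis by (simp add: z0)
  qed
  have l0: "?l L' c'' \<noteq> 0"
  proof
    assume a: "?l L' c'' = 0"
    let ?g1 = "L' (axis 1 1) \<bullet> C1 0" and ?g2 = "L' (axis 2 1) \<bullet> C1 0" and ?g3 = "L' (axis 3 1) \<bullet> C1 0"
    have lL: "linear L'" using L'(1) by (rule orthogonal_transformation_linear)
    have Xc: "B (c 0) + d = L' (vector [0, k * x0, c''])"
      using genL(2)[where L=L' and s=s' and k=k and cc=c'', OF L'(1,4), of "vector [x0, 0, 0]"] L'(5) by simp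
    have "B (B (c 0) + d) = L' (vector [- k * (k * x0), 0, 0])" by (simp add: Xc genL(1)[where L=L' and s=s' and k=k and cc=c'', OF L'(1,4)])
    also have "vector [- k * (k * x0), 0, 0] = (- k * (k * x0)) *\<^sub>R (axis 1 1 :: real^3)" by (simp add: vec3_eq_iff axis_def)
    finally have "B (B (c 0) + d) = (- k * (k * x0)) *\<^sub>R L' (axis 1 1)" by (simp only: linear_scale[OF lL])
    then have n1: "L' (axis 1 1) \<bullet> \<nu> 0 \<noteq> 0" using gen(2) by auto
    have "C1 0 = L' (vector [?g1, ?g2, ?g3])" using orthogonal_components(2)[OF L'(1), of "C1 0"] by simp
    also have "vector [?g1, ?g2, ?g3] = ?g1 *\<^sub>R axis 1 1 + (?g2 / (k * x0)) *\<^sub>R (vector [0, k * x0, c''] :: real^3)"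
      using a L'(2,3) by (simp add: vec3_eq_iff axis_def field_simps)
    finally have e: "C1 0 = ?g1 *\<^sub>R L' (axis 1 1) + (?g2 / (k * x0)) *\<^sub>R (\<mu> 0 *\<^sub>R c1 0)"
      using X\<mu>[OF J0] Xc by (simp add: linear_add[OF lL] linear_scale[OF lL])
    have "C1 0 \<bullet> \<nu> 0 = ?g1 * (L' (axis 1 1) \<bullet> \<nu> 0)" by (subst e) (simp add: inner_add_left c10(2))
    then have "?g1 = 0" using C1\<nu> n1 by simp
    then have "C1 0 = (?g2 / (k * x0) * \<mu> 0) *\<^sub>R ?Df 0 ?e2" by (subst e) (simp add: c1_def z0)
    then show False using ind(1) by blast
  qed
  obtain L cc where L: "orthogonal_transformation L" "\<And>t y. T t (L y + s') = L (screw k cc t y) + s'"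
      "L (vector [x0, 0, 0]) + s' = c 0" "?l L cc > 0"
  proof (cases "?l L' c'' > 0")
    case True then show ?thesis using that L' by blast
  next
    case False
    \<comment> \<open>the axial component becomes positive when the direction of the axis is reversed\<close>
    define R where "R y = (vector [y$1, y$2, - y$3] :: real^3)" for y :: "real^3"
    have lR: "linear R" unfolding R_def by (rule linearI) (simp_all add: vec3_eq_iff)
    have oR: "orthogonal_transformation R"
      unfolding orthogonal_transformation_def using lR by (simp add: inner3 R_def)
    have 1: "R (screw k (- c'') t y) = screw k c'' t (R y)" for t y by (simp add: R_def screw_def vec3_eq_iff)
    have R123: "R (axis 3 1) = - axis 3 1" "R (axis 2 1) = axis 2 1" "R (vector [x0, 0, 0]) = vector [x0, 0, 0]"
      by (simp_all add: R_def vec3_eq_iff axis_def)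
    have lL: "linear L'" using L'(1) by (rule orthogonal_transformation_linear)
    have "?l (L' \<circ> R) (- c'') = - ?l L' c''" by (simp add: R123 linear_neg[OF lL])
    then have "?l (L' \<circ> R) (- c'') > 0" using False l0 by linarith
    moreover have "T t ((L' \<circ> R) y + s') = (L' \<circ> R) (screw k (- c'') t y) + s'" for t y
      using L'(4)[of t "R y"] 1[of t y] by simp
    moreover have "(L' \<circ> R) (vector [x0, 0, 0]) + s' = c 0" using R123 L'(5) by simp
    ultimately show ?thesis using that[of "L' \<circ> R" "- c''"] orthogonal_transformation_compose[OF L'(1) oR] by blast
  qed
  \<comment> \<open>the profile in cylindrical coordinates\<close>
  define h where "h = cc / k"
  define \<gamma> where "\<gamma> i u = L (axis i 1) \<bullet> (f (vector [u, 0]) - s')" for i u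
  define g where "g i u = L (axis i 1) \<bullet> C1 (vector [u, 0])" for i u
  have \<gamma>L: "L (vector [\<gamma> 1 u, \<gamma> 2 u, \<gamma> 3 u]) + s' = f (vector [u, 0])" for u
    using orthogonal_components(2)[OF L(1), of "f (vector [u, 0]) - s'"] by (simp add: \<gamma>_def)
  have inb: "vector [u, 0] \<in> V" "vector [u, 0] \<in> ?O0" if "u \<in> ?J" for u
  proof -
    have "vector [u, 0] \<in> plane_box \<delta>" using that by (auto simp: plane_box_def)
    then show "vector [u, 0] \<in> V" "vector [u, 0] \<in> ?O0" using \<delta> OV by auto
  qed
  have \<gamma>': "(\<gamma> i has_real_derivative u ^ N * g i u) (at u)" if u: "u \<in> ?J" for i u
  proof -
    have 1: "((\<lambda>u. f (vector [u, 0]) - s') has_vector_derivative (u ^ N *\<^sub>R C1 (vector [u, 0])) - 0) (at u)"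
      using line_vector_deriv(1)[OF dif[OF inb(1)[OF u]]] C1(1)[OF inb(1)[OF u]]
      by (intro has_vector_derivative_diff has_vector_derivative_const) simp
    from bounded_linear.has_vector_derivative[OF bounded_linear_inner_right[of "L (axis i 1)"] this]
    show ?thesis unfolding \<gamma>_def g_def has_real_derivative_iff_has_vector_derivative by simp
  qed
  have sline: "smooth_on ?J (\<lambda>u. vector [u, 0] :: real^2)" by (intro smooth_on_vector2) auto
  have sg: "smooth_on ?J (g i)" for i unfolding g_def
    by (intro smooth_on_inner smooth_on_const smooth_on_compose2[OF C1(2) _ _ sline]) (use inb in auto)
  have s\<gamma>: "smooth_on ?J (\<gamma> i)" for i unfolding \<gamma>_def
    by (intro smooth_on_inner smooth_on_diff smooth_on_const smooth_on_compose2[OF f _ _ sline]) (use inb in auto)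
  have "vector [\<gamma> 1 0, \<gamma> 2 0, \<gamma> 3 0] = (vector [x0, 0, 0] :: real^3)"
    using orthogonal_components(1)[OF L(1), of "vector [x0, 0, 0]"] L(3)[symmetric] by (simp add: \<gamma>_def c_def z0)
  then have \<gamma>0: "\<gamma> 1 0 = x0" "\<gamma> 2 0 = 0" "\<gamma> 3 0 = 0" by (simp_all add: vec3_eq_iff)
  have iso': "isCont (\<gamma> 1) 0" using DERIV_isCont[OF \<gamma>'[OF J0]] .
  obtain \<delta>1 where \<delta>1: "\<delta>1 > 0" "\<And>u. \<bar>u\<bar> < \<delta>1 \<Longrightarrow> \<gamma> 1 u > 0" "\<delta>1 \<le> \<delta>"
  proof -
    obtain e where "e > 0" "\<And>u. \<bar>u\<bar> < e \<Longrightarrow> \<gamma> 1 u > 0"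
      by (rule isCont_pos[OF iso']) (use L'(3) \<gamma>0 in auto)
    then show ?thesis using that[of "min e \<delta>"] \<delta> by auto
  qed
  let ?I = "{-\<delta>1<..<\<delta>1}"
  have IJ: "?I \<subseteq> ?J" using \<delta>1 by auto
  have gp: "\<gamma> 1 u > 0" if "u \<in> ?I" for u using \<delta>1(2)[of u] that by auto
  define \<rho> where "\<rho> u = sqrt ((\<gamma> 1 u)\<^sup>2 + (\<gamma> 2 u)\<^sup>2)" for u
  define \<beta> where "\<beta> u = arctan (\<gamma> 2 u / \<gamma> 1 u)" for u
  define \<zeta> where "\<zeta> u = \<gamma> 3 u - h * \<beta> u" for u
  define r1 where "r1 u = (\<gamma> 1 u * g 1 u + \<gamma> 2 u * g 2 u) / \<rho> u" for u
  define b1 where "b1 u = (\<gamma> 1 u * g 2 u - \<gamma> 2 u * g 1 u) / (\<rho> u)\<^sup>2" for u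
  define l1 where "l1 u = g 3 u - h * b1 u" for u
  have q: "(\<gamma> 1 u)\<^sup>2 + (\<gamma> 2 u)\<^sup>2 > 0" if "u \<in> ?I" for u using gp[OF that] by (intro add_pos_nonneg) auto
  have \<rho>p: "\<rho> u > 0" if "u \<in> ?I" for u using q[OF that] by (simp add: \<rho>_def)
  then have \<rho>n: "\<rho> u \<noteq> 0" "(\<rho> u)\<^sup>2 \<noteq> 0" if "u \<in> ?I" for u using that by (metis less_irrefl power_eq_0_iff)+
  note sI = smooth_on_subset[OF s\<gamma> IJ] smooth_on_subset[OF sg IJ]
  have s\<rho>: "smooth_on ?I \<rho>" unfolding \<rho>_def
    by (rule smooth_on_sqrt[OF _ _ q]) (auto intro!: smooth_on_add smooth_on_power sI)
  have sr1: "smooth_on ?I r1" unfolding r1_def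
    by (rule smooth_on_divide[OF _ s\<rho>]) (use \<rho>n in \<open>auto intro!: smooth_on_add smooth_on_mult sI\<close>)
  have sb1: "smooth_on ?I b1" unfolding b1_def
    by (rule smooth_on_divide[OF _ smooth_on_power[OF _ s\<rho>]]) (use \<rho>n in \<open>auto intro!: smooth_on_diff smooth_on_mult sI\<close>)
  have sl1: "smooth_on ?I l1" unfolding l1_def
    by (intro smooth_on_diff smooth_on_mult sI sb1 smooth_on_const) auto
  have d\<rho>: "(\<rho> has_real_derivative u ^ N * r1 u) (at u)" if u: "u \<in> ?I" for u
  proof -
    note uJ = subsetD[OF IJ u]
    have "((\<lambda>u. (\<gamma> 1 u)\<^sup>2 + (\<gamma> 2 u)\<^sup>2) has_real_derivative 2 * (\<gamma> 1 u * (u ^ N * g 1 u)) + 2 * (\<gamma> 2 u * (u ^ N * g 2 u))) (at u)"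
      using DERIV_add[OF DERIV_power[OF \<gamma>'[OF uJ, of 1], of 2] DERIV_power[OF \<gamma>'[OF uJ, of 2], of 2]] by (simp add: mult_ac)
    from DERIV_chain2[where f=sqrt and x=u, OF DERIV_real_sqrt[OF q[OF u]] this]
    have "(\<rho> has_real_derivative inverse (\<rho> u) / 2 * (2 * (\<gamma> 1 u * (u ^ N * g 1 u)) + 2 * (\<gamma> 2 u * (u ^ N * g 2 u)))) (at u)"
      unfolding \<rho>_def .
    then show ?thesis by (rule DERIV_cong) (use \<rho>p[OF u] in \<open>simp add: r1_def field_simps\<close>)
  qed
  have d\<beta>: "(\<beta> has_real_derivative u ^ N * b1 u) (at u)" if u: "u \<in> ?I" for u
  proof -
    have uJ: "u \<in> ?J" using u IJ by blast
    have "((\<lambda>u. \<gamma> 2 u / \<gamma> 1 u) has_real_derivative ((u ^ N * g 2 u) * \<gamma> 1 u - \<gamma> 2 u * (u ^ N * g 1 u)) / (\<gamma> 1 u * \<gamma> 1 u)) (at u)"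
      by (rule DERIV_divide[OF \<gamma>'[OF uJ] \<gamma>'[OF uJ]]) (use gp[OF u] in simp)
    from DERIV_chain2[where f=arctan and x=u, OF DERIV_arctan this]
    have "(\<beta> has_real_derivative inverse (1 + (\<gamma> 2 u / \<gamma> 1 u)\<^sup>2) * (((u ^ N * g 2 u) * \<gamma> 1 u - \<gamma> 2 u * (u ^ N * g 1 u)) / (\<gamma> 1 u * \<gamma> 1 u))) (at u)"
      unfolding \<beta>_def .
    then show ?thesis
    proof (rule DERIV_cong)
      have "(\<rho> u)\<^sup>2 = (\<gamma> 1 u)\<^sup>2 + (\<gamma> 2 u)\<^sup>2" using q[OF u] by (simp add: \<rho>_def)
      also have "\<dots> = (\<gamma> 1 u * \<gamma> 1 u) * (1 + (\<gamma> 2 u / \<gamma> 1 u)\<^sup>2)" using gp[OF u] by (simp add: field_simps power2_eq_square)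
      finally have r: "(\<rho> u)\<^sup>2 = (\<gamma> 1 u * \<gamma> 1 u) * (1 + (\<gamma> 2 u / \<gamma> 1 u)\<^sup>2)" .
      show "inverse (1 + (\<gamma> 2 u / \<gamma> 1 u)\<^sup>2) * (((u ^ N * g 2 u) * \<gamma> 1 u - \<gamma> 2 u * (u ^ N * g 1 u)) / (\<gamma> 1 u * \<gamma> 1 u)) = u ^ N * b1 u"
      proof -
        have "inverse S * (((p * x) * X - Y * (p * y)) / Q) = p * ((X * x - Y * y) / (Q * S))" for S p x X Y y Q :: real
          by (simp add: divide_inverse algebra_simps)
        then show ?thesis unfolding b1_def r .
      qed
    qed
  qed
  have d\<zeta>: "(\<zeta> has_real_derivative u ^ N * l1 u) (at u)" if u: "u \<in> ?I" for u
    unfolding \<zeta>_def l1_def using DERIV_diff[OF \<gamma>'[OF subsetD[OF IJ u], of 3] DERIV_cmult[OF d\<beta>[OF u], of h]]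
    by (simp add: algebra_simps)
  have I0: "0 \<in> ?I" using \<delta>1 by simp
  have "l1 0 = ?l L cc"
    unfolding l1_def b1_def g_def h_def \<rho>_def \<gamma>0 using L'(3) by (simp add: z0 power2_eq_square)
  then have l10: "l1 0 > 0" using L(4) by simp
  obtain \<delta>2 where \<delta>2: "\<delta>2 > 0" "\<And>u. \<bar>u\<bar> < \<delta>2 \<Longrightarrow> l1 u > 0" "\<delta>2 \<le> \<delta>1"
  proof -
    have "isCont l1 0" using smooth_on_continuous[OF sl1] I0 by (simp add: continuous_on_eq_continuous_at)
    then obtain e where "e > 0" "\<And>u. \<bar>u\<bar> < e \<Longrightarrow> l1 u > 0" using isCont_pos[of l1] l10 by blast
    then show ?thesis using that[of "min e \<delta>1"] \<delta>1 by auto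
  qed
  let ?K = "{-\<delta>2<..<\<delta>2}"
  have KI: "?K \<subseteq> ?I" using \<delta>2 by auto
  have ep: "edge_profile N \<delta>2 k \<rho> r1 \<beta> b1 \<zeta> l1"
  proof
    show "l1 w > 0" if "w \<in> ?K" for w using \<delta>2(2)[of w] that by auto
  qed (use N \<delta>2 L'(2) KI \<rho>p d\<rho> d\<beta> d\<zeta> in \<open>auto intro: smooth_on_subset[OF sr1] smooth_on_subset[OF sb1] smooth_on_subset[OF sl1]\<close>)
  have \<beta>\<zeta>0: "\<beta> 0 = 0" "\<zeta> 0 = 0" by (simp_all add: \<beta>_def \<zeta>_def \<gamma>0)
  have swept: "T t (f (vector [u, 0])) = L (helix_surface k h \<rho> \<beta> \<zeta> (vector [u, t])) + s'" if u: "u \<in> ?K" for t u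
  proof -
    have p: "\<rho> u * cos (\<beta> u) = \<gamma> 1 u" "\<rho> u * sin (\<beta> u) = \<gamma> 2 u"
      using polar_arctan[OF gp[OF subsetD[OF KI u]], of "\<gamma> 2 u"] by (simp_all add: \<rho>_def \<beta>_def)
    have "screw k cc t (vector [\<gamma> 1 u, \<gamma> 2 u, \<gamma> 3 u]) = helix_surface k h \<rho> \<beta> \<zeta> (vector [u, t])"
      unfolding p[symmetric] using L'(2)
      by (simp add: screw_def helix_surface_def vec3_eq_iff cos_add sin_add \<zeta>_def h_def algebra_simps)
    then show ?thesis using L(2)[of t "vector [\<gamma> 1 u, \<gamma> 2 u, \<gamma> 3 u]"] \<gamma>L[of u] by simp
  qed
  obtain r \<upsilon> \<rho>' r1' \<beta>' b1' \<zeta>' l1' where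
    nat: "bour_profile N r k h \<rho>' r1' \<beta>' b1' \<zeta>' l1'" "smooth_on {-r<..<r} \<upsilon>" "\<upsilon> 0 = 0"
      "\<And>x. x \<in> {-r<..<r} \<Longrightarrow> \<upsilon> x \<in> ?K" "frechet_derivative \<upsilon> (at 0) 1 \<noteq> 0"
      "\<And>x. x \<in> {-r<..<r} \<Longrightarrow> \<rho>' x = \<rho> (\<upsilon> x)" "\<And>x. x \<in> {-r<..<r} \<Longrightarrow> \<zeta>' x = \<zeta> (\<upsilon> x)"
      "smooth_on {-r<..<r} (\<lambda>x. (\<beta>' x - \<beta> (\<upsilon> x)) / k)"
      "((\<lambda>x. (\<beta>' x - \<beta> (\<upsilon> x)) / k) has_real_derivative 0) (at 0)"
    by (rule natural_parametrization[OF ep L'(2) \<beta>\<zeta>0, where h=h]) (rule that)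
  interpret bp: bour_profile N r k h \<rho>' r1' \<beta>' b1' \<zeta>' l1' by (rule nat(1))
  \<comment> \<open>the chart: flow from the profile, with the angle shifted\<close>
  define \<tau> where "\<tau> x = (\<beta>' x - \<beta> (\<upsilon> x)) / k" for x
  have s\<tau>: "smooth_on {-r<..<r} \<tau>" and d\<tau>: "(\<tau> has_real_derivative 0) (at 0)" using nat(8,9) by (simp_all add: \<tau>_def[abs_def])
  have \<tau>0: "\<tau> 0 = 0" by (simp add: \<tau>_def nat(3) \<beta>\<zeta>0 bp.\<beta>0)
  define Z where "Z w = (w$2 + \<tau> (w$1), vector [\<upsilon> (w$1), 0] :: real^2)" for w :: "real^2"
  have sZ: "smooth_on (plane_box r) Z" unfolding Z_def
    by (intro smooth_on_Pair smooth_on_add smooth_on_vector2 smooth_on_nth' bp.smooth_fst_box s\<tau> nat(2) smooth_on_const open_plane_box)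
  have Z0: "Z 0 = (0, 0)" by (simp add: Z_def \<tau>0 nat(3) z0)
  define Y where "Y = plane_box r \<inter> Z -` O'"
  have oY: "open Y" unfolding Y_def by (rule continuous_open_preimage[OF smooth_on_continuous[OF sZ] open_plane_box O'(1)])
  have Y0: "0 \<in> Y" using Z0 O'(2) bp.r by (simp add: Y_def plane_box_def)
  have ZO: "Z w \<in> O'" if "w \<in> Y" for w using that by (simp add: Y_def)
  define \<Psi> where "\<Psi> w = H (Z w)" for w
  have s\<Psi>: "smooth_on Y \<Psi>" unfolding \<Psi>_def
    by (rule smooth_on_compose2[OF H(1) oY _ smooth_on_subset[OF sZ]]) (auto simp: Y_def)
  have f\<Psi>: "f (\<Psi> w) = L (helix_surface k h \<rho>' \<beta>' \<zeta>' w) + s'" if w: "w \<in> Y" for w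
  proof -
    have wr: "w$1 \<in> {-r<..<r}" using w bp.box1 by (simp add: Y_def)
    have "f (\<Psi> w) = T (w$2 + \<tau> (w$1)) (f (vector [\<upsilon> (w$1), 0]))"
      using H(4) ZO[OF w] unfolding \<Psi>_def Z_def by blast
    also have "\<dots> = L (helix_surface k h \<rho> \<beta> \<zeta> (vector [\<upsilon> (w$1), w$2 + \<tau> (w$1)])) + s'"
      by (rule swept[OF nat(4)[OF wr]])
    also have "helix_surface k h \<rho> \<beta> \<zeta> (vector [\<upsilon> (w$1), w$2 + \<tau> (w$1)]) = helix_surface k h \<rho>' \<beta>' \<zeta>' w"
    proof -
      have "k * (w$2 + \<tau> (w$1)) + \<beta> (\<upsilon> (w$1)) = k * w$2 + \<beta>' (w$1)" using L'(2) by (simp add: \<tau>_def field_simps)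
      then show ?thesis by (simp add: helix_surface_def nat(6,7)[OF wr])
    qed
    finally show ?thesis .
  qed
  have \<Psi>0: "\<Psi> 0 = 0" using H(3)[of 0] O'(2) by (simp add: \<Psi>_def Z0)
  have inj: "inj (frechet_derivative \<Psi> (at 0))"
  proof -
    have hH: "(H has_derivative frechet_derivative H (at (0, 0))) (at (Z 0))"
      unfolding Z0 by (rule smooth_on_has_derivative[OF H(1) O'(2)])
    let ?DH = "frechet_derivative H (at (0, 0))" and ?u = "frechet_derivative \<upsilon> (at 0) 1"
    have lH: "linear ?DH" by (rule has_derivative_linear[OF hH])
    have r0: "0 \<in> {-r<..<r}" using bp.r by simp
    have d1: "((\<lambda>w::real^2. \<tau> (w$1)) has_derivative (\<lambda>v. 0 * v$1)) (at 0)" by (rule bp.fst_deriv) (simp add: d\<tau>)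
    have d2: "((\<lambda>w::real^2. \<upsilon> (w$1)) has_derivative (\<lambda>v. ?u * v$1)) (at 0)"
      by (rule bp.fst_deriv) (use smooth_on_real_DERIV[OF nat(2) r0] in simp)
    have "(Z has_derivative (\<lambda>v. (v$2 + 0 * v$1, (?u * v$1) *\<^sub>R ?e1 + 0))) (at 0)"
      unfolding Z_def axis_line scaleR_zero_left
      by (intro has_derivative_Pair has_derivative_add has_derivative_scaleR_left nth_has_derivative d1 d2 has_derivative_const)
    from has_derivative_compose[where f=Z and g=H and x=0, OF this hH]
    have "(\<Psi> has_derivative (\<lambda>v. ?DH (v$2 + 0 * v$1, (?u * v$1) *\<^sub>R ?e1 + 0))) (at 0)" unfolding \<Psi>_def .
    from frechet_derivative_at[OF this]
    have D: "frechet_derivative \<Psi> (at 0) = (\<lambda>v. ?DH (v$2, (?u * v$1) *\<^sub>R ?e1))" by simp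
    have DH0: "?DH (0, w) = w" for w
    proof -
      have "((\<lambda>w. H (0, w)) has_derivative (\<lambda>w. ?DH (0, w))) (at 0)"
        by (rule has_derivative_compose[where f="\<lambda>w. (0, w)" and g=H and x=0])
           (use hH Z0 in \<open>auto intro!: derivative_eq_intros\<close>)
      moreover have "((\<lambda>w. H (0, w)) has_derivative (\<lambda>w. w)) (at 0)"
        by (rule has_derivative_transform_within_open[OF has_derivative_ident oO]) (use O'(2) H(3) in auto)
      ultimately have "(\<lambda>w. ?DH (0, w)) = (\<lambda>w. w)" by (rule has_derivative_unique)
      then show ?thesis by (rule fun_cong)
    qed
    have "v = 0" if v: "frechet_derivative \<Psi> (at 0) v = 0" for v
    proof -
      have "?DH (v$2, (?u * v$1) *\<^sub>R ?e1) = v$2 *\<^sub>R ?DH (1, 0) + ?DH (0, (?u * v$1) *\<^sub>R ?e1)"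
      proof -
        have "(v$2, (?u * v$1) *\<^sub>R ?e1) = v$2 *\<^sub>R (1, 0) + (0, (?u * v$1) *\<^sub>R ?e1)" by simp
        then show ?thesis by (simp only: linear_add[OF lH] linear_scale[OF lH])
      qed
      then have e: "v$2 *\<^sub>R \<xi> 0 + (?u * v$1) *\<^sub>R ?e1 = 0" using v unfolding D DH0 \<xi>_def by simp
      have "(v$2 *\<^sub>R \<xi> 0 + (?u * v$1) *\<^sub>R ?e1) $ 2 = v$2 * \<mu> 0" by (simp add: \<mu>_def z0 axis_def)
      then have "v$2 = 0" using e gen(1) by simp
      moreover have "(v$2 *\<^sub>R \<xi> 0 + (?u * v$1) *\<^sub>R ?e1) $ 1 = v$2 * \<xi> 0 $ 1 + ?u * v$1" by (simp add: axis_def)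
      ultimately show ?thesis using e nat(5) by (simp add: vec2_eq_iff)
    qed
    then show ?thesis
      using linear_injective_0[OF linear_frechet_derivative[OF smooth_on_differentiable[OF s\<Psi> Y0]]] by blast
  qed
  obtain U1 V1 \<Psi>' where U1: "open U1" "0 \<in> U1" "U1 \<subseteq> Y" "open V1" "homeomorphism U1 V1 \<Psi> \<Psi>'" "smooth_on V1 \<Psi>'"
    by (rule smooth_inverse_function[OF oY s\<Psi> Y0 inj])
  obtain r' where r': "r' > 0" "plane_box r' \<subseteq> U1" using plane_box_subset_ball[OF U1(1,2)] by blast
  define r2 where "r2 = min r r'"
  have r2: "r2 > 0" "r2 \<le> r" "plane_box r2 \<subseteq> U1" using r' bp.r plane_box_mono[of r2 r'] by (auto simp: r2_def)
  let ?\<Omega> = "V1 \<inter> \<Psi>' -` plane_box r2"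
  have oOm: "open ?\<Omega>" by (rule continuous_open_preimage[OF smooth_on_continuous[OF U1(6)] U1(4) open_plane_box])
  have hom: "homeomorphism ?\<Omega> (plane_box r2) \<Psi>' \<Psi>"
  proof (rule homeomorphismI)
    show "continuous_on ?\<Omega> \<Psi>'" by (rule continuous_on_subset[OF smooth_on_continuous[OF U1(6)]]) auto
    show "continuous_on (plane_box r2) \<Psi>" using U1(5) r2(3) by (meson continuous_on_subset homeomorphism_def)
  qed (use U1(5) r2(3) in \<open>auto simp: homeomorphism_def subset_iff\<close>)
  have OmV: "?\<Omega> \<subseteq> V"
  proof
    fix x assume x: "x \<in> ?\<Omega>"
    then have "\<Psi>' x \<in> Y" "\<Psi> (\<Psi>' x) = x" using r2(3) U1(3,5) by (auto simp: homeomorphism_def)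
    then show "x \<in> V" using H(2)[OF ZO[of "\<Psi>' x"]] by (simp add: \<Psi>_def)
  qed
  show ?thesis
  proof (rule that[OF bour_profile_mono[OF nat(1) r2(1,2)] euclidean_isometryI[OF L(1), of s'] oOm OmV hom])
    show "smooth_on ?\<Omega> \<Psi>'" by (rule smooth_on_subset[OF U1(6)]) auto
    show "smooth_on (plane_box r2) \<Psi>" by (rule smooth_on_subset[OF s\<Psi>]) (use r2(3) U1(3) in blast)
    show "\<Psi> 0 = 0" by (rule \<Psi>0)
    show "f (\<Psi> w) = L (helix_surface k h \<rho>' \<beta>' \<zeta>' w) + s'" if "w \<in> plane_box r2" for w
      using f\<Psi> that r2(3) U1(3) by blast
  qed
qed

text \<open>
  Differentiating the orthogonality of \<open>\<nu>\<close> to both partial derivatives shows that the normal acceleration of a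
  curve in the surface is quadratic in its velocity. Under the assumptions on the derivatives in the first
  direction only the second component of the velocity contributes, and it enters by its square.
\<close>

lemma normal_acceleration_coordinates:
  fixes f \<nu> :: "real^2 \<Rightarrow> real^3" and g :: "real^2 \<Rightarrow> real^2"
  assumes V: "open V" "0 \<in> V" and Y: "open Y" "y0 \<in> Y" and g: "smooth_on Y g" "g ` Y \<subseteq> V" "g y0 = 0"
    and f: "smooth_on V f" and nu: "smooth_on V \<nu>" "\<And>w v. w \<in> V \<Longrightarrow> frechet_derivative f (at w) v \<bullet> \<nu> w = 0"
    and f1: "frechet_derivative f (at 0) (axis 1 1) = 0"
    and f21: "frechet_derivative (\<lambda>w. frechet_derivative f (at w) (axis 2 1)) (at 0) (axis 1 1) = 0"
    and nz: "frechet_derivative (\<lambda>y. frechet_derivative (\<lambda>y. f (g y)) (at y) (axis 2 1)) (at y0) (axis 2 1) \<bullet> \<nu> 0 \<noteq> 0"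
  shows "frechet_derivative (\<lambda>w. frechet_derivative f (at w) (axis 2 1)) (at 0) (axis 2 1) \<bullet> \<nu> 0 \<noteq> 0"
proof -
  let ?e2 = "axis 2 1 :: real^2"
  define F2 where "F2 w = frechet_derivative f (at w) ?e2" for w
  define P where "P y = frechet_derivative (\<lambda>y. f (g y)) (at y) ?e2" for y
  have sF2: "smooth_on V F2" unfolding F2_def by (rule smooth_on_frechet[OF f])
  have sfg: "smooth_on Y (\<lambda>y. f (g y))" by (rule smooth_on_compose2[OF f Y(1) g(2,1)])
  have sP: "smooth_on Y P" unfolding P_def by (rule smooth_on_frechet[OF sfg])
  have snug: "smooth_on Y (\<lambda>y. \<nu> (g y))" by (rule smooth_on_compose2[OF nu(1) Y(1) g(2,1)])
  have P: "P y = frechet_derivative f (at (g y)) (frechet_derivative g (at y) ?e2)" if y: "y \<in> Y" for y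
  proof -
    have "frechet_derivative (\<lambda>y. f (g y)) (at y) = (\<lambda>v. frechet_derivative f (at (g y)) (frechet_derivative g (at y) v))"
      by (rule frechet_derivative_chain(1)) (use smooth_on_differentiable[OF g(1) y] smooth_on_differentiable[OF f] g(2) y in auto)
    then show ?thesis unfolding P_def by simp
  qed
  define k where "k = frechet_derivative g (at y0) ?e2"
  have lf: "linear (frechet_derivative f (at 0))" by (rule linear_frechet_derivative[OF smooth_on_differentiable[OF f V(2)]])
  have P0: "P y0 = k$2 *\<^sub>R F2 0"
    unfolding P[OF Y(2)] g(3) k_def[symmetric] F2_def by (subst linear_axes2[OF lf]) (simp add: f1)
  have prod: "D1 v \<bullet> b x0 + a x0 \<bullet> D2 v = 0"
    if "(a has_derivative D1) (at x0)" "(b has_derivative D2) (at x0)" "open Z" "x0 \<in> Z" "\<And>x. x \<in> Z \<Longrightarrow> a x \<bullet> b x = 0"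
    for a b :: "real^2 \<Rightarrow> real^3" and D1 D2 v x0 Z
  proof -
    have "((\<lambda>x. a x \<bullet> b x) has_derivative (\<lambda>v. a x0 \<bullet> D2 v + D1 v \<bullet> b x0)) (at x0)"
      by (rule has_derivative_inner[OF that(1,2)])
    moreover have "((\<lambda>x. a x \<bullet> b x) has_derivative (\<lambda>v. 0)) (at x0)"
      by (rule has_derivative_transform_within_open[OF has_derivative_const[of 0] that(3,4)]) (use that(5) in simp)
    ultimately have "(\<lambda>v. a x0 \<bullet> D2 v + D1 v \<bullet> b x0) = (\<lambda>v. 0)" by (rule has_derivative_unique)
    from fun_cong[OF this, of v] show ?thesis by simp
  qed
  have hnu: "(\<nu> has_derivative frechet_derivative \<nu> (at 0)) (at (g y0))"
    unfolding g(3) by (rule smooth_on_has_derivative[OF nu(1) V(2)])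
  have hnug: "((\<lambda>y. \<nu> (g y)) has_derivative (\<lambda>v. frechet_derivative \<nu> (at 0) (frechet_derivative g (at y0) v))) (at y0)"
    by (rule has_derivative_compose[OF smooth_on_has_derivative[OF g(1) Y(2)] hnu])
  have 1: "frechet_derivative P (at y0) ?e2 \<bullet> \<nu> (g y0) + P y0 \<bullet> frechet_derivative \<nu> (at 0) (frechet_derivative g (at y0) ?e2) = 0"
    by (rule prod[OF smooth_on_has_derivative[OF sP Y(2)] hnug Y]) (use P nu(2) g(2) in auto)
  have 2: "frechet_derivative F2 (at 0) v \<bullet> \<nu> 0 + F2 0 \<bullet> frechet_derivative \<nu> (at 0) v = 0" for v
    by (rule prod[OF smooth_on_has_derivative[OF sF2 V(2)] smooth_on_has_derivative[OF nu(1) V(2)] V]) (simp add: F2_def nu(2))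
  have l2: "linear (frechet_derivative F2 (at 0))" by (rule linear_frechet_derivative[OF smooth_on_differentiable[OF sF2 V(2)]])
  have "frechet_derivative F2 (at 0) k = k$2 *\<^sub>R frechet_derivative F2 (at 0) ?e2"
    by (subst linear_axes2[OF l2]) (use f21 in \<open>simp add: F2_def[abs_def]\<close>)
  then have "F2 0 \<bullet> frechet_derivative \<nu> (at 0) k = - (k$2 * (frechet_derivative F2 (at 0) ?e2 \<bullet> \<nu> 0))"
    using 2[of k] by simp
  then have "frechet_derivative P (at y0) ?e2 \<bullet> \<nu> 0 = k$2 * (k$2 * (frechet_derivative F2 (at 0) ?e2 \<bullet> \<nu> 0))"
    using 1 unfolding P0 g(3) k_def[symmetric] by simp
  moreover have "frechet_derivative P (at y0) ?e2 \<bullet> \<nu> 0 \<noteq> 0" using nz unfolding P_def[abs_def] .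
  ultimately show ?thesis unfolding F2_def[abs_def] by auto
qed

text \<open>
  These are the properties of the normal form of an edge that survive an arbitrary diffeomorphism \<open>\<Psi>\<close> of
  space: the first partial derivative is divisible by \<open>w\<^sub>1\<^sup>N\<close> with a quotient that is linearly independent of
  the second one at the origin, and the mixed derivative vanishes at the origin because \<open>N \<ge> 1\<close>.
\<close>

lemma edge_normal_form_derivatives:
  fixes a :: "real^2 \<Rightarrow> real" and \<Psi> :: "real^3 \<Rightarrow> real^3"
  assumes N: "N \<ge> 1" and V: "open V" "0 \<in> V" and a: "smooth_on V a" and Z: "open Z" and \<Psi>: "smooth_on Z \<Psi>"
    and nf_def: "nf = (\<lambda>w. vector [w$1 ^ Suc N, w$1 ^ (Suc N + 1) * a w, w$2] :: real^3)"
    and nfZ: "\<And>w. w \<in> V \<Longrightarrow> nf w \<in> Z" and inj: "inj (frechet_derivative \<Psi> (at (nf 0)))"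
  obtains C1 where "smooth_on V (\<lambda>w. \<Psi> (nf w))" "smooth_on V C1"
    "\<And>w. w \<in> V \<Longrightarrow> frechet_derivative (\<lambda>w. \<Psi> (nf w)) (at w) (axis 1 1) = w$1 ^ N *\<^sub>R C1 w"
    "\<And>x. C1 0 \<noteq> x *\<^sub>R frechet_derivative (\<lambda>w. \<Psi> (nf w)) (at 0) (axis 2 1)"
    "frechet_derivative (\<lambda>w. \<Psi> (nf w)) (at 0) (axis 2 1) \<noteq> 0"
    "frechet_derivative (\<lambda>w. frechet_derivative (\<lambda>w. \<Psi> (nf w)) (at w) (axis 2 1)) (at 0) (axis 1 1) = 0"
proof -
  let ?e1 = "axis 1 1 :: real^2" and ?e2 = "axis 2 1 :: real^2"
  let ?Da = "\<lambda>w v. frechet_derivative a (at w) v"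
  have snf: "smooth_on V nf" unfolding nf_def by (intro smooth_intros V a)
  have dnf: "(nf has_derivative (\<lambda>v. vector [(1 + real N) * w$1 ^ N * v$1,
      w$1 ^ (Suc N + 1) * ?Da w v + ((1 + real (Suc N)) * w$1 ^ Suc N * v$1) * a w, v$2])) (at w)" if w: "w \<in> V" for w
  proof -
    have p: "((\<lambda>w::real^2. w$1 ^ Suc m) has_derivative (\<lambda>v. (1 + real m) * w$1 ^ m * v$1)) (at w)" for m
      by (rule DERIV_compose_FDERIV[OF DERIV_power_Suc[OF DERIV_ident] nth_has_derivative, THEN has_derivative_eq_rhs]) (simp add: mult_ac)
    have da: "(a has_derivative ?Da w) (at w)" by (rule smooth_on_has_derivative[OF a w])
    have "((\<lambda>w::real^2. w$1 ^ (Suc N + 1)) has_derivative (\<lambda>v. (1 + real (Suc N)) * w$1 ^ Suc N * v$1)) (at w)"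
      using p[of "Suc N"] by simp
    from has_derivative_mult[OF this da]
    show ?thesis unfolding nf_def by (intro has_derivative_vector3 p nth_has_derivative)
  qed
  have Dnf: "frechet_derivative nf (at w) = (\<lambda>v. vector [(1 + real N) * w$1 ^ N * v$1,
      w$1 ^ (Suc N + 1) * ?Da w v + ((1 + real (Suc N)) * w$1 ^ Suc N * v$1) * a w, v$2])" if "w \<in> V" for w
    by (rule frechet_derivative_at[OF dnf[OF that], symmetric])
  have D\<Psi>: "linear (frechet_derivative \<Psi> (at (nf w)))" if "w \<in> V" for w
    by (rule linear_frechet_derivative[OF smooth_on_differentiable[OF \<Psi> nfZ[OF that]]])
  define K where "K j w = frechet_derivative \<Psi> (at (nf w)) (axis j 1)" for j w
  have sK: "smooth_on V (K j)" for j unfolding K_def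
    by (rule smooth_on_compose2[OF smooth_on_frechet[OF \<Psi>] V(1) _ snf]) (use nfZ in auto)
  have D: "frechet_derivative (\<lambda>w. \<Psi> (nf w)) (at w) v = (let d = frechet_derivative nf (at w) v in d$1 *\<^sub>R K 1 w + d$2 *\<^sub>R K 2 w + d$3 *\<^sub>R K 3 w)"
    if w: "w \<in> V" for w v
  proof -
    have "frechet_derivative (\<lambda>w. \<Psi> (nf w)) (at w) = (\<lambda>v. frechet_derivative \<Psi> (at (nf w)) (frechet_derivative nf (at w) v))"
      by (rule frechet_derivative_chain(1)) (use smooth_on_differentiable[OF \<Psi> nfZ[OF w]] smooth_on_differentiable[OF snf w] in auto)
    moreover have "frechet_derivative \<Psi> (at (nf w)) d = d$1 *\<^sub>R K 1 w + d$2 *\<^sub>R K 2 w + d$3 *\<^sub>R K 3 w" for d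
    proof -
      have "d = d$1 *\<^sub>R axis 1 1 + d$2 *\<^sub>R axis 2 1 + d$3 *\<^sub>R axis 3 1" by (simp add: vec3_eq_iff axis_def)
      then have "frechet_derivative \<Psi> (at (nf w)) d = frechet_derivative \<Psi> (at (nf w)) (d$1 *\<^sub>R axis 1 1 + d$2 *\<^sub>R axis 2 1 + d$3 *\<^sub>R axis 3 1)"
        by simp
      then show ?thesis unfolding K_def by (simp only: linear_add[OF D\<Psi>[OF w]] linear_scale[OF D\<Psi>[OF w]])
    qed
    ultimately show ?thesis by (simp add: Let_def)
  qed
  define C1 where "C1 w = (1 + real N) *\<^sub>R K 1 w + ((w$1)\<^sup>2 * ?Da w ?e1 + (1 + real (Suc N)) * w$1 * a w) *\<^sub>R K 2 w" for w
  define s where "s w = w$1 ^ (Suc N + 1) * ?Da w ?e2" for w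
  have E1: "frechet_derivative (\<lambda>w. \<Psi> (nf w)) (at w) ?e1 = w$1 ^ N *\<^sub>R C1 w" if "w \<in> V" for w
    unfolding D[OF that] Dnf[OF that] Let_def
    by (simp add: axis_def C1_def scaleR_add_right power2_eq_square algebra_simps)
  have E2: "frechet_derivative (\<lambda>w. \<Psi> (nf w)) (at w) ?e2 = s w *\<^sub>R K 2 w + K 3 w" if "w \<in> V" for w
    unfolding D[OF that] Dnf[OF that] Let_def by (simp add: axis_def s_def)
  have Dl0: "linear (frechet_derivative \<Psi> (at (nf 0)))" by (rule D\<Psi>[OF V(2)])
  have K13: "u *\<^sub>R K 1 0 = v *\<^sub>R K 3 0 \<Longrightarrow> u = 0 \<and> v = 0" for u v
  proof -
    assume "u *\<^sub>R K 1 0 = v *\<^sub>R K 3 0"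
    then have "frechet_derivative \<Psi> (at (nf 0)) (u *\<^sub>R axis 1 1) = frechet_derivative \<Psi> (at (nf 0)) (v *\<^sub>R axis 3 1)"
      unfolding K_def by (simp only: linear_scale[OF Dl0])
    then have "u *\<^sub>R axis 1 1 = (v *\<^sub>R axis 3 1 :: real^3)" using inj by (simp add: inj_eq)
    then show ?thesis by (simp add: vec3_eq_iff axis_def)
  qed
  have E20: "frechet_derivative (\<lambda>w. \<Psi> (nf w)) (at 0) ?e2 = K 3 0" using E2[OF V(2)] by (simp add: s_def)
  have C10: "C1 0 = (1 + real N) *\<^sub>R K 1 0" by (simp add: C1_def)
  have sda: "smooth_on V (\<lambda>w. ?Da w v)" for v by (rule smooth_on_frechet[OF a])
  have ss: "smooth_on V s" unfolding s_def by (intro smooth_intros sda V)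
  have F: "frechet_derivative (\<lambda>w. frechet_derivative (\<lambda>w. \<Psi> (nf w)) (at w) ?e2) (at 0) ?e1 = 0"
  proof -
    have "frechet_derivative (\<lambda>w. frechet_derivative (\<lambda>w. \<Psi> (nf w)) (at w) ?e2) (at 0) = frechet_derivative (\<lambda>w. s w *\<^sub>R K 2 w + K 3 w) (at 0)"
      by (rule frechet_derivative_cong[OF V E2])
    moreover have h: "((\<lambda>w. s w *\<^sub>R K 2 w + K 3 w) has_derivative (\<lambda>v. s 0 *\<^sub>R frechet_derivative (K 2) (at 0) v + frechet_derivative s (at 0) v *\<^sub>R K 2 0 + frechet_derivative (K 3) (at 0) v)) (at 0)"
      by (intro has_derivative_add has_derivative_scaleR smooth_on_has_derivative[OF ss] smooth_on_has_derivative[OF sK] V)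
    ultimately have e: "frechet_derivative (\<lambda>w. frechet_derivative (\<lambda>w. \<Psi> (nf w)) (at w) ?e2) (at 0) ?e1 =
      s 0 *\<^sub>R frechet_derivative (K 2) (at 0) ?e1 + frechet_derivative s (at 0) ?e1 *\<^sub>R K 2 0 + frechet_derivative (K 3) (at 0) ?e1"
      by (simp only: frechet_derivative_at[OF h, symmetric])
    have h: "(s has_derivative (\<lambda>v. (0::real^2)$1 ^ (Suc N + 1) * frechet_derivative (\<lambda>w. ?Da w ?e2) (at 0) v + ((1 + real (Suc N)) * (0::real^2)$1 ^ Suc N * v$1) * ?Da 0 ?e2)) (at 0)"
      unfolding s_def
    proof (rule has_derivative_mult[OF _ smooth_on_has_derivative[OF sda V(2)]])
      show "((\<lambda>w::real^2. w$1 ^ (Suc N + 1)) has_derivative (\<lambda>v. (1 + real (Suc N)) * (0::real^2)$1 ^ Suc N * v$1)) (at 0)"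
        unfolding Suc_eq_plus1[symmetric]
        by (rule DERIV_compose_FDERIV[OF DERIV_power_Suc[OF DERIV_ident] nth_has_derivative, THEN has_derivative_eq_rhs]) (simp add: mult_ac)
    qed
    have "frechet_derivative s (at 0) ?e1 = 0" by (simp add: frechet_derivative_at[OF h, symmetric])
    moreover have "frechet_derivative (K 3) (at 0) ?e1 = 0"
    proof -
      let ?k = "\<lambda>y. frechet_derivative \<Psi> (at y) (axis 3 1)"
      have dk: "?k differentiable (at (nf 0))" by (rule smooth_on_differentiable[OF smooth_on_frechet[OF \<Psi>] nfZ[OF V(2)]])
      have "frechet_derivative (K 3) (at 0) = (\<lambda>v. frechet_derivative ?k (at (nf 0)) (frechet_derivative nf (at 0) v))"
        unfolding K_def[abs_def] by (rule frechet_derivative_chain(1)[OF dk smooth_on_differentiable[OF snf V(2)]])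
      moreover have "frechet_derivative nf (at 0) ?e1 = 0"
        unfolding Dnf[OF V(2)] using N by (simp add: vec3_eq_iff axis_def power_0_left)
      ultimately show ?thesis using linear_0[OF linear_frechet_derivative[OF dk]] by simp
    qed
    ultimately show ?thesis unfolding e by (simp add: s_def)
  qed
  show ?thesis
  proof (rule that)
    show "smooth_on V (\<lambda>w. \<Psi> (nf w))" by (rule smooth_on_compose2[OF \<Psi> V(1) _ snf]) (use nfZ in auto)
    show "smooth_on V C1" unfolding C1_def by (intro smooth_intros sK sda a V)
    show "frechet_derivative (\<lambda>w. \<Psi> (nf w)) (at w) ?e1 = w$1 ^ N *\<^sub>R C1 w" if "w \<in> V" for w by (rule E1[OF that])
    show "C1 0 \<noteq> x *\<^sub>R frechet_derivative (\<lambda>w. \<Psi> (nf w)) (at 0) ?e2" for x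
      unfolding C10 E20 using K13[of "1 + real N" x] by auto
    show "frechet_derivative (\<lambda>w. \<Psi> (nf w)) (at 0) ?e2 \<noteq> 0"
      unfolding E20 using K13[of 0 1] by auto
    show "frechet_derivative (\<lambda>w. frechet_derivative (\<lambda>w. \<Psi> (nf w)) (at w) ?e2) (at 0) ?e1 = 0" by (rule F)
  qed
qed

lemma A_equivalentE:
  assumes "A_equivalent A f p B g q"
  obtains U V W Z \<phi> \<Phi> where "open U" "open V" "open W" "open Z" "p \<in> U" "q \<in> V"
    "diffeo A B U V \<phi>" "\<phi> p = q" "diffeo euclidean_atlas euclidean_atlas W Z \<Phi>" "f ` U \<subseteq> W"
    "\<And>w. w \<in> V \<Longrightarrow> g w = \<Phi> (f (inv_into U \<phi> w))"
  using assms unfolding A_equivalent_def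
  apply (elim exE conjE)
  subgoal premises prems for U V W Z \<phi> \<Phi>
    by (rule prems(1)[of U V W Z \<phi> \<Phi>]) (use prems in auto)
  done

text \<open>
  The normal form provides coordinates in which \<open>plane_extraction\<close> applies to \<open>f\<close>; the local flow that lifts
  the motion and the curvature condition are transported to them.
\<close>

theorem edge_extraction:
  fixes A :: "('a::topological_space, real^2) chart set" and f :: "'a \<Rightarrow> real^3"
  assumes or: "oriented_atlas A" and N: "N \<ge> 1" and E: "open E"
    and f: "generic_helicoidal_edge (Suc N) A E f" and p: "p \<in> singular_set A E f"
  obtains D r \<kappa> k h \<rho> r1 \<beta> b1 \<zeta> l1 \<Sigma> where
    "bour_profile N r k h \<rho> r1 \<beta> b1 \<zeta> l1" "coords A D (plane_box r) \<kappa>" "p \<in> D" "D \<subseteq> E" "\<kappa> p = 0"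
    "euclidean_isometry \<Sigma>" "\<And>q. q \<in> D \<Longrightarrow> f q = \<Sigma> (helix_surface k h \<rho> \<beta> \<zeta> (\<kappa> q))"
proof -
  have A: "smooth_atlas A" using or by (simp add: oriented_atlas_def)
  have pE: "p \<in> E" using p by (simp add: singular_set_def)
  have fE: "smooth_map A euclidean_atlas E f" using f by (simp add: generic_helicoidal_edge_def frontal_def surface_def)
  have nt: "n_type_edge (Suc N) A f p" and ga: "generic_at A f p" using f p by (auto simp: generic_helicoidal_edge_def)
  obtain T where T: "helicoidal_motion T" "invariant_under A E f T" using f by (auto simp: generic_helicoidal_edge_def)
  obtain V0 and a :: "real^2 \<Rightarrow> real" where V0: "open V0" "0 \<in> V0" "smooth_on V0 a"
    "A_equivalent A f p euclidean_atlas (\<lambda>w::real^2. vector [(w$1) ^ Suc N, (w$1) ^ (Suc N + 1) * a w, w$2] :: real^3) 0"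
    using nt unfolding n_type_edge_def by blast
  define nf :: "real^2 \<Rightarrow> real^3" where "nf = (\<lambda>w. vector [w$1 ^ Suc N, w$1 ^ (Suc N + 1) * a w, w$2])"
  have "A_equivalent A f p euclidean_atlas nf 0" unfolding nf_def by (rule V0(4))
  then obtain U V W Z \<phi> \<Phi> where o: "open U" "open V" "open W" "open Z" "p \<in> U" "0 \<in> V"
    and \<phi>: "diffeo A euclidean_atlas U V \<phi>" "\<phi> p = 0" and \<Phi>: "diffeo euclidean_atlas euclidean_atlas W Z \<Phi>"
    and fU: "f ` U \<subseteq> W" and nf: "\<And>w. w \<in> V \<Longrightarrow> nf w = \<Phi> (f (inv_into U \<phi> w))"
    by (rule A_equivalentE) (rule that)
  interpret C: coords A U V \<phi> using A o \<phi> by (simp add: coords_def)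
  note \<Phi>D = diffeoD[OF \<Phi>]
  let ?\<Psi> = "inv_into W \<Phi>"
  obtain N1 \<nu> c where N1: "open N1" "p \<in> N1" "unit_normal_field A N1 f \<nu>" "oriented_chart A c" "p \<in> fst c"
    "limiting_normal_curvature c f \<nu> p \<noteq> 0"
    using ga unfolding generic_at_def by blast
  obtain Uc x where c: "c = (Uc, x)" by (cases c)
  have s\<nu>: "smooth_map A euclidean_atlas N1 \<nu>" using N1(3) by (simp add: unit_normal_field_def)
  define V1 where "V1 = V0 \<inter> (V \<inter> C.\<kappa>i -` (E \<inter> N1))"
  have V1: "open V1" "0 \<in> V1" "V1 \<subseteq> V" "V1 \<subseteq> V0"
  proof -
    show "open V1" unfolding V1_def by (intro open_Int V0(1) C.open_coord_preimage E N1(1))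
    have "C.\<kappa>i 0 = p" using C.\<kappa>D(5)[OF o(5)] \<phi>(2) by simp
    then show "0 \<in> V1" using V0(2) o(6) pE N1(2) by (simp add: V1_def)
  qed (auto simp: V1_def)
  define fh where "fh = (\<lambda>w. ?\<Psi> (nf w))"
  have fh: "f (C.\<kappa>i w) = fh w" "nf w \<in> Z" if "w \<in> V" for w
  proof -
    have "f (C.\<kappa>i w) \<in> W" using fU C.\<kappa>D(6)[OF that] by blast
    then show "f (C.\<kappa>i w) = fh w" "nf w \<in> Z" unfolding fh_def nf[OF that] using \<Phi>D(4,5) by simp_all
  qed
  have s\<Psi>: "smooth_on Z ?\<Psi>" and s\<Phi>: "smooth_on W \<Phi>" using \<Phi>D(2,3) by simp_all
  have inj: "inj (frechet_derivative ?\<Psi> (at (nf 0)))"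
  proof -
    have z: "nf 0 \<in> Z" using fh(2)[OF o(6)] .
    have "frechet_derivative (\<lambda>y. \<Phi> (?\<Psi> y)) (at (nf 0)) = (\<lambda>v. frechet_derivative \<Phi> (at (?\<Psi> (nf 0))) (frechet_derivative ?\<Psi> (at (nf 0)) v))"
      by (rule frechet_derivative_chain(1)) (use smooth_on_differentiable[OF s\<Psi> z] smooth_on_differentiable[OF s\<Phi> \<Phi>D(6)[OF z]] in auto)
    moreover have "frechet_derivative (\<lambda>y. \<Phi> (?\<Psi> y)) (at (nf 0)) = frechet_derivative (\<lambda>y. y) (at (nf 0))"
      by (rule frechet_derivative_cong[OF o(4) z]) (use \<Phi>D(7) in auto)
    ultimately have "(\<lambda>v. frechet_derivative \<Phi> (at (?\<Psi> (nf 0))) (frechet_derivative ?\<Psi> (at (nf 0)) v)) = (\<lambda>v. v)"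
      by (simp add: frechet_derivative_ident id_def)
    from fun_cong[OF this] show ?thesis by (rule inj_on_inverseI)
  qed
  obtain C1 where C1: "smooth_on V1 fh" "smooth_on V1 C1"
    "\<And>w. w \<in> V1 \<Longrightarrow> frechet_derivative fh (at w) (axis 1 1) = w$1 ^ N *\<^sub>R C1 w"
    "\<And>x. C1 0 \<noteq> x *\<^sub>R frechet_derivative fh (at 0) (axis 2 1)"
    "frechet_derivative fh (at 0) (axis 2 1) \<noteq> 0"
    "frechet_derivative (\<lambda>w. frechet_derivative fh (at w) (axis 2 1)) (at 0) (axis 1 1) = 0"
    using edge_normal_form_derivatives[OF N V1(1,2) smooth_on_subset[OF V0(3) V1(4)] o(4) s\<Psi> nf_def fh(2)[OF subsetD[OF V1(3)]] inj]
    unfolding fh_def[symmetric] by blast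
  define \<nu>h where "\<nu>h w = \<nu> (C.\<kappa>i w)" for w
  have s\<nu>h: "smooth_on V1 \<nu>h" unfolding \<nu>h_def
    by (rule smooth_on_subset[OF C.smooth_in[OF N1(1) s\<nu>]]) (auto simp: V1_def)
  have fq: "f q = fh (\<phi> q)" if "q \<in> U" for q using fh(1)[OF C.\<kappa>D(4)[OF that]] C.\<kappa>D(5)[OF that] by simp
  have \<nu>h: "frechet_derivative fh (at w) v \<bullet> \<nu>h w = 0" if w: "w \<in> V1" for w v
  proof -
    let ?q = "C.\<kappa>i w"
    have q: "?q \<in> U" "\<phi> ?q = w" "?q \<in> N1" using w V1(3) C.\<kappa>D(6,7) by (auto simp: V1_def)
    obtain U0 x0 where c0: "(U0, x0) \<in> A" "?q \<in> U0" using smooth_atlas_cover[OF A] .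
    have "range (chart_deriv (U0, x0) f ?q) = range (frechet_derivative fh (at (\<phi> ?q)))"
      by (rule C.range_chart_deriv[where c="(U0, x0)" and F=f and G=fh and N=U and q="?q", OF c0(1) _ q(1) o(1) q(1) fq]) (use c0 q smooth_on_differentiable[OF C1(1) w] in auto)
    then obtain b where "frechet_derivative fh (at w) v = chart_deriv (U0, x0) f ?q b" unfolding q(2) by blast
    then show ?thesis using N1(3) c0 q(3) unfolding unit_normal_field_def \<nu>h_def by force
  qed
  \<comment> \<open>the curvature condition, transferred to the coordinates of the normal form\<close>
  have Ac: "smooth_atlas (insert c A)" using N1(4) by (simp add: oriented_chart_def oriented_atlas_def)
  have cA: "(Uc, x) \<in> insert c A" by (simp add: c)
  interpret CI: coords "insert c A" U V \<phi> by (rule C.insert_chart[OF Ac])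
  let ?B = "Uc \<inter> (U \<inter> \<phi> -` V1)"
  have oB: "open (U \<inter> \<phi> -` V1)" by (rule continuous_open_preimage[OF smooth_map_continuous[OF C.\<kappa>D(2)] o(1) V1(1)])
  define Y where "Y = x ` ?B"
  have oY: "open Y" unfolding Y_def using chart_open[OF Ac cA] oB by (intro chart_image_open[OF Ac cA]) auto
  define g where "g y = \<phi> (inv_into Uc x y)" for y
  have sg: "smooth_on Y g"
  proof -
    have "smooth_on (x ` (Uc \<inter> U)) (\<phi> \<circ> inv_into Uc x)" using CI.\<kappa>D(2) cA unfolding smooth_map_to_euclidean by blast
    then have "smooth_on Y (\<phi> \<circ> inv_into Uc x)" by (rule smooth_on_subset) (auto simp: Y_def)
    then show ?thesis by (simp add: g_def[abs_def] comp_def)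
  qed
  have gY: "g ` Y \<subseteq> V1" using chart_inv[OF Ac cA] by (auto simp: Y_def g_def)
  have pB: "p \<in> ?B" using N1(5) o(5) \<phi>(2) V1(2) by (simp add: c)
  have y0: "x p \<in> Y" using pB by (auto simp: Y_def)
  have g0: "g (x p) = 0" using chart_inv[OF Ac cA] pB \<phi>(2) by (simp add: g_def)
  have fx: "(f \<circ> inv_into Uc x) y = fh (g y)" if "y \<in> Y" for y
  proof -
    have "inv_into Uc x y \<in> U" using that chart_inv[OF Ac cA] by (auto simp: Y_def)
    then show ?thesis using fq by (simp add: g_def)
  qed
  have part: "chart_partial c 2 f q = frechet_derivative (\<lambda>y. fh (g y)) (at (x q)) (axis 2 1)" if q: "q \<in> ?B" for q
  proof -
    have "x q \<in> Y" using q by (auto simp: Y_def)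
    then have "frechet_derivative (f \<circ> inv_into Uc x) (at (x q)) = frechet_derivative (\<lambda>y. fh (g y)) (at (x q))"
      by (rule frechet_derivative_cong[OF oY]) (rule fx)
    then show ?thesis unfolding chart_partial_def chart_deriv_def c by simp
  qed
  have "chart_partial c 2 (chart_partial c 2 f) p =
      frechet_derivative (\<lambda>y. frechet_derivative (\<lambda>y. fh (g y)) (at y) (axis 2 1)) (at (x p)) (axis 2 1)"
  proof -
    have "frechet_derivative (chart_partial c 2 f \<circ> inv_into Uc x) (at (x p)) =
        frechet_derivative (\<lambda>y. frechet_derivative (\<lambda>y. fh (g y)) (at y) (axis 2 1)) (at (x p))"
    proof (rule frechet_derivative_cong[OF oY y0])
      fix y assume "y \<in> Y"
      then obtain q where q: "q \<in> ?B" "y = x q" unfolding Y_def by blast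
      then show "(chart_partial c 2 f \<circ> inv_into Uc x) y = frechet_derivative (\<lambda>y. fh (g y)) (at y) (axis 2 1)"
        using part[OF q(1)] chart_inv[OF Ac cA, of q] by simp
    qed
    then show ?thesis unfolding chart_partial_def[of c 2 "chart_partial c 2 f" p] chart_deriv_def[of c] using c by simp
  qed
  moreover have "chart_partial c 2 (chart_partial c 2 f) p \<bullet> \<nu> p \<noteq> 0"
    using N1(6) by (auto simp: limiting_normal_curvature_def)
  moreover have "\<nu>h 0 = \<nu> p" using C.\<kappa>D(5)[OF o(5)] \<phi>(2) by (simp add: \<nu>h_def)
  ultimately have nz: "frechet_derivative (\<lambda>y. frechet_derivative (\<lambda>y. fh (g y)) (at y) (axis 2 1)) (at (x p)) (axis 2 1) \<bullet> \<nu>h 0 \<noteq> 0"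
    by simp
  have f10: "frechet_derivative fh (at 0) (axis 1 1) = 0" using C1(3)[OF V1(2)] N by (simp add: power_0_left)
  have cur: "frechet_derivative (\<lambda>w. frechet_derivative fh (at w) (axis 2 1)) (at 0) (axis 2 1) \<bullet> \<nu>h 0 \<noteq> 0"
    by (rule normal_acceleration_coordinates[where f=fh and \<nu>=\<nu>h and g=g and V=V1 and Y=Y and ?y0.0="x p", OF V1(1,2) oY y0 sg gY g0 C1(1) s\<nu>h \<nu>h f10 C1(6) nz])
  \<comment> \<open>the lifted motion in coordinates\<close>
  obtain \<epsilon> Uf \<psi> where fl: "\<epsilon> > 0" "open Uf" "p \<in> Uf" "Uf \<subseteq> E" "smooth_map (line_times_atlas A) A ({-\<epsilon><..<\<epsilon>} \<times> Uf) \<psi>"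
    "\<And>q. q \<in> Uf \<Longrightarrow> \<psi> (0, q) = q" "\<And>t q. t \<in> {-\<epsilon><..<\<epsilon>} \<Longrightarrow> q \<in> Uf \<Longrightarrow> f (\<psi> (t, q)) = T t (f q)"
  proof -
    from bspec[OF T(2)[unfolded invariant_under_def] pE]
    show ?thesis by (elim exE conjE) (rule that, assumption+, simp, simp)
  qed
  define M where "M = {-\<epsilon><..<\<epsilon>} \<times> (V \<inter> C.\<kappa>i -` Uf)"
  have oM: "open M" unfolding M_def by (intro open_Times C.open_coord_preimage fl(2)) simp
  define s where "s z = \<psi> (fst z, C.\<kappa>i (snd z))" for z :: "real \<times> (real^2)"
  have ss: "smooth_map euclidean_atlas A M s"
    unfolding s_def
  proof (rule smooth_map_compose[where \<phi>="\<lambda>z. (fst z, C.\<kappa>i (snd z))" and \<psi>=\<psi>,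
        OF smooth_atlas_euclidean smooth_atlas_line_times[OF A] A oM _ _ fl(5)])
    show "open ({-\<epsilon><..<\<epsilon>} \<times> Uf)" using fl(2) by (intro open_Times) simp_all
    show "smooth_map euclidean_atlas (line_times_atlas A) M (\<lambda>z. (fst z, C.\<kappa>i (snd z)))"
      by (rule smooth_map_subset[OF C.line_times_in]) (auto simp: M_def)
  qed (auto simp: M_def)
  define O' where "O' = M \<inter> s -` (U \<inter> \<phi> -` V1)"
  have oO: "open O'" unfolding O'_def by (rule continuous_open_preimage[OF smooth_map_continuous[OF ss] oM oB])
  define H where "H z = \<phi> (s z)" for z
  have sH: "smooth_on O' H"
  proof -
    have "smooth_map euclidean_atlas euclidean_atlas O' (\<lambda>z. \<phi> (s z))"
      by (rule smooth_map_compose[OF smooth_atlas_euclidean A smooth_atlas_euclidean oO o(1) smooth_map_subset[OF ss] C.\<kappa>D(2)])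
         (auto simp: O'_def)
    then show ?thesis by (simp add: H_def[abs_def])
  qed
  have s0: "s (0, w) = C.\<kappa>i w" if "C.\<kappa>i w \<in> Uf" for w using fl(6)[OF that] by (simp add: s_def)
  have \<kappa>0: "C.\<kappa>i 0 = p" using C.\<kappa>D(5)[OF o(5)] \<phi>(2) by simp
  have O0: "(0, 0) \<in> O'" using fl(1,3) o(5,6) \<phi>(2) V1(2) s0[of 0] \<kappa>0 by (simp add: O'_def M_def)
  have HV: "H z \<in> V1" if "z \<in> O'" for z using that by (auto simp: O'_def H_def)
  have H0: "H (0, w) = w" if "(0, w) \<in> O'" for w
    using that s0[of w] C.\<kappa>D(7)[of w] by (auto simp: O'_def M_def H_def)
  have Hf: "fh (H (t, w)) = T t (fh w)" if z: "(t, w) \<in> O'" for t w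
  proof -
    have w: "w \<in> V" "C.\<kappa>i w \<in> Uf" "t \<in> {-\<epsilon><..<\<epsilon>}" "s (t, w) \<in> U" using z by (auto simp: O'_def M_def)
    have "fh (H (t, w)) = f (s (t, w))" using fq[OF w(4)] by (simp add: H_def)
    also have "\<dots> = T t (f (C.\<kappa>i w))" using fl(7)[OF w(3,2)] by (simp add: s_def)
    finally show ?thesis using fh(1)[OF w(1)] by simp
  qed
  obtain r k h \<rho> r1 \<beta> b1 \<zeta> l1 \<Sigma> \<Omega> \<Psi> \<Psi>' where R:
    "bour_profile N r k h \<rho> r1 \<beta> b1 \<zeta> l1" "euclidean_isometry \<Sigma>" "open \<Omega>" "\<Omega> \<subseteq> V1"
    "homeomorphism \<Omega> (plane_box r) \<Psi>' \<Psi>" "smooth_on \<Omega> \<Psi>'" "smooth_on (plane_box r) \<Psi>" "\<Psi> 0 = 0"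
    "\<And>w. w \<in> plane_box r \<Longrightarrow> fh (\<Psi> w) = \<Sigma> (helix_surface k h \<rho> \<beta> \<zeta> w)"
    by (rule plane_extraction[OF N V1(1,2) C1(1,3,2,4,5) s\<nu>h \<nu>h cur oO O0 sH HV H0 Hf T(1)], assumption+, rule that)
  have rp: "r > 0" using R(1) by (simp add: bour_profile_def edge_profile_def)
  interpret C2: coords A "U \<inter> \<phi> -` \<Omega>" \<Omega> \<phi> by (rule C.restrict[OF R(3)]) (use R(4) V1(3) in auto)
  have d: "diffeo euclidean_atlas euclidean_atlas \<Omega> (plane_box r) \<Psi>'"
    by (rule diffeo_euclideanI(1)[OF open_plane_box R(6,7,5)])
  have "coords A (U \<inter> \<phi> -` \<Omega>) (plane_box r) (\<lambda>q. \<Psi>' (\<phi> q))"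
    unfolding coords_def
    using diffeo_compose(1)[OF A smooth_atlas_euclidean smooth_atlas_euclidean C2.D R(3) open_plane_box C2.diffeo d] A C2.D by simp
  moreover have b0: "0 \<in> plane_box r" using rp by (simp add: plane_box_def)
  moreover have "0 \<in> \<Omega>" "\<Psi>' 0 = 0" using R(5,8) b0 by (force simp: homeomorphism_def)+
  moreover have "U \<inter> \<phi> -` \<Omega> \<subseteq> E"
  proof
    fix q assume q: "q \<in> U \<inter> \<phi> -` \<Omega>"
    then have "\<phi> q \<in> V1" using R(4) by blast
    then show "q \<in> E" using C.\<kappa>D(5)[of q] q by (auto simp: V1_def)
  qed
  moreover have "f q = \<Sigma> (helix_surface k h \<rho> \<beta> \<zeta> (\<Psi>' (\<phi> q)))" if q: "q \<in> U \<inter> \<phi> -` \<Omega>" for q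
  proof -
    have "\<Psi>' (\<phi> q) \<in> plane_box r" "\<Psi> (\<Psi>' (\<phi> q)) = \<phi> q" using R(5) q by (auto simp: homeomorphism_def)
    then show ?thesis using R(9)[of "\<Psi>' (\<phi> q)"] fq q by simp
  qed
  ultimately show ?thesis
    using that[OF R(1), of "U \<inter> \<phi> -` \<Omega>" "\<lambda>q. \<Psi>' (\<phi> q)" \<Sigma>] R(2) o(5) \<phi>(2) by simp
qed

section \<open>The family of all helicoidal edges with a given metric\<close>

lemma avg_cong:
  assumes "\<And>x. x \<in> {-r<..<r} \<Longrightarrow> e x = e' x" "u \<in> {-r<..<r}"
  shows "avg j e u = avg j e' u"
  unfolding avg_def by (rule integral_cong) (use assms scaled_in_interval in auto)

locale metric_data =
  fixes N :: nat and R :: real and P p1 :: "real \<Rightarrow> real"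
  assumes N1: "N \<ge> 1" and R: "R > 0" and sP: "smooth_on {-R<..<R} P" and sp: "smooth_on {-R<..<R} p1"
    and Ppos: "\<And>x. x \<in> {-R<..<R} \<Longrightarrow> P x > 0"
    and dP: "\<And>x. x \<in> {-R<..<R} \<Longrightarrow> (P has_real_derivative x ^ N * p1 x) (at x)"
begin

text \<open>
  Bour's construction. The radius is \<open>rad = \<surd>(m\<^sup>2 P - h\<^sup>2)\<close>, with derivative \<open>x\<^sup>N rad1\<close>. The conditions \<open>orth\<close> and
  \<open>unit\<close> on a profile in natural parameters then become \<open>m\<^sup>2 P ang1 = - h hgt1\<close> and
  \<open>rad\<^sup>4 hgt1\<^sup>2 = m\<^sup>2 P gap\<close>, where \<open>gap = rad\<^sup>2 (1 - rad1\<^sup>2)\<close>.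
\<close>

definition gap :: "real \<Rightarrow> real \<Rightarrow> real \<Rightarrow> real"
  where "gap h m x = m\<^sup>2 * P x - h\<^sup>2 - m ^ 4 * (p1 x)\<^sup>2 / 4"

definition rad where "rad h m x = sqrt (m\<^sup>2 * P x - h\<^sup>2)"
definition rad1 where "rad1 h m x = m\<^sup>2 * p1 x / (2 * rad h m x)"
definition hgt1 where "hgt1 h m x = m * sqrt (gap h m x * P x) / (m\<^sup>2 * P x - h\<^sup>2)"
definition ang1 where "ang1 h m x = - (h * hgt1 h m x) / (m\<^sup>2 * P x)"
definition hgt where "hgt h m x = x ^ Suc N * avg N (hgt1 h m) x"
definition ang where "ang h m x = x ^ Suc N * avg N (ang1 h m) x"

lemma gap_imp: "gap h m x > 0 \<Longrightarrow> m\<^sup>2 * P x - h\<^sup>2 > 0"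
proof -
  assume g: "gap h m x > 0"
  have "m ^ 4 * (p1 x)\<^sup>2 / 4 \<ge> 0" by simp
  then show ?thesis using g unfolding gap_def by linarith
qed

lemma family_bour_profile:
  assumes m: "m > 0" and r: "0 < r" "r \<le> R" and g: "\<And>x. x \<in> {-r<..<r} \<Longrightarrow> gap h m x > 0"
  shows "bour_profile N r (1/m) h (rad h m) (rad1 h m) (ang h m) (ang1 h m) (hgt h m) (hgt1 h m)"
proof -
  let ?I = "{-r<..<r}"
  have IR: "x \<in> {-R<..<R}" if "x \<in> ?I" for x using that r by auto
  then have sub: "?I \<subseteq> {-R<..<R}" by blast
  note sP' = smooth_on_subset[OF sP sub] and sp' = smooth_on_subset[OF sp sub]
  have P: "P x > 0" if "x \<in> ?I" for x using Ppos[OF IR[OF that]] .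
  have Q: "m\<^sup>2 * P x - h\<^sup>2 > 0" if "x \<in> ?I" for x using gap_imp[OF g[OF that]] .
  have radp: "rad h m x > 0" if "x \<in> ?I" for x using Q[OF that] by (simp add: rad_def)
  have rad2: "(rad h m x)\<^sup>2 = m\<^sup>2 * P x - h\<^sup>2" if "x \<in> ?I" for x using Q[OF that] by (simp add: rad_def)
  have sQ: "smooth_on ?I (\<lambda>x. m\<^sup>2 * P x - h\<^sup>2)" by (intro smooth_intros sP') auto
  have srad: "smooth_on ?I (rad h m)" unfolding rad_def by (rule smooth_on_sqrt[OF _ sQ Q]) auto
  have srad1: "smooth_on ?I (rad1 h m)" unfolding rad1_def
  proof (rule smooth_on_divide)
    show "smooth_on ?I (\<lambda>x. 2 * rad h m x)" "smooth_on ?I (\<lambda>x. m\<^sup>2 * p1 x)" by (intro smooth_intros srad sp'; simp)+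
    show "2 * rad h m x \<noteq> 0" if "x \<in> ?I" for x using radp[OF that] by simp
  qed simp
  have sgap: "smooth_on ?I (\<lambda>x. gap h m x * P x)"
  proof -
    have "smooth_on ?I (\<lambda>x. (m\<^sup>2 * P x - h\<^sup>2 - m ^ 4 / 4 * (p1 x)\<^sup>2) * P x)" by (intro smooth_intros sP' sp') auto
    then show ?thesis by (simp add: gap_def)
  qed
  have shgt1: "smooth_on ?I (hgt1 h m)" unfolding hgt1_def
  proof (rule smooth_on_divide[OF _ sQ])
    show "smooth_on ?I (\<lambda>x. m * sqrt (gap h m x * P x))"
      by (intro smooth_on_mult smooth_on_const smooth_on_sqrt sgap) (use g P in auto)
    show "m\<^sup>2 * P x - h\<^sup>2 \<noteq> 0" if "x \<in> ?I" for x using Q[OF that] by simp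
  qed simp
  have sang1: "smooth_on ?I (ang1 h m)" unfolding ang1_def
  proof (rule smooth_on_divide)
    show "smooth_on ?I (\<lambda>x. m\<^sup>2 * P x)" "smooth_on ?I (\<lambda>x. - (h * hgt1 h m x))" by (intro smooth_intros shgt1 sP'; simp)+
    show "m\<^sup>2 * P x \<noteq> 0" if "x \<in> ?I" for x using P[OF that] m by simp
  qed simp
  have hgt1p: "hgt1 h m x > 0" if "x \<in> ?I" for x
    unfolding hgt1_def using m g[OF that] P[OF that] Q[OF that] by simp
  have "edge_profile N r (1/m) (rad h m) (rad1 h m) (ang h m) (ang1 h m) (hgt h m) (hgt1 h m)"
  proof
    fix x assume x: "x \<in> ?I"
    show "(rad h m has_real_derivative x ^ N * rad1 h m x) (at x)"
    proof -
      have "((\<lambda>x. m\<^sup>2 * P x - h\<^sup>2) has_real_derivative m\<^sup>2 * (x ^ N * p1 x) - 0) (at x)"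
        by (intro DERIV_diff DERIV_cmult dP IR x DERIV_const)
      from DERIV_chain2[where f=sqrt and x=x, OF DERIV_real_sqrt[OF Q[OF x]] this]
      have "(rad h m has_real_derivative inverse (rad h m x) / 2 * (m\<^sup>2 * (x ^ N * p1 x) - 0)) (at x)"
        unfolding rad_def .
      then show ?thesis by (rule DERIV_cong) (use radp[OF x] in \<open>simp add: rad1_def field_simps\<close>)
    qed
    show "(hgt h m has_real_derivative x ^ N * hgt1 h m x) (at x)"
      unfolding hgt_def by (rule avg_primitive[OF shgt1 x])
    show "(ang h m has_real_derivative x ^ N * ang1 h m x) (at x)"
      unfolding ang_def by (rule avg_primitive[OF sang1 x])
  qed (use N1 r m radp hgt1p srad1 sang1 shgt1 in auto)
  moreover have "(rad1 h m x)\<^sup>2 + (rad h m x * ang1 h m x)\<^sup>2 + (hgt1 h m x + h * ang1 h m x)\<^sup>2 = 1"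
    and "(rad h m x)\<^sup>2 * ang1 h m x + h * (hgt1 h m x + h * ang1 h m x) = 0" if x: "x \<in> ?I" for x
  proof -
    define S where "S = m\<^sup>2 * P x"
    define q where "q = m\<^sup>2 * P x - h\<^sup>2"
    define l where "l = hgt1 h m x"
    define b where "b = ang1 h m x"
    have S: "S > 0" "S = q + h\<^sup>2" "q > 0" using P[OF x] m Q[OF x] by (simp_all add: S_def q_def)
    have bS: "b * S = - (h * l)" unfolding b_def ang1_def l_def S_def[symmetric] using S(1) by simp
    have rq: "(rad h m x)\<^sup>2 = q" using rad2[OF x] by (simp add: q_def)
    show "(rad h m x)\<^sup>2 * ang1 h m x + h * (hgt1 h m x + h * ang1 h m x) = 0"
      unfolding rq b_def[symmetric] l_def[symmetric] using bS S(2) by algebra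
    have "q * (rad1 h m x)\<^sup>2 = q * (m ^ 4 * (p1 x)\<^sup>2 / (4 * (rad h m x)\<^sup>2))"
      by (simp add: rad1_def power_divide power_mult_distrib power_mult[symmetric])
    then have 1: "q * (rad1 h m x)\<^sup>2 = m ^ 4 * (p1 x)\<^sup>2 / 4" unfolding rq using S(3) by (simp add: field_simps)
    have "l * q = m * sqrt (gap h m x * P x)" using S(3) by (simp add: l_def hgt1_def q_def)
    then have "(l * q)\<^sup>2 = m\<^sup>2 * (gap h m x * P x)" using g[OF x] P[OF x] by (simp add: power_mult_distrib)
    then have 2: "l\<^sup>2 * q\<^sup>2 = gap h m x * S" by (simp add: power_mult_distrib S_def mult_ac)
    have 3: "gap h m x = q - q * (rad1 h m x)\<^sup>2" unfolding 1 by (simp add: gap_def q_def)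
    have "q * S\<^sup>2 * ((rad1 h m x)\<^sup>2 + (rad h m x * b)\<^sup>2 + (l + h * b)\<^sup>2)
       = S\<^sup>2 * (q * (rad1 h m x)\<^sup>2) + q * ((rad h m x)\<^sup>2 * (b * S)\<^sup>2 + (l * S + h * (b * S))\<^sup>2)"
      by algebra
    also have "\<dots> = S\<^sup>2 * (q - gap h m x) + q * (q * (h * l)\<^sup>2 + (l * S - h * (h * l))\<^sup>2)"
      unfolding rq bS 3 by (simp add: algebra_simps)
    also have "\<dots> = S\<^sup>2 * (q - gap h m x) + (q + h\<^sup>2) * (l\<^sup>2 * q\<^sup>2)" unfolding S(2) by algebra
    also have "\<dots> = q * S\<^sup>2" unfolding 2 S(2)[symmetric] by (simp add: power2_eq_square algebra_simps)
    finally have "q * S\<^sup>2 * ((rad1 h m x)\<^sup>2 + (rad h m x * b)\<^sup>2 + (l + h * b)\<^sup>2) = q * S\<^sup>2 * 1" by simp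
    moreover have "q * S\<^sup>2 \<noteq> 0" using S by simp
    ultimately have "(rad1 h m x)\<^sup>2 + (rad h m x * b)\<^sup>2 + (l + h * b)\<^sup>2 = 1" by (simp only: mult_cancel_left) blast
    then show "(rad1 h m x)\<^sup>2 + (rad h m x * ang1 h m x)\<^sup>2 + (hgt1 h m x + h * ang1 h m x)\<^sup>2 = 1"
      by (simp add: b_def l_def)
  qed
  ultimately show ?thesis using m by (simp add: bour_profile_def bour_profile_axioms_def ang_def hgt_def)
qed

lemma family_metric:
  assumes "m > 0" "gap h m x > 0"
  shows "(1/m)\<^sup>2 * ((rad h m x)\<^sup>2 + h\<^sup>2) = P x"
  using gap_imp[OF assms(2)] assms(1) by (simp add: rad_def power_divide)

text \<open>
  Bour's lemma: the metric determines \<open>r1\<close> by differentiation of \<open>\<rho>\<^sup>2 = m\<^sup>2 P - h\<^sup>2\<close>, then \<open>orth\<close> and \<open>unit\<close>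
  determine \<open>b1\<close> and \<open>l1\<^sup>2\<close>, and the root is fixed by \<open>l1 > 0\<close>.
\<close>

theorem bour_unique:
  assumes bp: "bour_profile N r k h \<rho> r1 \<beta> b1 \<zeta> l1" and rR: "r \<le> R"
    and met: "\<And>x. x \<in> {-r<..<r} \<Longrightarrow> k\<^sup>2 * ((\<rho> x)\<^sup>2 + h\<^sup>2) = P x" and x: "x \<in> {-r<..<r}"
  shows "gap h (1/k) x > 0" "\<rho> x = rad h (1/k) x" "\<beta> x = ang h (1/k) x" "\<zeta> x = hgt h (1/k) x"
proof -
  interpret bour_profile N r k h \<rho> r1 \<beta> b1 \<zeta> l1 by (rule bp)
  let ?I = "{-r<..<r}"
  define m where "m = 1 / k"
  have m: "m > 0" using kpos by (simp add: m_def)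
  have \<rho>2: "(\<rho> x)\<^sup>2 + h\<^sup>2 = m\<^sup>2 * P x" if "x \<in> ?I" for x
    using met[OF that] kpos by (simp add: m_def power_divide field_simps)
  have \<rho>rad: "\<rho> x = rad h m x" if "x \<in> ?I" for x
    using \<rho>2[OF that] \<rho>pos[OF that] by (simp add: rad_def real_sqrt_unique eq_diff_eq)
  have r1nz: "2 * \<rho> x * r1 x = m\<^sup>2 * p1 x" if x: "x \<in> ?I" and nz: "x \<noteq> 0" for x
  proof -
    have "((\<lambda>x. (\<rho> x)\<^sup>2 + h\<^sup>2) has_real_derivative 2 * (\<rho> x * (x ^ N * r1 x)) + 0) (at x)"
      using DERIV_add[OF DERIV_power[OF d\<rho>[OF x], of 2] DERIV_const[of "h\<^sup>2"]] by (simp add: mult_ac)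
    moreover have "((\<lambda>x. (\<rho> x)\<^sup>2 + h\<^sup>2) has_real_derivative m\<^sup>2 * (x ^ N * p1 x)) (at x)"
    proof (rule has_field_derivative_transform_within_open[OF DERIV_cmult[OF dP] _ x])
      show "x \<in> {-R<..<R}" using x rR by auto
    qed (use \<rho>2 in auto)
    ultimately have "2 * (\<rho> x * (x ^ N * r1 x)) + 0 = m\<^sup>2 * (x ^ N * p1 x)" by (rule DERIV_unique)
    then have "x ^ N * (2 * \<rho> x * r1 x) = x ^ N * (m\<^sup>2 * p1 x)" by (simp add: mult_ac)
    then show ?thesis using nz by simp
  qed
  have r1all: "2 * \<rho> x * r1 x = m\<^sup>2 * p1 x" if x: "x \<in> ?I" for x
  proof (cases "x = 0")
    case True
    have I0: "0 \<in> ?I" using x True by simp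
    have IR: "?I \<subseteq> {-R<..<R}" using rR by auto
    have "continuous_on ?I (\<lambda>x. 2 * \<rho> x * r1 x - m\<^sup>2 * p1 x)"
      by (intro continuous_intros smooth_on_continuous s\<rho> sr smooth_on_subset[OF sp IR])
    then have "isCont (\<lambda>x. 2 * \<rho> x * r1 x - m\<^sup>2 * p1 x) 0" using I0 by (simp add: continuous_on_eq_continuous_at)
    then have "((\<lambda>x. 2 * \<rho> x * r1 x - m\<^sup>2 * p1 x) \<longlongrightarrow> 2 * \<rho> 0 * r1 0 - m\<^sup>2 * p1 0) (at 0)" by (simp add: isCont_def)
    moreover have "((\<lambda>x. 2 * \<rho> x * r1 x - m\<^sup>2 * p1 x) \<longlongrightarrow> 0) (at 0)"
    proof (rule tendsto_eventually)
      have "eventually (\<lambda>x. x \<in> ?I - {0}) (at (0::real))" using I0 by (intro eventually_at_in_open) auto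
      then show "\<forall>\<^sub>F x in at 0. 2 * \<rho> x * r1 x - m\<^sup>2 * p1 x = 0" by eventually_elim (use r1nz in auto)
    qed
    ultimately have "2 * \<rho> 0 * r1 0 - m\<^sup>2 * p1 0 = 0" by (rule LIM_unique)
    then show ?thesis using True by simp
  qed (use r1nz x in blast)
  have main: "gap h m x > 0 \<and> l1 x = hgt1 h m x \<and> b1 x = ang1 h m x" if x: "x \<in> ?I" for x
  proof -
    define S where "S = m\<^sup>2 * P x"
    define q where "q = (\<rho> x)\<^sup>2"
    have xR: "x \<in> {-R<..<R}" using x rR by auto
    then have P: "P x > 0" by (rule Ppos)
    have q: "q > 0" using \<rho>pos[OF x] by (simp add: q_def)
    have S: "S = q + h\<^sup>2" "S > 0" using \<rho>2[OF x] P m by (simp_all add: S_def q_def)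
    have bS: "b1 x * S = - (h * l1 x)" using orth[OF x] unfolding S(1) q_def by algebra
    have un: "(r1 x)\<^sup>2 + (\<rho> x * b1 x)\<^sup>2 + (l1 x + h * b1 x)\<^sup>2 = 1" by (rule unit[OF x])
    have rr: "4 * q * (r1 x)\<^sup>2 = m ^ 4 * (p1 x)\<^sup>2"
    proof -
      have "(2 * \<rho> x * r1 x)\<^sup>2 = (m\<^sup>2 * p1 x)\<^sup>2" using r1all[OF x] by simp
      then show ?thesis by (simp add: power_mult_distrib q_def power_mult[symmetric])
    qed
    have gq: "gap h m x = q - q * (r1 x)\<^sup>2"
    proof -
      have "gap h m x = S - h\<^sup>2 - (m ^ 4 * (p1 x)\<^sup>2) / 4" by (simp add: gap_def S_def)
      also have "\<dots> = q - q * (r1 x)\<^sup>2" unfolding rr[symmetric] S(1) by simp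
      finally show ?thesis .
    qed
    have "S\<^sup>2 * (1 - (r1 x)\<^sup>2) = q * (b1 x * S)\<^sup>2 + (l1 x * S + h * (b1 x * S))\<^sup>2"
      using un unfolding q_def by algebra
    also have "\<dots> = S * (q * (l1 x)\<^sup>2)" unfolding bS unfolding S(1) by algebra
    finally have "S * (S * (1 - (r1 x)\<^sup>2)) = S * (q * (l1 x)\<^sup>2)" by (simp add: power2_eq_square mult_ac)
    then have "S * (1 - (r1 x)\<^sup>2) = q * (l1 x)\<^sup>2" using S(2) by simp
    then have lq: "S * gap h m x = (q * l1 x)\<^sup>2" unfolding gq by algebra
    have "(q * l1 x)\<^sup>2 > 0" using q l1pos[OF x] by simp
    then have gp: "gap h m x > 0" using lq S(2) by (metis zero_less_mult_pos)
    have "q * l1 x = sqrt (S * gap h m x)" unfolding lq using q l1pos[OF x] by simp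
    also have "\<dots> = m * sqrt (gap h m x * P x)" unfolding S_def using m by (simp add: real_sqrt_mult)
    finally have "l1 x = m * sqrt (gap h m x * P x) / q" using q by (simp add: field_simps)
    moreover have "q = m\<^sup>2 * P x - h\<^sup>2" using S(1) by (simp add: S_def)
    ultimately have l: "l1 x = hgt1 h m x" by (simp add: hgt1_def)
    have "b1 x = ang1 h m x" unfolding ang1_def S_def[symmetric] l[symmetric] using bS S(2) by (simp add: field_simps)
    then show ?thesis using gp l by blast
  qed
  show "gap h (1/k) x > 0" "\<rho> x = rad h (1/k) x" using main[OF x] \<rho>rad[OF x] by (simp_all add: m_def)
  have "\<beta> x = \<beta> 0 + x ^ Suc N * avg N b1 x" by (rule avg_unique[OF sb x d\<beta>])
  also have "avg N b1 x = avg N (ang1 h m) x" by (rule avg_cong[OF _ x]) (use main in blast)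
  finally show "\<beta> x = ang h (1/k) x" by (simp add: \<beta>0 ang_def m_def)
  have "\<zeta> x = \<zeta> 0 + x ^ Suc N * avg N l1 x" by (rule avg_unique[OF sl x d\<zeta>])
  also have "avg N l1 x = avg N (hgt1 h m) x" by (rule avg_cong[OF _ x]) (use main in blast)
  finally show "\<zeta> x = hgt h (1/k) x" by (simp add: \<zeta>0 hgt_def m_def)
qed

definition params :: "(real \<times> real) set"
  where "params = {(h, m). m > 0 \<and> gap h m 0 > 0}"

lemma open_params: "open params"
proof -
  have "params = {z. snd z > 0} \<inter> {z. gap (fst z) (snd z) 0 > 0}" by (auto simp: params_def)
  moreover have "open {z::real \<times> real. gap (fst z) (snd z) 0 > 0}"
    unfolding gap_def by (intro open_Collect_less continuous_intros) simp_all
  moreover have "open {z::real \<times> real. snd z > 0}" by (intro open_Collect_less continuous_intros)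
  ultimately show ?thesis by auto
qed

text \<open>
  For fixed \<open>m\<close> the admissible \<open>h\<close> form a symmetric interval, and these intervals are not empty exactly for
  \<open>m\<close> in an interval; thus \<open>params\<close> is the image of a rectangle.
\<close>

lemma connected_params: "connected params"
proof -
  let ?a = "P 0" and ?b = "(p1 0)\<^sup>2 / 4"
  define J where "J = {m. 0 < m \<and> m\<^sup>2 * ?b < ?a}"
  define F where "F = (\<lambda>(s, m). (s * sqrt (m\<^sup>2 * ?a - m ^ 4 * ?b), m) :: real \<times> real)"
  have cJ: "connected J"
    unfolding connected_iff_interval
  proof (intro allI impI ballI)
    fix u v w assume u: "u \<in> J" and w: "v \<in> J" and v: "u \<le> w" "w \<le> v"
    have "w\<^sup>2 \<le> v\<^sup>2" using u v by (intro power_mono) (auto simp: J_def)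
    then have "w\<^sup>2 * ?b \<le> v\<^sup>2 * ?b" by (intro mult_right_mono) auto
    then show "w \<in> J" using u v w by (auto simp: J_def)
  qed
  have pos: "m\<^sup>2 * ?a - m ^ 4 * ?b > 0" if "m \<in> J" for m
  proof -
    have "m\<^sup>2 * ?a - m ^ 4 * ?b = m\<^sup>2 * (?a - m\<^sup>2 * ?b)" by (simp add: power2_eq_square algebra_simps power4_eq_xxxx)
    then show ?thesis using that by (simp add: J_def)
  qed
  have "params = F ` ({-1<..<1} \<times> J)"
  proof (intro equalityI subsetI)
    fix z assume z: "z \<in> params"
    obtain h m where zz: "z = (h, m)" by (cases z)
    have m: "m > 0" and g: "h\<^sup>2 < m\<^sup>2 * ?a - m ^ 4 * ?b" using z by (auto simp: zz params_def gap_def)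
    then have q: "m\<^sup>2 * ?a - m ^ 4 * ?b > 0" using zero_le_power2[of h] by linarith
    have "m\<^sup>2 * (?a - m\<^sup>2 * ?b) > 0" using q by (simp add: power2_eq_square algebra_simps power4_eq_xxxx)
    then have mJ: "m \<in> J" using m by (simp add: J_def zero_less_mult_iff)
    let ?q = "sqrt (m\<^sup>2 * ?a - m ^ 4 * ?b)"
    have "\<bar>h\<bar> < ?q" using g by (simp add: real_less_rsqrt)
    then have "h / ?q \<in> {-1<..<1}" using q by (auto simp: abs_less_iff field_simps)
    moreover have "z = F (h / ?q, m)" using q by (simp add: zz F_def)
    ultimately show "z \<in> F ` ({-1<..<1} \<times> J)" using mJ by blast
  next
    fix z assume "z \<in> F ` ({-1<..<1} \<times> J)"
    then obtain s m where s: "s \<in> {-1<..<1}" "m \<in> J" "z = F (s, m)" by auto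
    have "\<bar>s\<bar> < 1" using s(1) by (auto simp: abs_less_iff)
    then have "s\<^sup>2 < 1" by (simp add: abs_square_less_1)
    then have "s\<^sup>2 * (m\<^sup>2 * ?a - m ^ 4 * ?b) < 1 * (m\<^sup>2 * ?a - m ^ 4 * ?b)" using pos[OF s(2)] by (rule mult_strict_right_mono)
    moreover have "gap (s * sqrt (m\<^sup>2 * ?a - m ^ 4 * ?b)) m 0 = (m\<^sup>2 * ?a - m ^ 4 * ?b) - s\<^sup>2 * (m\<^sup>2 * ?a - m ^ 4 * ?b)"
      using pos[OF s(2)] by (simp add: gap_def power_mult_distrib)
    ultimately have "gap (s * sqrt (m\<^sup>2 * ?a - m ^ 4 * ?b)) m 0 > 0" by (simp only: diff_gt_0_iff_gt mult_1)
    then show "z \<in> params" using s by (simp add: params_def F_def J_def)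
  qed
  moreover have "continuous_on ({-1<..<1} \<times> J) F"
    unfolding F_def case_prod_unfold by (intro continuous_intros)
  ultimately show ?thesis
    using connected_continuous_image[of "{-1<..<1} \<times> J" F] cJ connected_Times[OF connected_Ioo cJ] by metis
qed

text \<open>
  \<open>safe\<close> is a radius, continuous in the parameters, on which they are admissible: the distance to the
  complement of the open set of admissible triples.
\<close>

definition adm :: "((real \<times> real) \<times> real) set"
  where "adm = {((h, m), x). m > 0 \<and> x \<in> {-R<..<R} \<and> gap h m x > 0}"

definition safe :: "real \<Rightarrow> real \<Rightarrow> real"
  where "safe h m = infdist ((h, m), 0) (- adm)"

lemma continuous_PR: "continuous_on (UNIV \<times> {-R<..<R}) (\<lambda>z. P (snd z))" "continuous_on (UNIV \<times> {-R<..<R}) (\<lambda>z. p1 (snd z))"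
  by (auto intro!: continuous_on_compose2[OF smooth_on_continuous[OF sP]] continuous_on_compose2[OF smooth_on_continuous[OF sp]] continuous_intros)

lemma open_adm: "open adm"
proof -
  let ?U = "UNIV \<times> {-R<..<R} :: ((real \<times> real) \<times> real) set"
  have "continuous_on ?U (\<lambda>z. gap (fst (fst z)) (snd (fst z)) (snd z))"
    unfolding gap_def by (intro continuous_intros continuous_PR) simp_all
  then have "open (?U \<inter> (\<lambda>z. gap (fst (fst z)) (snd (fst z)) (snd z)) -` {0<..})"
    by (intro continuous_open_preimage open_Times) auto
  moreover have "open {z::(real \<times> real) \<times> real. snd (fst z) > 0}" by (intro open_Collect_less continuous_intros)
  moreover have "adm = (?U \<inter> (\<lambda>z. gap (fst (fst z)) (snd (fst z)) (snd z)) -` {0<..}) \<inter> {z. snd (fst z) > 0}"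
    by (auto simp: adm_def)
  ultimately show ?thesis by auto
qed

lemma compl_adm_ne: "((h, m), R) \<in> - adm" by (auto simp: adm_def)

lemma safe_pos: "(h, m) \<in> params \<Longrightarrow> safe h m > 0"
proof -
  assume p: "(h, m) \<in> params"
  have "((h, m), 0) \<in> adm" using p R by (auto simp: adm_def params_def)
  then show ?thesis unfolding safe_def
    using in_closed_iff_infdist_zero[of "- adm" "((h, m), 0)"] open_adm compl_adm_ne[of h m] infdist_nonneg[of "((h, m), 0)" "- adm"]
    by (metis ComplD closed_Compl empty_iff order_le_less)
qed

lemma safe_adm:
  assumes "\<bar>x\<bar> < safe h m" shows "((h, m), x) \<in> adm"
proof (rule ccontr)
  assume "((h, m), x) \<notin> adm"
  then have "infdist ((h, m), 0) (- adm) \<le> dist ((h, m), 0) ((h, m), x)" by (intro infdist_le) simp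
  then show False using assms by (simp add: safe_def dist_prod_def dist_real_def)
qed

lemma safe_le: "safe h m \<le> R"
proof -
  have "infdist ((h, m), 0) (- adm) \<le> dist ((h, m), 0) ((h, m), R)" by (intro infdist_le compl_adm_ne)
  then show ?thesis using R by (simp add: safe_def dist_prod_def dist_real_def)
qed

lemma continuous_safe: "continuous_on S (\<lambda>z. safe (fst z) (snd z))"
  unfolding safe_def by (intro continuous_on_infdist continuous_intros)

lemma continuous_family:
  "continuous_on adm (\<lambda>z. rad (fst (fst z)) (snd (fst z)) (snd z))"
  "continuous_on {z. \<bar>snd z\<bar> < safe (fst (fst z)) (snd (fst z))} (\<lambda>z. hgt (fst (fst z)) (snd (fst z)) (snd z))"
  "continuous_on {z. \<bar>snd z\<bar> < safe (fst (fst z)) (snd (fst z))} (\<lambda>z. ang (fst (fst z)) (snd (fst z)) (snd z))"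
proof -
  have sub: "adm \<subseteq> UNIV \<times> {-R<..<R}" by (auto simp: adm_def)
  note cP = continuous_on_subset[OF continuous_PR(1) sub] continuous_on_subset[OF continuous_PR(2) sub]
  show "continuous_on adm (\<lambda>z. rad (fst (fst z)) (snd (fst z)) (snd z))"
    unfolding rad_def by (intro continuous_intros cP)
  have ne: "(snd (fst z))\<^sup>2 * P (snd z) - (fst (fst z))\<^sup>2 \<noteq> 0" "(snd (fst z))\<^sup>2 * P (snd z) \<noteq> 0" if "z \<in> adm" for z
    using that gap_imp[of "fst (fst z)" "snd (fst z)" "snd z"] Ppos[of "snd z"] by (auto simp: adm_def)
  have ch: "continuous_on adm (\<lambda>z. hgt1 (fst (fst z)) (snd (fst z)) (snd z))"
    unfolding hgt1_def gap_def by (intro continuous_intros cP ballI ne) simp_all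
  have ca: "continuous_on adm (\<lambda>z. ang1 (fst (fst z)) (snd (fst z)) (snd z))"
    unfolding ang1_def by (intro continuous_intros cP ch ballI ne)
  let ?U = "{z. \<bar>snd z\<bar> < safe (fst (fst z)) (snd (fst z))}"
  have avgc: "continuous_on ?U (\<lambda>z. snd z ^ Suc N * avg N (e (fst (fst z)) (snd (fst z))) (snd z))"
    if e: "continuous_on adm (\<lambda>z. e (fst (fst z)) (snd (fst z)) (snd z))" for e :: "real \<Rightarrow> real \<Rightarrow> real \<Rightarrow> real"
  proof -
    have in_adm: "(fst z, t * snd z) \<in> adm" if "z \<in> ?U" "t \<in> {0..1}" for z t
    proof -
      have "\<bar>t * snd z\<bar> \<le> 1 * \<bar>snd z\<bar>" unfolding abs_mult using that(2) by (intro mult_right_mono) auto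
      then show ?thesis using that(1) safe_adm[of "t * snd z" "fst (fst z)" "snd (fst z)"] by simp
    qed
    have "continuous_on (?U \<times> {0..1}) (\<lambda>y. snd y ^ N * e (fst (fst (fst y))) (snd (fst (fst y))) (snd y * snd (fst y)))"
    proof (intro continuous_on_mult continuous_on_power continuous_on_snd continuous_on_id)
      have "continuous_on (?U \<times> {0..1}) (\<lambda>y. (\<lambda>z. e (fst (fst z)) (snd (fst z)) (snd z)) (fst (fst y), snd y * snd (fst y)))"
        by (rule continuous_on_compose2[OF e]) (use in_adm in \<open>auto intro!: continuous_intros\<close>)
      then show "continuous_on (?U \<times> {0..1}) (\<lambda>y. e (fst (fst (fst y))) (snd (fst (fst y))) (snd y * snd (fst y)))" by simp
    qed
    then have "continuous_on (?U \<times> cbox 0 1) (\<lambda>(z, t). t ^ N * e (fst (fst z)) (snd (fst z)) (t * snd z))"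
      by (simp add: case_prod_unfold)
    from integral_continuous_on_param[OF this]
    have "continuous_on ?U (\<lambda>z. avg N (e (fst (fst z)) (snd (fst z))) (snd z))" by (simp add: avg_def)
    then show ?thesis by (intro continuous_intros)
  qed
  show "continuous_on ?U (\<lambda>z. hgt (fst (fst z)) (snd (fst z)) (snd z))" unfolding hgt_def by (rule avgc[OF ch])
  show "continuous_on ?U (\<lambda>z. ang (fst (fst z)) (snd (fst z)) (snd z))" unfolding ang_def by (rule avgc[OF ca])
qed

end

section \<open>A two-parameter family on a common domain\<close>

text \<open>
  The odd square root of the fractional linear map \<open>t \<mapsto> a t/(b + c t)\<close> of \<open>t = x\<^sup>2\<close>; its inverse is of the same
  form.
\<close>

definition rescale :: "real \<Rightarrow> real \<Rightarrow> real \<Rightarrow> real \<Rightarrow> real"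
  where "rescale a b c x = x * (sqrt a / sqrt (b + c * x\<^sup>2))"

lemma rescale_square:
  assumes "a > 0" "b + c * x\<^sup>2 > 0"
  shows "(rescale a b c x)\<^sup>2 = a * x\<^sup>2 / (b + c * x\<^sup>2)"
  using assms by (simp add: rescale_def power_mult_distrib power_divide)

lemma rescale_inverse:
  assumes a: "a > 0" and b: "b > 0" and q: "b + c * x\<^sup>2 > 0"
  shows "rescale b a (- c) (rescale a b c x) = x"
proof -
  let ?q = "b + c * x\<^sup>2"
  have e: "a + - c * (rescale a b c x)\<^sup>2 = a * b / ?q"
    unfolding rescale_square[OF a q] using q by (simp add: field_simps)
  have "sqrt b / sqrt (a + - c * (rescale a b c x)\<^sup>2) = sqrt ?q / sqrt a"
    unfolding e real_sqrt_divide real_sqrt_mult using a b q by simp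
  then have "rescale b a (- c) (rescale a b c x) = rescale a b c x * (sqrt ?q / sqrt a)" by (simp only: rescale_def[of b a])
  also have "\<dots> = x" using a q by (simp add: rescale_def)
  finally show ?thesis .
qed

lemma rescale_deriv:
  assumes a: "a > 0" and q: "b + c * x\<^sup>2 > 0"
  shows "(rescale a b c has_real_derivative sqrt a * b / (sqrt (b + c * x\<^sup>2) * (b + c * x\<^sup>2))) (at x)"
proof -
  let ?q = "b + c * x\<^sup>2"
  have dq: "((\<lambda>x. b + c * x\<^sup>2) has_real_derivative 2 * c * x) (at x)" by (auto intro!: derivative_eq_intros)
  have ds: "((\<lambda>x. sqrt (b + c * x\<^sup>2)) has_real_derivative inverse (sqrt ?q) / 2 * (2 * c * x)) (at x)"
    by (rule DERIV_chain2[where f=sqrt and x=x, OF DERIV_real_sqrt[OF q] dq])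
  have "((\<lambda>x. (x * sqrt a) / sqrt (b + c * x\<^sup>2)) has_real_derivative
      (sqrt a * sqrt ?q - (x * sqrt a) * (inverse (sqrt ?q) / 2 * (2 * c * x))) / (sqrt ?q * sqrt ?q)) (at x)"
    by (rule DERIV_divide[OF _ ds]) (use q in \<open>auto intro!: derivative_eq_intros\<close>)
  moreover have "(sqrt a * sqrt ?q - (x * sqrt a) * (inverse (sqrt ?q) / 2 * (2 * c * x))) / (sqrt ?q * sqrt ?q)
      = sqrt a * b / (sqrt ?q * ?q)"
  proof -
    define t where "t = sqrt ?q"
    have t: "t > 0" "t * t = b + c * x\<^sup>2" using q by (simp_all add: t_def)
    have "sqrt a * t - (x * sqrt a) * (inverse t / 2 * (2 * c * x)) = sqrt a * (t * t - c * x\<^sup>2) / t"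
      using t(1) by (simp add: field_simps power2_eq_square)
    also have "t * t - c * x\<^sup>2 = b" using t(2) by simp
    finally show ?thesis unfolding t_def[symmetric] t(2)[symmetric] using t(1) by (simp add: field_simps)
  qed
  ultimately show ?thesis by (simp add: rescale_def[abs_def])
qed

lemma smooth_rescale:
  assumes "a > 0" "open S" "\<And>x. x \<in> S \<Longrightarrow> b + c * x\<^sup>2 > 0"
  shows "smooth_on S (\<lambda>x. sqrt a / sqrt (b + c * x\<^sup>2))" "smooth_on S (rescale a b c)"
proof -
  have q: "smooth_on S (\<lambda>x. sqrt (b + c * x\<^sup>2))" by (intro smooth_on_sqrt smooth_intros assms)
  show 1: "smooth_on S (\<lambda>x. sqrt a / sqrt (b + c * x\<^sup>2))"
    by (rule smooth_on_divide[OF assms(2) q]) (use assms(3) in \<open>force intro: smooth_intros\<close>)+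
  show "smooth_on S (rescale a b c)" unfolding rescale_def[abs_def] by (intro smooth_on_mult assms(2) smooth_on_id 1)
qed

lemma edge_profile_reparam:
  assumes ep: "edge_profile N B k \<rho> r1 \<beta> b1 \<zeta> l1" and d: "d > 0"
    and j: "smooth_on {-d<..<d} j" "\<And>x. x \<in> {-d<..<d} \<Longrightarrow> j x > 0"
    and \<psi>: "\<And>x. \<psi> x = x * j x" "\<And>x. x \<in> {-d<..<d} \<Longrightarrow> \<psi> x \<in> {-B<..<B}"
    and d\<psi>: "\<And>x. x \<in> {-d<..<d} \<Longrightarrow> (\<psi> has_real_derivative \<psi>1 x) (at x)"
    and s\<psi>1: "smooth_on {-d<..<d} \<psi>1" "\<And>x. x \<in> {-d<..<d} \<Longrightarrow> \<psi>1 x > 0"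
  shows "edge_profile N d k (\<lambda>x. \<rho> (\<psi> x)) (\<lambda>x. j x ^ N * \<psi>1 x * r1 (\<psi> x)) (\<lambda>x. \<beta> (\<psi> x)) (\<lambda>x. j x ^ N * \<psi>1 x * b1 (\<psi> x))
    (\<lambda>x. \<zeta> (\<psi> x)) (\<lambda>x. j x ^ N * \<psi>1 x * l1 (\<psi> x))"
proof -
  interpret edge_profile N B k 0 \<rho> r1 \<beta> b1 \<zeta> l1 by (rule ep)
  let ?I = "{-d<..<d}"
  have s\<psi>: "smooth_on ?I \<psi>" unfolding \<psi>(1)[abs_def] by (intro smooth_on_mult smooth_on_id j(1)) simp
  have comp: "smooth_on ?I (\<lambda>x. e (\<psi> x))" if "smooth_on {-B<..<B} e" for e :: "real \<Rightarrow> real"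
    by (rule smooth_on_compose2[OF that _ _ s\<psi>]) (use \<psi>(2) in auto)
  have fac: "smooth_on ?I (\<lambda>x. j x ^ N * \<psi>1 x * e (\<psi> x))" if "smooth_on {-B<..<B} e" for e :: "real \<Rightarrow> real"
    by (intro smooth_on_mult smooth_on_power j(1) s\<psi>1(1) comp that) simp_all
  have der: "((\<lambda>x. g (\<psi> x)) has_real_derivative x ^ N * (j x ^ N * \<psi>1 x * e (\<psi> x))) (at x)"
    if "\<And>w. w \<in> {-B<..<B} \<Longrightarrow> (g has_real_derivative w ^ N * e w) (at w)" "x \<in> ?I" for g e x
    by (rule DERIV_cong[OF DERIV_chain2[where f=g and g=\<psi> and x=x, OF that(1)[OF \<psi>(2)[OF that(2)]] d\<psi>[OF that(2)]]])
       (simp add: \<psi>(1) power_mult_distrib mult_ac)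
  show ?thesis
  proof
    show "j w ^ N * \<psi>1 w * l1 (\<psi> w) > 0" if "w \<in> ?I" for w
      using l1pos[OF \<psi>(2)[OF that]] j(2)[OF that] s\<psi>1(2)[OF that] by simp
    show "\<rho> (\<psi> w) > 0" if "w \<in> ?I" for w by (rule \<rho>pos[OF \<psi>(2)[OF that]])
  qed (intro N d k fac sr sb sl der d\<rho> d\<beta> d\<zeta>; assumption)+
qed

lemma (in bour_profile) G_inner:
  assumes "w \<in> plane_box r"
  shows "frechet_derivative G (at w) a \<bullet> frechet_derivative G (at w) b =
    a$1 * b$1 * w$1 ^ (2 * N) + a$2 * b$2 * (k\<^sup>2 * ((\<rho> (w$1))\<^sup>2 + h\<^sup>2))"
  unfolding G_metric[OF assms] inner_frame unit[OF box1[OF assms]] orth[OF box1[OF assms]] by simp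

lemma euclidean_isometry_derivative:
  fixes G :: "'a::real_normed_vector \<Rightarrow> real^3"
  assumes T: "euclidean_isometry T" and G: "G differentiable (at w)"
  obtains L where "orthogonal_transformation L"
    "frechet_derivative (\<lambda>w. T (G w)) (at w) = (\<lambda>v. L (frechet_derivative G (at w) v))"
    "(\<lambda>w. T (G w)) differentiable (at w)"
proof -
  obtain L s where L: "orthogonal_transformation L" "\<And>y. T y = L y + s" by (rule euclidean_isometryE[OF T]) (rule that)
  have bl: "bounded_linear L" using L(1) orthogonal_transformation_linear linear_conv_bounded_linear by blast
  have "(G has_derivative frechet_derivative G (at w)) (at w)" using G frechet_derivative_works by blast
  then have "((\<lambda>w. L (G w)) has_derivative (\<lambda>v. L (frechet_derivative G (at w) v))) (at w)"
    by (rule bounded_linear.has_derivative[OF bl])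
  from has_derivative_add[OF this has_derivative_const]
  have "((\<lambda>w. T (G w)) has_derivative (\<lambda>v. L (frechet_derivative G (at w) v))) (at w)" by (simp add: L(2))
  then show ?thesis using that[OF L(1)] frechet_derivative_at[symmetric] differentiableI by metis
qed

lemma euclidean_isometry_derivative_facts:
  fixes G :: "real^2 \<Rightarrow> real^3"
  assumes T: "euclidean_isometry T" and G: "G differentiable (at w)"
  shows "frechet_derivative (\<lambda>w. T (G w)) (at w) a \<bullet> frechet_derivative (\<lambda>w. T (G w)) (at w) b =
      frechet_derivative G (at w) a \<bullet> frechet_derivative G (at w) b"
    "inj (frechet_derivative (\<lambda>w. T (G w)) (at w)) \<longleftrightarrow> inj (frechet_derivative G (at w))"
    "(\<lambda>w. T (G w)) differentiable (at w)"
proof -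
  obtain L where L: "orthogonal_transformation L"
    "frechet_derivative (\<lambda>w. T (G w)) (at w) = (\<lambda>v. L (frechet_derivative G (at w) v))"
    "(\<lambda>w. T (G w)) differentiable (at w)" by (rule euclidean_isometry_derivative[OF assms]) (rule that)
  show "frechet_derivative (\<lambda>w. T (G w)) (at w) a \<bullet> frechet_derivative (\<lambda>w. T (G w)) (at w) b =
      frechet_derivative G (at w) a \<bullet> frechet_derivative G (at w) b"
    unfolding L(2) by (rule orthogonal_transformation_inner[OF L(1)])
  have il: "inj L" by (rule orthogonal_transformation_inj[OF L(1)])
  show "inj (frechet_derivative (\<lambda>w. T (G w)) (at w)) \<longleftrightarrow> inj (frechet_derivative G (at w))"
    unfolding L(2) inj_def inj_eq[OF il] ..
  show "(\<lambda>w. T (G w)) differentiable (at w)" by (rule L(3))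
qed

lemma vector3_axes: "(vector [x, y, z] :: real^3) = x *\<^sub>R axis 1 1 + y *\<^sub>R axis 2 1 + z *\<^sub>R axis 3 1"
  by (simp add: vec3_eq_iff axis_def)

lemma diffeo_cong:
  assumes A: "smooth_atlas A" and B: "smooth_atlas B" and D: "open D" and d: "diffeo A B D E \<phi>"
    and eq: "\<And>q. q \<in> D \<Longrightarrow> \<phi> q = \<psi> q"
  shows "diffeo A B D E \<psi>"
proof -
  have "inv_into D \<phi> = inv_into D \<psi>"
    unfolding inv_into_def by (intro ext arg_cong[where f=Eps]) (use eq in auto)
  then show ?thesis
    using d smooth_map_cong[OF A B D _ eq] bij_betw_cong[of D \<phi> \<psi> E] eq by (simp add: diffeo_def)
qed

text \<open>
  A given edge \<open>f\<close> in natural coordinates, with parameters \<open>(h0, m0)\<close>, is embedded in a family of maps on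
  the common domain \<open>D\<close>.
\<close>

locale edge_family = metric_data N R P p1 + coords A D0 "plane_box R" \<kappa>
  for N R P p1 and A :: "('a::topological_space, real^2) chart set" and D0 \<kappa> +
  fixes h0 m0 p \<Sigma> f
  assumes or: "oriented_atlas A" and par0: "(h0, m0) \<in> params" and p: "p \<in> D0" "\<kappa> p = 0"
    and \<Sigma>: "euclidean_isometry \<Sigma>"
    and f: "\<And>q. q \<in> D0 \<Longrightarrow> f q = \<Sigma> (helix_surface (1 / m0) h0 (rad h0 m0) (ang h0 m0) (hgt h0 m0) (\<kappa> q))"
    and gap0: "\<And>x. x \<in> {-R<..<R} \<Longrightarrow> gap h0 m0 x > 0"
begin

text \<open>
  On \<open>D\<close> the first coordinate runs through \<open>(-\<delta>, \<delta>)\<close>. The map \<open>psi h m\<close> sends this interval into the one of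
  radius \<open>min (safe h m) \<delta>\<close>, on which the member \<open>(h, m)\<close> exists, and it fixes \<open>0\<close> and \<open>\<plusminus>eps h m\<close>, where \<open>eps\<close> is
  half of that radius and \<open>K = 4 eps\<^sup>2\<close>. Hence it maps \<open>(-eps, eps)\<close> onto itself, with the inverse \<open>phi h m\<close>; the
  coefficients are chosen for these properties. For \<open>(h0, m0)\<close> one has \<open>s = 0\<close>, and \<open>psi\<close> is the identity.
\<close>

definition \<delta> :: real where "\<delta> = safe h0 m0"
definition D where "D = D0 \<inter> \<kappa> -` plane_box \<delta>"
definition K where "K h m = (min (safe h m) \<delta>)\<^sup>2"
definition s where "s h m = 1 - K h m / \<delta>\<^sup>2"
definition psi where "psi h m = rescale ((3 + s h m) * K h m) (3 * K h m) (4 * s h m)"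
definition phi where "phi h m = rescale (3 * K h m) ((3 + s h m) * K h m) (- (4 * s h m))"
definition eps where "eps h m = min (safe h m) \<delta> / 2"
definition F where "F h m q = helix_surface (1 / m) h (\<lambda>x. rad h m (psi h m x)) (\<lambda>x. ang h m (psi h m x))
  (\<lambda>x. hgt h m (psi h m x)) (\<kappa> q)"

lemma \<delta>: "\<delta> > 0" "\<delta> \<le> R" using safe_pos[OF par0] safe_le by (auto simp: \<delta>_def)

sublocale CD: coords A D "plane_box \<delta>" \<kappa>
  unfolding D_def by (rule restrict[OF open_plane_box plane_box_mono[OF \<delta>(2)]])

lemma D_sub: "D \<subseteq> D0" and D_p: "p \<in> D"
  using p \<delta>(1) by (auto simp: D_def plane_box_def)

context
  fixes h m assumes par: "(h, m) \<in> params"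
begin

lemma m_pos: "m > 0" using par by (simp add: params_def)

lemma KS: "K h m > 0" "0 \<le> s h m" "s h m < 1" "K h m = (1 - s h m) * \<delta>\<^sup>2" "K h m = 4 * (eps h m)\<^sup>2" "eps h m > 0"
proof -
  have m: "min (safe h m) \<delta> > 0" using safe_pos[OF par] \<delta>(1) by simp
  then show K: "K h m > 0" unfolding K_def by (rule zero_less_power)
  show "K h m = 4 * (eps h m)\<^sup>2" by (simp add: K_def eps_def power_divide)
  show "eps h m > 0" using m by (simp add: eps_def)
  have "K h m \<le> \<delta>\<^sup>2" unfolding K_def using m by (intro power_mono) auto
  then show "0 \<le> s h m" using \<delta>(1) by (simp add: s_def)
  show "s h m < 1" using K \<delta>(1) by (simp add: s_def)
  show "K h m = (1 - s h m) * \<delta>\<^sup>2" using \<delta>(1) by (simp add: s_def)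
qed

lemma psi_den: "3 * K h m + 4 * s h m * x\<^sup>2 > 0" and psi_num: "(3 + s h m) * K h m > 0"
  using KS by (auto intro: add_pos_nonneg)

lemma psi_range: "\<bar>x\<bar> < \<delta> \<Longrightarrow> \<bar>psi h m x\<bar> < min (safe h m) \<delta>"
proof -
  assume x: "\<bar>x\<bar> < \<delta>"
  have "\<bar>x\<bar>\<^sup>2 < \<delta>\<^sup>2" by (rule power_strict_mono[OF x]) auto
  then have "3 * ((1 - s h m) * x\<^sup>2) < 3 * ((1 - s h m) * \<delta>\<^sup>2)" using KS(3) by simp
  then have "(3 + s h m) * x\<^sup>2 < 3 * K h m + 4 * s h m * x\<^sup>2" unfolding KS(4) by (simp add: algebra_simps)
  then have "K h m * ((3 + s h m) * x\<^sup>2) < K h m * (3 * K h m + 4 * s h m * x\<^sup>2)" using KS(1) by simp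
  then have "(psi h m x)\<^sup>2 < K h m"
    unfolding psi_def rescale_square[OF psi_num psi_den] using psi_den[of x] by (simp add: pos_divide_less_eq mult_ac)
  then have "\<bar>psi h m x\<bar>\<^sup>2 < (min (safe h m) \<delta>)\<^sup>2" by (simp add: K_def)
  then show ?thesis by (rule power2_less_imp_less) (use safe_pos[OF par] \<delta>(1) in auto)
qed

lemma psi_eps: "\<bar>x\<bar> < eps h m \<Longrightarrow> \<bar>psi h m x\<bar> < eps h m"
  and phi_eps: "\<bar>x\<bar> < eps h m \<Longrightarrow> \<bar>phi h m x\<bar> < eps h m"
  and phi_den: "\<bar>x\<bar> < eps h m \<Longrightarrow> (3 + s h m) * K h m + - (4 * s h m) * x\<^sup>2 > 0"
proof -
  assume x: "\<bar>x\<bar> < eps h m"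
  have "\<bar>x\<bar>\<^sup>2 < (eps h m)\<^sup>2" by (rule power_strict_mono[OF x]) auto
  then have x4: "4 * x\<^sup>2 < K h m" unfolding KS(5) by simp
  have sx: "s h m * (4 * x\<^sup>2) \<le> s h m * K h m" using x4 KS(2) by (intro mult_left_mono) auto
  then show den: "(3 + s h m) * K h m + - (4 * s h m) * x\<^sup>2 > 0" using KS(1) by (simp add: algebra_simps)
  have less: "\<bar>y\<bar> < eps h m" if "4 * y\<^sup>2 < K h m" for y
  proof -
    have "\<bar>y\<bar>\<^sup>2 < (eps h m)\<^sup>2" using that unfolding KS(5) by simp
    then show ?thesis by (rule power2_less_imp_less) (use KS(6) in simp)
  qed
  have "4 * ((3 + s h m) * K h m * x\<^sup>2) < K h m * (3 * K h m + 4 * s h m * x\<^sup>2)"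
  proof -
    have "3 * (4 * x\<^sup>2) < 3 * K h m" using x4 by simp
    then have "4 * ((3 + s h m) * x\<^sup>2) < 3 * K h m + 4 * s h m * x\<^sup>2" by (simp add: algebra_simps)
    then have "K h m * (4 * ((3 + s h m) * x\<^sup>2)) < K h m * (3 * K h m + 4 * s h m * x\<^sup>2)" using KS(1) by simp
    then show ?thesis by (simp add: mult_ac)
  qed
  then have "4 * (psi h m x)\<^sup>2 < K h m"
    unfolding psi_def rescale_square[OF psi_num psi_den] using psi_den[of x] by (simp add: pos_divide_less_eq mult_ac)
  then show "\<bar>psi h m x\<bar> < eps h m" by (rule less)
  have K3: "3 * K h m > 0" using KS(1) by simp
  have "4 * (3 * K h m * x\<^sup>2) < K h m * ((3 + s h m) * K h m + - (4 * s h m) * x\<^sup>2)"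
  proof -
    have "(3 + s h m) * (4 * x\<^sup>2) < (3 + s h m) * K h m" using x4 KS(2) by (intro mult_strict_left_mono) auto
    then have "4 * (3 * x\<^sup>2) < (3 + s h m) * K h m + - (4 * s h m) * x\<^sup>2" by (simp add: algebra_simps)
    then have "K h m * (4 * (3 * x\<^sup>2)) < K h m * ((3 + s h m) * K h m + - (4 * s h m) * x\<^sup>2)" using KS(1) by (rule mult_strict_left_mono)
    then show ?thesis by (simp add: mult_ac)
  qed
  then have "4 * (phi h m x)\<^sup>2 < K h m"
    unfolding phi_def rescale_square[OF K3 den] using den by (simp add: pos_divide_less_eq mult_ac)
  then show "\<bar>phi h m x\<bar> < eps h m" by (rule less)
qed

lemma phi_psi: "phi h m (psi h m x) = x" and psi_phi: "\<bar>x\<bar> < eps h m \<Longrightarrow> psi h m (phi h m x) = x"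
proof -
  have K3: "3 * K h m > 0" using KS(1) by simp
  show "phi h m (psi h m x) = x"
    unfolding phi_def psi_def by (rule rescale_inverse[OF psi_num K3 psi_den])
  show "psi h m (phi h m x) = x" if "\<bar>x\<bar> < eps h m"
    using rescale_inverse[OF K3 psi_num phi_den[OF that]] unfolding phi_def psi_def by simp
qed

lemma smooth_psi: "smooth_on S (psi h m)" if "open S"
  unfolding psi_def by (rule smooth_rescale(2)[OF psi_num that psi_den])

lemma smooth_phi: "smooth_on {-eps h m<..<eps h m} (phi h m)"
  unfolding phi_def by (rule smooth_rescale(2)) (use KS(1) phi_den in auto)

lemma psi_0: "psi h m 0 = 0" and phi_0: "phi h m 0 = 0"
  by (simp_all add: psi_def phi_def rescale_def)

lemma member_bour: "bour_profile N (safe h m) (1 / m) h (rad h m) (rad1 h m) (ang h m) (ang1 h m) (hgt h m) (hgt1 h m)"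
proof (rule family_bour_profile[OF m_pos safe_pos[OF par] safe_le])
  fix x assume "x \<in> {- safe h m<..<safe h m}"
  then have "\<bar>x\<bar> < safe h m" by auto
  from safe_adm[OF this] show "gap h m x > 0" by (simp add: adm_def)
qed

lemma member_profile: obtains r1 b1 l1 where
  "edge_profile N \<delta> (1 / m) (\<lambda>x. rad h m (psi h m x)) r1 (\<lambda>x. ang h m (psi h m x)) b1 (\<lambda>x. hgt h m (psi h m x)) l1"
proof -
  let ?j = "\<lambda>x. sqrt ((3 + s h m) * K h m) / sqrt (3 * K h m + 4 * s h m * x\<^sup>2)"
  let ?d = "\<lambda>x. sqrt ((3 + s h m) * K h m) * (3 * K h m) / (sqrt (3 * K h m + 4 * s h m * x\<^sup>2) * (3 * K h m + 4 * s h m * x\<^sup>2))"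
  have "edge_profile N (safe h m) (1 / m) (rad h m) (rad1 h m) (ang h m) (ang1 h m) (hgt h m) (hgt1 h m)"
    using member_bour by (simp add: bour_profile_def)
  from edge_profile_reparam[where j="?j" and \<psi>="psi h m" and ?\<psi>1.0="?d", OF this \<delta>(1)]
  show ?thesis
  proof (rule that)
    show "smooth_on {-\<delta><..<\<delta>} ?j" by (rule smooth_rescale(1)[OF psi_num _ psi_den]) simp
    show "?j x > 0" for x using psi_num psi_den[of x] by simp
    show "psi h m x = x * ?j x" for x by (simp add: psi_def rescale_def)
    show "psi h m x \<in> {- safe h m<..<safe h m}" if "x \<in> {-\<delta><..<\<delta>}" for x
      using psi_range[of x] that by (auto simp: abs_less_iff)
    show "(psi h m has_real_derivative ?d x) (at x)" for x
      unfolding psi_def by (rule rescale_deriv[OF psi_num psi_den])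
    show "?d x > 0" for x using psi_num psi_den[of x] KS(1) by simp
    have q: "smooth_on {-\<delta><..<\<delta>} (\<lambda>x. 3 * K h m + 4 * s h m * x\<^sup>2)" by (intro smooth_intros) simp_all
    show "smooth_on {-\<delta><..<\<delta>} ?d"
    proof (rule smooth_on_divide)
      show "smooth_on {-\<delta><..<\<delta>} (\<lambda>x. sqrt (3 * K h m + 4 * s h m * x\<^sup>2) * (3 * K h m + 4 * s h m * x\<^sup>2))"
        by (intro smooth_on_mult smooth_on_sqrt q psi_den) simp_all
      show "sqrt (3 * K h m + 4 * s h m * x\<^sup>2) * (3 * K h m + 4 * s h m * x\<^sup>2) \<noteq> 0" for x using psi_den[of x] by simp
    qed simp_all
  qed
qed

lemma member_generic: "generic_helicoidal_edge (Suc N) A D (F h m)"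
  and member_surface: "surface A D (F h m)"
proof -
  obtain r1 b1 l1 where ep: "edge_profile N \<delta> (1 / m) (\<lambda>x. rad h m (psi h m x)) r1 (\<lambda>x. ang h m (psi h m x)) b1 (\<lambda>x. hgt h m (psi h m x)) l1"
    by (rule member_profile)
  interpret ES: edge_surface N \<delta> "1 / m" h "\<lambda>x. rad h m (psi h m x)" r1 "\<lambda>x. ang h m (psi h m x)" b1 "\<lambda>x. hgt h m (psi h m x)" l1 A D \<kappa>
    using ep CD.coords_axioms by (rule edge_surface.intro)
  have "ES.F = F h m" by (simp add: fun_eq_iff ES.F_def F_def)
  then show "generic_helicoidal_edge (Suc N) A D (F h m)" "surface A D (F h m)"
    using ES.generic_helicoidal_edge_F[OF or] ES.surface_F by simp_all
qed

end

lemma base_bour: "bour_profile N R (1 / m0) h0 (rad h0 m0) (rad1 h0 m0) (ang h0 m0) (ang1 h0 m0) (hgt h0 m0) (hgt1 h0 m0)"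
  by (rule family_bour_profile[OF m_pos[OF par0] R order_refl gap0])

lemma F_base: "F h0 m0 q = helix_surface (1 / m0) h0 (rad h0 m0) (ang h0 m0) (hgt h0 m0) (\<kappa> q)"
proof -
  have K: "K h0 m0 = \<delta>\<^sup>2" by (simp add: K_def \<delta>_def)
  then have "s h0 m0 = 0" using \<delta>(1) by (simp add: s_def)
  then have "psi h0 m0 x = x" for x using \<delta>(1) by (simp add: psi_def rescale_def K)
  then show ?thesis by (simp add: F_def)
qed

lemma F_continuous: "continuous_on (params \<times> D) (\<lambda>((h, m), q). F h m q)"
proof -
  let ?M = "params \<times> D"
  have cK: "continuous_on ?M (\<lambda>z. K (fst (fst z)) (snd (fst z)))"
    unfolding K_def by (intro continuous_intros continuous_on_compose2[OF continuous_safe[of UNIV], of _ fst]) auto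
  have cs: "continuous_on ?M (\<lambda>z. s (fst (fst z)) (snd (fst z)))"
    unfolding s_def by (intro continuous_intros cK) (use \<delta>(1) in auto)
  have c\<kappa>: "continuous_on ?M (\<lambda>z. \<kappa> (snd z) $ i)" for i
    by (intro continuous_intros continuous_on_compose2[OF smooth_map_continuous[OF CD.\<kappa>D(2)]]) auto
  have q: "3 * K (fst (fst z)) (snd (fst z)) + 4 * s (fst (fst z)) (snd (fst z)) * (\<kappa> (snd z) $ 1)\<^sup>2 > 0" if "z \<in> ?M" for z
    using psi_den that by auto
  define e where "e z = (fst z, psi (fst (fst z)) (snd (fst z)) (\<kappa> (snd z) $ 1))" for z
  have ce: "continuous_on ?M e"
    unfolding e_def psi_def rescale_def by (intro continuous_intros cK cs c\<kappa>) (use q in force)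
  have bx: "\<bar>\<kappa> q $ 1\<bar> < \<delta>" if "q \<in> D" for q using that by (auto simp: D_def plane_box_def)
  have sub: "e ` ?M \<subseteq> {z. \<bar>snd z\<bar> < safe (fst (fst z)) (snd (fst z))}"
    using psi_range bx by (auto simp: e_def)
  have "{z. \<bar>snd z\<bar> < safe (fst (fst z)) (snd (fst z))} \<subseteq> adm"
    using safe_adm by (metis (no_types, lifting) mem_Collect_eq prod.collapse subsetI)
  then have sub': "e ` ?M \<subseteq> adm" using sub by blast
  note c = continuous_on_compose2[OF continuous_family(1) ce sub'] continuous_on_compose2[OF continuous_family(2) ce sub]
    continuous_on_compose2[OF continuous_family(3) ce sub]
  have m: "snd (fst z) \<noteq> 0" if "z \<in> ?M" for z using that m_pos by fastforce
  note c = c[unfolded e_def fst_conv snd_conv]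
  define an where "an z = 1 / snd (fst z) * \<kappa> (snd z) $ 2 +
      ang (fst (fst z)) (snd (fst z)) (psi (fst (fst z)) (snd (fst z)) (\<kappa> (snd z) $ 1))" for z :: "(real \<times> real) \<times> 'a"
  have ca: "continuous_on ?M an" unfolding an_def
    by (intro continuous_on_add continuous_on_mult continuous_on_divide continuous_on_const continuous_on_snd continuous_on_fst
        continuous_on_id c\<kappa> c(3)) (use m in auto)
  have cc: "continuous_on ?M (\<lambda>z. cos (an z))" "continuous_on ?M (\<lambda>z. sin (an z))"
    by (rule continuous_on_compose2[OF _ ca subset_UNIV], intro continuous_intros)+
  have "continuous_on ?M (\<lambda>z. F (fst (fst z)) (snd (fst z)) (snd z))"
    unfolding F_def helix_surface_def vector3_axes an_def[symmetric]
    by (intro continuous_on_add continuous_on_scaleR continuous_on_mult continuous_on_const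
        continuous_on_fst continuous_on_id c ca cc)
  then show ?thesis by (simp add: case_prod_unfold)
qed

text \<open>
  The member \<open>(h, m)\<close> becomes isometric to \<open>f\<close> after the reparametrization of the first coordinate is undone.
\<close>

definition E where "E h m = D0 \<inter> \<kappa> -` plane_box (eps h m)"
definition \<phi> where "\<phi> h m q = inv_into D0 \<kappa> (vector [phi h m (\<kappa> q $ 1), \<kappa> q $ 2])"

lemma eps_le: "eps h m \<le> \<delta>" "eps h m \<le> safe h m" if "(h, m) \<in> params"
  using KS(6)[OF that] by (auto simp: eps_def)

context
  fixes h m assumes par: "(h, m) \<in> params"
begin

lemma coords_E: "coords A (E h m) (plane_box (eps h m)) \<kappa>"
  unfolding E_def by (rule restrict[OF open_plane_box plane_box_mono]) (use eps_le[OF par] \<delta>(2) in linarith)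

lemma E_facts: "open (E h m)" "p \<in> E h m" "E h m \<subseteq> D" "\<phi> h m p = p"
  "\<And>q. q \<in> E h m \<Longrightarrow> \<phi> h m q \<in> E h m"
  "\<And>q. q \<in> E h m \<Longrightarrow> \<kappa> (\<phi> h m q) = vector [phi h m (\<kappa> q $ 1), \<kappa> q $ 2]"
  "\<And>q. q \<in> E h m \<Longrightarrow> F h m (\<phi> h m q) = helix_surface (1 / m) h (rad h m) (ang h m) (hgt h m) (\<kappa> q)"
proof -
  interpret CE: coords A "E h m" "plane_box (eps h m)" \<kappa> by (rule coords_E)
  show "open (E h m)" by (rule CE.D)
  show "p \<in> E h m" using p KS(6)[OF par] by (simp add: E_def plane_box_def)
  show "E h m \<subseteq> D" unfolding E_def D_def using plane_box_mono[OF eps_le(1)[OF par]] by blast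
  have "inv_into D0 \<kappa> (\<kappa> p) = p" by (rule \<kappa>D(5)[OF p(1)])
  moreover have "(vector [0, 0] :: real^2) = 0" by (simp add: vec2_eq_iff)
  ultimately show "\<phi> h m p = p" using p(2) by (simp add: \<phi>_def phi_0[OF par])
  have v: "vector [phi h m (w$1), w$2] \<in> plane_box (eps h m)" if "w \<in> plane_box (eps h m)" for w :: "real^2"
    using that phi_eps[OF par] by (auto simp: plane_box_def)
  have v': "vector [phi h m (\<kappa> q $ 1), \<kappa> q $ 2] \<in> plane_box R" if "q \<in> E h m" for q
    using v[of "\<kappa> q"] that plane_box_mono[of "eps h m" R] eps_le[OF par] \<delta>(2) by (auto simp: E_def)
  show \<kappa>\<phi>: "\<kappa> (\<phi> h m q) = vector [phi h m (\<kappa> q $ 1), \<kappa> q $ 2]" if "q \<in> E h m" for q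
    unfolding \<phi>_def by (rule \<kappa>D(7)[OF v'[OF that]])
  show "\<phi> h m q \<in> E h m" if "q \<in> E h m" for q
  proof -
    have "\<phi> h m q \<in> D0" unfolding \<phi>_def by (rule \<kappa>D(6)[OF v'[OF that]])
    then show ?thesis using \<kappa>\<phi>[OF that] v[of "\<kappa> q"] that by (simp add: E_def)
  qed
  show "F h m (\<phi> h m q) = helix_surface (1 / m) h (rad h m) (ang h m) (hgt h m) (\<kappa> q)" if "q \<in> E h m" for q
    using psi_phi[OF par, of "\<kappa> q $ 1"] that unfolding F_def \<kappa>\<phi>[OF that] by (simp add: helix_surface_def E_def plane_box_def)
qed

lemma \<phi>_diffeo: "diffeo A A (E h m) (E h m) (\<phi> h m)"
proof -
  interpret CE: coords A "E h m" "plane_box (eps h m)" \<kappa> by (rule coords_E)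
  let ?B = "plane_box (eps h m)"
  let ?t = "\<lambda>w::real^2. vector [phi h m (w$1), w$2] :: real^2" and ?t' = "\<lambda>w::real^2. vector [psi h m (w$1), w$2] :: real^2"
  have eE: "inv_into (E h m) \<kappa> w = inv_into D0 \<kappa> w" if "w \<in> ?B" for w
    unfolding E_def by (rule diffeo_restrict(3)[OF A smooth_atlas_euclidean D \<Omega> diffeo open_plane_box plane_box_mono that])
      (use eps_le[OF par] \<delta>(2) in linarith)
  have cm: "smooth_on ?B (\<lambda>w::real^2. e (w$1))" if "smooth_on {-eps h m<..<eps h m} e" for e :: "real \<Rightarrow> real"
    by (rule smooth_on_compose2[OF that open_plane_box]) (auto simp: plane_box_def)
  have st: "smooth_on ?B ?t" "smooth_on ?B ?t'"
    by (intro smooth_on_vector2 cm smooth_phi[OF par] smooth_psi[OF par] smooth_on_nth'; simp)+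
  have tB: "?t w \<in> ?B" "?t' w \<in> ?B" "?t' (?t w) = w" "?t (?t' w) = w" if "w \<in> ?B" for w
    using that phi_eps[OF par] psi_eps[OF par] phi_psi[OF par] psi_phi[OF par] by (auto simp: plane_box_def vec2_eq_iff)
  have s: "smooth_map A A (E h m) (\<lambda>q. inv_into (E h m) \<kappa> (t (\<kappa> q)))"
    if t: "smooth_on ?B t" "\<And>w. w \<in> ?B \<Longrightarrow> t w \<in> ?B" for t
  proof (rule smooth_map_compose[where \<phi>="\<lambda>q. t (\<kappa> q)", OF A smooth_atlas_euclidean A CE.D CE.\<Omega> _ CE.\<kappa>D(3)])
    show "smooth_map A euclidean_atlas (E h m) (\<lambda>q. t (\<kappa> q))"
      by (rule CE.smooth_out[OF CE.D order_refl t(1) open_plane_box]) (use CE.\<kappa>D(4) in blast)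
  qed (use t(2) CE.\<kappa>D(4) in blast)
  have "diffeo A A (E h m) (E h m) (\<lambda>q. inv_into (E h m) \<kappa> (?t (\<kappa> q)))"
  proof (rule diffeoI(1)[OF A A CE.D s[OF st(1) tB(1)] s[OF st(2) tB(2)]])
    fix q assume "q \<in> E h m"
    then have "\<kappa> q \<in> ?B" by (rule CE.\<kappa>D(4))
    note t = tB[OF this]
    show "inv_into (E h m) \<kappa> (?t (\<kappa> q)) \<in> E h m" "inv_into (E h m) \<kappa> (?t' (\<kappa> q)) \<in> E h m"
      using CE.\<kappa>D(6) t by blast+
    show "inv_into (E h m) \<kappa> (?t' (\<kappa> (inv_into (E h m) \<kappa> (?t (\<kappa> q))))) = q"
      unfolding CE.\<kappa>D(7)[OF t(1)] t(3) by (rule CE.\<kappa>D(5)) fact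
    show "inv_into (E h m) \<kappa> (?t (\<kappa> (inv_into (E h m) \<kappa> (?t' (\<kappa> q))))) = q"
      unfolding CE.\<kappa>D(7)[OF t(2)] t(4) by (rule CE.\<kappa>D(5)) fact
  qed
  moreover have "inv_into (E h m) \<kappa> (?t (\<kappa> q)) = \<phi> h m q" if "q \<in> E h m" for q
    unfolding \<phi>_def by (rule eE) (use tB(1) CE.\<kappa>D(4)[OF that] in blast)
  ultimately show ?thesis by (rule diffeo_cong[OF A A CE.D])
qed

lemma member_isometric: "isometric_at A f p D (F h m)"
  unfolding isometric_at_def
proof (intro conjI exI)
  interpret CE: coords A "E h m" "plane_box (eps h m)" \<kappa> by (rule coords_E)
  interpret B0: bour_profile N R "1 / m0" h0 "rad h0 m0" "rad1 h0 m0" "ang h0 m0" "ang1 h0 m0" "hgt h0 m0" "hgt1 h0 m0"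
    by (rule base_bour)
  interpret B1: bour_profile N "safe h m" "1 / m" h "rad h m" "rad1 h m" "ang h m" "ang1 h m" "hgt h m" "hgt1 h m"
    by (rule member_bour[OF par])
  show "surface A D (F h m)" by (rule member_surface[OF par])
  show "open (E h m)" "p \<in> E h m" "E h m \<subseteq> D" "\<phi> h m p = p" by (fact E_facts)+
  show "diffeo A A (E h m) (E h m) (\<phi> h m)" by (rule \<phi>_diffeo)
  note d = diffeoD[OF \<phi>_diffeo]
  have sF: "smooth_map A euclidean_atlas D (F h m)" using member_surface[OF par] by (simp add: surface_def)
  have ED: "\<phi> h m ` E h m \<subseteq> D" using E_facts(3,5) by blast
  show "metric_pullback A (E h m) (\<phi> h m) f (F h m)"
  proof (rule first_fundamental_pullback_iff[OF A d(2) sF CE.D ED, THEN iffD2], intro ballI impI allI)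
    fix q c a b assume q: "q \<in> E h m" and c: "c \<in> A" "q \<in> fst c"
    obtain U x where c': "c = (U, x)" by (cases c)
    have U: "(U, x) \<in> A" "q \<in> U" using c by (simp_all add: c')
    have w: "\<kappa> q \<in> plane_box (eps h m)" by (rule CE.\<kappa>D(4)[OF q])
    have "eps h m \<le> R" using eps_le(1)[OF par] \<delta>(2) by linarith
    then have w0: "\<kappa> q \<in> plane_box R" using w plane_box_mono by blast
    have w1: "\<kappa> q \<in> plane_box (safe h m)" using w plane_box_mono eps_le(2)[OF par] by blast
    have wR: "\<kappa> q $ 1 \<in> {-R<..<R}" using w0 by (auto simp: plane_box_def)
    note i = euclidean_isometry_derivative_facts[OF \<Sigma> smooth_on_differentiable[OF B0.smooth_G w0]]
    have 0: "chart_deriv c f q = (\<lambda>a. frechet_derivative (\<lambda>w. \<Sigma> (B0.G w)) (at (\<kappa> q)) (chart_deriv (U, x) \<kappa> q a))"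
      unfolding c' by (rule CE.chart_deriv_coord[OF U q CE.D q _ i(3)]) (use f E_facts(3) D_sub in blast)
    have 1: "chart_deriv c (\<lambda>q. F h m (\<phi> h m q)) q = (\<lambda>a. frechet_derivative B1.G (at (\<kappa> q)) (chart_deriv (U, x) \<kappa> q a))"
      unfolding c' by (rule CE.chart_deriv_coord[OF U q CE.D q E_facts(7) smooth_on_differentiable[OF B1.smooth_G w1]])
    have m1: "(1 / m)\<^sup>2 * ((rad h m (\<kappa> q $ 1))\<^sup>2 + h\<^sup>2) = P (\<kappa> q $ 1)"
    proof (rule family_metric[OF m_pos[OF par]])
      have "\<bar>\<kappa> q $ 1\<bar> < safe h m" using w1 by (simp add: plane_box_def)
      from safe_adm[OF this] show "gap h m (\<kappa> q $ 1) > 0" by (simp add: adm_def)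
    qed
    note m0 = family_metric[OF m_pos[OF par0] gap0[OF wR]]
    show "chart_deriv c f q a \<bullet> chart_deriv c f q b =
        chart_deriv c (\<lambda>q. F h m (\<phi> h m q)) q a \<bullet> chart_deriv c (\<lambda>q. F h m (\<phi> h m q)) q b"
      unfolding 0 1 i(1) B0.G_inner[OF w0] B1.G_inner[OF w1] m0 m1 ..
  qed
qed

end

end

section \<open>The members of the family are not congruent\<close>

text \<open>The square of the chord of a helix over the arc \<open>t\<close>, by the sum of squares \<open>a\<close> of radius and pitch.\<close>

definition helix_chord :: "real \<Rightarrow> real \<Rightarrow> real \<Rightarrow> real"
  where "helix_chord a h t = 2 * a * (1 - cos t) + h\<^sup>2 * (t\<^sup>2 - 2 * (1 - cos t))"

lemma helix_chord:
  assumes "\<beta> 0 = 0" "\<zeta> 0 = 0" "w$1 = 0" "w'$1 = 0"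
  shows "(dist (helix_surface k h \<rho> \<beta> \<zeta> w) (helix_surface k h \<rho> \<beta> \<zeta> w'))\<^sup>2 = helix_chord ((\<rho> 0)\<^sup>2 + h\<^sup>2) h (k * (w$2 - w'$2))"
proof -
  define a where "a = k * w$2"
  define b where "b = k * w'$2"
  define r where "r = \<rho> 0"
  have e: "(dist (helix_surface k h \<rho> \<beta> \<zeta> w) (helix_surface k h \<rho> \<beta> \<zeta> w'))\<^sup>2
    = (r * cos a - r * cos b)\<^sup>2 + (r * sin a - r * sin b)\<^sup>2 + (h * a - h * b)\<^sup>2"
    unfolding dist_norm power2_norm_eq_inner helix_surface_def inner3
    using assms by (simp add: a_def b_def r_def power2_eq_square)
  have s: "sin a * sin a + cos a * cos a = 1" "sin b * sin b + cos b * cos b = 1"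
    using sin_cos_squared_add[of a] sin_cos_squared_add[of b] by (simp_all add: power2_eq_square)
  have "(r * cos a - r * cos b)\<^sup>2 + (r * sin a - r * sin b)\<^sup>2 + (h * a - h * b)\<^sup>2
    = 2 * (r\<^sup>2 + h\<^sup>2) * (1 - (cos a * cos b + sin a * sin b)) + h\<^sup>2 * ((a - b)\<^sup>2 - 2 * (1 - (cos a * cos b + sin a * sin b)))"
    using s by algebra
  then have "(r * cos a - r * cos b)\<^sup>2 + (r * sin a - r * sin b)\<^sup>2 + (h * a - h * b)\<^sup>2 = helix_chord (r\<^sup>2 + h\<^sup>2) h (a - b)"
    by (simp add: helix_chord_def cos_diff)
  then show ?thesis unfolding e by (simp add: a_def b_def r_def right_diff_distrib)
qed

lemma cosine_strict: "t \<noteq> 0 \<Longrightarrow> 2 * (1 - cos t) < (t::real)\<^sup>2"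
proof -
  assume t: "t \<noteq> 0"
  define u where "u = t / 4"
  have c: "cos t = 1 - 2 * (2 * sin u * cos u)\<^sup>2"
  proof -
    have "cos t = 1 - 2 * (sin (2 * u))\<^sup>2" using cos_double_sin[of "2 * u"] by (simp add: u_def)
    then show ?thesis by (simp only: sin_double)
  qed
  have "\<bar>sin u\<bar>\<^sup>2 \<le> \<bar>u\<bar>\<^sup>2" by (rule power_mono[OF abs_sin_x_le_abs_x]) simp
  then have su: "(sin u)\<^sup>2 \<le> u\<^sup>2" by simp
  have u2: "u\<^sup>2 > 0" using t by (simp add: u_def)
  have "(sin u)\<^sup>2 * (cos u)\<^sup>2 < u\<^sup>2"
  proof (cases "sin u = 0")
    case False
    then have "(sin u)\<^sup>2 > 0" by simp
    then have "(cos u)\<^sup>2 < 1" using sin_cos_squared_add[of u] by linarith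
    then have "(sin u)\<^sup>2 * (cos u)\<^sup>2 < (sin u)\<^sup>2 * 1" using \<open>(sin u)\<^sup>2 > 0\<close> by (rule mult_strict_left_mono)
    then show ?thesis using su by linarith
  qed (use u2 in simp)
  then have "16 * ((sin u)\<^sup>2 * (cos u)\<^sup>2) < 16 * u\<^sup>2" by simp
  then show ?thesis unfolding c by (simp add: u_def power_mult_distrib power_divide)
qed

lemma helix_chord_mono:
  assumes "h\<^sup>2 < h'\<^sup>2" "t \<noteq> 0" shows "helix_chord a h t < helix_chord a h' t"
  using cosine_strict[OF assms(2)] assms(1) by (simp add: helix_chord_def)

lemma helix_chord_nonneg: "a \<ge> 0 \<Longrightarrow> helix_chord a h t \<ge> 0"
  unfolding helix_chord_def using cosine_strict[of t] by (cases "t = 0") (auto intro!: add_nonneg_nonneg mult_nonneg_nonneg)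

lemma helix_chord_even: "helix_chord a h \<bar>t\<bar> = helix_chord a h t"
  by (simp add: helix_chord_def abs_if)

text \<open>
  A map between parameter intervals of the same length cannot preserve the chords if \<open>h\<^sup>2\<close> differs and \<open>a\<close> does
  not: the largest chord of the helix with the smaller \<open>h\<^sup>2\<close> would bound those of the other.
\<close>

lemma helix_arcs_not_congruent:
  fixes z :: "real \<Rightarrow> real"
  assumes a: "a \<ge> 0" and k: "k > 0" and d: "d > 0" and h: "h\<^sup>2 < h'\<^sup>2"
    and z: "\<And>y. \<bar>y\<bar> < d \<Longrightarrow> \<bar>z y\<bar> < d"
    and eq: "\<And>y y'. \<bar>y\<bar> < d \<Longrightarrow> \<bar>y'\<bar> < d \<Longrightarrow> helix_chord a h' (k * (y - y')) = helix_chord a h (k * (z y - z y'))"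
  shows False
proof -
  let ?Q = "\<lambda>h t. helix_chord a h (k * t)"
  have c: "continuous_on S (?Q h)" for S h unfolding helix_chord_def by (intro continuous_intros)
  have "{0..2*d} \<noteq> {}" using d by simp
  from continuous_attains_sup[OF compact_Icc this c[of _ h]]
  obtain t where t: "t \<in> {0..2*d}" "\<And>u. u \<in> {0..2*d} \<Longrightarrow> ?Q h u \<le> ?Q h t" by blast
  have le: "?Q h' u \<le> ?Q h t" if u: "u \<in> {0..<2*d}" for u
  proof -
    have b: "\<bar>u/2\<bar> < d" "\<bar>- u/2\<bar> < d" using u by auto
    have "?Q h' u = ?Q h (z (u/2) - z (- u/2))" using eq[OF b] by simp
    also have "\<dots> = ?Q h \<bar>z (u/2) - z (- u/2)\<bar>"
      using helix_chord_even[of a h "k * (z (u/2) - z (- u/2))"] k by (simp add: abs_mult)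
    also have "\<dots> \<le> ?Q h t" using z[OF b(1)] z[OF b(2)] by (intro t(2)) auto
    finally show ?thesis .
  qed
  have cl: "closure {0..<2*d} = {0..2*d}" using d by simp
  have le': "?Q h' u \<le> ?Q h t" if "u \<in> {0..2*d}" for u
    by (rule continuous_le_on_closure[where S="{0..<2*d}" and f="?Q h'"]) (use c le that cl in auto)
  show False
  proof (cases "t = 0")
    case True
    have "?Q h d < ?Q h' d" by (rule helix_chord_mono[OF h]) (use k d in simp)
    also have "\<dots> \<le> ?Q h t" by (rule le') (use d in simp)
    also have "\<dots> = 0" by (simp add: True helix_chord_def)
    finally show False using helix_chord_nonneg[OF a, of h "k * d"] by simp
  next
    case False
    have "?Q h t < ?Q h' t" by (rule helix_chord_mono[OF h]) (use k False in simp)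
    then show False using le'[OF t(1)] by simp
  qed
qed

context edge_family
begin

lemma member_singular:
  assumes par: "(h, m) \<in> params"
  shows "singular_set A D (F h m) = {q \<in> D. \<kappa> q $ 1 = 0}"
proof -
  obtain r1 b1 l1 where ep: "edge_profile N \<delta> (1 / m) (\<lambda>x. rad h m (psi h m x)) r1 (\<lambda>x. ang h m (psi h m x)) b1 (\<lambda>x. hgt h m (psi h m x)) l1"
    by (rule member_profile[OF par])
  interpret ES: edge_surface N \<delta> "1 / m" h "\<lambda>x. rad h m (psi h m x)" r1 "\<lambda>x. ang h m (psi h m x)" b1 "\<lambda>x. hgt h m (psi h m x)" l1 A D \<kappa>
    using ep CD.coords_axioms by (rule edge_surface.intro)
  have "ES.F = F h m" by (simp add: fun_eq_iff ES.F_def F_def)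
  then show ?thesis using ES.singular_F by simp
qed

lemma ang_hgt_0: "ang h m 0 = 0" "hgt h m 0 = 0" by (simp_all add: ang_def hgt_def)

lemma rad_0: "(h, m) \<in> params \<Longrightarrow> (rad h m 0)\<^sup>2 + h\<^sup>2 = m\<^sup>2 * P 0"
  using gap_imp[of h m 0] by (simp add: rad_def params_def)

text \<open>
  A member congruent to \<open>f\<close> would have a congruent singular curve. The singular curve of the member \<open>(h, m)\<close>
  is an arc of a helix; the squares of its radius and pitch add up to \<open>m\<^sup>2 P(0)\<close>; so it is enough to enlarge \<open>h\<close>
  while \<open>m\<close> is kept.
\<close>

lemma family_nontrivial:
  "\<not> (\<forall>(h, m)\<in>params. \<exists>T \<phi>. euclidean_isometry T \<and> diffeo A A D D \<phi> \<and> (\<forall>q\<in>D. F h m q = T (f (inv_into D \<phi> q))))"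
proof
  assume triv: "\<forall>(h, m)\<in>params. \<exists>T \<phi>. euclidean_isometry T \<and> diffeo A A D D \<phi> \<and> (\<forall>q\<in>D. F h m q = T (f (inv_into D \<phi> q)))"
  \<comment> \<open>half of \<open>gap\<close> at the origin is used up, and \<open>(h1, m0)\<close> is still admissible\<close>
  define h1 where "h1 = sqrt (h0\<^sup>2 + gap h0 m0 0 / 2)"
  have g: "gap h0 m0 0 > 0" "m0 > 0" using par0 by (simp_all add: params_def)
  have h1: "h1\<^sup>2 = h0\<^sup>2 + gap h0 m0 0 / 2" using g by (simp add: h1_def)
  have "gap h1 m0 0 = gap h0 m0 0 - (h1\<^sup>2 - h0\<^sup>2)" by (simp add: gap_def)
  also have "\<dots> = gap h0 m0 0 / 2" unfolding h1 by simp
  finally have par: "(h1, m0) \<in> params" using g by (simp add: params_def)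
  obtain T \<phi> where T: "euclidean_isometry T" and \<phi>: "diffeo A A D D \<phi>"
    and eq: "\<And>q. q \<in> D \<Longrightarrow> F h1 m0 q = T (f (inv_into D \<phi> q))"
    using bspec[OF triv par] by auto
  let ?\<theta> = "inv_into D \<phi>"
  have \<theta>: "diffeo A A D D ?\<theta>" by (rule diffeo_inv(1)[OF A A CD.D \<phi>])
  interpret C\<theta>: coords A D "plane_box \<delta>" "\<lambda>q. \<kappa> (?\<theta> q)"
    unfolding coords_def
    using diffeo_compose(1)[OF A A smooth_atlas_euclidean CD.D CD.D CD.\<Omega> \<theta> CD.diffeo] A CD.D CD.\<Omega> by simp
  interpret B0: bour_profile N R "1 / m0" h0 "rad h0 m0" "rad1 h0 m0" "ang h0 m0" "ang1 h0 m0" "hgt h0 m0" "hgt1 h0 m0"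
    by (rule base_bour)
  have T2: "euclidean_isometry (\<lambda>y. T (\<Sigma> y))" by (rule euclidean_isometry_compose[OF T \<Sigma>])
  have Fq: "F h1 m0 q = T (\<Sigma> (B0.G (\<kappa> (?\<theta> q))))" if "q \<in> D" for q
    using eq[OF that] f[of "?\<theta> q"] diffeoD(4)[OF \<theta> that] D_sub by auto
  have sing: "\<kappa> (?\<theta> q) $ 1 = 0" if q: "q \<in> D" "\<kappa> q $ 1 = 0" for q
  proof -
    have b: "\<kappa> (?\<theta> q) \<in> plane_box R" using C\<theta>.\<kappa>D(4)[OF q(1)] plane_box_mono[OF \<delta>(2)] by blast
    note i = euclidean_isometry_derivative_facts[OF T2 smooth_on_differentiable[OF B0.smooth_G b]]
    have "q \<in> singular_set A D (F h1 m0)" unfolding member_singular[OF par] using q by simp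
    then have "\<not> inj (frechet_derivative (\<lambda>w. T (\<Sigma> (B0.G w))) (at (\<kappa> (?\<theta> q))))"
      using C\<theta>.singular_set_iff[of q D D "F h1 m0" "\<lambda>w. T (\<Sigma> (B0.G w))", OF q(1) q(1) CD.D q(1) Fq i(3)] by simp
    then show ?thesis unfolding i(2) B0.inj_frechet_G[OF b] by simp
  qed
  define Y where "Y y = CD.\<kappa>i (vector [0, y])" for y
  define z where "z y = \<kappa> (?\<theta> (Y y)) $ 2" for y
  have Y: "Y y \<in> D" "\<kappa> (Y y) = vector [0, y]" if "\<bar>y\<bar> < \<delta>" for y
  proof -
    have b: "vector [0, y] \<in> plane_box \<delta>" using that \<delta>(1) by (simp add: plane_box_def)
    show "Y y \<in> D" "\<kappa> (Y y) = vector [0, y]" unfolding Y_def by (rule CD.\<kappa>D(6)[OF b], rule CD.\<kappa>D(7)[OF b])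
  qed
  have dT: "dist (T (\<Sigma> y)) (T (\<Sigma> y')) = dist y y'" for y y' using T2 by (simp add: euclidean_isometry_def)
  show False
  proof (rule helix_arcs_not_congruent[where a="m0\<^sup>2 * P 0" and k="1 / m0" and d=\<delta> and h=h0 and h'=h1 and z=z])
    show "h0\<^sup>2 < h1\<^sup>2" unfolding h1 using g by simp
    show "m0\<^sup>2 * P 0 \<ge> 0" unfolding rad_0[OF par, symmetric] by simp
    show "\<bar>z y\<bar> < \<delta>" if "\<bar>y\<bar> < \<delta>" for y
      using C\<theta>.\<kappa>D(4)[OF Y(1)[OF that]] by (simp add: z_def plane_box_def)
    fix y y' assume y: "\<bar>y\<bar> < \<delta>" "\<bar>y'\<bar> < \<delta>"
    have "helix_chord (m0\<^sup>2 * P 0) h1 (1 / m0 * (y - y')) = (dist (F h1 m0 (Y y)) (F h1 m0 (Y y')))\<^sup>2"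
      unfolding F_def Y(2)[OF y(1)] Y(2)[OF y(2)]
      by (subst helix_chord) (simp_all add: psi_0[OF par] ang_hgt_0 rad_0[OF par])
    also have "\<dots> = (dist (B0.G (\<kappa> (?\<theta> (Y y)))) (B0.G (\<kappa> (?\<theta> (Y y')))))\<^sup>2"
      unfolding Fq[OF Y(1)[OF y(1)]] Fq[OF Y(1)[OF y(2)]] dT ..
    also have "\<dots> = helix_chord (m0\<^sup>2 * P 0) h0 (1 / m0 * (z y - z y'))"
      unfolding z_def using sing[OF Y(1)[OF y(1)]] sing[OF Y(1)[OF y(2)]] Y(2)[OF y(1)] Y(2)[OF y(2)]
      by (subst helix_chord) (simp_all add: ang_hgt_0 rad_0[OF par0])
    finally show "helix_chord (m0\<^sup>2 * P 0) h1 (1 / m0 * (y - y')) = helix_chord (m0\<^sup>2 * P 0) h0 (1 / m0 * (z y - z y'))" .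
  qed (use g \<delta>(1) in auto)
qed

end

section \<open>Every isometric edge belongs to the family\<close>

lemma diffeo_restrict_source:
  assumes A: "smooth_atlas A" "smooth_atlas B" and D: "open D" "open E" and d: "diffeo A B D E \<phi>"
    and N: "open N" "N \<subseteq> D"
  shows "diffeo A B N (\<phi> ` N) \<phi>" "open (\<phi> ` N)"
proof -
  note dD = diffeoD[OF d]
  have "\<phi> ` N = E \<inter> inv_into D \<phi> -` N"
  proof (intro equalityI subsetI)
    fix w assume "w \<in> \<phi> ` N"
    then show "w \<in> E \<inter> inv_into D \<phi> -` N" using dD(4,5) N(2) by auto
  next
    fix w assume "w \<in> E \<inter> inv_into D \<phi> -` N"
    then show "w \<in> \<phi> ` N" using dD(7)[of w] by (metis IntD1 IntD2 imageI vimageE)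
  qed
  then show o: "open (\<phi> ` N)" using continuous_open_preimage[OF smooth_map_continuous[OF dD(3)] D(2) N(1)] by simp
  have "D \<inter> \<phi> -` (\<phi> ` N) = N" using N(2) dD(5) by (auto, metis subsetD)
  moreover have "\<phi> ` N \<subseteq> E" using dD(4) N(2) by blast
  ultimately show "diffeo A B N (\<phi> ` N) \<phi>" using diffeo_restrict(1)[OF A D d o] by simp
qed

context coords
begin

lemma pullback:
  assumes E: "open E" and \<theta>: "diffeo A A E E \<theta>"
  shows "coords A (E \<inter> \<theta> -` (D \<inter> E)) (\<Omega> \<inter> \<kappa>i -` E) (\<lambda>q. \<kappa> (\<theta> q))"
proof -
  have DE: "open (D \<inter> E)" using D E by auto
  note r1 = diffeo_restrict[OF A A E E \<theta> DE Int_lower2]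
  have o: "open (\<Omega> \<inter> \<kappa>i -` E)" by (rule open_coord_preimage[OF E])
  have "D \<inter> \<kappa> -` (\<Omega> \<inter> \<kappa>i -` E) = D \<inter> E" using \<kappa>D(4,5) by auto
  then have r2: "diffeo A euclidean_atlas (D \<inter> E) (\<Omega> \<inter> \<kappa>i -` E) \<kappa>"
    using coords.diffeo[OF restrict[OF o Int_lower1]] by simp
  show ?thesis
    unfolding coords_def using diffeo_compose(1)[OF A A smooth_atlas_euclidean r1(2) DE o r1(1) r2] A r1(2) o by simp
qed

lemma transition:
  assumes "coords A D' \<Omega>' \<kappa>'"
  shows "homeomorphism (\<Omega> \<inter> \<kappa>i -` D') (\<Omega>' \<inter> inv_into D' \<kappa>' -` D) (\<lambda>w. \<kappa>' (\<kappa>i w)) (\<lambda>w. \<kappa> (inv_into D' \<kappa>' w))"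
    "smooth_on (\<Omega> \<inter> \<kappa>i -` D') (\<lambda>w. \<kappa>' (\<kappa>i w))"
    "smooth_on (\<Omega>' \<inter> inv_into D' \<kappa>' -` D) (\<lambda>w. \<kappa> (inv_into D' \<kappa>' w))"
proof -
  interpret C': coords A D' \<Omega>' \<kappa>' by (rule assms)
  show s: "smooth_on (\<Omega> \<inter> \<kappa>i -` D') (\<lambda>w. \<kappa>' (\<kappa>i w))" by (rule smooth_in[OF C'.D C'.\<kappa>D(2)])
  show s': "smooth_on (\<Omega>' \<inter> inv_into D' \<kappa>' -` D) (\<lambda>w. \<kappa> (inv_into D' \<kappa>' w))" by (rule C'.smooth_in[OF D \<kappa>D(2)])
  have in1: "\<kappa>' (\<kappa>i w) \<in> \<Omega>' \<inter> C'.\<kappa>i -` D" "\<kappa> (C'.\<kappa>i (\<kappa>' (\<kappa>i w))) = w" if w: "w \<in> \<Omega> \<inter> \<kappa>i -` D'" for w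
    using w C'.\<kappa>D(4,5)[of "\<kappa>i w"] \<kappa>D(6,7)[of w] by auto
  have in2: "\<kappa> (C'.\<kappa>i w) \<in> \<Omega> \<inter> \<kappa>i -` D'" "\<kappa>' (\<kappa>i (\<kappa> (C'.\<kappa>i w))) = w" if w: "w \<in> \<Omega>' \<inter> C'.\<kappa>i -` D" for w
    using w \<kappa>D(4,5)[of "C'.\<kappa>i w"] C'.\<kappa>D(6,7)[of w] by auto
  show "homeomorphism (\<Omega> \<inter> \<kappa>i -` D') (\<Omega>' \<inter> C'.\<kappa>i -` D) (\<lambda>w. \<kappa>' (\<kappa>i w)) (\<lambda>w. \<kappa> (C'.\<kappa>i w))"
    by (rule homeomorphismI[OF smooth_on_continuous[OF s] smooth_on_continuous[OF s']]) (use in1 in2 in blast)+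
qed

end

text \<open>
  Reversing the directions of the two coordinates amounts to a symmetry of space and a change of the sign
  of the pitch.
\<close>

lemma bour_flip:
  assumes bp: "bour_profile N r k h \<rho> r1 \<beta> b1 \<zeta> l1" and \<sigma>: "\<sigma> = 1 \<or> \<sigma> = (-1::real)" and c: "c \<noteq> 0"
  obtains k' h' \<rho>' r1' \<beta>' b1' \<zeta>' l1' \<Sigma> where
    "bour_profile N r k' h' \<rho>' r1' \<beta>' b1' \<zeta>' l1'" "euclidean_isometry \<Sigma>"
    "\<And>x. k'\<^sup>2 * ((\<rho>' x)\<^sup>2 + h'\<^sup>2) = c\<^sup>2 * (k\<^sup>2 * ((\<rho> (\<sigma> * x))\<^sup>2 + h\<^sup>2))"
    "\<And>w. helix_surface k h \<rho> \<beta> \<zeta> (vector [\<sigma> * w$1, c * w$2]) = \<Sigma> (helix_surface k' h' \<rho>' \<beta>' \<zeta>' w)"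
proof -
  interpret bour_profile N r k h \<rho> r1 \<beta> b1 \<zeta> l1 by (rule bp)
  let ?I = "{-r<..<r}"
  define s where "s = sgn c"
  define b where "b = \<sigma> ^ Suc N"
  have s: "s * s = 1" "s * \<bar>c\<bar> = c" using c by (auto simp: s_def sgn_if)
  have \<sigma>2: "\<sigma> * \<sigma> = 1" using \<sigma> by auto
  have b2: "b * b = 1" unfolding b_def using \<sigma> by (auto simp: power_mult_distrib[symmetric])
  have I: "\<sigma> * x \<in> ?I" if "x \<in> ?I" for x using that \<sigma> by auto
  have sm: "smooth_on ?I (\<lambda>x. a * e (\<sigma> * x))" if "smooth_on ?I e" for a and e :: "real \<Rightarrow> real"
    by (intro smooth_on_mult smooth_on_const smooth_on_compose2[where f=e and g="\<lambda>x. \<sigma> * x", OF that] smooth_on_id) (use I in auto)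
  have der: "((\<lambda>x. a * g (\<sigma> * x)) has_real_derivative x ^ N * (a * b * e (\<sigma> * x))) (at x)"
    if "\<And>w. w \<in> ?I \<Longrightarrow> (g has_real_derivative w ^ N * e w) (at w)" "x \<in> ?I" for g e a x
  proof -
    have "((\<lambda>x. \<sigma> * x) has_real_derivative \<sigma>) (at x)" by (auto intro!: derivative_eq_intros)
    from DERIV_cmult[OF DERIV_chain2[where f=g and g="\<lambda>x. \<sigma> * x" and x=x, OF that(1)[OF I[OF that(2)]] this], of a]
    show ?thesis by (rule DERIV_cong) (simp add: b_def power_mult_distrib mult_ac)
  qed
  define h' where "h' = s * b * h"
  define \<beta>' where "\<beta>' x = s * \<beta> (\<sigma> * x)" for x
  define \<zeta>' where "\<zeta>' x = b * \<zeta> (\<sigma> * x)" for x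
  define \<rho>' where "\<rho>' x = 1 * \<rho> (\<sigma> * x)" for x
  define r1' where "r1' x = 1 * b * r1 (\<sigma> * x)" for x
  define b1' where "b1' x = s * b * b1 (\<sigma> * x)" for x
  define l1' where "l1' x = b * b * l1 (\<sigma> * x)" for x
  have h2: "h' * b1' x = h * b1 (\<sigma> * x)" for x
  proof -
    have "h' * b1' x = (s * s) * (b * b) * (h * b1 (\<sigma> * x))" by (simp add: h'_def b1'_def mult_ac)
    then show ?thesis by (simp add: s b2)
  qed
  have h'2: "h'\<^sup>2 = h\<^sup>2"
  proof -
    have "h'\<^sup>2 = (s * s) * (b * b) * h\<^sup>2" by (simp add: h'_def power2_eq_square mult_ac)
    then show ?thesis by (simp add: s b2)
  qed
  have ep: "edge_profile N r (k * \<bar>c\<bar>) \<rho>' r1' \<beta>' b1' \<zeta>' l1'"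
  proof
    show "smooth_on ?I r1'" "smooth_on ?I b1'" "smooth_on ?I l1'"
      unfolding r1'_def[abs_def] b1'_def[abs_def] l1'_def[abs_def] by (rule sm sr sb sl)+
    show "(\<rho>' has_real_derivative w ^ N * r1' w) (at w)" if "w \<in> ?I" for w
      unfolding \<rho>'_def[abs_def] r1'_def by (rule der[OF d\<rho> that])
    show "(\<beta>' has_real_derivative w ^ N * b1' w) (at w)" if "w \<in> ?I" for w
      unfolding \<beta>'_def[abs_def] b1'_def by (rule der[OF d\<beta> that])
    show "(\<zeta>' has_real_derivative w ^ N * l1' w) (at w)" if "w \<in> ?I" for w
      unfolding \<zeta>'_def[abs_def] l1'_def by (rule der[OF d\<zeta> that])
    show "\<rho>' w > 0" "l1' w > 0" if "w \<in> ?I" for w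
      using \<rho>pos[OF I[OF that]] l1pos[OF I[OF that]] by (simp_all add: \<rho>'_def l1'_def b2)
  qed (use N r k c in auto)
  have bp': "bour_profile N r (k * \<bar>c\<bar>) h' \<rho>' r1' \<beta>' b1' \<zeta>' l1'"
    unfolding bour_profile_def bour_profile_axioms_def
  proof (intro conjI allI impI ep)
    show "k * \<bar>c\<bar> > 0" using kpos c by simp
    show "\<beta>' 0 = 0" "\<zeta>' 0 = 0" by (simp_all add: \<beta>'_def \<zeta>'_def \<beta>0 \<zeta>0)
    fix w assume "w \<in> ?I"
    note u = unit[OF I[OF this]] orth[OF I[OF this]]
    have l: "l1' w = l1 (\<sigma> * w)" by (simp add: l1'_def b2)
    have "(r1' w)\<^sup>2 + (\<rho>' w * b1' w)\<^sup>2 = (b * b) * (r1 (\<sigma> * w))\<^sup>2 + (s * s) * (b * b) * (\<rho> (\<sigma> * w) * b1 (\<sigma> * w))\<^sup>2"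
      by (simp add: r1'_def \<rho>'_def b1'_def power2_eq_square mult_ac)
    then show "(r1' w)\<^sup>2 + (\<rho>' w * b1' w)\<^sup>2 + (l1' w + h' * b1' w)\<^sup>2 = 1" using u(1) unfolding h2 l by (simp add: s b2)
    have "(\<rho>' w)\<^sup>2 * b1' w + h' * (l1' w + h' * b1' w) = s * b * ((\<rho> (\<sigma> * w))\<^sup>2 * b1 (\<sigma> * w) + h * (l1 (\<sigma> * w) + h * b1 (\<sigma> * w)))"
      unfolding h2 l by (simp add: \<rho>'_def b1'_def h'_def algebra_simps)
    then show "(\<rho>' w)\<^sup>2 * b1' w + h' * (l1' w + h' * b1' w) = 0" using u(2) by simp
  qed
  define \<Sigma> :: "real^3 \<Rightarrow> real^3" where "\<Sigma> y = vector [y$1, s * y$2, b * y$3]" for y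
  have iso: "euclidean_isometry \<Sigma>"
    unfolding euclidean_isometry_def
  proof (intro allI)
    fix y z
    have "(\<Sigma> y - \<Sigma> z) \<bullet> (\<Sigma> y - \<Sigma> z) = (y$1 - z$1) * (y$1 - z$1) + (s * s) * ((y$2 - z$2) * (y$2 - z$2)) + (b * b) * ((y$3 - z$3) * (y$3 - z$3))"
      by (simp add: \<Sigma>_def inner3 algebra_simps)
    also have "\<dots> = (y - z) \<bullet> (y - z)" by (simp add: s b2 inner3)
    finally show "dist (\<Sigma> y) (\<Sigma> z) = dist y z" by (simp add: dist_norm norm_eq_sqrt_inner)
  qed
  have G: "helix_surface k h \<rho> \<beta> \<zeta> (vector [\<sigma> * w$1, c * w$2]) = \<Sigma> (helix_surface (k * \<bar>c\<bar>) h' \<rho>' \<beta>' \<zeta>' w)" for w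
  proof -
    define t where "t = k * \<bar>c\<bar> * w$2 + \<beta>' (w$1)"
    have st: "s * t = k * (c * w$2) + \<beta> (\<sigma> * w$1)"
    proof -
      have "s * t = k * ((s * \<bar>c\<bar>) * w$2) + (s * s) * \<beta> (\<sigma> * w$1)" by (simp add: t_def \<beta>'_def algebra_simps)
      then show ?thesis by (simp only: s mult_1)
    qed
    have trig: "cos (s * t) = cos t" "sin (s * t) = s * sin t" using c by (auto simp: s_def sgn_if)
    have z: "b * (\<zeta>' (w$1) + h' * t) = \<zeta> (\<sigma> * w$1) + h * (s * t)"
    proof -
      have "b * (\<zeta>' (w$1) + h' * t) = (b * b) * \<zeta> (\<sigma> * w$1) + (b * b) * (h * (s * t))"
        by (simp add: \<zeta>'_def h'_def algebra_simps)
      then show ?thesis by (simp only: b2 mult_1)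
    qed
    show ?thesis
      unfolding helix_surface_def \<Sigma>_def vector_2 st[symmetric] trig t_def[symmetric] vector_3 z
      by (simp add: \<rho>'_def mult_ac)
  qed
  have met: "(k * \<bar>c\<bar>)\<^sup>2 * ((\<rho>' x)\<^sup>2 + h'\<^sup>2) = c\<^sup>2 * (k\<^sup>2 * ((\<rho> (\<sigma> * x))\<^sup>2 + h\<^sup>2))" for x
    unfolding h'2 \<rho>'_def by (simp add: power_mult_distrib mult_ac)
  show ?thesis by (rule that[OF bp' iso met G])
qed

context edge_family
begin

text \<open>
  Singular directions are the null directions of the metric, and \<open>\<theta>\<close> is a diffeomorphism fixing \<open>p\<close>.
\<close>

lemma isometric_singular:
  assumes E: "open E1" "p \<in> E1" "E1 \<subseteq> E'" "open E'" and \<theta>: "diffeo A A E1 E1 \<theta>" "\<theta> p = p"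
    and g: "smooth_map A euclidean_atlas E' g"
    and ff: "\<And>q c a b. q \<in> E1 \<Longrightarrow> c \<in> A \<Longrightarrow> q \<in> fst c \<Longrightarrow>
      chart_deriv c f q a \<bullet> chart_deriv c f q b = chart_deriv c (\<lambda>q. g (\<theta> q)) q a \<bullet> chart_deriv c (\<lambda>q. g (\<theta> q)) q b"
  shows "p \<in> singular_set A E' g"
proof -
  interpret B0: bour_profile N R "1 / m0" h0 "rad h0 m0" "rad1 h0 m0" "ang h0 m0" "ang1 h0 m0" "hgt h0 m0" "hgt1 h0 m0"
    by (rule base_bour)
  obtain U x where c: "(U, x) \<in> A" "p \<in> U" by (rule smooth_atlas_cover[OF A])
  interpret C\<theta>: coords A "E1 \<inter> \<theta> -` (D0 \<inter> E1)" "plane_box R \<inter> \<kappa>i -` E1" "\<lambda>q. \<kappa> (\<theta> q)"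
    by (rule pullback[OF E(1) \<theta>(1)])
  have p3: "p \<in> E1 \<inter> \<theta> -` (D0 \<inter> E1)" using E(2) \<theta>(2) p(1) by simp
  have w: "0 \<in> plane_box R" using R by (simp add: plane_box_def)
  note d\<theta> = diffeoD[OF \<theta>(1)]
  have s\<theta>: "smooth_map A euclidean_atlas E1 (\<lambda>q. g (\<theta> q))"
    by (rule smooth_map_compose[where \<phi>=\<theta>, OF A A smooth_atlas_euclidean E(1) E(4) d\<theta>(2) g]) (use d\<theta>(4) E(3) in blast)
  have dg: "(\<lambda>w. g (\<kappa>i w)) differentiable (at (\<kappa> p))"
    by (rule smooth_on_differentiable[OF smooth_in[OF E(4) g]]) (use p w \<kappa>D(5)[OF p(1)] E(2,3) in auto)
  have nB: "surj (chart_deriv (U, x) \<kappa> p)" using bij_chart_deriv(1)[OF c p(1)] by (simp add: bij_def)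
  then obtain v where v: "chart_deriv (U, x) \<kappa> p v = axis 1 1" by (metis surjD)
  have lin0: "linear (chart_deriv (U, x) \<kappa> p)" by (rule bij_chart_deriv(2)[OF c p(1)])
  have vnz: "v \<noteq> 0" using v linear_0[OF lin0] by (auto simp: axis_eq_0_iff)
  note i = euclidean_isometry_derivative_facts[OF \<Sigma> smooth_on_differentiable[OF B0.smooth_G w]]
  have "chart_deriv (U, x) f p = (\<lambda>a. frechet_derivative (\<lambda>w. \<Sigma> (B0.G w)) (at (\<kappa> p)) (chart_deriv (U, x) \<kappa> p a))"
    by (rule chart_deriv_coord[OF c p(1) D p(1)]) (use f i(3) p(2) in auto)
  then have "chart_deriv (U, x) f p v \<bullet> chart_deriv (U, x) f p v = 0"
    using B0.N by (simp add: v p(2) i(1) B0.frechet_G[OF w] axis_def power_0_left)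
  then have g0: "chart_deriv (U, x) (\<lambda>q. g (\<theta> q)) p v = 0" using ff[OF E(2) c(1)] c(2) by simp
  have "linear (chart_deriv (U, x) (\<lambda>q. g (\<theta> q)) p)" by (rule chart_deriv_linear[OF A c(1) s\<theta> c(2) E(2)])
  then have "\<not> inj (chart_deriv (U, x) (\<lambda>q. g (\<theta> q)) p)" using g0 vnz linear_injective_0 by blast
  then have "p \<in> singular_set A E1 (\<lambda>q. g (\<theta> q))" unfolding singular_set_def
    by (intro CollectI conjI E(2) bexI[OF _ c(1)]) (use c(2) in simp_all)
  moreover have "p \<in> singular_set A E1 (\<lambda>q. g (\<theta> q)) \<longleftrightarrow> \<not> inj (frechet_derivative (\<lambda>w. g (\<kappa>i w)) (at (\<kappa> (\<theta> p))))"
    by (rule C\<theta>.singular_set_iff[OF p3 E(2) C\<theta>.D p3]) (use \<kappa>D(5) dg \<theta>(2) in auto)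
  moreover have "p \<in> singular_set A E' g \<longleftrightarrow> \<not> inj (frechet_derivative (\<lambda>w. g (\<kappa>i w)) (at (\<kappa> p)))"
    by (rule singular_set_iff[OF p(1) _ D p(1)]) (use \<kappa>D(5) dg E(2,3) in auto)
  ultimately show ?thesis by (simp add: \<theta>(2))
qed

text \<open>
  In the natural coordinates of \<open>g\<close>, pulled back by the isometry \<open>\<theta>\<close>, the metric is of the same form as in
  those of \<open>f\<close>. By \<open>edge_isometry_rigid\<close> the transition between them is \<open>(x, y) \<mapsto> (\<sigma> x, c y)\<close>, so that up to a
  symmetry of space \<open>g \<circ> \<theta>\<close> has a profile with the metric of \<open>f\<close> in the coordinates of \<open>f\<close>.
\<close>

theorem isometric_edge_in_family:
  assumes E': "open E'" and gE: "generic_helicoidal_edge (Suc N) A E' g" and iso: "isometric_at A f p E' g"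
  obtains h m T U V \<psi> where "(h, m) \<in> params" "euclidean_isometry T" "open U" "p \<in> U" "U \<subseteq> E'" "open V" "p \<in> V" "V \<subseteq> D"
    "diffeo A A U V \<psi>" "\<psi> p = p" "\<And>q. q \<in> U \<Longrightarrow> g q = T (F h m (\<psi> q))"
proof -
  interpret B0: bour_profile N R "1 / m0" h0 "rad h0 m0" "rad1 h0 m0" "ang h0 m0" "ang1 h0 m0" "hgt h0 m0" "hgt1 h0 m0"
    by (rule base_bour)
  obtain E1 \<theta> where E: "open E1" "p \<in> E1" "E1 \<subseteq> E'" and \<theta>: "diffeo A A E1 E1 \<theta>" "\<theta> p = p"
    and mp: "metric_pullback A E1 \<theta> f g"
    using iso unfolding isometric_at_def by (elim conjE exE) (rule that)
  note d\<theta> = diffeoD[OF \<theta>(1)]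
  have g: "smooth_map A euclidean_atlas E' g" using iso by (simp add: isometric_at_def surface_def)
  have \<theta>E: "\<theta> ` E1 \<subseteq> E'" using d\<theta>(4) E(3) by blast
  have ff: "chart_deriv c f q a \<bullet> chart_deriv c f q b = chart_deriv c (\<lambda>q. g (\<theta> q)) q a \<bullet> chart_deriv c (\<lambda>q. g (\<theta> q)) q b"
    if "q \<in> E1" "c \<in> A" "q \<in> fst c" for q c a b
    using first_fundamental_pullback_iff[OF A d\<theta>(2) g E(1) \<theta>E, THEN iffD1, OF mp] that by simp
  have sing: "p \<in> singular_set A E' g" by (rule isometric_singular[OF E E' \<theta> g ff])
  obtain D2 r2 \<kappa>2 k2 h2 \<rho>2 r12 \<beta>2 b12 \<zeta>2 l12 \<Sigma>2 where X:
    "bour_profile N r2 k2 h2 \<rho>2 r12 \<beta>2 b12 \<zeta>2 l12" "coords A D2 (plane_box r2) \<kappa>2" "p \<in> D2" "D2 \<subseteq> E'" "\<kappa>2 p = 0"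
    "euclidean_isometry \<Sigma>2" "\<And>q. q \<in> D2 \<Longrightarrow> g q = \<Sigma>2 (helix_surface k2 h2 \<rho>2 \<beta>2 \<zeta>2 (\<kappa>2 q))"
    by (rule edge_extraction[OF or N1 E' gE sing]) (rule that)
  interpret B2: bour_profile N r2 k2 h2 \<rho>2 r12 \<beta>2 b12 \<zeta>2 l12 by (rule X(1))
  interpret C2: coords A D2 "plane_box r2" \<kappa>2 by (rule X(2))
  \<comment> \<open>the coordinates of \<open>g\<close> pulled back by \<open>\<theta>\<close>, and the transition to them\<close>
  define D4 where "D4 = E1 \<inter> \<theta> -` (D2 \<inter> E1)"
  define \<Omega>4 where "\<Omega>4 = plane_box r2 \<inter> C2.\<kappa>i -` E1"
  define \<kappa>4 where "\<kappa>4 q = \<kappa>2 (\<theta> q)" for q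
  interpret C4: coords A D4 \<Omega>4 \<kappa>4 unfolding D4_def \<Omega>4_def \<kappa>4_def by (rule C2.pullback[OF E(1) \<theta>(1)])
  have p4: "p \<in> D4" "\<kappa>4 p = 0" using E(2) \<theta>(2) X(3,5) by (simp_all add: D4_def \<kappa>4_def)
  define U where "U = plane_box R \<inter> \<kappa>i -` D4"
  define V where "V = \<Omega>4 \<inter> C4.\<kappa>i -` D0"
  define \<Theta> where "\<Theta> w = \<kappa>4 (\<kappa>i w)" for w
  define \<Theta>' where "\<Theta>' w = \<kappa> (C4.\<kappa>i w)" for w
  have tr: "homeomorphism U V \<Theta> \<Theta>'" "smooth_on U \<Theta>" "smooth_on V \<Theta>'"
    using transition[OF C4.coords_axioms] unfolding U_def V_def \<Theta>_def[abs_def] \<Theta>'_def[abs_def] by blast+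
  have oU: "open U" "open V" unfolding U_def V_def by (rule open_coord_preimage[OF C4.D], rule C4.open_coord_preimage[OF D])
  have \<kappa>p: "\<kappa>i 0 = p" using \<kappa>D(5)[OF p(1)] p(2) by simp
  have U0: "0 \<in> U" using R \<kappa>p p4(1) by (simp add: U_def plane_box_def)
  have \<Theta>0: "\<Theta> 0 = 0" by (simp add: \<Theta>_def \<kappa>p p4(2))
  have URb: "w \<in> plane_box R" if "w \<in> U" for w using that by (simp add: U_def)
  have V2b: "w \<in> plane_box r2" if "w \<in> V" for w using that by (simp add: V_def \<Omega>4_def)
  have \<Theta>V: "\<Theta> w \<in> V" if "w \<in> U" for w using tr(1) that by (auto simp: homeomorphism_def)
  let ?P2 = "\<lambda>x. k2\<^sup>2 * ((\<rho>2 x)\<^sup>2 + h2\<^sup>2)"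
  have g\<theta>: "g (\<theta> q) = \<Sigma>2 (B2.G (\<Theta> (\<kappa> q)))" if "q \<in> D0 \<inter> D4" for q
    using that X(7)[of "\<theta> q"] \<kappa>D(5)[of q] by (simp add: D4_def \<Theta>_def \<kappa>4_def)
  have iso_eq: "edge_metric N ?P2 (\<Theta> w) (frechet_derivative \<Theta> (at w) v) = edge_metric N P w v" if w: "w \<in> U" for w v
  proof -
    let ?q = "\<kappa>i w"
    have wR: "w \<in> plane_box R" by (rule URb[OF w])
    have q: "?q \<in> D0" "\<kappa> ?q = w" "?q \<in> D4" using \<kappa>D(6,7)[OF wR] w by (simp_all add: U_def)
    have qE: "?q \<in> E1" using q(3) by (simp add: D4_def)
    obtain U0 x0 where c: "(U0, x0) \<in> A" "?q \<in> U0" by (rule smooth_atlas_cover[OF A])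
    have "surj (chart_deriv (U0, x0) \<kappa> ?q)" using bij_chart_deriv(1)[OF c q(1)] by (simp add: bij_def)
    then obtain a where a: "chart_deriv (U0, x0) \<kappa> ?q a = v" by (metis surjD)
    have b2: "\<Theta> w \<in> plane_box r2" by (rule V2b[OF \<Theta>V[OF w]])
    have d2: "B2.G differentiable (at (\<Theta> w))" by (rule smooth_on_differentiable[OF B2.smooth_G b2])
    have d\<Theta>: "\<Theta> differentiable (at w)" by (rule smooth_on_differentiable[OF tr(2) w])
    note ch = frechet_derivative_chain[OF d2 d\<Theta>]
    note i0 = euclidean_isometry_derivative_facts[OF \<Sigma> smooth_on_differentiable[OF B0.smooth_G wR]]
    note i2 = euclidean_isometry_derivative_facts[OF X(6) ch(2)]
    have 1: "chart_deriv (U0, x0) f ?q = (\<lambda>a. frechet_derivative (\<lambda>w. \<Sigma> (B0.G w)) (at (\<kappa> ?q)) (chart_deriv (U0, x0) \<kappa> ?q a))"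
      by (rule chart_deriv_coord[OF c q(1) D q(1)]) (use f i0(3) q(2) in auto)
    have 2: "chart_deriv (U0, x0) (\<lambda>q. g (\<theta> q)) ?q = (\<lambda>a. frechet_derivative (\<lambda>w. \<Sigma>2 (B2.G (\<Theta> w))) (at (\<kappa> ?q)) (chart_deriv (U0, x0) \<kappa> ?q a))"
    proof (rule chart_deriv_coord[OF c q(1), of "D0 \<inter> D4"])
      show "open (D0 \<inter> D4)" using D C4.D by (rule open_Int)
      show "?q \<in> D0 \<inter> D4" using q by simp
      show "(\<lambda>w. \<Sigma>2 (B2.G (\<Theta> w))) differentiable (at (\<kappa> ?q))" unfolding q(2) by (rule i2(3))
    qed (rule g\<theta>)
    have "frechet_derivative B0.G (at w) v \<bullet> frechet_derivative B0.G (at w) v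
      = chart_deriv (U0, x0) f ?q a \<bullet> chart_deriv (U0, x0) f ?q a" unfolding 1 a q(2) i0(1) ..
    also have "\<dots> = chart_deriv (U0, x0) (\<lambda>q. g (\<theta> q)) ?q a \<bullet> chart_deriv (U0, x0) (\<lambda>q. g (\<theta> q)) ?q a"
      by (rule ff[OF qE c(1)]) (use c(2) in simp)
    also have "\<dots> = edge_metric N ?P2 (\<Theta> w) (frechet_derivative \<Theta> (at w) v)"
      unfolding 2 a q(2) i2(1) ch(1) by (rule B2.G_edge_metric[OF b2])
    finally have "edge_metric N ?P2 (\<Theta> w) (frechet_derivative \<Theta> (at w) v) = frechet_derivative B0.G (at w) v \<bullet> frechet_derivative B0.G (at w) v" ..
    also have "\<dots> = edge_metric N P w v"
      unfolding B0.G_inner[OF wR] family_metric[OF m_pos[OF par0] gap0[OF B0.box1[OF wR]]]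
      by (simp add: edge_metric_def power2_eq_square)
    finally show ?thesis .
  qed
  have P2pos: "?P2 (w$1) > 0" if "w \<in> V" for w
    using B2.\<rho>pos[OF B2.box1[OF V2b[OF that]]] B2.kpos by (intro mult_pos_pos add_pos_nonneg) simp_all
  obtain e \<sigma> c where e: "e > 0" "plane_box e \<subseteq> U" "\<sigma> = 1 \<or> \<sigma> = -1" "c \<noteq> 0"
    "\<And>w. w \<in> plane_box e \<Longrightarrow> \<Theta> w = vector [\<sigma> * w$1, c * w$2]"
    "\<And>w. w \<in> plane_box e \<Longrightarrow> P (w$1) = c\<^sup>2 * ?P2 (\<sigma> * w$1)"
    by (rule edge_isometry_rigid[where P=P and P'="?P2" and \<Theta>=\<Theta> and \<Theta>'=\<Theta>', OF N1 oU(1) U0 oU(2) tr(2,3,1) \<Theta>0 _ P2pos iso_eq])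
      (use Ppos[OF B0.box1[OF URb]] that in blast)+
  define e2 where "e2 = min e (min R r2)"
  have e2: "e2 > 0" "e2 \<le> e" "e2 \<le> R" "e2 \<le> r2" using e(1) R B2.r by (auto simp: e2_def)
  obtain k' h' \<rho>' r1' \<beta>' b1' \<zeta>' l1' \<Sigma>' where Y:
    "bour_profile N e2 k' h' \<rho>' r1' \<beta>' b1' \<zeta>' l1'" "euclidean_isometry \<Sigma>'"
    "\<And>x. k'\<^sup>2 * ((\<rho>' x)\<^sup>2 + h'\<^sup>2) = c\<^sup>2 * ?P2 (\<sigma> * x)"
    "\<And>w. B2.G (vector [\<sigma> * w$1, c * w$2]) = \<Sigma>' (helix_surface k' h' \<rho>' \<beta>' \<zeta>' w)"
    by (rule bour_flip[OF bour_profile_mono[OF X(1) e2(1,4)] e(3,4)]) (rule that)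
  have met: "k'\<^sup>2 * ((\<rho>' x)\<^sup>2 + h'\<^sup>2) = P x" if "x \<in> {-e2<..<e2}" for x
  proof -
    have "vector [x, 0] \<in> plane_box e" using that e2 by (auto simp: plane_box_def)
    from e(6)[OF this] show ?thesis by (simp add: Y(3))
  qed
  have bu: "gap h' (1 / k') x > 0" "\<rho>' x = rad h' (1 / k') x" "\<beta>' x = ang h' (1 / k') x" "\<zeta>' x = hgt h' (1 / k') x"
    if "x \<in> {-e2<..<e2}" for x
    by (rule bour_unique[OF Y(1) e2(3)], erule met, rule that)+
  define m' where "m' = 1 / k'"
  have k': "k' > 0" using Y(1) by (simp add: bour_profile_def bour_profile_axioms_def)
  have par: "(h', m') \<in> params" using bu(1)[of 0] e2(1) k' by (simp add: params_def m'_def)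
  have k'm: "1 / m' = k'" by (simp add: m'_def)
  define e3 where "e3 = min e2 (eps h' m')"
  have e3: "e3 > 0" "e3 \<le> e2" "e3 \<le> eps h' m'" using e2(1) KS(6)[OF par] by (auto simp: e3_def)
  define V1 where "V1 = D0 \<inter> \<kappa> -` plane_box e3"
  have V1box: "\<kappa> q \<in> plane_box e" "\<kappa> q \<in> plane_box e2" "\<kappa> q \<in> plane_box (eps h' m')" if "q \<in> V1" for q
    using that plane_box_mono[of e3 e] plane_box_mono[of e3 e2] plane_box_mono[of e3 "eps h' m'"] e2 e3 by (auto simp: V1_def)
  have V1D: "q \<in> D0" "q \<in> D4" "q \<in> E1" "q \<in> E h' m'" if "q \<in> V1" for q
  proof -
    show 0: "q \<in> D0" using that by (simp add: V1_def)
    have "\<kappa> q \<in> U" using V1box(1)[OF that] e(2) by blast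
    then show "q \<in> D4" using \<kappa>D(5)[OF 0] by (simp add: U_def)
    then show "q \<in> E1" by (simp add: D4_def)
    show "q \<in> E h' m'" using 0 V1box(3)[OF that] by (simp add: E_def)
  qed
  have e3R: "e3 \<le> R" using e2 e3 by linarith
  have oV1: "open V1" unfolding V1_def
    by (rule diffeo_restrict(2)[OF A smooth_atlas_euclidean D \<Omega> diffeo open_plane_box plane_box_mono[OF e3R]])
  have pV1: "p \<in> V1" using p e3(1) by (simp add: V1_def plane_box_def)
  note f' = E_facts[OF par]
  have eq: "g (\<theta> q) = \<Sigma>2 (\<Sigma>' (F h' m' (\<phi> h' m' q)))" if q: "q \<in> V1" for q
  proof -
    have x: "\<kappa> q $ 1 \<in> {-e2<..<e2}" using V1box(2)[OF q] by (auto simp: plane_box_def)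
    have "g (\<theta> q) = \<Sigma>2 (B2.G (\<Theta> (\<kappa> q)))" by (rule g\<theta>) (use V1D[OF q] in simp)
    also have "\<dots> = \<Sigma>2 (\<Sigma>' (helix_surface k' h' \<rho>' \<beta>' \<zeta>' (\<kappa> q)))" unfolding e(5)[OF V1box(1)[OF q]] Y(4) ..
    also have "helix_surface k' h' \<rho>' \<beta>' \<zeta>' (\<kappa> q) = F h' m' (\<phi> h' m' q)"
      unfolding f'(7)[OF V1D(4)[OF q]] k'm by (simp add: helix_surface_def bu(2-4)[OF x] m'_def)
    finally show ?thesis .
  qed
  have sub: "V1 \<subseteq> E1" "V1 \<subseteq> E h' m'" using V1D by blast+
  note r\<theta> = diffeo_restrict_source[OF A A E(1) E(1) \<theta>(1) oV1 sub(1)]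
  note r\<phi> = diffeo_restrict_source[OF A A f'(1) f'(1) \<phi>_diffeo[OF par] oV1 sub(2)]
  note inv = diffeo_inv(1)[OF A A oV1 r\<theta>(1)]
  have inv\<theta>: "inv_into V1 \<theta> (\<theta> q) = q" if "q \<in> V1" for q by (rule diffeoD(5)[OF r\<theta>(1) that])
  show ?thesis
  proof (rule that[of h' m' "\<lambda>y. \<Sigma>2 (\<Sigma>' y)" "\<theta> ` V1" "\<phi> h' m' ` V1" "\<lambda>q. \<phi> h' m' (inv_into V1 \<theta> q)"])
    show "(h', m') \<in> params" by (rule par)
    show "euclidean_isometry (\<lambda>y. \<Sigma>2 (\<Sigma>' y))" by (rule euclidean_isometry_compose[OF X(6) Y(2)])
    show "open (\<theta> ` V1)" "open (\<phi> h' m' ` V1)" by (rule r\<theta>(2), rule r\<phi>(2))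
    show "p \<in> \<theta> ` V1" using pV1 \<theta>(2) by force
    show "p \<in> \<phi> h' m' ` V1" using pV1 f'(4) by force
    show "\<theta> ` V1 \<subseteq> E'" using sub(1) \<theta>E by blast
    show "\<phi> h' m' ` V1 \<subseteq> D" using sub(2) f'(3,5) by blast
    show "diffeo A A (\<theta> ` V1) (\<phi> h' m' ` V1) (\<lambda>q. \<phi> h' m' (inv_into V1 \<theta> q))"
      by (rule diffeo_compose(1)[OF A A A r\<theta>(2) oV1 r\<phi>(2) inv r\<phi>(1)])
    show "\<phi> h' m' (inv_into V1 \<theta> p) = p" using inv\<theta>[OF pV1] \<theta>(2) f'(4) by simp
    show "g q = \<Sigma>2 (\<Sigma>' (F h' m' (\<phi> h' m' (inv_into V1 \<theta> q))))" if "q \<in> \<theta> ` V1" for q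
      using that eq inv\<theta> by auto
  qed
qed

end

section \<open>The deformation theorem\<close>

theorem theorem3p7:
  fixes A :: "('a::{t2_space,second_countable_topology}, real^2) chart set"
    and f :: "'a \<Rightarrow> real^3" and n :: nat and p :: 'a
  assumes "oriented_atlas A"
    and "n \<ge> 2"
    and "generic_helicoidal_edge n A UNIV f"
    and "p \<in> singular_set A UNIV f"
  shows "\<exists>D (\<Lambda> :: (real \<times> real) set) (F :: real \<Rightarrow> real \<Rightarrow> 'a \<Rightarrow> real^3).
    open D \<and> p \<in> D \<and> open \<Lambda> \<and> connected \<Lambda> \<and> \<Lambda> \<noteq> {} \<and>
    (\<forall>(h, m)\<in>\<Lambda>. generic_helicoidal_edge n A D (F h m)) \<and>
    gives_nontrivial_isometric_deformation A f p D \<Lambda> F \<and>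
    (\<forall>E g. isometric_deformation A f p E g \<and> \<not> trivial_deformation A f E g \<and>
        (\<forall>\<tau>\<in>{0..1}. generic_helicoidal_edge n A E (g \<tau>)) \<longrightarrow>
      deformation_given_by A p E g D \<Lambda> F)"
proof -
  obtain N where n: "n = Suc N" "N \<ge> 1" using assms(2) by (cases n) auto
  have gf: "generic_helicoidal_edge (Suc N) A UNIV f" using assms(3) n(1) by simp
  obtain D0 R \<kappa> k h0 \<rho> r1 \<beta> b1 \<zeta> l1 \<Sigma> where X:
    "bour_profile N R k h0 \<rho> r1 \<beta> b1 \<zeta> l1" "coords A D0 (plane_box R) \<kappa>" "p \<in> D0" "D0 \<subseteq> UNIV" "\<kappa> p = 0"
    "euclidean_isometry \<Sigma>" "\<And>q. q \<in> D0 \<Longrightarrow> f q = \<Sigma> (helix_surface k h0 \<rho> \<beta> \<zeta> (\<kappa> q))"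
    by (rule edge_extraction[OF assms(1) n(2) open_UNIV gf assms(4)]) (rule that)
  interpret B: bour_profile N R k h0 \<rho> r1 \<beta> b1 \<zeta> l1 by (rule X(1))
  interpret C: coords A D0 "plane_box R" \<kappa> by (rule X(2))
  define P where "P x = k\<^sup>2 * ((\<rho> x)\<^sup>2 + h0\<^sup>2)" for x
  define p1 where "p1 x = k\<^sup>2 * (2 * (\<rho> x * r1 x))" for x
  have "metric_data N R P p1"
  proof
    show "smooth_on {-R<..<R} P" unfolding P_def[abs_def] by (intro smooth_intros B.s\<rho>) simp_all
    show "smooth_on {-R<..<R} p1" unfolding p1_def[abs_def] by (intro smooth_on_mult smooth_on_const B.s\<rho> B.sr) simp_all
    fix x assume x: "x \<in> {-R<..<R}"
    show "P x > 0" unfolding P_def using B.\<rho>pos[OF x] B.kpos by (intro mult_pos_pos add_pos_nonneg) simp_all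
    have "((\<lambda>x. (\<rho> x)\<^sup>2 + h0\<^sup>2) has_real_derivative 2 * (\<rho> x * (x ^ N * r1 x)) + 0) (at x)"
      using DERIV_add[OF DERIV_power[OF B.d\<rho>[OF x], of 2] DERIV_const[of "h0\<^sup>2"]] by (simp add: mult_ac)
    from DERIV_cmult[OF this, of "k\<^sup>2"] show "(P has_real_derivative x ^ N * p1 x) (at x)"
      unfolding P_def[abs_def] p1_def by (rule DERIV_cong) simp
  qed (use n(2) B.r in auto)
  then interpret M: metric_data N R P p1 .
  have "R \<le> R" by simp
  note bu = M.bour_unique[OF X(1) this P_def[symmetric]]
  have k: "k > 0" by (rule B.kpos)
  have fm: "helix_surface k h0 \<rho> \<beta> \<zeta> w = helix_surface (1 / (1 / k)) h0 (M.rad h0 (1 / k)) (M.ang h0 (1 / k)) (M.hgt h0 (1 / k)) w"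
    if "w \<in> plane_box R" for w using bu(2-4)[OF B.box1[OF that]] by (simp add: helix_surface_def)
  interpret EF: edge_family N R P p1 A D0 \<kappa> h0 "1 / k" p \<Sigma> f
  proof unfold_locales
    show "oriented_atlas A" by (rule assms(1))
    show "(h0, 1 / k) \<in> M.params" using bu(1)[of 0] B.r k by (simp add: M.params_def)
    show "f q = \<Sigma> (helix_surface (1 / (1 / k)) h0 (M.rad h0 (1 / k)) (M.ang h0 (1 / k)) (M.hgt h0 (1 / k)) (\<kappa> q))" if "q \<in> D0" for q
      unfolding X(7)[OF that] fm[OF C.\<kappa>D(4)[OF that]] ..
    show "M.gap h0 (1 / k) x > 0" if "x \<in> {-R<..<R}" for x by (rule bu(1)[OF that])
  qed (fact X)+
  show ?thesis
  proof (intro exI[of _ EF.D] exI[of _ M.params] exI[of _ EF.F] conjI allI impI)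
    show "open EF.D" "p \<in> EF.D" by (rule EF.CD.D, rule EF.D_p)
    show "open M.params" "connected M.params" by (rule M.open_params, rule M.connected_params)
    show "M.params \<noteq> {}" using EF.par0 by blast
    show "\<forall>(h, m)\<in>M.params. generic_helicoidal_edge n A EF.D (EF.F h m)" using EF.member_generic n(1) by auto
    show "gives_nontrivial_isometric_deformation A f p EF.D M.params EF.F"
      unfolding gives_nontrivial_isometric_deformation_def
    proof (intro conjI EF.F_continuous EF.family_nontrivial)
      obtain \<Sigma>' where S: "euclidean_isometry \<Sigma>'" "\<And>y. \<Sigma>' (\<Sigma> y) = y"
        by (rule euclidean_isometry_inverse[OF X(6)]) (rule that)
      have "EF.F h0 (1 / k) q = \<Sigma>' (f q)" if "q \<in> EF.D" for q
        unfolding EF.F_base using EF.f[of q] that EF.D_sub S(2) by auto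
      then show "\<exists>(h, m)\<in>M.params. \<exists>T. euclidean_isometry T \<and> (\<forall>q\<in>EF.D. EF.F h m q = T (f q))"
        using EF.par0 S(1) by blast
      show "\<forall>(h, m)\<in>M.params. isometric_at A f p EF.D (EF.F h m)" using EF.member_isometric by auto
    qed
    fix E g
    assume a: "isometric_deformation A f p E g \<and> \<not> trivial_deformation A f E g \<and>
        (\<forall>\<tau>\<in>{0..1}. generic_helicoidal_edge n A E (g \<tau>))"
    show "deformation_given_by A p E g EF.D M.params EF.F"
      unfolding deformation_given_by_def
    proof
      fix \<tau> :: real assume \<tau>: "\<tau> \<in> {0..1}"
      have E: "open E" "isometric_at A f p E (g \<tau>)" "generic_helicoidal_edge (Suc N) A E (g \<tau>)"
        using a \<tau> n(1) by (auto simp: isometric_deformation_def)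
      obtain h m T U V \<psi> where Z: "(h, m) \<in> M.params" "euclidean_isometry T" "open U" "p \<in> U" "U \<subseteq> E" "open V" "p \<in> V" "V \<subseteq> EF.D"
        "diffeo A A U V \<psi>" "\<psi> p = p" "\<And>q. q \<in> U \<Longrightarrow> g \<tau> q = T (EF.F h m (\<psi> q))"
        by (rule EF.isometric_edge_in_family[OF E(1,3,2)]) (rule that)
      show "\<exists>(h, m)\<in>M.params. \<exists>T U V \<phi>. euclidean_isometry T \<and>
        open U \<and> p \<in> U \<and> U \<subseteq> E \<and> open V \<and> p \<in> V \<and> V \<subseteq> EF.D \<and>
        diffeo A A U V \<phi> \<and> \<phi> p = p \<and> (\<forall>q\<in>U. g \<tau> q = T (EF.F h m (\<phi> q)))"
        by (rule bexI[OF _ Z(1)], unfold case_prod_conv, intro exI[of _ T] exI[of _ U] exI[of _ V] exI[of _ \<psi>] conjI ballI Z)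
    qed
  qed
qed

end
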